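(* Let $1\le p,\theta\le\infty$ and $1/p<\alpha<1+1/p$. Then there is a constant $C>0$, independent of $n$, such that for every $n\in\mathbb N$, with $b_n$ the $n$th Fibonacci number and $N=5b_n-2$, $$\sup_{f\in U^\alpha_{p,\theta}(\mathbb I^2)}|Q_N(f)-I(f)|\le C\,N^{-\alpha}(\log N)^{(1-1/\theta)_+},$$ where $I(f)=\int_{[0,1]^2}f(x)\,dx$ and $$\begin{aligned}Q_N(f)=&\frac1{b_n}\sum_{(x_i,y_i)\in X_{b_n}}f(x_i,y_i)\\&+\frac1{b_n}\sum_{(x_i,y_i)\in X_{b_n}}\Big[\big(y_i-\tfrac12\big)\big(f(x_i,0)-f(x_i,1)\big)+\big(x_i-\tfrac12\big)\big(f(0,y_i)-f(1,y_i)\big)\Big]\\&+\Big(\frac1{2b_n}-\frac14+\frac1{b_n}\sum_{(x_i,y_i)\in X_{b_n}}x_iy_i\Big)\big(f(0,0)-f(1,0)+f(1,1)-f(0,1)\big).\end{aligned}$$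
   Context: Conventions: $1/\infty=0$, $a_+=\max\{a,0\}$, $[d]=\{1,\dots,d\}$ (here $d=2$), $\mathbb I=[0,1]$. Fibonacci lattice: $b_0=b_1=1$, $b_n=b_{n-1}+b_{n-2}$ for $n\ge2$, and $$X_{b_n}=\Big\{\Big(\frac{\mu}{b_n},\Big\{\mu\frac{b_{n-1}}{b_n}\Big\}\Big):\mu=0,\dots,b_n-1\Big\},$$ where $\{x\}=x-\lfloor x\rfloor$. Besov spaces of mixed smoothness on the cube: Fix an integer $\ell>\alpha$. For univariate $f:[0,1]\to\mathbb C$, $x\in[0,1]$ and $h\in\mathbb R$, $\Delta_h^\ell(f,x)=\sum_{j=0}^{\ell}(-1)^{\ell-j}\binom{\ell}{j}f(x+jh)$ if $x+\ell h\in[0,1]$, and $\Delta_h^\ell(f,x)=0$ otherwise. For $e\subset[d]$ and $h\in\mathbb R^d$, $\Delta_h^{\ell,e}=\prod_{i\in e}\Delta^\ell_{h_i}$, where $\Delta^\ell_{h_i}$ acts in the variable $x_i$ with the other variables fixed, and $\Delta_h^{\ell,\emptyset}=\mathrm{Id}$. For $t\in[0,1]^d$, $\omega_\ell^e(f,t)_p=\sup_{|h_i|<t_i,\,i\in e}\|\Delta_h^{\ell,e}(f)\|_{L_p(\mathbb I^d)}$. Define $$|f|_{B^{\alpha,e}_{p,\theta}}=\Big(\int_{[0,1]^d}\Big[\prod_{i\in e}t_i^{-\alpha}\,\omega_\ell^e(f,t)_p\Big]^\theta\prod_{i\in e}t_i^{-1}\,dt\Big)^{1/\theta}\quad(\theta<\infty),$$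 and $|f|_{B^{\alpha,e}_{p,\theta}}=\sup_{t}\prod_{i\in e}t_i^{-\alpha}\omega^e_\ell(f,t)_p$ if $\theta=\infty$; for $e=\emptyset$ this is $\|f\|_p$. Then $B^\alpha_{p,\theta}(\mathbb I^d)$ is the set of $f\in L_p(\mathbb I^d)$ with $\|f\|_{B^\alpha_{p,\theta}(\mathbb I^d)}=\sum_{e\subset[d]}|f|_{B^{\alpha,e}_{p,\theta}}<\infty$ (different choices of $\ell>\alpha$ give equivalent quasi-norms), and $U^\alpha_{p,\theta}(\mathbb I^d)$ is its unit ball. Since $\alpha>1/p$, every element has a representative continuous on $[0,1]^d$, which is used for point evaluations. *)

theory Defs
  imports "HOL-Probability.Essential_Supremum" "HOL-Number_Theory.Fib"
begin

text \<open>The exponents \<open>p\<close> and \<open>\<theta>\<close> are of type \<^typ>\<open>ennreal\<close>; \<open>\<infinity>\<close> is the top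
  element and \<open>1 / \<infinity> = 0\<close> there.\<close>

abbreviation unit_square :: "(real \<times> real) set" where
  "unit_square \<equiv> {0..1} \<times> {0..1}"

text \<open>Power with a positive real exponent; the library has no \<open>powr\<close> on \<^typ>\<open>ennreal\<close>.\<close>

definition epowr :: "ennreal \<Rightarrow> real \<Rightarrow> ennreal" where
  "epowr x a = (if x = \<infinity> then \<infinity> else ennreal (enn2real x powr a))"

definition Lp_norm :: "ennreal \<Rightarrow> (real \<times> real \<Rightarrow> complex) \<Rightarrow> ennreal" where
  "Lp_norm p f =
    (if p = \<infinity> then esssup (lebesgue_on unit_square) (\<lambda>z. ennreal (cmod (f z)))
     else epowr (\<integral>\<^sup>+ z. ennreal (cmod (f z) powr enn2real p) \<partial>lebesgue_on unit_square)
                (1 / enn2real p))"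

definition Lp_space :: "ennreal \<Rightarrow> (real \<times> real \<Rightarrow> complex) set" where
  "Lp_space p = {f \<in> borel_measurable (lebesgue_on unit_square). Lp_norm p f < \<infinity>}"


definition finite_difference :: "nat \<Rightarrow> real \<Rightarrow> (real \<Rightarrow> complex) \<Rightarrow> real \<Rightarrow> complex" where
  "finite_difference l h g x =
    (if x \<in> {0..1} \<and> x + real l * h \<in> {0..1}
     then (\<Sum>j\<le>l. (-1) ^ (l - j) * of_nat (l choose j) * g (x + real j * h))
     else 0)"

definition coord :: "nat \<Rightarrow> real \<times> real \<Rightarrow> real" where
  "coord i t = (if i = 1 then fst t else snd t)"

definition coord_difference ::
    "nat \<Rightarrow> nat \<Rightarrow> real \<Rightarrow> (real \<times> real \<Rightarrow> complex) \<Rightarrow> real \<times> real \<Rightarrow> complex" where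
  "coord_difference l i h f =
    (if i = 1 then (\<lambda>(x, y). finite_difference l h (\<lambda>u. f (u, y)) x)
     else (\<lambda>(x, y). finite_difference l h (\<lambda>v. f (x, v)) y))"

text \<open>Sets \<open>e\<close> of directions are subsets of \<open>{1, 2}\<close>.\<close>

definition mixed_difference ::
    "nat \<Rightarrow> nat set \<Rightarrow> real \<times> real \<Rightarrow> (real \<times> real \<Rightarrow> complex) \<Rightarrow> real \<times> real \<Rightarrow> complex" where
  "mixed_difference l e h =
    (if 1 \<in> e then coord_difference l 1 (coord 1 h) else id) \<circ>
    (if 2 \<in> e then coord_difference l 2 (coord 2 h) else id)"

definition mixed_modulus ::
    "ennreal \<Rightarrow> nat \<Rightarrow> nat set \<Rightarrow> (real \<times> real \<Rightarrow> complex) \<Rightarrow> real \<times> real \<Rightarrow> ennreal" where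
  "mixed_modulus p l e f t =
    (SUP h\<in>{h. \<forall>i\<in>e. \<bar>coord i h\<bar> < coord i t}. Lp_norm p (mixed_difference l e h f))"

text \<open>The points \<open>t\<close> with a vanishing coordinate, where \<open>0 powr (- \<alpha>) = 0\<close>, contribute nothing:
  they form a null set, and for the supremum the modulus vanishes there if \<open>t\<^sub>i = 0\<close> with \<open>i \<in> e\<close>,
  being a supremum over the empty set. For \<open>e = {}\<close> both cases reduce to the \<open>L\<^sub>p\<close>-norm of \<open>f\<close>.\<close>

definition besov_seminorm ::
    "real \<Rightarrow> ennreal \<Rightarrow> ennreal \<Rightarrow> nat \<Rightarrow> nat set \<Rightarrow> (real \<times> real \<Rightarrow> complex) \<Rightarrow> ennreal" where
  "besov_seminorm \<alpha> p \<theta> l e f =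
    (if \<theta> = \<infinity>
     then (SUP t\<in>unit_square. ennreal (\<Prod>i\<in>e. coord i t powr (- \<alpha>)) * mixed_modulus p l e f t)
     else epowr
       (\<integral>\<^sup>+ t. epowr (ennreal (\<Prod>i\<in>e. coord i t powr (- \<alpha>)) * mixed_modulus p l e f t) (enn2real \<theta>)
               * ennreal (\<Prod>i\<in>e. 1 / coord i t) \<partial>lebesgue_on unit_square)
       (1 / enn2real \<theta>))"

definition besov_norm ::
    "real \<Rightarrow> ennreal \<Rightarrow> ennreal \<Rightarrow> nat \<Rightarrow> (real \<times> real \<Rightarrow> complex) \<Rightarrow> ennreal" where
  "besov_norm \<alpha> p \<theta> l f = (\<Sum>e\<in>Pow {1, 2}. besov_seminorm \<alpha> p \<theta> l e f)"

definition besov_space ::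
    "real \<Rightarrow> ennreal \<Rightarrow> ennreal \<Rightarrow> nat \<Rightarrow> (real \<times> real \<Rightarrow> complex) set" where
  "besov_space \<alpha> p \<theta> l = {f \<in> Lp_space p. besov_norm \<alpha> p \<theta> l f < \<infinity>}"

text \<open>Elements are functions, not classes modulo null sets. Point evaluations make sense for the
  continuous representatives only: these are the \<open>f\<close> in the unit ball that satisfy
  \<open>continuous_on unit_square f\<close>, at most one per class up to values outside the square.\<close>

definition besov_unit_ball ::
    "real \<Rightarrow> ennreal \<Rightarrow> ennreal \<Rightarrow> nat \<Rightarrow> (real \<times> real \<Rightarrow> complex) set" where
  "besov_unit_ball \<alpha> p \<theta> l = {f \<in> besov_space \<alpha> p \<theta> l. besov_norm \<alpha> p \<theta> l f \<le> 1}"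


text \<open>The indexing here is \<open>b\<^sub>0 = b\<^sub>1 = 1\<close>, one step ahead of the library's \<^const>\<open>fib\<close>.\<close>

definition fib_b :: "nat \<Rightarrow> nat" where
  "fib_b n = fib (Suc n)"

text \<open>For \<open>n \<ge> 1\<close>, \<open>b\<^sub>n\<^sub>-\<^sub>1\<close> is \<open>fib_b (n - 1)\<close>. For \<open>n = 0\<close> only \<open>\<mu> = 0\<close> occurs and the
  truncated index plays no role: the lattice is the origin, as for \<open>n = 1\<close>.\<close>

definition fib_lattice :: "nat \<Rightarrow> (real \<times> real) set" where
  "fib_lattice n =
    (\<lambda>\<mu>. (real \<mu> / real (fib_b n), frac (real \<mu> * (real (fib_b (n - 1)) / real (fib_b n)))))
      ` {0..<fib_b n}"

text \<open>The cubature formula \<open>Q\<^sub>N\<close>, \<open>N = 5 b\<^sub>n - 2\<close>, as a function of \<open>n\<close>.\<close>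

definition fib_cubature :: "nat \<Rightarrow> (real \<times> real \<Rightarrow> complex) \<Rightarrow> complex" where
  "fib_cubature n f =
    of_real (1 / real (fib_b n)) * (\<Sum>(x, y)\<in>fib_lattice n. f (x, y))
    + of_real (1 / real (fib_b n)) *
        (\<Sum>(x, y)\<in>fib_lattice n.
            of_real (y - 1 / 2) * (f (x, 0) - f (x, 1))
          + of_real (x - 1 / 2) * (f (0, y) - f (1, y)))
    + of_real (1 / (2 * real (fib_b n)) - 1 / 4
               + 1 / real (fib_b n) * (\<Sum>(x, y)\<in>fib_lattice n. x * y))
      * (f (0, 0) - f (1, 0) + f (1, 1) - f (0, 1))"

definition square_integral :: "(real \<times> real \<Rightarrow> complex) \<Rightarrow> complex" where
  "square_integral f = (LINT z|lebesgue_on unit_square. f z)"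

end

(*
Write b for the number of nodes. The end point terms of the cubature formula amount to applying the
lattice rule to f + (x - 1/2) (f(0,y) - f(1,y)) + ..., which has equal values at opposite end points,
and whose integral is that of f.

If k = a h (mod b) with h nonzero mod b, where a is the preceding Fibonacci number, then |k| |h| is at
least a constant times b. Together with discrete Fourier coefficient bounds coming from first and second
cyclic differences, this shows that for bumps F, G of widths 2^-s, 2^-t the lattice error of F(x) G(y)
is at most C/b R^g for every 0 < g < 1, where R = 2^(s+t)/b.

The function f is a telescoping sum of layers: one averages f over points x + a (v - x), v in [0,1], so
no extension beyond the square is needed. A combination of such means at l different scales
reproduces f up to l-th differences, and so a layer at level (s, t) is an integral of l-th differences
of f of steps at most 2^-s and 2^-t against products of bumps. Since |H| <= c^(1-p) |H|^p + c for
each c > 0, the error of a layer is at most C min(R^B, R^S) M, where M is the mixed modulus of f at the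
level and 1/p < S < alpha < B < 2. The Besov norm bounds the sum of M over s + t = m by
C 2^(-alpha m) (m+1)^(1-1/theta), and the sum over m is dominated by the levels with 2^m close to b.
For p infinite, H is estimated with a large finite exponent in place of p.
*)
theory Submission
  imports Defs
begin

section \<open>Fibonacci lattices and discrete Fourier coefficients\<close>

text \<open>Both exponents come from one estimate. A product of layer kernels has height about
  4^(s+t) and lives on base points and steps of volume about 2^-(s+t), which turns R^g/b into
  R^(1+g); this makes every B in (1, 2) available. Playing that bound against the total mass of the
  error kernel, which stays bounded at all levels, gives S = (1+g)/p, any number in (1/p, 2/p).
  Because S < \<alpha> < B, the series over the levels decays geometrically on both sides of 2^m = b
  and no logarithm is lost beyond the one in the Besov bound.

  The obstacle is the end point correction: applied to a narrow bump that does not vanish at 0 or 1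
  it produces a linear function spread over the whole interval, so estimates for narrow bumps do not
  apply to the result. The way around it is to express an end point bump through bumps of all larger
  widths, up to width 1, where a linear function is harmless. This costs only a geometric sum of
  2^(s g), for which g > 0 is essential; g < 1 reflects that only two differences of a bump are
  controlled.\<close>

text \<open>d'Ocagne's identity. With n = m + k it says that multiplication by F_n modulo F_(n+1)
  sends F_(k+1) to (-1)^k F_(n-k), which provides explicit short points of the dual lattice.\<close>

lemma fib_dOcagne:
  "int (fib (m + k)) * int (fib (Suc k)) - int (fib (Suc (m + k))) * int (fib k) = (-1) ^ k * int (fib m)"
proof (induction k)
  case (Suc k)
  have "int (fib (m + Suc k)) * int (fib (Suc (Suc k))) - int (fib (Suc (m + Suc k))) * int (fib (Suc k))
     = - (int (fib (m + k)) * int (fib (Suc k)) - int (fib (Suc (m + k))) * int (fib k))"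
    by (simp add: algebra_simps)
  also have "\<dots> = - ((-1) ^ k * int (fib m))" by (simp only: Suc)
  finally show ?case by simp
qed simp

lemma fib_Suc_le_double: "k > 0 \<Longrightarrow> fib (Suc k) \<le> 2 * fib k"
  by (cases k) (use fib_Suc_mono[of "k - 1"] in auto)

text \<open>The pairs (x, y) with y = F_n x modulo b = F_(n+1) form a lattice of determinant b. For
  F_k <= h < F_(k+1) and m = n - k, the determinant \<open>D1\<close> of (h, g) and the lattice
  point (F_(k+1), (-1)^k F_m) is a nonzero multiple of b, so b <= h F_m + |g| F_(k+1). Since b =
  F_(k+1) F_(m+1) + F_k F_m and h F_m <= F_(k+1) F_(m+1), this forces F_m <= 2 |g|. Finally b <= 5
  F_k F_m and F_k <= h give the constant 10.\<close>

lemma fib_dual_lattice: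
  fixes h g :: int
  assumes h: "0 < h" "h < int (fib (Suc n))"
    and dv: "int (fib (Suc n)) dvd int (fib n) * h - g"
  shows "int (fib (Suc n)) \<le> 10 * h * \<bar>g\<bar>"
proof -
  define b where "b = int (fib (Suc n))"
  define k where "k = (LEAST k. h < int (fib (Suc k)))"
  have k1: "h < int (fib (Suc k))" unfolding k_def by (rule LeastI) (rule h(2))
  have "k \<le> n" unfolding k_def by (rule Least_le) (rule h(2))
  have "k \<noteq> 0" using k1 h(1) by (cases "k = 0") auto
  then obtain k' where k': "k = Suc k'" by (cases k) auto
  have "\<not> h < int (fib (Suc k'))"
    by (rule not_less_Least[of k' "\<lambda>k. h < int (fib (Suc k))", folded k_def]) (simp add: k')
  then have k2: "int (fib k) \<le> h" by (simp add: k')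
  define m where "m = n - k"
  have n: "n = m + k" using \<open>k \<le> n\<close> by (simp add: m_def)
  obtain t where t: "int (fib n) * h - g = b * t" using dv by (auto simp: b_def elim: dvdE)
  define D1 where "D1 = h * (-1) ^ k * int (fib m) - g * int (fib (Suc k))"
  define D2 where "D2 = h * (-1) ^ k' * int (fib (Suc m)) - g * int (fib k)"
  have g: "g = int (fib n) * h - b * t" using t by simp
  have dO1: "(-1) ^ k * int (fib m) = int (fib n) * int (fib (Suc k)) - b * int (fib k)"
    using fib_dOcagne[of m k] by (simp add: n b_def)
  have dO2: "(-1) ^ k' * int (fib (Suc m)) = int (fib n) * int (fib k) - b * int (fib k')"
    using fib_dOcagne[of "Suc m" k'] by (simp add: n b_def k')
  have D1: "D1 = b * (t * int (fib (Suc k)) - h * int (fib k))"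
    unfolding D1_def mult.assoc dO1 g by (simp add: algebra_simps)
  have D2: "D2 = b * (t * int (fib k) - h * int (fib k'))"
    unfolding D2_def mult.assoc dO2 g by (simp add: algebra_simps)
  have b_eq: "b = int (fib (Suc k)) * int (fib (Suc m)) + int (fib k) * int (fib m)"
    using fib_add[of m k] unfolding b_def n by (metis of_nat_add of_nat_mult)
  have bpos: "b > 0" unfolding b_def by (simp add: fib_neq_0_nat)
  \<comment> \<open>Otherwise (h, g) is parallel to (F_(k+1), (-1)^k F_m). The determinant
    \<open>D2\<close> with the neighbouring lattice point (F_k, (-1)^(k-1) F_(m+1)) is a multiple of
    b too, and then F_(k+1) divides h, against 0 < h < F_(k+1).\<close>
  have "D1 \<noteq> 0"
  proof
    assume 0: "D1 = 0"
    have "int (fib (Suc k)) * D2 = (-1) ^ k' * h * b"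
    proof -
      have "g * int (fib (Suc k)) = h * (-1) ^ k * int (fib m)" using 0 by (simp add: D1_def)
      then have "int (fib k) * (g * int (fib (Suc k))) = int (fib k) * (h * (-1) ^ k * int (fib m))" by simp
      then show ?thesis unfolding D2_def b_eq by (simp add: algebra_simps k')
    qed
    then have "int (fib (Suc k)) * (t * int (fib k) - h * int (fib k')) = (-1) ^ k' * h"
      using bpos unfolding D2 by simp
    then have "int (fib (Suc k)) dvd (-1) ^ k' * h" by (metis dvd_triv_left)
    then have "int (fib (Suc k)) dvd h" by (cases "even k'") auto
    with k1 h(1) show False using zdvd_imp_le by fastforce
  qed
  then have "b \<le> \<bar>D1\<bar>" using bpos unfolding D1 abs_mult by (simp add: mult_le_cancel_left1)
  also have "\<dots> \<le> h * int (fib m) + \<bar>g\<bar> * int (fib (Suc k))"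
    unfolding D1_def by (rule order_trans[OF abs_triangle_ineq4]) (use h(1) in \<open>simp add: abs_mult power_abs\<close>)
  finally have main: "b \<le> h * int (fib m) + \<bar>g\<bar> * int (fib (Suc k))" .
  have F2: "int (fib (Suc k)) \<le> 2 * int (fib k)" using fib_Suc_le_double[of k] \<open>k \<noteq> 0\<close> by linarith
  have kpos: "int (fib k) > 0" using \<open>k \<noteq> 0\<close> by (simp add: fib_neq_0_nat)
  show ?thesis
  \<comment> \<open>F_(m+1) <= 2 F_m fails for m = 0. There b = F_(k+1) <= 2 h, and g is nonzero by
    \<open>main\<close>.\<close>
  proof (cases "m = 0")
    case True
    then have b1: "b = int (fib (Suc k))" using b_eq by simp
    have "\<bar>g\<bar> \<noteq> 0" using main True bpos by auto
    then have "\<bar>g\<bar> \<ge> 1" by simp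
    then have "h * 1 \<le> h * \<bar>g\<bar>" using h(1) by (intro mult_left_mono) auto
    then show ?thesis using F2 k2 b1 h(1) unfolding b_def by linarith
  next
    case False
    have Fm: "int (fib m) \<le> int (fib (Suc m))" using fib_Suc_mono[of m] by simp
    have Fm2: "int (fib (Suc m)) \<le> 2 * int (fib m)" using fib_Suc_le_double[of m] False by linarith
    have "h * int (fib m) \<le> int (fib (Suc k)) * int (fib (Suc m))"
      using k1 Fm h(1) by (intro mult_mono) auto
    then have "int (fib k) * int (fib m) \<le> \<bar>g\<bar> * int (fib (Suc k))" using main b_eq by linarith
    also have "\<dots> \<le> \<bar>g\<bar> * (2 * int (fib k))" using F2 by (intro mult_left_mono) auto
    finally have "int (fib k) * int (fib m) \<le> int (fib k) * (2 * \<bar>g\<bar>)" by (simp add: algebra_simps)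
    then have gm: "int (fib m) \<le> 2 * \<bar>g\<bar>" using kpos by simp
    have "int (fib (Suc k)) * int (fib (Suc m)) \<le> (2 * int (fib k)) * (2 * int (fib m))"
      using F2 Fm2 by (intro mult_mono) auto
    then have "b \<le> 5 * (int (fib k) * int (fib m))" using b_eq by linarith
    also have "int (fib k) * int (fib m) \<le> h * (2 * \<bar>g\<bar>)" using k2 gm h(1) by (intro mult_mono) auto
    finally show ?thesis unfolding b_def by simp
  qed
qed

section \<open>Discrete Fourier coefficients on the residues modulo b and their decay\<close>

definition dft :: "nat \<Rightarrow> (nat \<Rightarrow> real) \<Rightarrow> int \<Rightarrow> complex" where
  "dft b u h = (\<Sum>\<mu><b. of_real (u \<mu>) * cis (- 2 * pi * of_int h * real \<mu> / real b)) / of_nat b"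

lemma cis_2pi_int: "cis (2 * pi * of_int k) = 1"
  using cis_multiple_2pi[of "of_int k"] by (simp add: mult.commute)

lemma sum_cis_orthogonal:
  fixes d :: int
  assumes b: "b > 0"
  shows "(\<Sum>k<b. cis (2 * pi * real k * of_int d / real b)) = (if int b dvd d then of_nat b else 0)"
proof -
  define z where "z = cis (2 * pi * of_int d / real b)"
  have pw: "cis (2 * pi * real k * of_int d / real b) = z ^ k" for k
    unfolding z_def Complex.DeMoivre by (rule arg_cong[of _ _ cis]) simp
  show ?thesis
  proof (cases "int b dvd d")
    case True
    then obtain m where "d = int b * m" by (auto elim: dvdE)
    then have "z = 1" using b cis_2pi_int[of m] by (simp add: z_def mult_ac)
    then show ?thesis using True by (simp add: pw)
  next
    case False
    have "z \<noteq> 1"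
    proof
      assume "z = 1"
      then have "cos (2 * pi * of_int d / real b) = 1" by (simp add: z_def complex_eq_iff)
      then obtain m :: int where "2 * pi * of_int d / real b = of_int m * 2 * pi"
        using cos_one_2pi_int by auto
      then have "of_int d = (of_int (m * int b) :: real)" using b by (simp add: field_simps)
      then have "d = m * int b" by linarith
      then show False using False by simp
    qed
    moreover have "z ^ b = 1" using b cis_2pi_int[of d] by (simp add: z_def Complex.DeMoivre mult_ac)
    ultimately have "(\<Sum>k<b. z ^ k) = 0" by (simp add: geometric_sum)
    then show ?thesis using False by (simp add: pw)
  qed
qed

lemma dft_inversion:
  assumes "\<nu> < b"
  shows "of_real (u \<nu>) = (\<Sum>k<b. dft b u (int k) * cis (2 * pi * real k * real \<nu> / real b))"
proof -
  have b: "b > 0" using assms by simp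
  have "(\<Sum>k<b. dft b u (int k) * cis (2 * pi * real k * real \<nu> / real b))
    = (\<Sum>k<b. \<Sum>\<mu><b. of_real (u \<mu>) * cis (2 * pi * real k * of_int (int \<nu> - int \<mu>) / real b) / of_nat b)"
    unfolding dft_def sum_divide_distrib sum_distrib_right
    by (intro sum.cong refl)
      (simp add: cis_mult mult.assoc, simp add: algebra_simps diff_divide_distrib)
  also have "\<dots> = (\<Sum>\<mu><b. of_real (u \<mu>) * (\<Sum>k<b. cis (2 * pi * real k * of_int (int \<nu> - int \<mu>) / real b)) / of_nat b)"
    by (subst sum.swap) (simp add: sum_distrib_left sum_divide_distrib)
  also have "\<dots> = (\<Sum>\<mu><b. if \<mu> = \<nu> then of_real (u \<mu>) else 0)"
  proof (intro sum.cong refl)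
    fix \<mu> assume "\<mu> \<in> {..<b}"
    then have "int b dvd int \<nu> - int \<mu> \<longleftrightarrow> \<mu> = \<nu>" using assms
      by (auto dest: zdvd_imp_le simp flip: mod_eq_dvd_iff)
    then show "of_real (u \<mu>) * (\<Sum>k<b. cis (2 * pi * real k * of_int (int \<nu> - int \<mu>) / real b)) / of_nat b
       = (if \<mu> = \<nu> then of_real (u \<mu>) else 0)"
      unfolding sum_cis_orthogonal[OF b] using b by simp
  qed
  also have "\<dots> = of_real (u \<nu>)" using assms by simp
  finally show ?thesis by simp
qed

lemma dft_periodic: "b > 0 \<Longrightarrow> dft b u (h + int b * t) = dft b u h"
proof -
  assume b: "b > 0"
  have "cis (- 2 * pi * of_int (h + int b * t) * real \<mu> / real b) = cis (- 2 * pi * of_int h * real \<mu> / real b)" for \<mu>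
  proof -
    have "- 2 * pi * of_int (h + int b * t) * real \<mu> / real b = - 2 * pi * of_int h * real \<mu> / real b + 2 * pi * of_int (- t * int \<mu>)"
      using b by (simp add: field_simps)
    then show ?thesis by (simp only: cis_mult[symmetric] cis_2pi_int mult_1_right)
  qed
  then show ?thesis by (simp only: dft_def)
qed

lemma norm_dft_uminus: "norm (dft b u (- h)) = norm (dft b u h)"
proof -
  have "dft b u (- h) = cnj (dft b u h)"
    by (simp add: dft_def cis_cnj)
  then show ?thesis by simp
qed

text \<open>Inserting the inversion formula for v turns v (a mu mod b) into characters of frequency
  a k in mu, so the sum over mu is the coefficient of u at - a k. Only frequency pairs of the dual
  lattice survive.\<close>

lemma dft_lattice_sum:
  assumes b: "b > 0"
  shows "of_real ((\<Sum>\<mu><b. u \<mu> * v ((a * \<mu>) mod b)) / real b) = (\<Sum>k<b. dft b v (int k) * dft b u (- (int a * int k)))"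
proof -
  have e: "of_real (v ((a * \<mu>) mod b)) = (\<Sum>k<b. dft b v (int k) * cis (2 * pi * (real k * real a) * real \<mu> / real b))" for \<mu>
  proof -
    have "cis (2 * pi * real k * real ((a * \<mu>) mod b) / real b) = cis (2 * pi * (real k * real a) * real \<mu> / real b)" for k
    proof -
      have "real (a * \<mu>) = real b * real ((a * \<mu>) div b) + real ((a * \<mu>) mod b)"
        by (metis mult_div_mod_eq of_nat_add of_nat_mult)
      then have "2 * pi * (real k * real a) * real \<mu> / real b
        = 2 * pi * real k * (real b * real ((a * \<mu>) div b) + real ((a * \<mu>) mod b)) / real b"
        by (simp add: mult_ac)
      also have "\<dots> = 2 * pi * real k * real ((a * \<mu>) mod b) / real b + 2 * pi * of_int (int k * int ((a * \<mu>) div b))"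
        using b by (simp add: field_simps)
      finally show ?thesis by (simp only: cis_mult[symmetric] cis_2pi_int mult_1_right)
    qed
    then show ?thesis using dft_inversion[of "(a * \<mu>) mod b" b v] b by simp
  qed
  have "of_real ((\<Sum>\<mu><b. u \<mu> * v ((a * \<mu>) mod b)) / real b)
     = (\<Sum>\<mu><b. \<Sum>k<b. of_real (u \<mu>) * (dft b v (int k) * cis (2 * pi * (real k * real a) * real \<mu> / real b))) / of_nat b"
    by (simp add: e sum_distrib_left)
  also have "\<dots> = (\<Sum>k<b. dft b v (int k) * ((\<Sum>\<mu><b. of_real (u \<mu>) * cis (2 * pi * (real k * real a) * real \<mu> / real b)) / of_nat b))"
    by (subst sum.swap) (simp add: sum_distrib_left sum_divide_distrib mult_ac)
  also have "\<dots> = (\<Sum>k<b. dft b v (int k) * dft b u (- (int a * int k)))"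
    by (simp add: dft_def mult_ac)
  finally show ?thesis .
qed

lemma norm_dft_le: "norm (dft b u h) \<le> (\<Sum>\<mu><b. \<bar>u \<mu>\<bar>) / real b"
  unfolding dft_def norm_divide
  by (simp, intro divide_right_mono order_trans[OF norm_sum]) (auto simp: norm_mult)

lemma dft_shift:
  assumes b: "b > 0" and per: "u b = u 0"
  shows "dft b (\<lambda>\<mu>. u (Suc \<mu>)) h = cis (2 * pi * of_int h / real b) * dft b u h"
proof -
  define X where "X \<mu> = of_real (u \<mu>) * cis (- 2 * pi * of_int h * real \<mu> / real b)" for \<mu>
  have X0: "X b = X 0" using b cis_2pi_int[of "- h"] by (simp add: X_def per)
  have X1: "of_real (u (Suc \<mu>)) * cis (- 2 * pi * of_int h * real \<mu> / real b) = cis (2 * pi * of_int h / real b) * X (Suc \<mu>)" for \<mu>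
  proof -
    have "2 * pi * of_int h / real b + - 2 * pi * of_int h * real (Suc \<mu>) / real b = - 2 * pi * of_int h * real \<mu> / real b"
      using b by (simp add: field_simps)
    then have "cis (2 * pi * of_int h / real b) * cis (- 2 * pi * of_int h * real (Suc \<mu>) / real b) = cis (- 2 * pi * of_int h * real \<mu> / real b)"
      by (simp only: cis_mult)
    then show ?thesis unfolding X_def by (metis mult.left_commute)
  qed
  have "(\<Sum>\<mu><b. X (Suc \<mu>)) = (\<Sum>\<mu><b. X \<mu>)"
    using sum.lessThan_Suc_shift[of X b] X0 by simp
  then show ?thesis
    unfolding dft_def X1 by (simp add: X_def flip: sum_distrib_left)
qed

text \<open>|e^(it) - 1| = 2 |sin (t/2)|, and sin x >= x/2 on [0, pi/2] because the Taylor error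
  x^3/6 is at most x/2 for x <= 1.7.\<close>

lemma norm_cis_minus_1_ge: "\<bar>t\<bar> \<le> pi \<Longrightarrow> \<bar>t\<bar> / 2 \<le> norm (cis t - 1)"
proof -
  assume t: "\<bar>t\<bar> \<le> pi"
  have sin: "x / 2 \<le> sin x" if "0 \<le> x" "x \<le> pi / 2" for x :: real
  proof -
    have "\<bar>sin x - (\<Sum>m<3. sin_coeff m * x ^ m)\<bar> \<le> inverse (fact 3) * \<bar>x\<bar> ^ 3"
      by (rule Maclaurin_sin_bound)
    then have "\<bar>sin x - x\<bar> \<le> x ^ 3 / 6"
      using that by (simp add: eval_nat_numeral sin_coeff_def)
    moreover have "x ^ 3 / 6 \<le> x / 2"
    proof -
      have "x \<le> 1.7" using that pi_less_4 pi_approx by simp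
      then have "x ^ 2 \<le> 1.7 ^ 2" using that by (intro power_mono) auto
      then have "x * x ^ 2 \<le> x * 3" using that by (intro mult_left_mono) (auto simp: power2_eq_square)
      then show ?thesis by (simp add: power3_eq_cube power2_eq_square)
    qed
    ultimately show ?thesis by linarith
  qed
  have "norm (cis t - 1) = 2 * \<bar>sin (t / 2)\<bar>"
  proof -
    have "(norm (cis t - 1))\<^sup>2 = (cos t - 1)\<^sup>2 + (sin t)\<^sup>2"
      by (simp add: cmod_power2)
    also have "\<dots> = 2 - 2 * cos t" using sin_cos_squared_add[of t] by (simp add: power2_eq_square algebra_simps)
    also have "\<dots> = (2 * \<bar>sin (t / 2)\<bar>)\<^sup>2"
      using cos_double_sin[of "t / 2"] by (simp add: power_mult_distrib)
    finally show ?thesis by (metis abs_ge_zero mult_nonneg_nonneg norm_ge_zero power2_eq_iff_nonneg zero_le_numeral)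
  qed
  moreover have "\<bar>t\<bar> / 2 / 2 \<le> sin (\<bar>t\<bar> / 2)" using t by (intro sin) auto
  moreover have "sin (\<bar>t\<bar> / 2) \<le> \<bar>sin (t / 2)\<bar>" by (cases "t \<ge> 0") auto
  ultimately show ?thesis by linarith
qed

text \<open>Differencing a periodic sequence multiplies its coefficient at h by e^(2 pi i h/b) - 1,
  of modulus at least |h|/b for |h| <= b/2. For other representatives of the frequency this factor
  can vanish, hence the symmetric range.\<close>

lemma dft_decay1:
  fixes h :: int
  assumes b: "b > 0" and per: "u b = u 0" and h: "2 * \<bar>h\<bar> \<le> int b"
  shows "\<bar>real_of_int h\<bar> * norm (dft b u h) \<le> real b * norm (dft b (\<lambda>\<mu>. u (Suc \<mu>) - u \<mu>) h)"
proof -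
  define t where "t = 2 * pi * of_int h / real b"
  have D: "dft b (\<lambda>\<mu>. u (Suc \<mu>) - u \<mu>) h = (cis t - 1) * dft b u h"
    using dft_shift[OF b per, of h] unfolding t_def dft_def
    by (simp add: algebra_simps sum_subtractf diff_divide_distrib)
  have h': "2 * \<bar>real_of_int h\<bar> \<le> real b" using h by linarith
  have "\<bar>t\<bar> = 2 * pi * \<bar>real_of_int h\<bar> / real b" by (simp add: t_def abs_mult)
  moreover have "\<dots> \<le> pi" using h' b by (simp add: field_simps)
  ultimately have "pi * \<bar>real_of_int h\<bar> / real b \<le> norm (cis t - 1)" using norm_cis_minus_1_ge[of t] by simp
  moreover have "1 * (\<bar>real_of_int h\<bar> / real b) \<le> pi * (\<bar>real_of_int h\<bar> / real b)"
    using pi_ge_two by (intro mult_right_mono) auto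
  ultimately have "\<bar>real_of_int h\<bar> / real b \<le> norm (cis t - 1)" by simp
  then have "\<bar>real_of_int h\<bar> / real b * norm (dft b u h) \<le> norm (cis t - 1) * norm (dft b u h)"
    by (intro mult_right_mono) auto
  then have "\<bar>real_of_int h\<bar> / real b * norm (dft b u h) \<le> norm (dft b (\<lambda>\<mu>. u (Suc \<mu>) - u \<mu>) h)"
    by (simp only: D norm_mult)
  then show ?thesis using b by (simp add: field_simps)
qed

text \<open>One and two differencings. For a sampled bump of width 2^-s the assumptions hold with X
  = 2^s, so the coefficients decay like min (1/|h|, 2^s/h^2), with the change of regime at |h| =
  2^s.\<close>

lemma dft_decay:
  fixes h :: int
  assumes b: "b > 0" and per: "\<And>\<mu>. u (\<mu> + b) = u \<mu>" and h: "2 * \<bar>h\<bar> \<le> int b"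
    and V1: "(\<Sum>\<mu><b. \<bar>u (Suc \<mu>) - u \<mu>\<bar>) \<le> c"
    and V2: "real b * (\<Sum>\<mu><b. \<bar>u (Suc (Suc \<mu>)) - 2 * u (Suc \<mu>) + u \<mu>\<bar>) \<le> c * X"
  shows "\<bar>real_of_int h\<bar> * norm (dft b u h) \<le> c" "(real_of_int h)\<^sup>2 * norm (dft b u h) \<le> c * X"
proof -
  define du where "du \<mu> = u (Suc \<mu>) - u \<mu>" for \<mu>
  have p: "u b = u 0" using per[of 0] by simp
  have dp: "du b = du 0" using per[of 0] per[of 1] by (simp add: du_def)
  have 1: "\<bar>real_of_int h\<bar> * norm (dft b u h) \<le> real b * norm (dft b du h)"
    unfolding du_def by (rule dft_decay1[where u=u, OF b p h])
  also have "\<dots> \<le> real b * ((\<Sum>\<mu><b. \<bar>du \<mu>\<bar>) / real b)"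
    by (intro mult_left_mono norm_dft_le) simp
  also have "\<dots> \<le> c" using V1 b by (simp add: du_def)
  finally show "\<bar>real_of_int h\<bar> * norm (dft b u h) \<le> c" .
  have 2: "\<bar>real_of_int h\<bar> * norm (dft b du h) \<le> real b * norm (dft b (\<lambda>\<mu>. du (Suc \<mu>) - du \<mu>) h)"
    by (rule dft_decay1[where u=du, OF b dp h])
  have "(real_of_int h)\<^sup>2 * norm (dft b u h) = \<bar>real_of_int h\<bar> * (\<bar>real_of_int h\<bar> * norm (dft b u h))"
    by (simp add: power2_eq_square)
  also have "\<dots> \<le> \<bar>real_of_int h\<bar> * (real b * norm (dft b du h))" using 1 by (intro mult_left_mono) auto
  also have "\<dots> = real b * (\<bar>real_of_int h\<bar> * norm (dft b du h))" by simp
  also have "\<dots> \<le> real b * (real b * norm (dft b (\<lambda>\<mu>. du (Suc \<mu>) - du \<mu>) h))"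
    using 2 by (intro mult_left_mono) auto
  also have "\<dots> \<le> real b * (real b * ((\<Sum>\<mu><b. \<bar>du (Suc \<mu>) - du \<mu>\<bar>) / real b))"
    by (intro mult_left_mono norm_dft_le) auto
  also have "\<dots> = real b * (\<Sum>\<mu><b. \<bar>u (Suc (Suc \<mu>)) - 2 * u (Suc \<mu>) + u \<mu>\<bar>)"
    using b by (simp add: du_def algebra_simps)
  finally show "(real_of_int h)\<^sup>2 * norm (dft b u h) \<le> c * X" using V2 by simp
qed

section \<open>Sums over the dual lattice\<close>

lemma two_sided_geometric_sum:
  fixes q :: real
  assumes "0 \<le> q" "q < 1"
  shows "(\<Sum>t<T. q ^ nat \<bar>int t - int s\<bar>) \<le> 2 / (1 - q)"
proof -
  have geo: "(\<Sum>i<n. q ^ i) \<le> 1 / (1 - q)" for n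
  proof -
    have "(\<Sum>i<n. q ^ i) = (1 - q ^ n) / (1 - q)" using assms by (simp add: sum_gp_strict)
    then show ?thesis using assms by (simp add: divide_right_mono)
  qed
  have "(\<Sum>t<T. q ^ nat \<bar>int t - int s\<bar>) \<le> (\<Sum>t<T+s. q ^ nat \<bar>int t - int s\<bar>)"
    using assms by (intro sum_mono2) auto
  also have "{..<T+s} = {..<s} \<union> {s..<T+s}" by auto
  also have "(\<Sum>t\<in>{..<s} \<union> {s..<T+s}. q ^ nat \<bar>int t - int s\<bar>)
      = (\<Sum>t<s. q ^ nat \<bar>int t - int s\<bar>) + (\<Sum>t\<in>{s..<T+s}. q ^ nat \<bar>int t - int s\<bar>)"
    by (rule sum.union_disjoint) auto
  also have "(\<Sum>t<s. q ^ nat \<bar>int t - int s\<bar>) = (\<Sum>t<s. q ^ Suc t)"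
    by (subst sum.nat_diff_reindex[symmetric]) (auto intro!: sum.cong simp: nat_add_distrib)
  also have "\<dots> \<le> (\<Sum>t<s. q ^ t)" using assms by (intro sum_mono) (simp add: mult_left_le_one_le)
  also have "\<dots> \<le> 1 / (1 - q)" by (rule geo)
  also have "(\<Sum>t\<in>{s..<T+s}. q ^ nat \<bar>int t - int s\<bar>) = (\<Sum>t<T. q ^ t)"
    by (rule sum.reindex_bij_witness[of _ "\<lambda>t. t + s" "\<lambda>t. t - s"])
       (auto intro!: arg_cong[where f="\<lambda>n. q ^ n"])
  also have "\<dots> \<le> 1 / (1 - q)" by (rule geo)
  finally show ?thesis by simp
qed

text \<open>By the separation, i \<mapsto> floor (g i / d) is injective, so the sum is dominated by
  two copies of the series of (n+1)^(-1-\<gamma>), scaled by d. The assumption d/2 <= |g i| keeps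
  the points away from the singularity at 0.\<close>

lemma separated_sum_bound:
  fixes \<gamma> :: real
  assumes "\<gamma> > 0"
  obtains C where "C > 0"
    "\<And>(I :: int set) (g :: int \<Rightarrow> real) d. finite I \<Longrightarrow> d > 0 \<Longrightarrow> (\<And>i. i \<in> I \<Longrightarrow> d / 2 \<le> \<bar>g i\<bar>) \<Longrightarrow>
       (\<And>i j. i \<in> I \<Longrightarrow> j \<in> I \<Longrightarrow> i \<noteq> j \<Longrightarrow> d \<le> \<bar>g i - g j\<bar>) \<Longrightarrow>
       (\<Sum>i\<in>I. \<bar>g i\<bar> powr (- 1 - \<gamma>)) \<le> C * d powr (- 1 - \<gamma>)"
proof -
  define a where "a n = (real n + 1) powr (- 1 - \<gamma>)" for n :: nat
  define Z where "Z = (\<Sum>n. a n)"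
  have sa: "summable a"
  proof -
    have "summable (\<lambda>n. real n powr (- 1 - \<gamma>))" using assms by (subst summable_real_powr_iff) simp
    then have "summable (\<lambda>n. real (Suc n) powr (- 1 - \<gamma>))" by (subst summable_Suc_iff)
    then show ?thesis unfolding a_def by (simp add: add.commute)
  qed
  have a0: "a n \<ge> 0" for n by (simp add: a_def)
  have Z1: "Z \<ge> 1"
  proof -
    have "(\<Sum>n<1. a n) \<le> Z" unfolding Z_def using a0 sa by (intro sum_le_suminf) auto
    then show ?thesis by (simp add: a_def)
  qed
  show thesis
  proof (rule that[of "4 powr (1 + \<gamma>) * (2 * Z)"])
    show "4 powr (1 + \<gamma>) * (2 * Z) > 0" using Z1 by simp
    fix I :: "int set" and g :: "int \<Rightarrow> real" and d :: real
    assume fin: "finite I" and d: "d > 0" and half: "\<And>i. i \<in> I \<Longrightarrow> d / 2 \<le> \<bar>g i\<bar>"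
      and sep: "\<And>i j. i \<in> I \<Longrightarrow> j \<in> I \<Longrightarrow> i \<noteq> j \<Longrightarrow> d \<le> \<bar>g i - g j\<bar>"
    define m where "m i = \<lfloor>g i / d\<rfloor>" for i
    have inj: "inj_on m I"
    proof (rule inj_onI, rule ccontr)
      fix i j assume ij: "i \<in> I" "j \<in> I" "m i = m j" "i \<noteq> j"
      have "\<bar>g i / d - g j / d\<bar> < 1" using ij(3) unfolding m_def by linarith
      then have "\<bar>g i - g j\<bar> < d" using d by (simp add: field_simps abs_if split: if_splits)
      with sep[OF ij(1,2,4)] show False by simp
    qed
    \<comment> \<open>The factor 1/4 is attained at floor -1, where |g i| may be as small as
      d/2.\<close>
    have low: "d * (real (nat \<bar>m i\<bar>) + 1) / 4 \<le> \<bar>g i\<bar>" if "i \<in> I" for i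
    proof -
      have 1: "of_int (m i) \<le> g i / d" "g i / d < of_int (m i) + 1" unfolding m_def by linarith+
      have 2: "1 / 2 \<le> \<bar>g i / d\<bar>" using half[OF that] d by (simp add: field_simps)
      have gen: "(real_of_int \<bar>k\<bar> + 1) / 4 \<le> \<bar>x\<bar>"
        if "of_int k \<le> x" "x < of_int k + 1" "1 / 2 \<le> \<bar>x\<bar>" for k :: int and x :: real
      proof (cases "k \<ge> 1 \<or> k \<le> -2")
        case True then show ?thesis using that by (auto simp: abs_if)
      next
        case False
        then have "k = 0 \<or> k = -1" by auto
        then show ?thesis using that by auto
      qed
      have "(real_of_int \<bar>m i\<bar> + 1) / 4 \<le> \<bar>g i / d\<bar>" by (rule gen[OF 1 2])
      then have "d * ((real_of_int \<bar>m i\<bar> + 1) / 4) \<le> d * \<bar>g i / d\<bar>" using d by (intro mult_left_mono) auto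
      also have "\<dots> = \<bar>g i\<bar>" using d by (simp add: abs_divide)
      finally show ?thesis by simp
    qed
    have "(\<Sum>i\<in>I. \<bar>g i\<bar> powr (- 1 - \<gamma>)) \<le> (\<Sum>i\<in>I. (d / 4) powr (- 1 - \<gamma>) * a (nat \<bar>m i\<bar>))"
    proof (rule sum_mono)
      fix i assume i: "i \<in> I"
      have "\<bar>g i\<bar> powr (- 1 - \<gamma>) \<le> (d / 4 * (real (nat \<bar>m i\<bar>) + 1)) powr (- 1 - \<gamma>)"
        using low[OF i] d assms by (intro powr_mono2') (auto simp del: of_nat_nat)
      also have "\<dots> = (d / 4) powr (- 1 - \<gamma>) * a (nat \<bar>m i\<bar>)"
        unfolding a_def using d by (subst powr_mult) auto
      finally show "\<bar>g i\<bar> powr (- 1 - \<gamma>) \<le> (d / 4) powr (- 1 - \<gamma>) * a (nat \<bar>m i\<bar>)" .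
    qed
    also have "\<dots> = (d / 4) powr (- 1 - \<gamma>) * (\<Sum>k\<in>m ` I. a (nat \<bar>k\<bar>))"
      by (simp add: sum.reindex[OF inj] sum_distrib_left)
    also have "(\<Sum>k\<in>m ` I. a (nat \<bar>k\<bar>)) \<le> 2 * Z"
    proof -
      define P where "P = {k\<in>m ` I. k \<ge> 0}"
      define N where "N = {k\<in>m ` I. k < 0}"
      have fP: "finite P" "finite N" using fin by (auto simp: P_def N_def)
      have "(\<Sum>k\<in>m ` I. a (nat \<bar>k\<bar>)) = (\<Sum>k\<in>P. a (nat \<bar>k\<bar>)) + (\<Sum>k\<in>N. a (nat \<bar>k\<bar>))"
        by (subst sum.union_disjoint[symmetric]) (use fP in \<open>auto simp: P_def N_def intro!: sum.cong\<close>)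
      also have "(\<Sum>k\<in>P. a (nat \<bar>k\<bar>)) = (\<Sum>k\<in>(\<lambda>k. nat \<bar>k\<bar>) ` P. a k)"
        by (subst sum.reindex) (auto simp: P_def inj_on_def)
      also have "\<dots> \<le> Z" unfolding Z_def using fP a0 sa by (intro sum_le_suminf) auto
      also have "(\<Sum>k\<in>N. a (nat \<bar>k\<bar>)) = (\<Sum>k\<in>(\<lambda>k. nat \<bar>k\<bar>) ` N. a k)"
        by (subst sum.reindex) (auto simp: N_def inj_on_def)
      also have "\<dots> \<le> Z" unfolding Z_def using fP a0 sa by (intro sum_le_suminf) auto
      finally show ?thesis by simp
    qed
    finally have "(\<Sum>i\<in>I. \<bar>g i\<bar> powr (- 1 - \<gamma>)) \<le> (d / 4) powr (- 1 - \<gamma>) * (2 * Z)"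
      by (simp add: mult_left_mono)
    also have "(d / 4) powr (- 1 - \<gamma>) = d powr (- 1 - \<gamma>) * 4 powr (1 + \<gamma>)"
    proof -
      have "(d / 4) powr (- 1 - \<gamma>) = d powr (- 1 - \<gamma>) / 4 powr (- (1 + \<gamma>))"
        using d by (subst powr_divide) auto
      also have "\<dots> = d powr (- 1 - \<gamma>) * 4 powr (1 + \<gamma>)" by (subst powr_minus_divide) simp
      finally show ?thesis .
    qed
    finally show "(\<Sum>i\<in>I. \<bar>g i\<bar> powr (- 1 - \<gamma>)) \<le> 4 powr (1 + \<gamma>) * (2 * Z) * d powr (- 1 - \<gamma>)"
      by (simp add: mult_ac)
  qed
qed

text \<open>Two frequencies of the block differ by at most 2^t, so \<open>fib_dual_lattice\<close>,
  applied to their difference, separates the residues g by d = b / (10 * 2^t). Applied to a single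
  frequency below 2^(t+1) it gives |g| >= d/2. Thus \<open>separated_sum_bound\<close> applies and
  (1/d)^(1+\<gamma>) is the claimed order.\<close>

lemma fib_block_sum:
  fixes \<gamma> :: real
  assumes "\<gamma> > 0"
  obtains C where "C > 0"
    "\<And>n t (g :: int \<Rightarrow> int). (\<And>h. int (fib (Suc n)) dvd int (fib n) * h - g h) \<Longrightarrow>
       (\<Sum>h\<in>{h. 2 ^ t \<le> h \<and> h < 2 ^ Suc t \<and> 2 * h \<le> int (fib (Suc n)) \<and> h < int (fib (Suc n))}. \<bar>real_of_int (g h)\<bar> powr (- 1 - \<gamma>))
         \<le> C * (2 ^ t / real (fib (Suc n))) powr (1 + \<gamma>)"
proof (rule separated_sum_bound[OF assms])
  fix C :: real
  assume C: "C > 0" and sep: "\<And>(I :: int set) (g :: int \<Rightarrow> real) d. finite I \<Longrightarrow> d > 0 \<Longrightarrow> (\<And>i. i \<in> I \<Longrightarrow> d / 2 \<le> \<bar>g i\<bar>) \<Longrightarrow>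
       (\<And>i j. i \<in> I \<Longrightarrow> j \<in> I \<Longrightarrow> i \<noteq> j \<Longrightarrow> d \<le> \<bar>g i - g j\<bar>) \<Longrightarrow>
       (\<Sum>i\<in>I. \<bar>g i\<bar> powr (- 1 - \<gamma>)) \<le> C * d powr (- 1 - \<gamma>)"
  show thesis
  proof (rule that[of "C * 10 powr (1 + \<gamma>)"])
    show "C * 10 powr (1 + \<gamma>) > 0" using C by simp
    fix n t and g :: "int \<Rightarrow> int"
    assume g: "\<And>h. int (fib (Suc n)) dvd int (fib n) * h - g h"
    define b where "b = real (fib (Suc n))"
    have b: "b > 0" unfolding b_def by (simp add: fib_neq_0_nat)
    define d where "d = b / (10 * 2 ^ t)"
    have d: "d > 0" using b by (simp add: d_def)
    let ?I = "{h. 2 ^ t \<le> h \<and> h < 2 ^ Suc t \<and> 2 * h \<le> int (fib (Suc n)) \<and> h < int (fib (Suc n))}"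
    have pw: "(1::int) \<le> 2 ^ t" by simp
    have key: "b \<le> 10 * real_of_int h * \<bar>real_of_int y\<bar>"
      if "0 < h" "h < int (fib (Suc n))" "int (fib (Suc n)) dvd int (fib n) * h - y" for h y
    proof -
      have "real_of_int (int (fib (Suc n))) \<le> real_of_int (10 * h * \<bar>y\<bar>)"
        using fib_dual_lattice[OF that] by (simp only: of_int_le_iff)
      then show ?thesis by (simp add: b_def)
    qed
    have sep': "d \<le> \<bar>real_of_int (g i) - real_of_int (g j)\<bar>" if ij: "i \<in> ?I" "j \<in> ?I" "i > j" for i j
    proof -
      have "b \<le> 10 * real_of_int (i - j) * \<bar>real_of_int (g i - g j)\<bar>"
      proof (rule key)
        show "0 < i - j" using ij by simp
        show "i - j < int (fib (Suc n))" using ij pw by auto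
        have "int (fib n) * (i - j) - (g i - g j) = (int (fib n) * i - g i) - (int (fib n) * j - g j)"
          by (simp add: algebra_simps)
        then show "int (fib (Suc n)) dvd int (fib n) * (i - j) - (g i - g j)"
          using g[of i] g[of j] by (metis dvd_diff)
      qed
      also have "real_of_int (i - j) \<le> 2 ^ t"
      proof -
        have "i - j \<le> 2 ^ t" using ij by auto
        then have "real_of_int (i - j) \<le> real_of_int (2 ^ t)" by (simp only: of_int_le_iff)
        then show ?thesis by simp
      qed
      finally have "b \<le> 10 * 2 ^ t * \<bar>real_of_int (g i - g j)\<bar>" by (simp add: mult_right_mono)
      then show ?thesis by (simp add: d_def field_simps)
    qed
    have half: "d / 2 \<le> \<bar>real_of_int (g i)\<bar>" if i: "i \<in> ?I" for i
    proof -
      have "b \<le> 10 * real_of_int i * \<bar>real_of_int (g i)\<bar>"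
        by (rule key) (use i g pw in auto)
      also have "real_of_int i \<le> 2 * 2 ^ t"
      proof -
        have "i \<le> 2 * 2 ^ t" using i by auto
        then have "real_of_int i \<le> real_of_int (2 * 2 ^ t)" by (simp only: of_int_le_iff)
        then show ?thesis by simp
      qed
      finally have "b \<le> 10 * (2 * 2 ^ t) * \<bar>real_of_int (g i)\<bar>" by (simp add: mult_right_mono)
      then show ?thesis by (simp add: d_def field_simps)
    qed
    have fin: "finite ?I" by (rule finite_subset[of _ "{2 ^ t..2 ^ Suc t}"]) auto
    have "(\<Sum>h\<in>?I. \<bar>real_of_int (g h)\<bar> powr (- 1 - \<gamma>)) \<le> C * d powr (- 1 - \<gamma>)"
    proof (rule sep[OF fin d half])
      fix i j assume "i \<in> ?I" "j \<in> ?I" "i \<noteq> j"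
      then show "d \<le> \<bar>real_of_int (g i) - real_of_int (g j)\<bar>"
        using sep'[of i j] sep'[of j i] by (cases "i > j") (auto simp: abs_minus_commute)
    qed auto
    also have "d powr (- 1 - \<gamma>) = (1 / d) powr (1 + \<gamma>)"
    proof -
      have "d powr (- 1 - \<gamma>) = d powr (- (1 + \<gamma>))" by simp
      also have "\<dots> = 1 / d powr (1 + \<gamma>)" by (rule powr_minus_divide)
      also have "\<dots> = (1 / d) powr (1 + \<gamma>)" using d by (subst powr_divide) auto
      finally show ?thesis .
    qed
    also have "1 / d = 10 * (2 ^ t / b)" by (simp add: d_def)
    also have "(10 * (2 ^ t / b)) powr (1 + \<gamma>) = 10 powr (1 + \<gamma>) * (2 ^ t / b) powr (1 + \<gamma>)"
      using b by (subst powr_mult) auto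
    finally show "(\<Sum>h\<in>?I. \<bar>real_of_int (g h)\<bar> powr (- 1 - \<gamma>)) \<le> C * 10 powr (1 + \<gamma>) * (2 ^ t / real (fib (Suc n))) powr (1 + \<gamma>)"
      by (simp add: b_def mult_ac)
  qed
qed

lemma two_power_powr: "(2::real) ^ t = 2 powr real t"
  by (simp add: powr_realpow)

text \<open>The absolutely least residue, the representative for which the decay of Fourier
  coefficients is available.\<close>

lemma abs_residue:
  fixes a :: int
  assumes "b > 0"
  obtains r where "2 * \<bar>r\<bar> \<le> b" "b dvd a - r"
proof (cases "2 * (a mod b) \<le> b")
  case True
  have "b dvd a - a mod b" by (simp add: dvd_minus_mod)
  then show ?thesis using that[of "a mod b"] True assms by simp
next
  case False
  have "a - (a mod b - b) = (a - a mod b) + b" by simp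
  then have "b dvd a - (a mod b - b)" by (metis dvd_add dvd_minus_mod dvd_refl)
  moreover have "a mod b < b" using assms by simp
  have "2 * \<bar>m - b\<bar> \<le> b" if "m < b" "\<not> 2 * m \<le> b" for m using that by simp
  then have "2 * \<bar>a mod b - b\<bar> \<le> b" using False \<open>a mod b < b\<close> by blast
  ultimately show ?thesis using that[of "a mod b - b"] by blast
qed

text \<open>Geometric interpolation: x = x^(1-\<gamma>) x^\<gamma>, with 1/y inserted for the first
  factor and X/y^2 for the second.\<close>

lemma min_decay_powr:
  fixes x y :: real
  assumes "0 < \<gamma>" "\<gamma> < 1" "y > 0" "x \<ge> 0" "y * x \<le> 1" "y\<^sup>2 * x \<le> X"
  shows "x \<le> X powr \<gamma> * y powr (- 1 - \<gamma>)"
proof (cases "x = 0")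
  case False
  then have x: "x > 0" using assms by simp
  have X: "X > 0" using x assms by (smt (verit) mult_pos_pos zero_less_power)
  have "x = x powr (1 - \<gamma>) * x powr \<gamma>" using x by (simp flip: powr_add)
  also have "\<dots> \<le> (1 / y) powr (1 - \<gamma>) * (X / y\<^sup>2) powr \<gamma>"
    using assms x by (intro mult_mono powr_mono2) (auto simp: field_simps)
  also have "(1 / y) powr (1 - \<gamma>) = y powr (\<gamma> - 1)"
    using assms(3) by (simp add: powr_divide powr_minus_divide[of y "1 - \<gamma>", simplified])
  also have "(X / y\<^sup>2) powr \<gamma> = X powr \<gamma> * y powr (- (2 * \<gamma>))"
  proof -
    have "(y\<^sup>2) powr \<gamma> = y powr (2 * \<gamma>)" using assms(3) by (simp add: powr_powr flip: powr_numeral)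
    then show ?thesis using assms(3) X by (simp add: powr_divide powr_minus_divide)
  qed
  also have "y powr (\<gamma> - 1) * (X powr \<gamma> * y powr (- (2 * \<gamma>))) = X powr \<gamma> * (y powr (\<gamma> - 1) * y powr (- (2 * \<gamma>)))"
    by (simp add: mult_ac)
  also have "y powr (\<gamma> - 1) * y powr (- (2 * \<gamma>)) = y powr (- 1 - \<gamma>)"
    by (subst powr_add[symmetric]) (simp add: algebra_simps)
  finally show ?thesis .
qed auto

text \<open>V and U are even and b-periodic, so k and b - k contribute equally, and every frequency
  can be represented by some h <= b/2, where the decay bounds hold.\<close>

lemma sum_dual_fold:
  fixes V U :: "int \<Rightarrow> real"
  assumes b: "b > 0"
    and "\<And>h. V h \<ge> 0" "\<And>h. U h \<ge> 0"
    and V: "\<And>h t. V (h + int b * t) = V h" "\<And>h. V (- h) = V h"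
    and U: "\<And>h t. U (h + int b * t) = U h" "\<And>h. U (- h) = U h"
  shows "(\<Sum>k\<in>{1..<b}. V (int k) * U (int a * int k)) \<le> 2 * (\<Sum>h\<in>{h. 1 \<le> h \<and> 2 * h \<le> int b \<and> h < int b}. V h * U (int a * h))"
proof -
  let ?P = "{h. 1 \<le> h \<and> 2 * h \<le> int b \<and> h < int b}"
  have fP: "finite ?P" by (rule finite_subset[of _ "{1..int b}"]) auto
  have "{1..<b} = {k\<in>{1..<b}. 2 * k \<le> b} \<union> {k\<in>{1..<b}. \<not> 2 * k \<le> b}" by auto
  then have "(\<Sum>k\<in>{1..<b}. V (int k) * U (int a * int k)) = (\<Sum>k\<in>{k\<in>{1..<b}. 2 * k \<le> b}. V (int k) * U (int a * int k))
     + (\<Sum>k\<in>{k\<in>{1..<b}. \<not> 2 * k \<le> b}. V (int k) * U (int a * int k))"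
    by (metis (no_types, lifting) finite_atLeastLessThan sum.Int_Diff sum.inter_filter sum.setdiff_irrelevant sum.union_disjoint finite_Un disjoint_iff mem_Collect_eq)
  moreover have "(\<Sum>k\<in>{k\<in>{1..<b}. 2 * k \<le> b}. V (int k) * U (int a * int k)) \<le> (\<Sum>h\<in>?P. V h * U (int a * h))"
  proof -
    have "(\<Sum>k\<in>{k\<in>{1..<b}. 2 * k \<le> b}. V (int k) * U (int a * int k)) = (\<Sum>h\<in>int ` {k\<in>{1..<b}. 2 * k \<le> b}. V h * U (int a * h))"
      by (subst sum.reindex) auto
    also have "\<dots> \<le> (\<Sum>h\<in>?P. V h * U (int a * h))"
      using assms by (intro sum_mono2 fP) auto
    finally show ?thesis .
  qed
  moreover have "(\<Sum>k\<in>{k\<in>{1..<b}. \<not> 2 * k \<le> b}. V (int k) * U (int a * int k)) \<le> (\<Sum>h\<in>?P. V h * U (int a * h))"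
  proof -
    have e: "V (int k) * U (int a * int k) = V (int b - int k) * U (int a * (int b - int k))" for k
    proof -
      have "V (int b - int k) = V (int k)" using V(1)[of "- int k" 1] V(2)[of "int k"] by simp
      moreover have "U (int a * (int b - int k)) = U (int a * int k)"
        using U(1)[of "- (int a * int k)" "int a"] U(2)[of "int a * int k"] by (simp add: algebra_simps)
      ultimately show ?thesis by simp
    qed
    have "(\<Sum>k\<in>{k\<in>{1..<b}. \<not> 2 * k \<le> b}. V (int k) * U (int a * int k))
       = (\<Sum>h\<in>(\<lambda>k. int b - int k) ` {k\<in>{1..<b}. \<not> 2 * k \<le> b}. V h * U (int a * h))"
      by (subst sum.reindex) (auto simp: inj_on_def e)
    also have "\<dots> \<le> (\<Sum>h\<in>?P. V h * U (int a * h))"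
      using assms by (intro sum_mono2 fP) auto
    finally show ?thesis .
  qed
  ultimately show ?thesis by linarith
qed

text \<open>U and V stand for the normalised moduli of the Fourier coefficients of the two factors.
  On the block h ~ 2^t, V is at most min (2^-t, 2^(s2-2t)), while U at F_n h is interpolated to
  2^(s1 \<gamma>) |g|^(-1-\<gamma>), g being the least residue; \<open>fib_block_sum\<close> adds
  this up to the order (2^t/b)^(1+\<gamma>). The product peaks at t = s2 and decays geometrically on
  both sides.\<close>

lemma fib_dual_sum:
  fixes \<gamma> :: real
  assumes \<gamma>: "0 < \<gamma>" "\<gamma> < 1"
  obtains C where "C > 0"
    "\<And>n s1 s2 (U :: int \<Rightarrow> real) V.
       (\<And>h. V h \<ge> 0) \<Longrightarrow> (\<And>h. U h \<ge> 0) \<Longrightarrow>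
       (\<And>h t. V (h + int (fib (Suc n)) * t) = V h) \<Longrightarrow> (\<And>h. V (- h) = V h) \<Longrightarrow>
       (\<And>h t. U (h + int (fib (Suc n)) * t) = U h) \<Longrightarrow> (\<And>h. U (- h) = U h) \<Longrightarrow>
       (\<And>h. 2 * \<bar>h\<bar> \<le> int (fib (Suc n)) \<Longrightarrow> \<bar>real_of_int h\<bar> * U h \<le> 1 \<and> (real_of_int h)\<^sup>2 * U h \<le> 2 ^ s1) \<Longrightarrow>
       (\<And>h. 2 * \<bar>h\<bar> \<le> int (fib (Suc n)) \<Longrightarrow> \<bar>real_of_int h\<bar> * V h \<le> 1 \<and> (real_of_int h)\<^sup>2 * V h \<le> 2 ^ s2) \<Longrightarrow>
       (\<Sum>k\<in>{1..<fib (Suc n)}. V (int k) * U (int (fib n) * int k))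
          \<le> C / real (fib (Suc n)) * (2 ^ (s1 + s2) / real (fib (Suc n))) powr \<gamma>"
proof (rule fib_block_sum[OF \<gamma>(1)])
  fix C0 :: real
  assume C0: "C0 > 0" and block: "\<And>n t (g :: int \<Rightarrow> int). (\<And>h. int (fib (Suc n)) dvd int (fib n) * h - g h) \<Longrightarrow>
       (\<Sum>h\<in>{h. 2 ^ t \<le> h \<and> h < 2 ^ Suc t \<and> 2 * h \<le> int (fib (Suc n)) \<and> h < int (fib (Suc n))}. \<bar>real_of_int (g h)\<bar> powr (- 1 - \<gamma>))
         \<le> C0 * (2 ^ t / real (fib (Suc n))) powr (1 + \<gamma>)"
  \<comment> \<open>From block to block the bound changes by 2^\<gamma> up to t = s2 and by
    2^-(1-\<gamma>) beyond it; 0 < \<gamma> < 1 makes both sides summable.\<close>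
  define q where "q = max (2 powr (- \<gamma>)) (2 powr (- (1 - \<gamma>)) :: real)"
  have q: "0 \<le> q" "q < 1" unfolding q_def using \<gamma> powr_less_mono[of "-\<gamma>" 0 2] powr_less_mono[of "-(1 - \<gamma>)" 0 2]
    by (auto simp: max_def)
  show thesis
  proof (rule that[of "2 * (C0 * (2 / (1 - q)))"])
    show "2 * (C0 * (2 / (1 - q))) > 0" using C0 q by simp
    fix n s1 s2 and U V :: "int \<Rightarrow> real"
    assume V0: "\<And>h. V h \<ge> 0" and U0: "\<And>h. U h \<ge> 0"
      and Vp: "\<And>h t. V (h + int (fib (Suc n)) * t) = V h" and Ve: "\<And>h. V (- h) = V h"
      and Up: "\<And>h t. U (h + int (fib (Suc n)) * t) = U h" and Ue: "\<And>h. U (- h) = U h"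
      and Ud: "\<And>h. 2 * \<bar>h\<bar> \<le> int (fib (Suc n)) \<Longrightarrow> \<bar>real_of_int h\<bar> * U h \<le> 1 \<and> (real_of_int h)\<^sup>2 * U h \<le> 2 ^ s1"
      and Vd: "\<And>h. 2 * \<bar>h\<bar> \<le> int (fib (Suc n)) \<Longrightarrow> \<bar>real_of_int h\<bar> * V h \<le> 1 \<and> (real_of_int h)\<^sup>2 * V h \<le> 2 ^ s2"
    define b where "b = fib (Suc n)"
    have b: "b > 0" unfolding b_def by (simp add: fib_neq_0_nat)
    let ?P = "{h. 1 \<le> h \<and> 2 * h \<le> int b \<and> h < int b}"
    have fP: "finite ?P" by (rule finite_subset[of _ "{1..int b}"]) auto
    have "\<exists>g. \<forall>h. 2 * \<bar>g h\<bar> \<le> int b \<and> int b dvd int (fib n) * h - g h"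
    proof (rule choice, rule allI)
      fix h show "\<exists>y. 2 * \<bar>y\<bar> \<le> int b \<and> int b dvd int (fib n) * h - y"
        using abs_residue[of "int b" "int (fib n) * h"] b by auto
    qed
    then obtain g where g: "\<And>h. 2 * \<bar>g h\<bar> \<le> int b" "\<And>h. int b dvd int (fib n) * h - g h" by blast
    have Ug: "U (int (fib n) * h) \<le> (2 ^ s1) powr \<gamma> * \<bar>real_of_int (g h)\<bar> powr (- 1 - \<gamma>)" if "h \<in> ?P" for h
    proof -
      obtain t where "int (fib n) * h - g h = int b * t" using g(2)[of h] by (auto elim: dvdE)
      then have "int (fib n) * h = g h + int b * t" by simp
      then have e: "U (int (fib n) * h) = U (g h)" using Up[of "g h" t] by (simp add: b_def)
      have "int b \<le> 10 * h * \<bar>g h\<bar>" unfolding b_def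
        using that g(2)[of h] by (intro fib_dual_lattice) (auto simp: b_def)
      then have "g h \<noteq> 0" using b by auto
      then show ?thesis unfolding e using Ud[of "g h"] g(1)[of h] \<gamma> U0
        by (intro min_decay_powr) (auto simp: b_def)
    qed
    define B where "B t = {h. 2 ^ t \<le> h \<and> h < 2 ^ Suc t \<and> 2 * h \<le> int b \<and> h < int b}" for t
    define f where "f h = (SOME t. 2 ^ t \<le> h \<and> h < 2 ^ Suc t)" for h :: int
    have f: "2 ^ f h \<le> h \<and> h < 2 ^ Suc (f h)" if "1 \<le> h" for h
    proof -
      have "1 \<le> nat h" using that by simp
      then obtain t where "2 ^ t \<le> nat h" "nat h < 2 ^ (t + 1)" using ex_power_ivl1[of 2 "nat h"] by blast
      then have "2 ^ t \<le> h \<and> h < 2 ^ Suc t" using that by (simp add: nat_less_iff le_nat_iff)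
      then show ?thesis unfolding f_def by (rule someI)
    qed
    \<comment> \<open>A crude bound for the number of blocks; the geometric sum does not depend on
      it.\<close>
    have fT: "f ` ?P \<subseteq> {..<b}"
    proof
      fix t assume "t \<in> f ` ?P"
      then obtain h where h: "h \<in> ?P" "t = f h" by auto
      have "2 ^ t \<le> h" using f[of h] h by auto
      also have "h < int b" using h by auto
      also have "int b < 2 ^ b" by (metis less_exp of_nat_less_iff of_nat_numeral of_nat_power)
      finally show "t \<in> {..<b}" by simp
    qed
    have blk: "(\<Sum>h\<in>B t. V h * U (int (fib n) * h)) \<le> C0 * ((2 ^ (s1 + s2) / real b) powr \<gamma> / real b) * q ^ nat \<bar>int t - int s2\<bar>" for t
    proof -
      have Bf: "finite (B t)" unfolding B_def by (rule finite_subset[of _ "{2 ^ t..2 ^ Suc t}"]) auto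
      have "(1::int) \<le> 2 ^ t" by simp
      then have BP: "B t \<subseteq> ?P" unfolding B_def by fastforce
      define mn where "mn = min (1 / 2 ^ t) (2 ^ s2 / (2 ^ t)\<^sup>2 :: real)"
      have Vm: "V h \<le> mn" if "h \<in> B t" for h
      proof -
        have h: "2 ^ t \<le> real_of_int h" using that unfolding B_def
          by (metis (mono_tags, lifting) mem_Collect_eq of_int_le_iff of_int_numeral of_int_power)
        then have h: "2 ^ t \<le> \<bar>real_of_int h\<bar>" by linarith
        have h0: "2 * \<bar>h\<bar> \<le> int b" using that BP by auto
        have "2 ^ t * V h \<le> \<bar>real_of_int h\<bar> * V h" using h V0 by (intro mult_right_mono) auto
        also have "\<dots> \<le> 1" using Vd[of h] h0 by (simp add: b_def)
        finally have 1: "V h \<le> 1 / 2 ^ t" by (simp add: field_simps)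
        have "(2 ^ t)\<^sup>2 * V h \<le> \<bar>real_of_int h\<bar>\<^sup>2 * V h" using h V0 by (intro mult_right_mono power_mono) auto
        also have "\<dots> \<le> 2 ^ s2" unfolding power2_abs using Vd[of h] h0 by (simp add: b_def)
        finally have "V h \<le> 2 ^ s2 / (2 ^ t)\<^sup>2" by (simp add: field_simps)
        with 1 show ?thesis by (simp add: mn_def)
      qed
      have "(\<Sum>h\<in>B t. V h * U (int (fib n) * h)) \<le> (\<Sum>h\<in>B t. mn * ((2 ^ s1) powr \<gamma> * \<bar>real_of_int (g h)\<bar> powr (- 1 - \<gamma>)))"
        using Vm Ug BP U0 V0 by (intro sum_mono mult_mono) (auto intro: order_trans[OF V0 Vm])
      also have "\<dots> = mn * (2 ^ s1) powr \<gamma> * (\<Sum>h\<in>B t. \<bar>real_of_int (g h)\<bar> powr (- 1 - \<gamma>))"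
        by (simp add: sum_distrib_left mult_ac)
      also have "\<dots> \<le> mn * (2 ^ s1) powr \<gamma> * (C0 * (2 ^ t / real b) powr (1 + \<gamma>))"
        unfolding B_def b_def using g(2) by (intro mult_left_mono block) (auto simp: mn_def b_def)
      also have "\<dots> = C0 * ((2 ^ s1) powr \<gamma> / real b powr (1 + \<gamma>)) * (mn * (2 ^ t) powr (1 + \<gamma>))"
        using b by (simp add: powr_divide)
      finally have sumB: "(\<Sum>h\<in>B t. V h * U (int (fib n) * h)) \<le> C0 * ((2 ^ s1) powr \<gamma> / real b powr (1 + \<gamma>)) * (mn * (2 ^ t) powr (1 + \<gamma>))" .
      have mn2: "mn * (2 ^ t) powr (1 + \<gamma>) \<le> (2 ^ s2) powr \<gamma> * q ^ nat \<bar>int t - int s2\<bar>"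
      proof (cases "t \<le> s2")
        case True
        have "mn * (2 ^ t) powr (1 + \<gamma>) \<le> 1 / 2 ^ t * (2 ^ t) powr (1 + \<gamma>)"
          by (intro mult_right_mono) (auto simp: mn_def)
        also have "\<dots> = (2 ^ s2) powr \<gamma> * (2 powr (- \<gamma>)) ^ (s2 - t)"
          unfolding two_power_powr using True
          by (simp add: powr_powr of_nat_diff powr_power flip: powr_minus_divide powr_add) (simp add: algebra_simps)
        also have "\<dots> \<le> (2 ^ s2) powr \<gamma> * q ^ (s2 - t)"
          by (intro mult_left_mono power_mono) (auto simp: q_def)
        also have "s2 - t = nat \<bar>int t - int s2\<bar>" using True by auto
        finally show ?thesis .
      next
        case False
        have "mn * (2 ^ t) powr (1 + \<gamma>) \<le> 2 ^ s2 / (2 ^ t)\<^sup>2 * (2 ^ t) powr (1 + \<gamma>)"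
          by (intro mult_right_mono) (auto simp: mn_def)
        also have "\<dots> = (2 ^ s2) powr \<gamma> * (2 powr (- (1 - \<gamma>))) ^ (t - s2)"
          unfolding two_power_powr using False
          by (simp add: powr_powr of_nat_diff powr_power flip: powr_diff powr_add) (simp add: algebra_simps)
        also have "\<dots> \<le> (2 ^ s2) powr \<gamma> * q ^ (t - s2)"
          by (intro mult_left_mono power_mono) (auto simp: q_def)
        also have "t - s2 = nat \<bar>int t - int s2\<bar>" using False by auto
        finally show ?thesis .
      qed
      note sumB
      also have "C0 * ((2 ^ s1) powr \<gamma> / real b powr (1 + \<gamma>)) * (mn * (2 ^ t) powr (1 + \<gamma>)) \<le> C0 * ((2 ^ s1) powr \<gamma> / real b powr (1 + \<gamma>)) * ((2 ^ s2) powr \<gamma> * q ^ nat \<bar>int t - int s2\<bar>)"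
        using mn2 C0 by (intro mult_left_mono) auto
      also have "\<dots> = C0 * ((2 ^ (s1 + s2) / real b) powr \<gamma> / real b) * q ^ nat \<bar>int t - int s2\<bar>"
        using b by (simp add: powr_divide powr_add powr_mult power_add mult_ac)
      finally show ?thesis .
    qed
    have "(\<Sum>k\<in>{1..<b}. V (int k) * U (int (fib n) * int k)) \<le> 2 * (\<Sum>h\<in>?P. V h * U (int (fib n) * h))"
      using b V0 U0 Vp Ve Up Ue by (intro sum_dual_fold) (auto simp: b_def)
    also have "(\<Sum>h\<in>?P. V h * U (int (fib n) * h)) = (\<Sum>t<b. \<Sum>h\<in>{h\<in>?P. f h = t}. V h * U (int (fib n) * h))"
      by (rule sum.group[symmetric]) (use fP fT in auto)
    also have "\<dots> \<le> (\<Sum>t<b. \<Sum>h\<in>B t. V h * U (int (fib n) * h))"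
    proof (rule sum_mono)
      fix t
      have "finite (B t)" unfolding B_def by (rule finite_subset[of _ "{2 ^ t..2 ^ Suc t}"]) auto
      then show "(\<Sum>h\<in>{h\<in>?P. f h = t}. V h * U (int (fib n) * h)) \<le> (\<Sum>h\<in>B t. V h * U (int (fib n) * h))"
        using f V0 U0 by (intro sum_mono2) (auto simp: B_def)
    qed
    also have "\<dots> \<le> (\<Sum>t<b. C0 * ((2 ^ (s1 + s2) / real b) powr \<gamma> / real b) * q ^ nat \<bar>int t - int s2\<bar>)"
      by (intro sum_mono blk)
    also have "\<dots> = C0 * ((2 ^ (s1 + s2) / real b) powr \<gamma> / real b) * (\<Sum>t<b. q ^ nat \<bar>int t - int s2\<bar>)"
      by (simp add: sum_distrib_left)
    also have "\<dots> \<le> C0 * ((2 ^ (s1 + s2) / real b) powr \<gamma> / real b) * (2 / (1 - q))"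
      using C0 q by (intro mult_left_mono two_sided_geometric_sum) auto
    finally show "(\<Sum>k\<in>{1..<fib (Suc n)}. V (int k) * U (int (fib n) * int k))
          \<le> 2 * (C0 * (2 / (1 - q))) / real (fib (Suc n)) * (2 ^ (s1 + s2) / real (fib (Suc n))) powr \<gamma>"
      unfolding b_def by (simp add: mult_ac)
  qed
qed

section \<open>Lattice errors of tensor products of atoms\<close>

text \<open>A bump of width 2^-s. Derivatives are replaced by first and symmetric second
  differences, and only values in [0, 1] are constrained. In particular nothing is assumed across
  the joint when F is continued periodically.\<close>

definition atom :: "real \<Rightarrow> nat \<Rightarrow> (real \<Rightarrow> real) \<Rightarrow> bool" where
  "atom A s F \<longleftrightarrow>
     (\<forall>x\<in>{0..1}. \<bar>F x\<bar> \<le> 1) \<and>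
     (\<forall>x\<in>{0..1}. \<forall>y\<in>{0..1}. \<bar>F x - F y\<bar> \<le> 2 ^ s * \<bar>x - y\<bar>) \<and>
     (\<forall>x h. x - h \<in> {0..1} \<longrightarrow> x + h \<in> {0..1} \<longrightarrow> \<bar>F (x + h) - 2 * F x + F (x - h)\<bar> \<le> 4 ^ s * h\<^sup>2) \<and>
     (\<exists>c. \<forall>x\<in>{0..1}. F x \<noteq> 0 \<longrightarrow> \<bar>x - c\<bar> \<le> A / 2 ^ s)"

lemma card_near_le:
  assumes "t \<ge> 0"
  shows "real (card {\<mu>. \<mu> < b \<and> \<bar>real \<mu> - r\<bar> \<le> t}) \<le> 2 * t + 1"
proof -
  let ?S = "{\<mu>. \<mu> < b \<and> \<bar>real \<mu> - r\<bar> \<le> t}"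
  have "card ?S = card (int ` ?S)" by (simp add: card_image)
  also have "\<dots> \<le> card {\<lceil>r - t\<rceil>..\<lfloor>r + t\<rfloor>}"
    by (intro card_mono) (auto simp: abs_le_iff ceiling_le_iff le_floor_iff)
  finally have "real (card ?S) \<le> real (nat (\<lfloor>r + t\<rfloor> + 1 - \<lceil>r - t\<rceil>))" by simp
  also have "\<dots> \<le> 2 * t + 1"
  proof (cases "\<lfloor>r + t\<rfloor> + 1 - \<lceil>r - t\<rceil> \<ge> 0")
    case True
    then have "real (nat (\<lfloor>r + t\<rfloor> + 1 - \<lceil>r - t\<rceil>)) = of_int (\<lfloor>r + t\<rfloor> + 1 - \<lceil>r - t\<rceil>)" by simp
    also have "\<dots> \<le> 2 * t + 1" by linarith
    finally show ?thesis .
  qed (use assms in simp)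
  finally show ?thesis .
qed

lemma sum_near_le:
  fixes f :: "nat \<Rightarrow> real"
  assumes "t \<ge> 0" "m \<ge> 0"
    and "\<And>\<mu>. \<mu> < b \<Longrightarrow> \<bar>f \<mu>\<bar> \<le> m" and "\<And>\<mu>. \<mu> < b \<Longrightarrow> f \<mu> \<noteq> 0 \<Longrightarrow> \<bar>real \<mu> - r\<bar> \<le> t"
  shows "(\<Sum>\<mu><b. \<bar>f \<mu>\<bar>) \<le> m * (2 * t + 1)"
proof -
  let ?S = "{\<mu>. \<mu> < b \<and> \<bar>real \<mu> - r\<bar> \<le> t}"
  have "(\<Sum>\<mu><b. \<bar>f \<mu>\<bar>) = (\<Sum>\<mu>\<in>?S. \<bar>f \<mu>\<bar>)"
    by (rule sum.mono_neutral_right) (use assms in auto)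
  also have "\<dots> \<le> (\<Sum>\<mu>\<in>?S. m)" using assms by (intro sum_mono) auto
  also have "\<dots> = m * real (card ?S)" by simp
  also have "\<dots> \<le> m * (2 * t + 1)" using assms by (intro mult_left_mono card_near_le) auto
  finally show ?thesis .
qed

lemma atomD:
  assumes "atom A s F"
  shows "\<And>x. x \<in> {0..1} \<Longrightarrow> \<bar>F x\<bar> \<le> 1"
    "\<And>x y. x \<in> {0..1} \<Longrightarrow> y \<in> {0..1} \<Longrightarrow> \<bar>F x - F y\<bar> \<le> 2 ^ s * \<bar>x - y\<bar>"
    "\<And>x h. x - h \<in> {0..1} \<Longrightarrow> x + h \<in> {0..1} \<Longrightarrow> \<bar>F (x + h) - 2 * F x + F (x - h)\<bar> \<le> 4 ^ s * h\<^sup>2"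
    "\<exists>c. \<forall>x\<in>{0..1}. F x \<noteq> 0 \<longrightarrow> \<bar>x - c\<bar> \<le> A / 2 ^ s"
  using assms unfolding atom_def by auto

lemma atom_continuous: "atom A s F \<Longrightarrow> continuous_on {0..1} F"
  by (rule lipschitz_on_continuous_on[of "2 ^ s"])
    (auto simp: lipschitz_on_def dist_real_def dest: atomD(2))

definition grid :: "nat \<Rightarrow> (real \<Rightarrow> real) \<Rightarrow> nat \<Rightarrow> real" where
  "grid b F \<mu> = F (real (\<mu> mod b) / real b)"

lemma grid_eq: "b > 0 \<Longrightarrow> F 0 = F 1 \<Longrightarrow> \<mu> \<le> b \<Longrightarrow> grid b F \<mu> = F (real \<mu> / real b)"
  by (cases "\<mu> = b") (auto simp: grid_def)

lemma grid_periodic: "grid b F (\<mu> + b) = grid b F \<mu>"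
  by (simp add: grid_def)

lemma atom_scaled_support:
  assumes b: "b > 0" and c: "\<forall>x\<in>{0..1}. F x \<noteq> 0 \<longrightarrow> \<bar>x - c\<bar> \<le> w" and "j \<le> b" and F: "F (real j / real b) \<noteq> 0"
  shows "\<bar>real j - real b * c\<bar> \<le> real b * w"
proof -
  have "\<bar>real j / real b - c\<bar> \<le> w" using assms by auto
  then have "real b * \<bar>real j / real b - c\<bar> \<le> real b * w" by (intro mult_left_mono) auto
  moreover have "real b * \<bar>real j / real b - c\<bar> = \<bar>real j - real b * c\<bar>"
  proof -
    have "real b * (real j / real b - c) = real j - real b * c" using b by (simp add: algebra_simps)
    then show ?thesis by (metis abs_mult abs_of_nat)
  qed
  ultimately show ?thesis by simp
qed

text \<open>About b/2^s grid points meet the support, each with a first difference of at most 2^s/b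
  and a second difference of at most 4^s/b^2. The condition 2^s <= b keeps the rounding in this
  count bounded.\<close>

lemma atom_differences:
  assumes at: "atom A s F" and per: "F 0 = F 1" and b: "b > 0" and sb: "2 ^ s \<le> b" and A: "A \<ge> 0"
  shows "(\<Sum>\<mu><b. \<bar>grid b F (Suc \<mu>) - grid b F \<mu>\<bar>) \<le> 2 * (2 * A + 5)"
    and "real b * (\<Sum>\<mu><b. \<bar>grid b F (Suc (Suc \<mu>)) - 2 * grid b F (Suc \<mu>) + grid b F \<mu>\<bar>) \<le> 2 * (2 * A + 5) * 2 ^ s"
proof -
  let ?u = "grid b F"
  obtain c where c: "\<forall>x\<in>{0..1}. F x \<noteq> 0 \<longrightarrow> \<bar>x - c\<bar> \<le> A / 2 ^ s" using atomD(4)[OF at] by blast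
  note supp = atom_scaled_support[OF b c]
  have sb': "2 ^ s / real b \<le> 1" using sb b by (simp add: divide_le_eq flip: of_nat_power)
  have u: "\<And>\<mu>. \<mu> \<le> b \<Longrightarrow> ?u \<mu> = F (real \<mu> / real b)" using grid_eq[where F=F, OF b per] .
  have rb: "real b > 0" using b by simp
  have "(\<Sum>\<mu><b. \<bar>?u (Suc \<mu>) - ?u \<mu>\<bar>) \<le> 2 ^ s / real b * (2 * (real b * (A / 2 ^ s) + 1) + 1)"
  proof (rule sum_near_le[where r = "real b * c"])
    fix \<mu> assume \<mu>: "\<mu> < b"
    have "\<bar>F (real (Suc \<mu>) / real b) - F (real \<mu> / real b)\<bar> \<le> 2 ^ s * \<bar>real (Suc \<mu>) / real b - real \<mu> / real b\<bar>"
      using \<mu> by (intro atomD(2)[OF at]) auto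
    also have "real (Suc \<mu>) / real b - real \<mu> / real b = 1 / real b" by (simp add: diff_divide_distrib[symmetric])
    finally show "\<bar>?u (Suc \<mu>) - ?u \<mu>\<bar> \<le> 2 ^ s / real b" using \<mu> by (simp add: u)
    assume "?u (Suc \<mu>) - ?u \<mu> \<noteq> 0"
    then have "F (real (Suc \<mu>) / real b) \<noteq> 0 \<or> F (real \<mu> / real b) \<noteq> 0" using \<mu> by (auto simp: u)
    then show "\<bar>real \<mu> - real b * c\<bar> \<le> real b * (A / 2 ^ s) + 1"
      using supp[of "Suc \<mu>"] supp[of \<mu>] \<mu> by (auto simp: abs_le_iff)
  qed (use A in auto)
  also have "\<dots> = 2 * A + 3 * (2 ^ s / real b)" using rb by (simp add: field_simps)
  also have "\<dots> \<le> 2 * (2 * A + 5)"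
  proof -
    have "2 * A + 3 * z \<le> 2 * (2 * A + 5)" if "z \<le> 1" for z using that A by simp
    then show ?thesis using sb' by blast
  qed
  finally show "(\<Sum>\<mu><b. \<bar>?u (Suc \<mu>) - ?u \<mu>\<bar>) \<le> 2 * (2 * A + 5)" .
  define w where "w \<mu> = ?u (Suc (Suc \<mu>)) - 2 * ?u (Suc \<mu>) + ?u \<mu>" for \<mu>
  obtain b' where b': "b = Suc b'" using b by (cases b) auto
  have main: "(\<Sum>\<mu><b'. \<bar>w \<mu>\<bar>) \<le> 4 ^ s / (real b)\<^sup>2 * (2 * (real b * (A / 2 ^ s) + 2) + 1)"
  proof (rule sum_near_le[where r = "real b * c"])
    fix \<mu> assume \<mu>: "\<mu> < b'"
    define x where "x = real (Suc \<mu>) / real b"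
    have e: "x + 1 / real b = real (Suc (Suc \<mu>)) / real b" "x - 1 / real b = real \<mu> / real b"
      by (simp_all add: x_def add_divide_distrib diff_divide_distrib)
    have "\<bar>F (x + 1 / real b) - 2 * F x + F (x - 1 / real b)\<bar> \<le> 4 ^ s * (1 / real b)\<^sup>2"
      using \<mu> b' unfolding e by (intro atomD(3)[OF at, of x "1 / real b", unfolded e]) auto
    moreover have le: "Suc (Suc \<mu>) \<le> b" "Suc \<mu> \<le> b" "\<mu> \<le> b" using \<mu> b' by auto
    have we: "w \<mu> = F (x + 1 / real b) - 2 * F x + F (x - 1 / real b)"
      unfolding w_def u[OF le(1)] u[OF le(2)] u[OF le(3)] e by (simp add: x_def)
    ultimately show "\<bar>w \<mu>\<bar> \<le> 4 ^ s / (real b)\<^sup>2" by (simp add: power_divide)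
    assume "w \<mu> \<noteq> 0"
    then have "F (real (Suc (Suc \<mu>)) / real b) \<noteq> 0 \<or> F (real (Suc \<mu>) / real b) \<noteq> 0 \<or> F (real \<mu> / real b) \<noteq> 0"
      unfolding we e by (auto simp: x_def)
    then show "\<bar>real \<mu> - real b * c\<bar> \<le> real b * (A / 2 ^ s) + 2"
      using supp[of "Suc \<mu>"] supp[of "Suc (Suc \<mu>)"] supp[of \<mu>] \<mu> b' by (auto simp: abs_le_iff)
  qed (use A in auto)
  \<comment> \<open>The second difference across the joint is not controlled, as the periodic
    continuation may have a kink there. But all second differences around the cycle add up to 0, so
    this one is at most the sum of the others; hence the factor 2.\<close>
  have "(\<Sum>\<mu><b. w \<mu>) = (\<Sum>\<mu><b. (?u (Suc (Suc \<mu>)) - ?u (Suc \<mu>)) - (?u (Suc \<mu>) - ?u \<mu>))"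
    by (simp add: w_def algebra_simps)
  also have "\<dots> = (?u (Suc b) - ?u b) - (?u (Suc 0) - ?u 0)"
    by (rule sum_lessThan_telescope)
  also have "\<dots> = 0" using grid_periodic[of b F 0] grid_periodic[of b F 1] by simp
  finally have "w b' = - (\<Sum>\<mu><b'. w \<mu>)" by (simp add: b')
  then have "\<bar>w b'\<bar> \<le> (\<Sum>\<mu><b'. \<bar>w \<mu>\<bar>)" by (simp add: sum_abs)
  then have "(\<Sum>\<mu><b. \<bar>w \<mu>\<bar>) \<le> 2 * (\<Sum>\<mu><b'. \<bar>w \<mu>\<bar>)" by (simp add: b')
  also have "\<dots> \<le> 2 * (4 ^ s / (real b)\<^sup>2 * (2 * (real b * (A / 2 ^ s) + 2) + 1))" using main by simp
  finally have "real b * (\<Sum>\<mu><b. \<bar>w \<mu>\<bar>) \<le> real b * (2 * (4 ^ s / (real b)\<^sup>2 * (2 * (real b * (A / 2 ^ s) + 2) + 1)))"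
    by (intro mult_left_mono) auto
  also have "\<dots> = 2 * 2 ^ s * (2 * A + 5 * (2 ^ s / real b))"
  proof -
    have "(4::real) ^ s = 2 ^ s * 2 ^ s" by (simp flip: power_mult_distrib)
    then show ?thesis using rb by (simp add: field_simps power2_eq_square)
  qed
  also have "\<dots> \<le> 2 * 2 ^ s * (2 * A + 5)" using sb' by (intro mult_left_mono) auto
  finally show "real b * (\<Sum>\<mu><b. \<bar>grid b F (Suc (Suc \<mu>)) - 2 * grid b F (Suc \<mu>) + grid b F \<mu>\<bar>) \<le> 2 * (2 * A + 5) * 2 ^ s"
    by (simp add: w_def algebra_simps)
qed

text \<open>Reflection in the midpoint m: both F t + F (2 m - t) and F x + F (x + d) differ from 2 F
  m by a symmetric second difference, so integrating their difference over the cell bounds twice the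
  error.\<close>

lemma trapezoid_cell:
  fixes F :: "real \<Rightarrow> real"
  assumes cont: "continuous_on {x..x + d} F" and d: "d \<ge> 0"
    and F2: "\<And>y h. y - h \<in> {x..x + d} \<Longrightarrow> y + h \<in> {x..x + d} \<Longrightarrow> \<bar>F (y + h) - 2 * F y + F (y - h)\<bar> \<le> K * h\<^sup>2"
  shows "\<bar>integral {x..x + d} F - d * (F x + F (x + d)) / 2\<bar> \<le> K * d ^ 3"
proof (cases "d = 0")
  case False
  with d have d: "d > 0" by simp
  define m where "m = x + d / 2"
  have K: "K \<ge> 0"
  proof -
    have "0 \<le> K * (d / 2)\<^sup>2" using F2[of m "d / 2"] d by (auto simp: m_def intro: order_trans[OF abs_ge_zero])
    then show ?thesis using d by (simp add: zero_le_mult_iff)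
  qed
  have int: "F integrable_on {x..x + d}" by (rule integrable_continuous_interval[OF cont])
  have r: "((\<lambda>t. F (2 * m - t)) has_integral integral {x..x + d} F) {x..x + d}"
  proof -
    have "((\<lambda>t. F (- 1 *\<^sub>R t + 2 * m)) has_integral (1 / \<bar>- 1\<bar> ^ DIM(real)) *\<^sub>R integral {x..x + d} F) ((\<lambda>t. (1 / - 1) *\<^sub>R t + - ((1 / - 1) *\<^sub>R (2 * m))) ` cbox x (x + d))"
      by (rule has_integral_affinity) (use int in \<open>auto simp: has_integral_integral\<close>)
    moreover have "(\<lambda>t. (1 / - 1) *\<^sub>R t + - ((1 / - 1) *\<^sub>R (2 * m))) ` cbox x (x + d) = {x..x + d}"
    proof -
      have "(\<lambda>t. (1 / - 1) *\<^sub>R t + - ((1 / - 1) *\<^sub>R (2 * m))) = (\<lambda>t. 2 * m - t)" by auto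
      then show ?thesis by (simp add: image_diff_atLeastAtMost m_def)
    qed
    ultimately have "((\<lambda>t. F (- 1 *\<^sub>R t + 2 * m)) has_integral (1 / \<bar>- 1\<bar> ^ DIM(real)) *\<^sub>R integral {x..x + d} F) {x..x + d}"
      by (simp only:)
    then show ?thesis by simp
  qed
  have h: "((\<lambda>t. F t + F (2 * m - t) - (F x + F (x + d))) has_integral
     integral {x..x + d} F + integral {x..x + d} F - (F x + F (x + d)) * d) {x..x + d}"
    using has_integral_diff[OF has_integral_add[OF integrable_integral[OF int] r] has_integral_const_real[of "F x + F (x + d)" x "x + d"]] d
    by (simp add: mult.commute)
  have "norm (integral {x..x + d} F + integral {x..x + d} F - (F x + F (x + d)) * d) \<le> (2 * (K * d\<^sup>2)) * measure lborel {x..x + d}"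
  proof (rule has_integral_bound_real[OF _ _ h])
    fix t assume t': "t \<in> {x..x + d} - {}"
    then have t: "t \<in> {x..x + d}" by simp
    have q: "(t - m)\<^sup>2 \<le> d\<^sup>2" using t d unfolding m_def by (intro abs_le_square_iff[THEN iffD1]) (auto simp: abs_le_iff)
    have q': "(d / 2)\<^sup>2 \<le> d\<^sup>2" using d by (intro power_mono) auto
    have "\<bar>F (m + (t - m)) - 2 * F m + F (m - (t - m))\<bar> \<le> K * (t - m)\<^sup>2"
      by (rule F2) (use t in \<open>auto simp: m_def\<close>)
    also have "\<dots> \<le> K * d\<^sup>2" using q K by (rule mult_left_mono)
    finally have 1: "\<bar>F t - 2 * F m + F (2 * m - t)\<bar> \<le> K * d\<^sup>2" by (simp add: algebra_simps)
    have "\<bar>F (m + d / 2) - 2 * F m + F (m - d / 2)\<bar> \<le> K * (d / 2)\<^sup>2"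
      by (rule F2) (use d in \<open>auto simp: m_def\<close>)
    also have "\<dots> \<le> K * d\<^sup>2" using q' K by (rule mult_left_mono)
    finally have 2: "\<bar>F (x + d) - 2 * F m + F x\<bar> \<le> K * d\<^sup>2" by (simp add: m_def add.commute)
    show "norm (F t + F (2 * m - t) - (F x + F (x + d))) \<le> 2 * (K * d\<^sup>2)" using 1 2 by simp
  qed (use K in auto)
  then show ?thesis using d by (simp add: power3_eq_cube power2_eq_square abs_le_iff field_simps)
qed simp

lemma integral_grid_cells:
  fixes F :: "real \<Rightarrow> real"
  assumes cont: "continuous_on {0..1} F" and b: "b > 0"
  shows "integral {0..1} F = (\<Sum>\<mu><b. integral {real \<mu> / real b..real \<mu> / real b + 1 / real b} F)"
proof -
  have "m \<le> b \<Longrightarrow> integral {0..real m / real b} F = (\<Sum>\<mu><m. integral {real \<mu> / real b..real \<mu> / real b + 1 / real b} F)" for m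
  proof (induction m)
    case (Suc m)
    have e: "real (Suc m) / real b = real m / real b + 1 / real b" by (simp add: add_divide_distrib)
    have "integral {0..real m / real b} F + integral {real m / real b..real (Suc m) / real b} F = integral {0..real (Suc m) / real b} F"
    proof (rule Henstock_Kurzweil_Integration.integral_combine)
      show "F integrable_on {0..real (Suc m) / real b}"
        using Suc.prems by (intro integrable_continuous_interval continuous_on_subset[OF cont]) auto
    qed (auto simp: divide_right_mono)
    then show ?case unfolding e using Suc by simp
  qed simp
  from this[of b] show ?thesis using b by simp
qed

text \<open>As F 0 = F 1, the grid mean is the trapezoidal sum. A cell contributes an error of at
  most 4^s/b^3, and only about b/2^s cells meet the support.\<close>

lemma atom_trapezoid:
  assumes at: "atom A s F" and per: "F 0 = F 1" and b: "b > 0" and sb: "2 ^ s \<le> b" and A: "A \<ge> 0"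
  shows "\<bar>(\<Sum>\<mu><b. grid b F \<mu>) / real b - integral {0..1} F\<bar> \<le> (2 * A + 3) * 2 ^ s / (real b)\<^sup>2"
proof -
  obtain c where c: "\<forall>x\<in>{0..1}. F x \<noteq> 0 \<longrightarrow> \<bar>x - c\<bar> \<le> A / 2 ^ s" using atomD(4)[OF at] by blast
  note cont = atom_continuous[OF at]
  have rb: "real b > 0" using b by simp
  have sb': "2 ^ s / real b \<le> 1" using sb b by (simp add: divide_le_eq flip: of_nat_power)
  define E where "E \<mu> = 1 / real b * (F (real \<mu> / real b) + F (real \<mu> / real b + 1 / real b)) / 2
     - integral {real \<mu> / real b..real \<mu> / real b + 1 / real b} F" for \<mu>
  have u: "\<And>\<mu>. \<mu> \<le> b \<Longrightarrow> grid b F \<mu> = F (real \<mu> / real b)" using grid_eq[where F=F, OF b per] .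
  have tr: "(\<Sum>\<mu><b. grid b F \<mu>) / real b = (\<Sum>\<mu><b. 1 / real b * (F (real \<mu> / real b) + F (real \<mu> / real b + 1 / real b)) / 2)"
  proof -
    have "(\<Sum>\<mu><b. grid b F (Suc \<mu>)) = (\<Sum>\<mu><b. grid b F \<mu>)"
      using sum.lessThan_Suc_shift[of "grid b F" b] grid_periodic[of b F 0] by simp
    then have "(\<Sum>\<mu><b. grid b F \<mu>) / real b = (\<Sum>\<mu><b. (grid b F \<mu> + grid b F (Suc \<mu>)) / (2 * real b))"
      by (simp add: sum.distrib flip: sum_divide_distrib)
    also have "\<dots> = (\<Sum>\<mu><b. 1 / real b * (F (real \<mu> / real b) + F (real \<mu> / real b + 1 / real b)) / 2)"
      by (intro sum.cong refl) (simp add: u add_divide_distrib add.commute mult.commute)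
    finally show ?thesis .
  qed
  have "\<bar>(\<Sum>\<mu><b. grid b F \<mu>) / real b - integral {0..1} F\<bar> = \<bar>\<Sum>\<mu><b. E \<mu>\<bar>"
    unfolding tr integral_grid_cells[OF cont b] E_def by (simp only: sum_subtractf)
  also have "\<dots> \<le> (\<Sum>\<mu><b. \<bar>E \<mu>\<bar>)" by (rule sum_abs)
  also have "\<dots> \<le> 4 ^ s * (1 / real b) ^ 3 * (2 * (real b * (A / 2 ^ s) + 1) + 1)"
  proof (rule sum_near_le[where r = "real b * c"])
    fix \<mu> assume \<mu>: "\<mu> < b"
    have "real \<mu> / real b \<ge> 0" by simp
    moreover have "real \<mu> / real b + 1 / real b \<le> 1" using \<mu> by (auto simp: divide_simps)
    ultimately have sub: "{real \<mu> / real b..real \<mu> / real b + 1 / real b} \<subseteq> {0..1}"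
      by (auto simp del: zero_le_divide_iff)
    have "\<bar>integral {real \<mu> / real b..real \<mu> / real b + 1 / real b} F - 1 / real b * (F (real \<mu> / real b) + F (real \<mu> / real b + 1 / real b)) / 2\<bar> \<le> 4 ^ s * (1 / real b) ^ 3"
      by (intro trapezoid_cell continuous_on_subset[OF cont sub] atomD(3)[OF at]) (auto intro: subsetD[OF sub] simp del: atLeastAtMost_iff)
    then show "\<bar>E \<mu>\<bar> \<le> 4 ^ s * (1 / real b) ^ 3" unfolding E_def by linarith
    assume "E \<mu> \<noteq> 0"
    \<comment> \<open>A cell on which F vanishes has no error, so a cell with an error lies within
      1/b of the support.\<close>
    have "\<exists>x\<in>{real \<mu> / real b..real \<mu> / real b + 1 / real b}. F x \<noteq> 0"
    proof (rule ccontr)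
      assume "\<not> ?thesis"
      then have z: "\<And>x. x \<in> {real \<mu> / real b..real \<mu> / real b + 1 / real b} \<Longrightarrow> F x = 0" by blast
      then have "integral {real \<mu> / real b..real \<mu> / real b + 1 / real b} F = integral {real \<mu> / real b..real \<mu> / real b + 1 / real b} (\<lambda>_. 0)"
        by (intro Henstock_Kurzweil_Integration.integral_cong) auto
      then have "integral {real \<mu> / real b..real \<mu> / real b + 1 / real b} F = 0" by simp
      then show False using \<open>E \<mu> \<noteq> 0\<close> z by (simp add: E_def)
    qed
    then obtain x where x: "real \<mu> / real b \<le> x" "x \<le> real \<mu> / real b + 1 / real b" "F x \<noteq> 0" by auto
    then have "x \<in> {0..1}" by (intro subsetD[OF sub]) auto
    then have "\<bar>x - c\<bar> \<le> A / 2 ^ s" using c x(3) by auto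
    then have "\<bar>real b * (x - c)\<bar> \<le> real b * (A / 2 ^ s)" unfolding abs_mult using rb by (simp del: times_divide_eq_right)
    moreover have "real \<mu> \<le> real b * x" "real b * x \<le> real \<mu> + 1" using x rb by (auto simp: field_simps)
    moreover have "real b * (x - c) = real b * x - real b * c" by (simp add: algebra_simps)
    ultimately show "\<bar>real \<mu> - real b * c\<bar> \<le> real b * (A / 2 ^ s) + 1" by linarith
  qed (use A in auto)
  also have "\<dots> = 2 ^ s * (2 * A + 3 * (2 ^ s / real b)) / (real b)\<^sup>2"
  proof -
    have "(4::real) ^ s = 2 ^ s * 2 ^ s" by (simp flip: power_mult_distrib)
    then show ?thesis using rb by (simp add: field_simps power2_eq_square power3_eq_cube)
  qed
  also have "\<dots> \<le> 2 ^ s * (2 * A + 3) / (real b)\<^sup>2" using sb' by (intro divide_right_mono mult_left_mono) auto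
  finally show ?thesis by (simp add: mult_ac)
qed

lemma atom_mean_bound:
  assumes at: "atom A s F" and per: "F 0 = F 1" and b: "b > 0" and sb: "2 ^ s \<le> b" and A: "A \<ge> 0"
  shows "\<bar>(\<Sum>\<mu><b. grid b F \<mu>) / real b\<bar> \<le> (2 * A + 1) / 2 ^ s"
proof -
  obtain c where c: "\<forall>x\<in>{0..1}. F x \<noteq> 0 \<longrightarrow> \<bar>x - c\<bar> \<le> A / 2 ^ s" using atomD(4)[OF at] by blast
  have u: "\<And>\<mu>. \<mu> \<le> b \<Longrightarrow> grid b F \<mu> = F (real \<mu> / real b)" using grid_eq[where F=F, OF b per] .
  have "(\<Sum>\<mu><b. \<bar>grid b F \<mu>\<bar>) \<le> 1 * (2 * (real b * (A / 2 ^ s)) + 1)"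
  proof (rule sum_near_le[where r = "real b * c"])
    fix \<mu> assume \<mu>: "\<mu> < b"
    show "\<bar>grid b F \<mu>\<bar> \<le> 1" using \<mu> atomD(1)[OF at] by (auto simp: u)
    assume "grid b F \<mu> \<noteq> 0"
    then show "\<bar>real \<mu> - real b * c\<bar> \<le> real b * (A / 2 ^ s)"
      using atom_scaled_support[OF b c, of \<mu>] \<mu> by (simp add: u)
  qed (use A in auto)
  then have "\<bar>\<Sum>\<mu><b. grid b F \<mu>\<bar> \<le> 2 * (real b * (A / 2 ^ s)) + 1"
    by (intro order_trans[OF sum_abs]) (simp only: mult_1_left)
  then have "\<bar>\<Sum>\<mu><b. grid b F \<mu>\<bar> / real b \<le> (2 * (real b * (A / 2 ^ s)) + 1) / real b"
    by (intro divide_right_mono) auto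
  also have "\<dots> = 2 * A / 2 ^ s + 1 / real b" using b by (simp add: field_simps)
  also have "1 / real b \<le> 1 / 2 ^ s" using sb b by (intro divide_left_mono) (auto simp flip: of_nat_power)
  finally show ?thesis using b by (simp add: abs_divide add_divide_distrib)
qed

text \<open>Comparison with the grid of 2^s points, for which the grid mean and the trapezoidal
  error are both of order 2^-s.\<close>

lemma atom_integral_bound:
  assumes at: "atom A s F" and per: "F 0 = F 1" and A: "A \<ge> 0"
  shows "\<bar>integral {0..1} F\<bar> \<le> (4 * A + 4) / 2 ^ s"
proof -
  have "\<bar>(\<Sum>\<mu><2 ^ s. grid (2 ^ s) F \<mu>) / real (2 ^ s) - integral {0..1} F\<bar> \<le> (2 * A + 3) * 2 ^ s / (real (2 ^ s))\<^sup>2"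
    by (rule atom_trapezoid[OF at per _ _ A]) auto
  also have "\<dots> = (2 * A + 3) / 2 ^ s" by (simp add: power2_eq_square)
  finally have "\<bar>(\<Sum>\<mu><2 ^ s. grid (2 ^ s) F \<mu>) / real (2 ^ s) - integral {0..1} F\<bar> \<le> (2 * A + 3) / 2 ^ s" .
  moreover have "\<bar>(\<Sum>\<mu><2 ^ s. grid (2 ^ s) F \<mu>) / real (2 ^ s)\<bar> \<le> (2 * A + 1) / 2 ^ s"
    by (rule atom_mean_bound[OF at per _ _ A]) auto
  moreover have "(4 * A + 4) / 2 ^ s = (2 * A + 3) / 2 ^ s + (2 * A + 1) / 2 ^ s"
    by (simp flip: add_divide_distrib)
  ultimately show ?thesis by linarith
qed

section \<open>The lattice error of a product of two periodic atoms\<close>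

definition lattice_err :: "nat \<Rightarrow> (real \<Rightarrow> real) \<Rightarrow> (real \<Rightarrow> real) \<Rightarrow> real" where
  "lattice_err n F G = (\<Sum>\<mu><fib (Suc n). grid (fib (Suc n)) F \<mu> * grid (fib (Suc n)) G ((fib n * \<mu>) mod fib (Suc n))) / real (fib (Suc n))
     - integral {0..1} F * integral {0..1} G"

lemma lattice_err_fine:
  fixes A :: real
  assumes A: "A > 0" and F: "atom A s1 F" "F 0 = F 1" and G: "atom A s2 G" "G 0 = G 1"
    and large: "fib (Suc n) \<le> 2 ^ (s1 + s2)"
  shows "\<bar>lattice_err n F G\<bar> \<le> (40 * A\<^sup>2 + 2 + (4 * A + 4)\<^sup>2) / real (fib (Suc n))"
proof -
  define b where "b = fib (Suc n)"
  have b: "b > 0" unfolding b_def by (simp add: fib_neq_0_nat)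
  define a where "a = fib n"
  obtain c1 where c1: "\<forall>x\<in>{0..1}. F x \<noteq> 0 \<longrightarrow> \<bar>x - c1\<bar> \<le> A / 2 ^ s1" using atomD(4)[OF F(1)] by blast
  obtain c2 where c2: "\<forall>x\<in>{0..1}. G x \<noteq> 0 \<longrightarrow> \<bar>x - c2\<bar> \<le> A / 2 ^ s2" using atomD(4)[OF G(1)] by blast
  define w1 w2 where "w1 = A / 2 ^ s1" and "w2 = A / 2 ^ s2"
  have w: "w1 > 0" "w2 > 0" using A by (auto simp: w1_def w2_def)
  have large': "real b \<le> 2 ^ (s1 + s2)" using large unfolding b_def by (metis of_nat_le_iff of_nat_numeral of_nat_power)
  have ww: "real b * w1 * w2 \<le> A\<^sup>2"
  proof -
    have "real b * w1 * w2 = A\<^sup>2 * (real b / 2 ^ (s1 + s2))"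
      by (simp add: w1_def w2_def power_add power2_eq_square)
    also have "\<dots> \<le> A\<^sup>2 * 1" using large' by (intro mult_left_mono) auto
    finally show ?thesis by simp
  qed
  define T where "T = {\<mu>. \<mu> < b \<and> grid b F \<mu> * grid b G ((a * \<mu>) mod b) \<noteq> 0}"
  \<comment> \<open>Two nodes of \<open>T\<close> differ by at most 2 b w2 in the second coordinate
    times b, so by \<open>fib_dual_lattice\<close> their indices differ by at least b / (10 * 2 b
    w2) = D. The indices lie in an interval of length 2 b w1, which leaves room for 40 b w1 w2 + 2
    of them.\<close>
  define D where "D = 1 / (20 * w2)"
  have D: "D > 0" using w by (simp add: D_def)
  define m where "m \<mu> = \<lfloor>real \<mu> / D\<rfloor>" for \<mu> :: nat
  have Tc: "\<bar>real \<mu> - real b * c1\<bar> \<le> real b * w1" "\<bar>real ((a * \<mu>) mod b) - real b * c2\<bar> \<le> real b * w2"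
    if "\<mu> \<in> T" for \<mu>
    using that atom_scaled_support[OF b c1, of \<mu>] atom_scaled_support[OF b c2, of "(a * \<mu>) mod b"] b
    by (auto simp: T_def grid_def w1_def w2_def less_imp_le)
  have inj: "inj_on m T"
  proof (rule linorder_inj_onI')
    fix i j assume ij: "i \<in> T" "j \<in> T" "i < j"
    show "m i \<noteq> m j"
    proof
      assume "m i = m j"
      then have "\<bar>real j / D - real i / D\<bar> < 1" unfolding m_def by linarith
      then have d1: "real j - real i < D" using D by (simp add: field_simps abs_if split: if_splits)
      define h where "h = int j - int i"
      define g where "g = int ((a * j) mod b) - int ((a * i) mod b)"
      have "int b \<le> 10 * h * \<bar>g\<bar>" unfolding b_def
      proof (rule fib_dual_lattice)
        show "0 < h" using ij by (simp add: h_def)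
        show "h < int (fib (Suc n))" using ij by (simp add: h_def T_def b_def)
        have "int (fib n) * h - g = (int (a * j) - int ((a * j) mod b)) - (int (a * i) - int ((a * i) mod b))"
          by (simp add: h_def g_def a_def algebra_simps)
        moreover have "int b dvd int x - int (x mod b)" for x by (simp add: zmod_int dvd_minus_mod)
        ultimately show "int (fib (Suc n)) dvd int (fib n) * h - g" by (metis b_def dvd_diff)
      qed
      then have "real_of_int (int b) \<le> real_of_int (10 * h * \<bar>g\<bar>)" by (simp only: of_int_le_iff)
      then have "real b \<le> 10 * real_of_int h * \<bar>real_of_int g\<bar>" by simp
      also have "\<dots> < 10 * D * (2 * (real b * w2))"
      proof -
        have "\<bar>real_of_int g\<bar> \<le> 2 * (real b * w2)" using Tc(2)[OF ij(1)] Tc(2)[OF ij(2)] unfolding g_def by simp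
        moreover have "real_of_int h < D" using d1 by (simp add: h_def)
        moreover have "2 * (real b * w2) > 0" using b w by simp
        ultimately show ?thesis using ij(3)
          by (smt (verit, best) h_def mult_less_le_imp_less mult_strict_right_mono of_int_0_less_iff of_nat_less_iff mult_le_less_imp_less mult_left_mono)
      qed
      also have "\<dots> = real b" using w by (simp add: D_def)
      finally show False by simp
    qed
  qed
  have fT: "finite T" unfolding T_def by simp
  have cardT: "real (card T) \<le> 40 * A\<^sup>2 + 2"
  proof -
    have "card T = card (m ` T)" using inj by (simp add: card_image)
    also have "\<dots> \<le> card {\<lfloor>(real b * c1 - real b * w1) / D\<rfloor>..\<lfloor>(real b * c1 + real b * w1) / D\<rfloor>}"
    proof (intro card_mono image_subsetI)
      fix \<mu> assume "\<mu> \<in> T"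
      then have "real b * c1 - real b * w1 \<le> real \<mu>" "real \<mu> \<le> real b * c1 + real b * w1"
        using Tc(1)[of \<mu>] by (auto simp: abs_le_iff)
      then show "m \<mu> \<in> {\<lfloor>(real b * c1 - real b * w1) / D\<rfloor>..\<lfloor>(real b * c1 + real b * w1) / D\<rfloor>}"
        unfolding m_def using D by (auto intro!: floor_mono divide_right_mono)
    qed simp
    finally have "real (card T) \<le> real (nat (\<lfloor>(real b * c1 + real b * w1) / D\<rfloor> + 1 - \<lfloor>(real b * c1 - real b * w1) / D\<rfloor>))"
      by simp
    also have "\<dots> \<le> (real b * c1 + real b * w1) / D - (real b * c1 - real b * w1) / D + 2"
    proof -
      have "(real b * c1 - real b * w1) / D \<le> (real b * c1 + real b * w1) / D"
        using b w D by (intro divide_right_mono) auto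
      moreover have "real (nat (\<lfloor>y\<rfloor> + 1 - \<lfloor>x\<rfloor>)) \<le> y - x + 2" if "x \<le> y" for x y :: real
      proof -
        have "\<lfloor>x\<rfloor> \<le> \<lfloor>y\<rfloor>" using that by (rule floor_mono)
        then have "real (nat (\<lfloor>y\<rfloor> + 1 - \<lfloor>x\<rfloor>)) = of_int (\<lfloor>y\<rfloor> + 1 - \<lfloor>x\<rfloor>)" by simp
        also have "\<dots> \<le> y - x + 2" by linarith
        finally show ?thesis .
      qed
      ultimately show ?thesis by blast
    qed
    also have "\<dots> = 40 * (real b * w1 * w2) + 2" using w by (simp add: D_def field_simps)
    also have "\<dots> \<le> 40 * A\<^sup>2 + 2" using ww by simp
    finally show ?thesis .
  qed
  have "\<bar>\<Sum>\<mu><b. grid b F \<mu> * grid b G ((a * \<mu>) mod b)\<bar> \<le> (\<Sum>\<mu><b. \<bar>grid b F \<mu> * grid b G ((a * \<mu>) mod b)\<bar>)"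
    by (rule sum_abs)
  also have "\<dots> = (\<Sum>\<mu>\<in>T. \<bar>grid b F \<mu> * grid b G ((a * \<mu>) mod b)\<bar>)"
    by (rule sum.mono_neutral_right) (auto simp: T_def)
  also have "\<dots> \<le> (\<Sum>\<mu>\<in>T. 1)"
  proof (rule sum_mono)
    fix \<mu> assume "\<mu> \<in> T"
    have "\<bar>grid b F \<mu>\<bar> \<le> 1" "\<bar>grid b G ((a * \<mu>) mod b)\<bar> \<le> 1"
      unfolding grid_def using b by (auto intro!: atomD(1)[OF F(1)] atomD(1)[OF G(1)] simp: less_imp_le)
    then show "\<bar>grid b F \<mu> * grid b G ((a * \<mu>) mod b)\<bar> \<le> 1" unfolding abs_mult by (simp add: mult_le_one)
  qed
  also have "\<dots> \<le> 40 * A\<^sup>2 + 2" using cardT by simp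
  finally have 1: "\<bar>(\<Sum>\<mu><b. grid b F \<mu> * grid b G ((a * \<mu>) mod b)) / real b\<bar> \<le> (40 * A\<^sup>2 + 2) / real b"
    using b by (simp add: abs_divide divide_right_mono)
  have "\<bar>integral {0..1} F * integral {0..1} G\<bar> \<le> (4 * A + 4) / 2 ^ s1 * ((4 * A + 4) / 2 ^ s2)"
    unfolding abs_mult using A F G by (intro mult_mono atom_integral_bound) auto
  also have "\<dots> = (4 * A + 4)\<^sup>2 / 2 ^ (s1 + s2)" by (simp add: power_add power2_eq_square)
  also have "\<dots> \<le> (4 * A + 4)\<^sup>2 / real b" using large' b by (intro divide_left_mono) auto
  finally have 2: "\<bar>integral {0..1} F * integral {0..1} G\<bar> \<le> (4 * A + 4)\<^sup>2 / real b" .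
  have "\<bar>lattice_err n F G\<bar> \<le> (40 * A\<^sup>2 + 2) / real b + (4 * A + 4)\<^sup>2 / real b"
    unfolding lattice_err_def b_def[symmetric] a_def[symmetric] by (intro order_trans[OF abs_triangle_ineq4] add_mono 1 2)
  then show ?thesis by (simp add: b_def add_divide_distrib)
qed

lemma dft_0: "dft b u 0 = of_real ((\<Sum>\<mu><b. u \<mu>) / real b)"
  by (simp add: dft_def)

text \<open>The zero frequency contributes the product of the two grid means, which the trapezoidal
  estimate compares with the product of the integrals at a cost of order R/b; this is at most
  R^\<gamma>/b since R <= 1. The remaining frequencies run through the dual lattice and are summed
  by \<open>fib_dual_sum\<close>.\<close>

lemma lattice_err_coarse:
  fixes \<gamma> A :: real
  assumes \<gamma>: "0 < \<gamma>" "\<gamma> < 1" and A: "A > 0"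
  obtains C where "C > 0"
    "\<And>n s1 s2 F G. atom A s1 F \<Longrightarrow> F 0 = F 1 \<Longrightarrow> atom A s2 G \<Longrightarrow> G 0 = G 1 \<Longrightarrow> 2 ^ (s1 + s2) \<le> fib (Suc n) \<Longrightarrow>
       \<bar>lattice_err n F G\<bar> \<le> C / real (fib (Suc n)) * (2 ^ (s1 + s2) / real (fib (Suc n))) powr \<gamma>"
proof (rule fib_dual_sum[OF \<gamma>])
  fix C0 :: real
  assume C0: "C0 > 0" and dual: "\<And>n s1 s2 (U :: int \<Rightarrow> real) V.
       (\<And>h. V h \<ge> 0) \<Longrightarrow> (\<And>h. U h \<ge> 0) \<Longrightarrow>
       (\<And>h t. V (h + int (fib (Suc n)) * t) = V h) \<Longrightarrow> (\<And>h. V (- h) = V h) \<Longrightarrow>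
       (\<And>h t. U (h + int (fib (Suc n)) * t) = U h) \<Longrightarrow> (\<And>h. U (- h) = U h) \<Longrightarrow>
       (\<And>h. 2 * \<bar>h\<bar> \<le> int (fib (Suc n)) \<Longrightarrow> \<bar>real_of_int h\<bar> * U h \<le> 1 \<and> (real_of_int h)\<^sup>2 * U h \<le> 2 ^ s1) \<Longrightarrow>
       (\<And>h. 2 * \<bar>h\<bar> \<le> int (fib (Suc n)) \<Longrightarrow> \<bar>real_of_int h\<bar> * V h \<le> 1 \<and> (real_of_int h)\<^sup>2 * V h \<le> 2 ^ s2) \<Longrightarrow>
       (\<Sum>k\<in>{1..<fib (Suc n)}. V (int k) * U (int (fib n) * int k))
          \<le> C0 / real (fib (Suc n)) * (2 ^ (s1 + s2) / real (fib (Suc n))) powr \<gamma>"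
  \<comment> \<open>The constant of \<open>atom_differences\<close>; dividing the coefficients by it
    normalises them for \<open>fib_dual_sum\<close>.\<close>
  define c where "c = 2 * (2 * A + 5)"
  have c: "c > 0" using A by (simp add: c_def)
  define C1 where "C1 = (2 * A + 3) * (2 * A + 1) + (4 * A + 4) * (2 * A + 3)"
  have C1: "C1 > 0" using A by (simp add: C1_def add_pos_pos)
  show thesis
  proof (rule that[of "c\<^sup>2 * C0 + C1"])
    show "c\<^sup>2 * C0 + C1 > 0" using c C0 C1 by (simp add: add_pos_pos)
    fix n s1 s2 F G
    assume F: "atom A s1 F" "F 0 = F 1" and G: "atom A s2 G" "G 0 = G 1" and small: "2 ^ (s1 + s2) \<le> fib (Suc n)"
    define b where "b = fib (Suc n)"
    have b: "b > 0" unfolding b_def by (simp add: fib_neq_0_nat)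
    have s1: "2 ^ s1 \<le> b" and s2: "2 ^ s2 \<le> b"
      using small unfolding b_def by (meson le_add1 le_add2 one_le_numeral order_trans power_increasing)+
    have small': "2 ^ (s1 + s2) \<le> real b" using small unfolding b_def by (metis of_nat_le_iff of_nat_numeral of_nat_power)
    define R where "R = 2 ^ (s1 + s2) / real b"
    have R: "0 < R" "R \<le> 1" using small' b by (auto simp: R_def)
    define a where "a = fib n"
    define uh where "uh = dft b (grid b F)"
    define vh where "vh = dft b (grid b G)"
    define S where "S = (\<Sum>\<mu><b. grid b F \<mu> * grid b G ((a * \<mu>) mod b)) / real b"
    define mF where "mF = (\<Sum>\<mu><b. grid b F \<mu>) / real b"
    define mG where "mG = (\<Sum>\<mu><b. grid b G \<mu>) / real b"
    define IF where "IF = integral {0..1} F"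
    define IG where "IG = integral {0..1} G"
    have Sd: "of_real S = (\<Sum>k<b. vh (int k) * uh (- (int a * int k)))"
      unfolding S_def uh_def vh_def by (rule dft_lattice_sum[OF b])
    have split: "(\<Sum>k<b. vh (int k) * uh (- (int a * int k))) = vh 0 * uh 0 + (\<Sum>k\<in>{1..<b}. vh (int k) * uh (- (int a * int k)))"
    proof -
      have "{..<b} = insert 0 {1..<b}" using b by auto
      then show ?thesis by simp
    qed
    have "of_real (S - mF * mG) = (\<Sum>k\<in>{1..<b}. vh (int k) * uh (- (int a * int k)))"
      using Sd split by (simp add: uh_def vh_def dft_0 mF_def mG_def mult.commute)
    then have "\<bar>S - mF * mG\<bar> = norm (\<Sum>k\<in>{1..<b}. vh (int k) * uh (- (int a * int k)))"
      by (metis norm_of_real)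
    also have "\<dots> \<le> (\<Sum>k\<in>{1..<b}. norm (vh (int k)) * norm (uh (int a * int k)))"
      by (rule order_trans[OF norm_sum]) (simp add: norm_mult uh_def norm_dft_uminus)
    also have "\<dots> = c\<^sup>2 * (\<Sum>k\<in>{1..<b}. (norm (vh (int k)) / c) * (norm (uh (int a * int k)) / c))"
      using c by (simp add: sum_distrib_left power2_eq_square)
    also have "\<dots> \<le> c\<^sup>2 * (C0 / real b * R powr \<gamma>)"
      unfolding b_def R_def a_def
    proof (intro mult_left_mono dual)
      fix h :: int assume h: "2 * \<bar>h\<bar> \<le> int (fib (Suc n))"
      have "\<bar>real_of_int h\<bar> * norm (uh h) \<le> c \<and> (real_of_int h)\<^sup>2 * norm (uh h) \<le> c * 2 ^ s1"
        unfolding uh_def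
        using dft_decay[where u="grid b F" and c=c and X="2 ^ s1", OF b grid_periodic h[folded b_def]] atom_differences[OF F b s1] A
        by (simp add: c_def)
      then show "\<bar>real_of_int h\<bar> * (norm (uh h) / c) \<le> 1 \<and> (real_of_int h)\<^sup>2 * (norm (uh h) / c) \<le> 2 ^ s1"
        using c by (simp add: divide_le_eq mult.commute)
      have "\<bar>real_of_int h\<bar> * norm (vh h) \<le> c \<and> (real_of_int h)\<^sup>2 * norm (vh h) \<le> c * 2 ^ s2"
        unfolding vh_def
        using dft_decay[where u="grid b G" and c=c and X="2 ^ s2", OF b grid_periodic h[folded b_def]] atom_differences[OF G b s2] A
        by (simp add: c_def)
      then show "\<bar>real_of_int h\<bar> * (norm (vh h) / c) \<le> 1 \<and> (real_of_int h)\<^sup>2 * (norm (vh h) / c) \<le> 2 ^ s2"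
        using c by (simp add: divide_le_eq mult.commute)
    qed (use c b in \<open>auto simp: uh_def vh_def norm_dft_uminus dft_periodic b_def[symmetric]\<close>)
    finally have 1: "\<bar>S - mF * mG\<bar> \<le> c\<^sup>2 * C0 / real b * R powr \<gamma>" by simp
    have tF: "\<bar>mF - IF\<bar> \<le> (2 * A + 3) * 2 ^ s1 / (real b)\<^sup>2" unfolding mF_def IF_def using A by (intro atom_trapezoid F b s1) auto
    have tG: "\<bar>mG - IG\<bar> \<le> (2 * A + 3) * 2 ^ s2 / (real b)\<^sup>2" unfolding mG_def IG_def using A by (intro atom_trapezoid G b s2) auto
    have bG: "\<bar>mG\<bar> \<le> (2 * A + 1) / 2 ^ s2" unfolding mG_def using A by (intro atom_mean_bound G b s2) auto
    have bF: "\<bar>IF\<bar> \<le> (4 * A + 4) / 2 ^ s1" unfolding IF_def using A by (intro atom_integral_bound F) auto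
    have p1: "(2::real) ^ s1 / 2 ^ s2 \<le> 2 ^ (s1 + s2)" "(2::real) ^ s2 / 2 ^ s1 \<le> 2 ^ (s1 + s2)"
    proof -
      have "1 \<le> (2::real) ^ k * 2 ^ k" for k by (simp flip: power_add)
      then have "(2::real) ^ i * 1 \<le> 2 ^ i * (2 ^ k * 2 ^ k)" for i k by (intro mult_left_mono) auto
      then have "(2::real) ^ i / 2 ^ k \<le> 2 ^ (i + k)" for i k by (simp add: power_add divide_le_eq mult.assoc del: mult_le_cancel_left1)
      then show "(2::real) ^ s1 / 2 ^ s2 \<le> 2 ^ (s1 + s2)" "(2::real) ^ s2 / 2 ^ s1 \<le> 2 ^ (s1 + s2)"
        by (metis add.commute)+
    qed
    have "mF * mG - IF * IG = (mF - IF) * mG + IF * (mG - IG)" by (simp add: algebra_simps)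
    then have "\<bar>mF * mG - IF * IG\<bar> \<le> \<bar>mF - IF\<bar> * \<bar>mG\<bar> + \<bar>IF\<bar> * \<bar>mG - IG\<bar>"
      by (metis abs_mult abs_triangle_ineq)
    also have "\<dots> \<le> ((2 * A + 3) * 2 ^ s1 / (real b)\<^sup>2) * ((2 * A + 1) / 2 ^ s2) + ((4 * A + 4) / 2 ^ s1) * ((2 * A + 3) * 2 ^ s2 / (real b)\<^sup>2)"
      using tF tG bF bG A by (intro add_mono mult_mono) auto
    also have "\<dots> = ((2 * A + 3) * (2 * A + 1)) * (2 ^ s1 / 2 ^ s2) / (real b)\<^sup>2 + ((4 * A + 4) * (2 * A + 3)) * (2 ^ s2 / 2 ^ s1) / (real b)\<^sup>2"
    proof -
      have e: "(p * x / q) * (r / y) = (p * r) * (x / y) / q" "(r / y) * (p * x / q) = (r * p) * (x / y) / q" for p q r x y :: real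
        by (simp_all add: mult_ac)
      show ?thesis by (rule arg_cong2[where f = "(+)"]) (rule e)+
    qed
    also have "\<dots> \<le> ((2 * A + 3) * (2 * A + 1)) * 2 ^ (s1 + s2) / (real b)\<^sup>2 + ((4 * A + 4) * (2 * A + 3)) * 2 ^ (s1 + s2) / (real b)\<^sup>2"
      using A by (intro add_mono divide_right_mono mult_left_mono p1) auto
    also have "\<dots> = C1 / real b * R"
    proof -
      have "p * x / (real b)\<^sup>2 + q * x / (real b)\<^sup>2 = (p + q) / real b * (x / real b)" for p q x
        by (simp add: power2_eq_square add_divide_distrib ring_distribs)
      then show ?thesis unfolding C1_def R_def .
    qed
    also have "\<dots> \<le> C1 / real b * R powr \<gamma>"
    proof (intro mult_left_mono)
      have "R powr 1 \<le> R powr \<gamma>" using R \<gamma> by (intro powr_mono') auto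
      then show "R \<le> R powr \<gamma>" using R by simp
    qed (use C1 in auto)
    finally have 2: "\<bar>mF * mG - IF * IG\<bar> \<le> C1 / real b * R powr \<gamma>" .
    have "lattice_err n F G = (S - mF * mG) + (mF * mG - IF * IG)"
      by (simp add: lattice_err_def S_def a_def b_def IF_def IG_def)
    then have "\<bar>lattice_err n F G\<bar> \<le> c\<^sup>2 * C0 / real b * R powr \<gamma> + C1 / real b * R powr \<gamma>"
      by (simp only:) (rule order_trans[OF abs_triangle_ineq add_mono[OF 1 2]])
    also have "\<dots> = (c\<^sup>2 * C0 + C1) / real b * R powr \<gamma>" by (simp add: add_divide_distrib ring_distribs)
    finally show "\<bar>lattice_err n F G\<bar> \<le> (c\<^sup>2 * C0 + C1) / real (fib (Suc n)) * (2 ^ (s1 + s2) / real (fib (Suc n))) powr \<gamma>"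
      by (simp add: R_def b_def)
  qed
qed

text \<open>For R >= 1 the bound C/b of the fine case is at most C/b R^\<gamma>, so one estimate
  covers all scales.\<close>

lemma lattice_err_atom:
  fixes \<gamma> A :: real
  assumes \<gamma>: "0 < \<gamma>" "\<gamma> < 1" and A: "A > 0"
  obtains C where "C > 0"
    "\<And>n s1 s2 F G. atom A s1 F \<Longrightarrow> F 0 = F 1 \<Longrightarrow> atom A s2 G \<Longrightarrow> G 0 = G 1 \<Longrightarrow>
       \<bar>lattice_err n F G\<bar> \<le> C / real (fib (Suc n)) * (2 ^ (s1 + s2) / real (fib (Suc n))) powr \<gamma>"
proof (rule lattice_err_coarse[OF assms])
  fix C0 :: real
  assume C0: "C0 > 0" and coarse: "\<And>n s1 s2 F G. atom A s1 F \<Longrightarrow> F 0 = F 1 \<Longrightarrow> atom A s2 G \<Longrightarrow> G 0 = G 1 \<Longrightarrow> 2 ^ (s1 + s2) \<le> fib (Suc n) \<Longrightarrow>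
       \<bar>lattice_err n F G\<bar> \<le> C0 / real (fib (Suc n)) * (2 ^ (s1 + s2) / real (fib (Suc n))) powr \<gamma>"
  define C1 where "C1 = 40 * A\<^sup>2 + 2 + (4 * A + 4)\<^sup>2"
  have C1: "C1 > 0" unfolding C1_def by (smt (verit) zero_le_power2)
  show thesis
  proof (rule that[of "C0 + C1"])
    show "C0 + C1 > 0" using C0 C1 by simp
    fix n s1 s2 F G
    assume F: "atom A s1 F" "F 0 = F 1" and G: "atom A s2 G" "G 0 = G 1"
    let ?b = "real (fib (Suc n))" and ?R = "2 ^ (s1 + s2) / real (fib (Suc n))"
    have b: "?b > 0" using fib_neq_0_nat[of "Suc n"] by simp
    show "\<bar>lattice_err n F G\<bar> \<le> (C0 + C1) / ?b * ?R powr \<gamma>"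
    proof (cases "2 ^ (s1 + s2) \<le> fib (Suc n)")
      case True
      have "\<bar>lattice_err n F G\<bar> \<le> C0 / ?b * ?R powr \<gamma>" by (rule coarse[OF F G True])
      also have "\<dots> \<le> (C0 + C1) / ?b * ?R powr \<gamma>"
        using C1 b by (intro mult_right_mono divide_right_mono) auto
      finally show ?thesis .
    next
      case False
      then have le: "fib (Suc n) \<le> 2 ^ (s1 + s2)" by simp
      then have "?b \<le> 2 ^ (s1 + s2)" by (metis of_nat_le_iff of_nat_numeral of_nat_power)
      then have R: "1 \<le> ?R" using b by simp
      have "\<bar>lattice_err n F G\<bar> \<le> C1 / ?b" unfolding C1_def by (rule lattice_err_fine[OF A F G le])
      also have "\<dots> \<le> (C0 + C1) / ?b * 1" using C0 b by (simp add: divide_right_mono)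
      also have "\<dots> \<le> (C0 + C1) / ?b * ?R powr \<gamma>"
        using C0 C1 b R \<gamma> by (intro mult_left_mono ge_one_powr_ge_zero) auto
      finally show ?thesis .
    qed
  qed
qed

section \<open>Functions smooth at a given scale, and the basic bump\<close>

text \<open>The analogue on the whole line of the smoothness in \<open>atom\<close>, with scale r
  and a common constant B. In this form it is stable under sums, products and affine substitutions
  without any reference to derivatives.\<close>

definition scaled_C2 :: "real \<Rightarrow> real \<Rightarrow> (real \<Rightarrow> real) \<Rightarrow> bool" where
  "scaled_C2 r B F \<longleftrightarrow> (\<forall>x. \<bar>F x\<bar> \<le> B) \<and> (\<forall>x y. \<bar>F x - F y\<bar> \<le> B * r * \<bar>x - y\<bar>) \<and>
     (\<forall>x h. \<bar>F (x + h) - 2 * F x + F (x - h)\<bar> \<le> B * r\<^sup>2 * h\<^sup>2)"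

lemma smD:
  assumes "scaled_C2 r B F"
  shows "\<bar>F x\<bar> \<le> B" "\<bar>F x - F y\<bar> \<le> B * r * \<bar>x - y\<bar>" "\<bar>F (x + h) - 2 * F x + F (x - h)\<bar> \<le> B * r\<^sup>2 * h\<^sup>2"
    "B \<ge> 0"
  using assms unfolding scaled_C2_def by (auto intro: order_trans[OF abs_ge_zero])

lemma scaled_C2_mono: "scaled_C2 r B F \<Longrightarrow> 0 \<le> r \<Longrightarrow> r \<le> r' \<Longrightarrow> B \<le> B' \<Longrightarrow> scaled_C2 r' B' F"
  unfolding scaled_C2_def
  by (meson order_trans abs_ge_zero mult_mono mult_right_mono power_mono zero_le_power2 mult_nonneg_nonneg)

lemma scaled_C2_affine:
  assumes "scaled_C2 r B F" shows "scaled_C2 (r * \<bar>a\<bar>) B (\<lambda>x. F (a * x + c))"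
  unfolding scaled_C2_def
proof (intro conjI allI)
  fix x y h
  show "\<bar>F (a * x + c)\<bar> \<le> B" by (rule smD[OF assms])
  have "a * x + c - (a * y + c) = a * (x - y)" by (simp add: algebra_simps)
  then show "\<bar>F (a * x + c) - F (a * y + c)\<bar> \<le> B * (r * \<bar>a\<bar>) * \<bar>x - y\<bar>"
    using smD(2)[OF assms, of "a * x + c" "a * y + c"] by (simp add: abs_mult mult_ac)
  have "a * (x + h) + c = (a * x + c) + a * h" "a * (x - h) + c = (a * x + c) - a * h"
    by (simp_all add: algebra_simps)
  then show "\<bar>F (a * (x + h) + c) - 2 * F (a * x + c) + F (a * (x - h) + c)\<bar> \<le> B * (r * \<bar>a\<bar>)\<^sup>2 * h\<^sup>2"
    using smD(3)[OF assms, of "a * x + c" "a * h"] unfolding power_mult_distrib power2_abs by (simp only: mult_ac)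
qed

lemma scaled_C2_scale: "scaled_C2 r B F \<Longrightarrow> scaled_C2 r (\<bar>k\<bar> * B) (\<lambda>x. k * F x)"
  unfolding scaled_C2_def
proof (intro conjI allI; elim conjE)
  fix x y h
  assume 1: "\<forall>x. \<bar>F x\<bar> \<le> B" and 2: "\<forall>x y. \<bar>F x - F y\<bar> \<le> B * r * \<bar>x - y\<bar>"
    and 3: "\<forall>x h. \<bar>F (x + h) - 2 * F x + F (x - h)\<bar> \<le> B * r\<^sup>2 * h\<^sup>2"
  show "\<bar>k * F x\<bar> \<le> \<bar>k\<bar> * B" using 1 by (simp add: abs_mult mult_left_mono)
  have "\<bar>k * (F x - F y)\<bar> \<le> \<bar>k\<bar> * (B * r * \<bar>x - y\<bar>)" unfolding abs_mult using 2 by (intro mult_left_mono) auto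
  then show "\<bar>k * F x - k * F y\<bar> \<le> \<bar>k\<bar> * B * r * \<bar>x - y\<bar>" by (simp add: algebra_simps)
  have "\<bar>k * (F (x + h) - 2 * F x + F (x - h))\<bar> \<le> \<bar>k\<bar> * (B * r\<^sup>2 * h\<^sup>2)" unfolding abs_mult using 3 by (intro mult_left_mono) auto
  then show "\<bar>k * F (x + h) - 2 * (k * F x) + k * F (x - h)\<bar> \<le> \<bar>k\<bar> * B * r\<^sup>2 * h\<^sup>2" by (simp add: algebra_simps)
qed

lemma scaled_C2_add:
  assumes "scaled_C2 r B F" "scaled_C2 r C G" shows "scaled_C2 r (B + C) (\<lambda>x. F x + G x)"
  unfolding scaled_C2_def
proof (intro conjI allI)
  fix x y h
  show "\<bar>F x + G x\<bar> \<le> B + C" using smD(1)[OF assms(1), of x] smD(1)[OF assms(2), of x] by linarith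
  show "\<bar>F x + G x - (F y + G y)\<bar> \<le> (B + C) * r * \<bar>x - y\<bar>"
    using smD(2)[OF assms(1), of x y] smD(2)[OF assms(2), of x y] unfolding ring_distribs by linarith
  show "\<bar>F (x + h) + G (x + h) - 2 * (F x + G x) + (F (x - h) + G (x - h))\<bar> \<le> (B + C) * r\<^sup>2 * h\<^sup>2"
    using smD(3)[OF assms(1), of x h] smD(3)[OF assms(2), of x h] unfolding ring_distribs by linarith
qed

lemma scaled_C2_sum:
  assumes "finite I" "\<And>i. i \<in> I \<Longrightarrow> scaled_C2 r (B i) (F i)"
  shows "scaled_C2 r (\<Sum>i\<in>I. B i) (\<lambda>x. \<Sum>i\<in>I. F i x)"
  using assms
proof (induction I rule: finite_induct)
  case empty show ?case by (simp add: scaled_C2_def)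
next
  case (insert i I)
  then show ?case using scaled_C2_add[of r "B i" "F i"] by auto
qed

text \<open>Leibniz rule for the symmetric second difference: F times that of G, that of F times G,
  and one product of first differences on either side of x. These four terms give the factor
  4.\<close>

lemma scaled_C2_mult:
  assumes F: "scaled_C2 r B F" and G: "scaled_C2 r C G" and r: "r \<ge> 0" shows "scaled_C2 r (4 * (B * C)) (\<lambda>x. F x * G x)"
  unfolding scaled_C2_def
proof (intro conjI allI)
  fix x y h
  note B = smD(4)[OF F] and C = smD(4)[OF G]
  have p: "\<bar>F x\<bar> * \<bar>G x\<bar> \<le> B * C" for x using smD(1)[OF F] smD(1)[OF G] B by (intro mult_mono) auto
  show "\<bar>F x * G x\<bar> \<le> 4 * (B * C)"
  proof -
    have "0 \<le> B * C" using B C by simp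
    then show ?thesis using p[of x] unfolding abs_mult by linarith
  qed
  have "F x * G x - F y * G y = F x * (G x - G y) + (F x - F y) * G y" by (simp add: algebra_simps)
  then have "\<bar>F x * G x - F y * G y\<bar> \<le> \<bar>F x\<bar> * \<bar>G x - G y\<bar> + \<bar>F x - F y\<bar> * \<bar>G y\<bar>"
    by (metis abs_mult abs_triangle_ineq)
  also have "\<dots> \<le> B * (C * r * \<bar>x - y\<bar>) + (B * r * \<bar>x - y\<bar>) * C"
    using smD(1,2)[OF F] smD(1,2)[OF G] B C r by (intro add_mono mult_mono) auto
  also have "\<dots> \<le> 4 * (B * C) * r * \<bar>x - y\<bar>" using B C r by (simp add: algebra_simps)
  finally show "\<bar>F x * G x - F y * G y\<bar> \<le> 4 * (B * C) * r * \<bar>x - y\<bar>" .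
  have sq: "(B * r * \<bar>h\<bar>) * (C * r * \<bar>h\<bar>) = B * C * (r\<^sup>2 * h\<^sup>2)"
    by (simp add: power2_eq_square algebra_simps)
  have l1: "\<bar>F (x + h) - F x\<bar> * \<bar>G (x + h) - G x\<bar> \<le> (B * r * \<bar>h\<bar>) * (C * r * \<bar>h\<bar>)"
    using smD(2)[OF F, of "x + h" x] smD(2)[OF G, of "x + h" x] B C r by (intro mult_mono) auto
  have l2: "\<bar>F (x - h) - F x\<bar> * \<bar>G (x - h) - G x\<bar> \<le> (B * r * \<bar>h\<bar>) * (C * r * \<bar>h\<bar>)"
    using smD(2)[OF F, of "x - h" x] smD(2)[OF G, of "x - h" x] B C r by (intro mult_mono) auto
  have l3: "\<bar>F x\<bar> * \<bar>G (x + h) - 2 * G x + G (x - h)\<bar> \<le> B * (C * r\<^sup>2 * h\<^sup>2)"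
    using smD(1)[OF F, of x] smD(3)[OF G, of x h] B C r by (intro mult_mono) auto
  have l4: "\<bar>F (x + h) - 2 * F x + F (x - h)\<bar> * \<bar>G x\<bar> \<le> (B * r\<^sup>2 * h\<^sup>2) * C"
    using smD(1)[OF G, of x] smD(3)[OF F, of x h] B C r by (intro mult_mono) auto
  have eq: "F (x + h) * G (x + h) - 2 * (F x * G x) + F (x - h) * G (x - h)
     = F x * (G (x + h) - 2 * G x + G (x - h)) + (F (x + h) - 2 * F x + F (x - h)) * G x
       + (F (x + h) - F x) * (G (x + h) - G x) + (F (x - h) - F x) * (G (x - h) - G x)"
    by (simp add: algebra_simps)
  have tri: "\<bar>p + q + u + v\<bar> \<le> \<bar>p\<bar> + \<bar>q\<bar> + \<bar>u\<bar> + \<bar>v\<bar>" for p q u v :: real by linarith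
  have "\<bar>F (x + h) * G (x + h) - 2 * (F x * G x) + F (x - h) * G (x - h)\<bar>
     \<le> \<bar>F x\<bar> * \<bar>G (x + h) - 2 * G x + G (x - h)\<bar> + \<bar>F (x + h) - 2 * F x + F (x - h)\<bar> * \<bar>G x\<bar>
       + \<bar>F (x + h) - F x\<bar> * \<bar>G (x + h) - G x\<bar> + \<bar>F (x - h) - F x\<bar> * \<bar>G (x - h) - G x\<bar>"
    unfolding abs_mult[symmetric] eq by (rule tri)
  also have "\<dots> \<le> B * (C * r\<^sup>2 * h\<^sup>2) + (B * r\<^sup>2 * h\<^sup>2) * C + B * C * (r\<^sup>2 * h\<^sup>2) + B * C * (r\<^sup>2 * h\<^sup>2)"
    using l1 l2 l3 l4 unfolding sq by (intro add_mono)
  also have "\<dots> = 4 * (B * C) * r\<^sup>2 * h\<^sup>2" by simp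
  finally show "\<bar>F (x + h) * G (x + h) - 2 * (F x * G x) + F (x - h) * G (x - h)\<bar> \<le> 4 * (B * C) * r\<^sup>2 * h\<^sup>2" .
qed

text \<open>The positive part of 1 - t^2 is squared so that the derivative is Lipschitz, which is
  what the second differences require; the value 1 at 0 matters for the correction at the end
  points.\<close>

definition bump :: "real \<Rightarrow> real" where
  "bump t = (max 0 (1 - t\<^sup>2))\<^sup>2"

lemma DERIV_pos_part_square: "((\<lambda>u::real. (max 0 u)\<^sup>2) has_real_derivative 2 * max 0 u) (at u)"
proof -
  consider "u > 0" | "u < 0" | "u = 0" by linarith
  then show ?thesis
  proof cases
    case 1
    have "((\<lambda>u::real. u\<^sup>2) has_real_derivative 2 * max 0 u) (at u)" using 1 by (auto intro!: derivative_eq_intros)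
    then show ?thesis
      by (rule DERIV_cong_ev[THEN iffD1, rotated -1]) (use 1 in \<open>auto simp: eventually_nhds_metric dist_real_def intro!: exI[of _ u]\<close>)
  next
    case 2
    have "((\<lambda>u::real. 0) has_real_derivative 2 * max 0 u) (at u)" using 2 by (auto intro!: derivative_eq_intros)
    then show ?thesis
      by (rule DERIV_cong_ev[THEN iffD1, rotated -1]) (use 2 in \<open>auto simp: eventually_nhds_metric dist_real_def intro!: exI[of _ "-u"]\<close>)
  next
    case 3
    have "((\<lambda>h::real. ((max 0 (0 + h))\<^sup>2 - (max 0 0)\<^sup>2) / h) \<longlongrightarrow> 0) (at 0)"
    proof (rule Lim_null_comparison)
      show "\<forall>\<^sub>F h in at (0::real). norm (((max 0 (0 + h))\<^sup>2 - (max 0 0)\<^sup>2) / h) \<le> \<bar>h\<bar>"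
        by (intro always_eventually allI) (auto simp: max_def power2_eq_square)
      show "((\<lambda>h::real. \<bar>h\<bar>) \<longlongrightarrow> 0) (at 0)" by (rule tendsto_rabs_zero) (rule tendsto_ident_at)
    qed
    then show ?thesis using 3 by (simp add: DERIV_def)
  qed
qed

definition bump_slope :: "real \<Rightarrow> real" where
  "bump_slope t = t * max 0 (1 - t\<^sup>2)"

lemma DERIV_bump: "(bump has_real_derivative - 4 * bump_slope t) (at t)"
proof -
  have "((\<lambda>t::real. 1 - t\<^sup>2) has_real_derivative - 2 * t) (at t)" by (auto intro!: derivative_eq_intros)
  from DERIV_chain2[OF DERIV_pos_part_square this] show ?thesis unfolding bump_def bump_slope_def by (simp add: mult_ac)
qed

text \<open>Let k be t clamped to [-1, 1]. Then the slope is k - k^3, because k - k^3 vanishes at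
  both ends, and k - k^3 has difference quotient 1 - (x^2 + x y + y^2), which lies in
  [-2, 1].\<close>

lemma bump_slope_lipschitz: "\<bar>bump_slope t - bump_slope s\<bar> \<le> 2 * \<bar>t - s\<bar>"
proof -
  define k where "k t = max (- 1) (min 1 t)" for t :: real
  have e: "bump_slope t = k t - (k t) ^ 3" for t
  proof (cases "\<bar>t\<bar> \<le> 1")
    case True
    then have "t\<^sup>2 \<le> 1" by (simp add: abs_square_le_1)
    moreover have "k t = t" using True by (auto simp: k_def)
    ultimately show ?thesis by (simp add: bump_slope_def power3_eq_cube power2_eq_square algebra_simps)
  next
    case False
    then have "t\<^sup>2 > 1" by (meson abs_square_le_1 not_le)
    moreover have "k t = 1 \<or> k t = -1" using False by (auto simp: k_def)
    ultimately show ?thesis by (auto simp: bump_slope_def)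
  qed
  have kb: "\<bar>k t\<bar> \<le> 1" for t by (auto simp: k_def)
  have kl: "\<bar>k t - k s\<bar> \<le> \<bar>t - s\<bar>" unfolding k_def by linarith
  define x y where "x = k t" and "y = k s"
  have xy: "\<bar>x\<bar> \<le> 1" "\<bar>y\<bar> \<le> 1" using kb by (auto simp: x_def y_def)
  have sq: "x\<^sup>2 \<le> 1" "y\<^sup>2 \<le> 1" using xy by (auto simp: abs_square_le_1)
  have "\<bar>x * y\<bar> \<le> 1" using xy by (simp add: abs_mult mult_le_one)
  then have u: "x\<^sup>2 + x * y + y\<^sup>2 \<le> 3" using sq by linarith
  have l: "0 \<le> x\<^sup>2 + x * y + y\<^sup>2"
  proof -
    have "x\<^sup>2 + x * y + y\<^sup>2 = (x + y / 2)\<^sup>2 + 3 / 4 * y\<^sup>2" by (simp add: power2_eq_square algebra_simps)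
    then show ?thesis by simp
  qed
  have "x - x ^ 3 - (y - y ^ 3) = (x - y) * (1 - (x\<^sup>2 + x * y + y\<^sup>2))"
    by (simp add: power3_eq_cube power2_eq_square algebra_simps)
  then have "\<bar>x - x ^ 3 - (y - y ^ 3)\<bar> = \<bar>x - y\<bar> * \<bar>1 - (x\<^sup>2 + x * y + y\<^sup>2)\<bar>" by (simp add: abs_mult)
  also have "\<dots> \<le> \<bar>x - y\<bar> * 2" using u l by (intro mult_left_mono) auto
  finally have "\<bar>x - x ^ 3 - (y - y ^ 3)\<bar> \<le> 2 * \<bar>x - y\<bar>" by simp
  also have "\<dots> \<le> 2 * \<bar>t - s\<bar>" using kl by (simp add: x_def y_def)
  finally show ?thesis by (simp add: e x_def y_def)
qed

lemma scaled_C2_bump: "scaled_C2 1 16 bump"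
  unfolding scaled_C2_def
proof (intro conjI allI)
  fix x y h :: real
  show "\<bar>bump x\<bar> \<le> 16"
  proof -
    have "(max 0 (1 - x\<^sup>2))\<^sup>2 \<le> 1\<^sup>2" by (intro power_mono) auto
    then show ?thesis by (simp add: bump_def)
  qed
  have slope: "\<bar>bump_slope t\<bar> \<le> 1" for t
  proof (cases "\<bar>t\<bar> \<le> 1")
    case True
    then have "t\<^sup>2 \<le> 1" by (simp add: abs_square_le_1)
    then show ?thesis using True unfolding abs_mult bump_slope_def by (intro mult_le_one) auto
  next
    case False
    then have "t\<^sup>2 > 1" by (meson abs_square_le_1 not_le)
    then show ?thesis by (simp add: bump_slope_def)
  qed
  have "norm (bump x - bump y) \<le> 4 * norm (x - y)"
  proof (rule field_differentiable_bound[of UNIV bump "\<lambda>t. - 4 * bump_slope t"])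
    fix z :: real
    show "(bump has_field_derivative - 4 * bump_slope z) (at z within UNIV)" using DERIV_bump by simp
    show "norm (- 4 * bump_slope z) \<le> 4" using slope[of z] by (simp add: abs_mult)
  qed auto
  then have "\<bar>bump x - bump y\<bar> \<le> 4 * \<bar>x - y\<bar>" by simp
  also have "\<dots> \<le> 16 * 1 * \<bar>x - y\<bar>" by simp
  finally show "\<bar>bump x - bump y\<bar> \<le> 16 * 1 * \<bar>x - y\<bar>" .
  \<comment> \<open>The second difference is g h - g 0. The derivative of g is 4 times a difference
    of slopes at points 2|t| apart, hence at most 16 |h| for |t| <= |h|.\<close>
  define g where "g t = bump (x + t) + bump (x - t)" for t
  have "norm (g h - g 0) \<le> (16 * \<bar>h\<bar>) * norm (h - 0)"
  proof (rule field_differentiable_bound[of "cball 0 \<bar>h\<bar>" g "\<lambda>t. - 4 * bump_slope (x + t) + 4 * bump_slope (x - t)"])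
    fix z :: real assume z: "z \<in> cball 0 \<bar>h\<bar>"
    have "((\<lambda>t. x + t) has_real_derivative 1) (at z)" "((\<lambda>t. x - t) has_real_derivative - 1) (at z)"
      by (auto intro!: derivative_eq_intros)
    from DERIV_chain2[OF DERIV_bump this(1)] DERIV_chain2[OF DERIV_bump this(2)]
    have "((\<lambda>t. bump (x + t) + bump (x - t)) has_real_derivative - 4 * bump_slope (x + z) * 1 + - 4 * bump_slope (x - z) * - 1) (at z)"
      by (rule DERIV_add)
    then show "(g has_field_derivative - 4 * bump_slope (x + z) + 4 * bump_slope (x - z)) (at z within cball 0 \<bar>h\<bar>)"
      unfolding g_def by - (rule has_field_derivative_at_within, simp)
    have "\<bar>bump_slope (x - z) - bump_slope (x + z)\<bar> \<le> 2 * \<bar>(x - z) - (x + z)\<bar>"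
      by (rule bump_slope_lipschitz)
    moreover have "2 * \<bar>(x - z) - (x + z)\<bar> \<le> 4 * \<bar>h\<bar>" using z by (simp add: dist_real_def)
    moreover have "norm (- 4 * p + 4 * q) \<le> 16 * \<bar>h\<bar>" if "\<bar>q - p\<bar> \<le> c" "c \<le> 4 * \<bar>h\<bar>" for p q c :: real
    proof -
      have "norm (- 4 * p + 4 * q) = 4 * \<bar>q - p\<bar>" by (simp add: abs_if)
      then show ?thesis using that by simp
    qed
    ultimately show "norm (- 4 * bump_slope (x + z) + 4 * bump_slope (x - z)) \<le> 16 * \<bar>h\<bar>" by blast
  qed (auto simp: dist_real_def)
  moreover have "g h - g 0 = bump (x + h) - 2 * bump x + bump (x - h)" by (simp add: g_def)
  moreover have "(16 * \<bar>h\<bar>) * norm (h - 0) = 16 * 1\<^sup>2 * h\<^sup>2" by (simp add: power2_eq_square)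
  ultimately show "\<bar>bump (x + h) - 2 * bump x + bump (x - h)\<bar> \<le> 16 * 1\<^sup>2 * h\<^sup>2" by (simp only: real_norm_def)
qed

lemma bump_0 [simp]: "bump 0 = 1" and bump_eq_0: "\<bar>t\<bar> \<ge> 1 \<Longrightarrow> bump t = 0"
proof -
  show "bump 0 = 1" by (simp add: bump_def)
  assume "\<bar>t\<bar> \<ge> 1"
  then have "1 \<le> t\<^sup>2" by (meson abs_square_less_1 not_le)
  then show "bump t = 0" by (simp add: bump_def)
qed

lemma atomI_scaled_C2:
  assumes "scaled_C2 (2 ^ s) 1 F" "\<And>x. x \<in> {0..1} \<Longrightarrow> F x \<noteq> 0 \<Longrightarrow> \<bar>x - c\<bar> \<le> A / 2 ^ s"
  shows "atom A s F"
proof -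
  have "(4::real) ^ s = (2 ^ s)\<^sup>2" by (simp add: power2_eq_square flip: power_mult_distrib)
  moreover have "\<exists>c. \<forall>x\<in>{0..1}. F x \<noteq> 0 \<longrightarrow> \<bar>x - c\<bar> \<le> A / 2 ^ s" using assms(2) by blast
  ultimately show ?thesis unfolding atom_def using smD[OF assms(1)] by auto
qed

section \<open>Removing the condition of equal end values\<close>

lemma sum_two_powr_le:
  fixes \<gamma> :: real
  assumes "\<gamma> > 0"
  shows "(\<Sum>s\<le>q. (2 ^ s) powr \<gamma>) \<le> (2 ^ q) powr \<gamma> / (1 - 2 powr (- \<gamma>))"
proof -
  define r where "r = (2::real) powr (- \<gamma>)"
  have r: "0 < r" "r < 1" unfolding r_def using assms powr_less_mono[of "-\<gamma>" 0 2] by auto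
  have "(\<Sum>s\<le>q. (2 ^ s) powr \<gamma>) = (\<Sum>s\<le>q. (2 ^ q) powr \<gamma> * r ^ (q - s))"
  proof (rule sum.cong[OF refl])
    fix s assume "s \<in> {..q}"
    then have "(2::real) ^ q = 2 ^ s * 2 ^ (q - s)" by (simp flip: power_add)
    then have "(2 ^ q) powr \<gamma> * r ^ (q - s) = (2 ^ s) powr \<gamma> * ((2 ^ (q - s)) powr \<gamma> * r ^ (q - s))"
      by (simp add: powr_mult)
    also have "(2 ^ (q - s)) powr \<gamma> * r ^ (q - s) = 1"
      unfolding r_def two_power_powr by (simp add: powr_powr powr_power mult.commute flip: powr_add)
    finally show "(2 ^ s) powr \<gamma> = (2 ^ q) powr \<gamma> * r ^ (q - s)" by simp
  qed
  also have "\<dots> = (2 ^ q) powr \<gamma> * (\<Sum>s\<le>q. r ^ s)"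
    unfolding sum_distrib_left by (rule sum.reindex_bij_witness[of _ "\<lambda>s. q - s" "\<lambda>s. q - s"]) auto
  also have "(\<Sum>s\<le>q. r ^ s) \<le> 1 / (1 - r)"
    using r by (simp add: sum_gp0 divide_right_mono)
  finally show ?thesis using r by (simp add: mult_left_mono r_def)
qed

text \<open>\<open>\<Lambda>\<close> will be the corrected lattice error as a function of one
  factor; it is controlled for atoms with equal end values and for atoms of width 1. Subtracting
  multiples of end point bumps of width 2^-q makes F vanish at 0 and 1. Such a bump is the bump of
  width 1 plus differences of bumps of consecutive widths, and these differences vanish at both end
  points. Their costs 2^(s \<gamma>) add up to a multiple of 2^(q \<gamma>).\<close>

lemma endpoint_decomposition:
  fixes \<Lambda> :: "(real \<Rightarrow> real) \<Rightarrow> real"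
  assumes lin: "\<And>F G c. continuous_on {0..1} F \<Longrightarrow> continuous_on {0..1} G \<Longrightarrow> \<Lambda> (\<lambda>x. F x + c * G x) = \<Lambda> F + c * \<Lambda> G"
    and bd: "\<And>s F. atom (A + 2) s F \<Longrightarrow> s = 0 \<or> F 0 = F 1 \<Longrightarrow> \<bar>\<Lambda> F\<bar> \<le> B * (2 ^ s) powr \<gamma>"
    and F: "scaled_C2 (2 ^ q) 1 F" "\<And>x. x \<in> {0..1} \<Longrightarrow> F x \<noteq> 0 \<Longrightarrow> \<bar>x - c\<bar> \<le> A / 2 ^ q"
    and A: "A \<ge> 0" and \<gamma>: "\<gamma> > 0" and B: "B \<ge> 0"
  shows "\<bar>\<Lambda> F\<bar> \<le> (33 + 64 / (1 - 2 powr (- \<gamma>))) * B * (2 ^ q) powr \<gamma>"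
proof -
  have cont: "continuous_on {0..1} F" if F: "scaled_C2 r K F" and r: "r \<ge> 0" for r K F
  proof (rule lipschitz_on_continuous_on[of "K * r"])
    show "(K * r)-lipschitz_on {0..1} F"
      using smD(2)[OF F] smD(4)[OF F] r by (auto simp: lipschitz_on_def dist_real_def)
  qed
  have z: "\<Lambda> (\<lambda>x. 0) = 0" using lin[of "\<lambda>x. 0" "\<lambda>x. 0" 1] by simp
  have bdK: "\<bar>\<Lambda> F\<bar> \<le> K * B * (2 ^ s) powr \<gamma>"
    if "scaled_C2 (2 ^ s) K F" "\<And>x. x \<in> {0..1} \<Longrightarrow> F x \<noteq> 0 \<Longrightarrow> \<bar>x - c\<bar> \<le> (A + 2) / 2 ^ s" "s = 0 \<or> F 0 = F 1" "K > 0"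
    for s K F c
  proof -
    have a: "atom (A + 2) s (\<lambda>x. 1 / K * F x)"
      using that(2,4) scaled_C2_scale[OF that(1), of "1 / K"] by (intro atomI_scaled_C2[where c = c]) auto
    have "\<Lambda> F = \<Lambda> (\<lambda>x. 0 + K * (1 / K * F x))" using that(4) by simp
    also have "\<dots> = K * \<Lambda> (\<lambda>x. 1 / K * F x)"
      using atom_continuous[OF a] by (subst lin) (auto simp: z)
    also have "\<bar>\<dots>\<bar> \<le> K * (B * (2 ^ s) powr \<gamma>)"
      unfolding abs_mult using that(3,4) by (intro mult_mono bd[OF a]) auto
    finally show ?thesis by (simp add: mult_ac)
  qed
  define \<phi>0 \<phi>1 where "\<phi>0 s x = bump (2 ^ s * x)" and "\<phi>1 s x = bump (2 ^ s * (1 - x))" for s :: nat and x :: real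
  have sm0: "scaled_C2 (2 ^ s) 16 (\<phi>0 s)" for s
    using scaled_C2_affine[OF scaled_C2_bump, of "2 ^ s" 0] by (simp add: \<phi>0_def[abs_def])
  have sm1: "scaled_C2 (2 ^ s) 16 (\<phi>1 s)" for s
    using scaled_C2_affine[OF scaled_C2_bump, of "- (2 ^ s)" "2 ^ s"] by (simp add: \<phi>1_def[abs_def] algebra_simps)
  have b2: "bump (2 ^ s) = 0" for s by (rule bump_eq_0) simp
  have supp: "x \<le> 1 / 2 ^ s" if "bump (2 ^ s * x) \<noteq> 0" for s x
  proof (rule ccontr)
    assume "\<not> ?thesis"
    then have "1 \<le> \<bar>2 ^ s * x\<bar>" by (simp add: field_simps)
    then show False using bump_eq_0 that by blast
  qed
  have up: "\<bar>\<Lambda> (\<phi> q)\<bar> \<le> 32 * B * (\<Sum>s\<le>q. (2 ^ s) powr \<gamma>)"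
    if \<phi>: "\<And>s. scaled_C2 (2 ^ s) 16 (\<phi> s)" and ends: "\<And>s. \<phi> s 0 = \<phi> 0 0" "\<And>s. \<phi> s 1 = \<phi> 0 1"
      and su: "\<And>s x. x \<in> {0..1} \<Longrightarrow> \<phi> s x \<noteq> 0 \<Longrightarrow> \<bar>x - c\<bar> \<le> 1 / 2 ^ s" for \<phi> :: "nat \<Rightarrow> real \<Rightarrow> real" and c :: real
  proof (induction q)
    case 0
    have "\<bar>\<Lambda> (\<phi> 0)\<bar> \<le> 32 * B * (2 ^ 0) powr \<gamma>"
    proof (rule bdK[where c = c])
      show "scaled_C2 (2 ^ 0) 32 (\<phi> 0)" using \<phi>[of 0] by (rule scaled_C2_mono) auto
      show "\<bar>x - c\<bar> \<le> (A + 2) / 2 ^ 0" if "x \<in> {0..1}" "\<phi> 0 x \<noteq> 0" for x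
        using su[OF that] A by simp
    qed auto
    then show ?case by simp
  next
    case (Suc q)
    \<comment> \<open>The two bumps agree at both end points. The constant is 16 + 16, and the wider
      bump has radius 2/2^(q+1), which explains the radius A + 2.\<close>
    define \<theta> where "\<theta> x = \<phi> (Suc q) x + - 1 * \<phi> q x" for x
    have "scaled_C2 (2 ^ q) (\<bar>- 1\<bar> * 16) (\<lambda>x. - 1 * \<phi> q x)" by (rule scaled_C2_scale[OF \<phi>])
    then have "scaled_C2 (2 ^ Suc q) (16 + 16) \<theta>" unfolding \<theta>_def
      by (intro scaled_C2_add[OF \<phi>]) (auto intro: scaled_C2_mono)
    then have "\<bar>\<Lambda> \<theta>\<bar> \<le> 32 * B * (2 ^ Suc q) powr \<gamma>"
    proof (intro bdK[where c = c])
      fix x :: real assume x: "x \<in> {0..1}" "\<theta> x \<noteq> 0"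
      then have "\<phi> (Suc q) x \<noteq> 0 \<or> \<phi> q x \<noteq> 0" by (auto simp: \<theta>_def)
      then have "\<bar>x - c\<bar> \<le> 2 / 2 ^ Suc q"
        using su[of x "Suc q"] su[of x q] x by (auto intro: order_trans simp: divide_right_mono)
      also have "\<dots> \<le> (A + 2) / 2 ^ Suc q" using A by (intro divide_right_mono) auto
      finally show "\<bar>x - c\<bar> \<le> (A + 2) / 2 ^ Suc q" .
    qed (auto simp: \<theta>_def ends[of q] ends[of "Suc q"])
    moreover have "\<Lambda> \<theta> = \<Lambda> (\<phi> (Suc q)) + - 1 * \<Lambda> (\<phi> q)"
      unfolding \<theta>_def by (rule lin; rule cont[OF \<phi>]; simp)
    ultimately have "\<bar>\<Lambda> (\<phi> (Suc q))\<bar> \<le> \<bar>\<Lambda> (\<phi> q)\<bar> + 32 * B * (2 ^ Suc q) powr \<gamma>" by linarith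
    then show ?case using Suc by (simp add: ring_distribs)
  qed
  have up0: "\<bar>\<Lambda> (\<phi>0 q)\<bar> \<le> 32 * B * (\<Sum>s\<le>q. (2 ^ s) powr \<gamma>)"
    by (rule up[OF sm0, where c = 0]) (use supp in \<open>auto simp: \<phi>0_def b2 bump_eq_0\<close>)
  have up1: "\<bar>\<Lambda> (\<phi>1 q)\<bar> \<le> 32 * B * (\<Sum>s\<le>q. (2 ^ s) powr \<gamma>)"
    by (rule up[OF sm1, where c = 1]) (use supp[of _ "1 - x" for x] in \<open>auto simp: \<phi>1_def b2 bump_eq_0\<close>)
  \<comment> \<open>Each bump is 1 at its own end point and 0 at the other one, already at width 1,
    so P vanishes at both. As |F| <= 1, the constant is 1 + 16 + 16 = 33.\<close>
  define P where "P x = (F x + - F 0 * \<phi>0 q x) + - F 1 * \<phi>1 q x" for x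
  have F01: "\<bar>F 0\<bar> \<le> 1" "\<bar>F 1\<bar> \<le> 1" using smD(1)[OF F(1)] by auto
  have smP: "scaled_C2 (2 ^ q) 33 P"
  proof -
    have "scaled_C2 (2 ^ q) ((1 + \<bar>- F 0\<bar> * 16) + \<bar>- F 1\<bar> * 16) P"
      unfolding P_def by (intro scaled_C2_add scaled_C2_scale F sm0 sm1)
    then show ?thesis by (rule scaled_C2_mono) (use F01 in auto)
  qed
  have LP: "\<bar>\<Lambda> P\<bar> \<le> 33 * B * (2 ^ q) powr \<gamma>"
  proof (rule bdK[OF smP, where c = c])
    fix x :: real assume x: "x \<in> {0..1}" "P x \<noteq> 0"
    then consider "F x \<noteq> 0" | "F 0 \<noteq> 0" "\<phi>0 q x \<noteq> 0" | "F 1 \<noteq> 0" "\<phi>1 q x \<noteq> 0"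
      unfolding P_def by (cases "F x = 0"; cases "F 0 * \<phi>0 q x = 0"; cases "F 1 * \<phi>1 q x = 0"; auto)
    then have "\<bar>x - c\<bar> \<le> A / 2 ^ q + 1 / 2 ^ q"
    proof cases
      case 1
      then show ?thesis using F(2)[OF x(1)] by (smt (verit) divide_nonneg_nonneg zero_le_power)
    next
      case 2
      have "\<bar>0 - c\<bar> \<le> A / 2 ^ q" using F(2)[of 0] 2 by auto
      moreover have "x \<le> 1 / 2 ^ q" using supp[of q x] 2 by (simp add: \<phi>0_def)
      ultimately show ?thesis using x(1) by (auto simp: abs_le_iff)
    next
      case 3
      have "\<bar>1 - c\<bar> \<le> A / 2 ^ q" using F(2)[of 1] 3 by auto
      moreover have "1 - x \<le> 1 / 2 ^ q" using supp[of q "1 - x"] 3 by (simp add: \<phi>1_def)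
      ultimately show ?thesis using x(1) by (auto simp: abs_le_iff)
    qed
    also have "\<dots> = (A + 1) / 2 ^ q" by (simp add: add_divide_distrib)
    also have "\<dots> \<le> (A + 2) / 2 ^ q" by (intro divide_right_mono) auto
    finally show "\<bar>x - c\<bar> \<le> (A + 2) / 2 ^ q" .
  qed (auto simp: P_def \<phi>0_def \<phi>1_def b2)
  have "\<Lambda> P = (\<Lambda> F + - F 0 * \<Lambda> (\<phi>0 q)) + - F 1 * \<Lambda> (\<phi>1 q)"
  proof -
    have cF: "continuous_on {0..1} F" "continuous_on {0..1} (\<phi>0 q)" "continuous_on {0..1} (\<phi>1 q)"
      using cont[OF F(1)] cont[OF sm0] cont[OF sm1] by auto
    have "\<Lambda> P = \<Lambda> (\<lambda>x. F x + - F 0 * \<phi>0 q x) + - F 1 * \<Lambda> (\<phi>1 q)"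
      unfolding P_def by (rule lin) (use cF in \<open>auto intro!: continuous_intros\<close>)
    also have "\<Lambda> (\<lambda>x. F x + - F 0 * \<phi>0 q x) = \<Lambda> F + - F 0 * \<Lambda> (\<phi>0 q)"
      by (rule lin) (use cF in auto)
    finally show ?thesis .
  qed
  then have "\<Lambda> F = \<Lambda> P + F 0 * \<Lambda> (\<phi>0 q) + F 1 * \<Lambda> (\<phi>1 q)" by simp
  then have "\<bar>\<Lambda> F\<bar> \<le> \<bar>\<Lambda> P\<bar> + \<bar>F 0 * \<Lambda> (\<phi>0 q)\<bar> + \<bar>F 1 * \<Lambda> (\<phi>1 q)\<bar>" by linarith
  also have "\<dots> \<le> \<bar>\<Lambda> P\<bar> + 1 * \<bar>\<Lambda> (\<phi>0 q)\<bar> + 1 * \<bar>\<Lambda> (\<phi>1 q)\<bar>"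
    unfolding abs_mult using F01 by (intro add_mono mult_right_mono) auto
  also have "\<dots> \<le> 33 * B * (2 ^ q) powr \<gamma> + 64 * B * (\<Sum>s\<le>q. (2 ^ s) powr \<gamma>)"
    using LP up0 up1 by linarith
  also have "\<dots> \<le> 33 * B * (2 ^ q) powr \<gamma> + 64 * B * ((2 ^ q) powr \<gamma> / (1 - 2 powr (- \<gamma>)))"
    using B sum_two_powr_le[OF \<gamma>, of q] by (intro add_mono mult_left_mono) auto
  also have "\<dots> = (33 + 64 / (1 - 2 powr (- \<gamma>))) * B * (2 ^ q) powr \<gamma>" by (simp add: ring_distribs)
  finally show ?thesis .
qed

definition periodize :: "(real \<Rightarrow> real) \<Rightarrow> real \<Rightarrow> real" where
  "periodize F x = F x + (x - 1 / 2) * (F 0 - F 1)"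

definition tensor_err :: "nat \<Rightarrow> (real \<Rightarrow> real) \<Rightarrow> (real \<Rightarrow> real) \<Rightarrow> real" where
  "tensor_err n F G = lattice_err n (periodize F) (periodize G)"

lemma periodize_eq: "F 0 = F 1 \<Longrightarrow> periodize F = F"
  by (auto simp: periodize_def)

lemma periodize_ends: "periodize F 0 = periodize F 1"
  by (simp add: periodize_def field_simps)

text \<open>With equal end values the correction is 0. At s = 0 it adds a linear function of slope
  at most 1, which leaves second differences unchanged and at most doubles the other constants;
  hence the factor 1/2. The support condition at width 1 reads A >= 1.\<close>

lemma atom_periodize:
  assumes "atom A s F" "s = 0 \<or> F 0 = F 1" "A \<ge> 1"
  shows "atom A s (\<lambda>x. 1 / 2 * periodize F x)"
proof (cases "F 0 = F 1")
  case True
  have "\<bar>1 / 2 * x\<bar> \<le> y" if "\<bar>x\<bar> \<le> y" for x y :: real using that by simp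
  note half = this
  obtain c where "\<forall>x\<in>{0..1}. F x \<noteq> 0 \<longrightarrow> \<bar>x - c\<bar> \<le> A / 2 ^ s" using atomD(4)[OF assms(1)] by blast
  moreover have "\<bar>1 / 2 * F x - 1 / 2 * F y\<bar> \<le> 2 ^ s * \<bar>x - y\<bar>" if "x \<in> {0..1}" "y \<in> {0..1}" for x y
    using half[OF atomD(2)[OF assms(1) that]] by (simp add: algebra_simps)
  moreover have "\<bar>1 / 2 * F (x + h) - 2 * (1 / 2 * F x) + 1 / 2 * F (x - h)\<bar> \<le> 4 ^ s * h\<^sup>2" if "x - h \<in> {0..1}" "x + h \<in> {0..1}" for x h
    using half[OF atomD(3)[OF assms(1) that]] by (simp add: algebra_simps)
  moreover have "\<bar>1 / 2 * F x\<bar> \<le> 1" if "x \<in> {0..1}" for x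
    using half[OF atomD(1)[OF assms(1) that]] by simp
  ultimately show ?thesis unfolding periodize_eq[where F=F, OF True] atom_def by auto
next
  case False
  with assms have s: "s = 0" by auto
  let ?d = "F 0 - F 1"
  have d: "\<bar>?d\<bar> \<le> 1" using atomD(2)[OF assms(1), of 0 1] by (simp add: s)
  show ?thesis unfolding atom_def s
  proof (intro conjI ballI allI impI)
    fix x :: real assume x: "x \<in> {0..1}"
    have "\<bar>x - 1 / 2\<bar> \<le> 1 / 2" unfolding abs_le_iff using x by auto
    then have "\<bar>(x - 1 / 2) * ?d\<bar> \<le> 1 / 2 * 1" unfolding abs_mult using d by (intro mult_mono) auto
    moreover have "\<bar>1 / 2 * (p + q)\<bar> \<le> 1" if "\<bar>p\<bar> \<le> 1" "\<bar>q\<bar> \<le> 1 / 2 * 1" for p q :: real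
    proof -
      have "\<bar>p + q\<bar> \<le> 2" using that by linarith
      then show ?thesis by simp
    qed
    ultimately show "\<bar>1 / 2 * periodize F x\<bar> \<le> 1" using atomD(1)[OF assms(1) x] unfolding periodize_def by blast
    fix y :: real assume y: "y \<in> {0..1}"
    have "\<bar>(x - y) * ?d\<bar> \<le> \<bar>x - y\<bar> * 1" unfolding abs_mult using d by (intro mult_left_mono) auto
    moreover have "\<bar>F x - F y\<bar> \<le> \<bar>x - y\<bar>" using atomD(2)[OF assms(1) x y] by (simp add: s)
    moreover have "1 / 2 * periodize F x - 1 / 2 * periodize F y = ((F x - F y) + (x - y) * ?d) / 2"
      by (simp add: periodize_def algebra_simps add_divide_distrib diff_divide_distrib)
    ultimately show "\<bar>1 / 2 * periodize F x - 1 / 2 * periodize F y\<bar> \<le> 2 ^ 0 * \<bar>x - y\<bar>" by auto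
  next
    fix x h :: real assume xh: "x - h \<in> {0..1}" "x + h \<in> {0..1}"
    have "1 / 2 * periodize F (x + h) - 2 * (1 / 2 * periodize F x) + 1 / 2 * periodize F (x - h) = (F (x + h) - 2 * F x + F (x - h)) / 2"
      by (simp add: periodize_def algebra_simps add_divide_distrib diff_divide_distrib)
    then show "\<bar>1 / 2 * periodize F (x + h) - 2 * (1 / 2 * periodize F x) + 1 / 2 * periodize F (x - h)\<bar> \<le> 4 ^ 0 * h\<^sup>2"
      using atomD(3)[OF assms(1) xh] by (simp add: s)
  next
    show "\<exists>c. \<forall>x\<in>{0..1}. 1 / 2 * periodize F x \<noteq> 0 \<longrightarrow> \<bar>x - c\<bar> \<le> A / 2 ^ 0"
      using assms(3) by (intro exI[of _ 0]) auto
  qed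
qed

lemma lattice_err_linear1:
  assumes "continuous_on {0..1} F" "continuous_on {0..1} G"
  shows "lattice_err n (\<lambda>x. F x + c * G x) H = lattice_err n F H + c * lattice_err n G H"
proof -
  have "integral {0..1} (\<lambda>x. F x + c * G x) = integral {0..1} F + c * integral {0..1} G"
    using assms by (subst integral_add) (auto intro!: integrable_continuous_interval continuous_intros)
  then show ?thesis
    by (simp add: lattice_err_def grid_def ring_distribs sum.distrib sum_distrib_left add_divide_distrib mult_ac)
qed

lemma lattice_err_linear2:
  assumes "continuous_on {0..1} F" "continuous_on {0..1} G"
  shows "lattice_err n H (\<lambda>x. F x + c * G x) = lattice_err n H F + c * lattice_err n H G"
proof -
  have "integral {0..1} (\<lambda>x. F x + c * G x) = integral {0..1} F + c * integral {0..1} G"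
    using assms by (subst integral_add) (auto intro!: integrable_continuous_interval continuous_intros)
  then show ?thesis
    by (simp add: lattice_err_def grid_def ring_distribs sum.distrib sum_distrib_left add_divide_distrib mult_ac)
qed

lemma continuous_on_periodize: "continuous_on {0..1} F \<Longrightarrow> continuous_on {0..1} (periodize F)"
  unfolding periodize_def by (intro continuous_intros)

lemma periodize_linear: "periodize (\<lambda>x. F x + c * G x) = (\<lambda>x. periodize F x + c * periodize G x)"
  unfolding periodize_def by (rule ext) algebra

lemma tensor_err_linear1:
  "continuous_on {0..1} F \<Longrightarrow> continuous_on {0..1} G \<Longrightarrow>
    tensor_err n (\<lambda>x. F x + c * G x) H = tensor_err n F H + c * tensor_err n G H"
  unfolding tensor_err_def periodize_linear by (intro lattice_err_linear1 continuous_on_periodize)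

lemma tensor_err_linear2:
  "continuous_on {0..1} F \<Longrightarrow> continuous_on {0..1} G \<Longrightarrow>
    tensor_err n H (\<lambda>x. F x + c * G x) = tensor_err n H F + c * tensor_err n H G"
  unfolding tensor_err_def periodize_linear by (intro lattice_err_linear2 continuous_on_periodize)

text \<open>\<open>endpoint_decomposition\<close> in one variable after the other: first for F
  against an admissible G', then for G, where the first result serves as the hypothesis. The factor
  4 undoes the two halves of \<open>atom_periodize\<close>.\<close>

lemma tensor_err_local:
  fixes \<gamma> A :: real
  assumes \<gamma>: "0 < \<gamma>" "\<gamma> < 1" and A: "A \<ge> 0"
  obtains C where "C > 0"
    "\<And>n q1 q2 F G c1 c2. scaled_C2 (2 ^ q1) 1 F \<Longrightarrow> (\<And>x. x \<in> {0..1} \<Longrightarrow> F x \<noteq> 0 \<Longrightarrow> \<bar>x - c1\<bar> \<le> A / 2 ^ q1) \<Longrightarrow>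
       scaled_C2 (2 ^ q2) 1 G \<Longrightarrow> (\<And>x. x \<in> {0..1} \<Longrightarrow> G x \<noteq> 0 \<Longrightarrow> \<bar>x - c2\<bar> \<le> A / 2 ^ q2) \<Longrightarrow>
       \<bar>tensor_err n F G\<bar> \<le> C / real (fib (Suc n)) * (2 ^ (q1 + q2) / real (fib (Suc n))) powr \<gamma>"
proof (rule lattice_err_atom[OF \<gamma>, of "A + 2"])
  show "A + 2 > 0" using A by simp
  fix C0 :: real
  assume C0: "C0 > 0" and at: "\<And>n s1 s2 F G. atom (A + 2) s1 F \<Longrightarrow> F 0 = F 1 \<Longrightarrow> atom (A + 2) s2 G \<Longrightarrow> G 0 = G 1 \<Longrightarrow>
       \<bar>lattice_err n F G\<bar> \<le> C0 / real (fib (Suc n)) * (2 ^ (s1 + s2) / real (fib (Suc n))) powr \<gamma>"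
  define K where "K = 33 + 64 / (1 - 2 powr (- \<gamma>))"
  have K: "K > 0" unfolding K_def using \<gamma> powr_less_mono[of "-\<gamma>" 0 2] by (auto intro!: add_pos_nonneg)
  show thesis
  proof (rule that[of "K\<^sup>2 * (4 * C0)"])
    show "K\<^sup>2 * (4 * C0) > 0" using K C0 by simp
    fix n q1 q2 F G c1 c2
    assume F: "scaled_C2 (2 ^ q1) 1 F" "\<And>x. x \<in> {0..1} \<Longrightarrow> F x \<noteq> 0 \<Longrightarrow> \<bar>x - c1\<bar> \<le> A / 2 ^ q1"
      and G: "scaled_C2 (2 ^ q2) 1 G" "\<And>x. x \<in> {0..1} \<Longrightarrow> G x \<noteq> 0 \<Longrightarrow> \<bar>x - c2\<bar> \<le> A / 2 ^ q2"
    define b where "b = real (fib (Suc n))"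
    have b: "b > 0" unfolding b_def using fib_neq_0_nat[of "Suc n"] by simp
    define D where "D = 4 * C0 / b / b powr \<gamma>"
    have D: "D > 0" using C0 b by (simp add: D_def)
    have 0: "\<bar>tensor_err n F' G'\<bar> \<le> D * (2 ^ s1) powr \<gamma> * (2 ^ s2) powr \<gamma>"
      if F': "atom (A + 2) s1 F'" "s1 = 0 \<or> F' 0 = F' 1" and G': "atom (A + 2) s2 G'" "s2 = 0 \<or> G' 0 = G' 1" for s1 s2 F' G'
    proof -
      note aF = atom_periodize[OF F'] and aG = atom_periodize[OF G']
      have cF: "continuous_on {0..1} (periodize F')" "continuous_on {0..1} (periodize G')"
        by (intro continuous_on_periodize atom_continuous[OF F'(1)] atom_continuous[OF G'(1)])+
      have z1: "lattice_err n (\<lambda>x. 0) H = 0" for H by (simp add: lattice_err_def grid_def)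
      have z2: "lattice_err n H (\<lambda>x. 0) = 0" for H by (simp add: lattice_err_def grid_def)
      have l1: "lattice_err n (\<lambda>x. 1 / 2 * periodize F' x) H = 1 / 2 * lattice_err n (periodize F') H" for H
        using lattice_err_linear1[OF continuous_on_const[of _ 0] cF(1), of n "1 / 2" H] by (simp add: z1)
      have l2: "lattice_err n H (\<lambda>x. 1 / 2 * periodize G' x) = 1 / 2 * lattice_err n H (periodize G')" for H
        using lattice_err_linear2[OF continuous_on_const[of _ 0] cF(2), of n H "1 / 2"] by (simp add: z2)
      have "tensor_err n F' G' = 4 * lattice_err n (\<lambda>x. 1 / 2 * periodize F' x) (\<lambda>x. 1 / 2 * periodize G' x)"
        unfolding l1 l2 tensor_err_def by simp
      moreover have "\<bar>lattice_err n (\<lambda>x. 1 / 2 * periodize F' x) (\<lambda>x. 1 / 2 * periodize G' x)\<bar> \<le> C0 / b * (2 ^ (s1 + s2) / b) powr \<gamma>"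
        unfolding b_def by (rule at[OF aF _ aG]) (use A in \<open>auto simp: periodize_ends[of F'] periodize_ends[of G']\<close>)
      moreover have "4 * (C0 / b * (2 ^ (s1 + s2) / b) powr \<gamma>) = D * (2 ^ s1) powr \<gamma> * (2 ^ s2) powr \<gamma>"
        using b by (simp add: D_def powr_divide powr_mult power_add)
      ultimately show ?thesis by linarith
    qed
    have 1: "\<bar>tensor_err n F G'\<bar> \<le> K * (D * (2 ^ s2) powr \<gamma>) * (2 ^ q1) powr \<gamma>"
      if G': "atom (A + 2) s2 G'" "s2 = 0 \<or> G' 0 = G' 1" for s2 G'
      unfolding K_def
      by (rule endpoint_decomposition[where \<Lambda> = "\<lambda>F. tensor_err n F G'", OF _ _ F A \<gamma>(1)])
         (use 0[OF _ _ G'] D in \<open>auto simp: tensor_err_linear1 mult_ac\<close>)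
    have "\<bar>tensor_err n F G\<bar> \<le> K * (K * D * (2 ^ q1) powr \<gamma>) * (2 ^ q2) powr \<gamma>"
      by (subst (1) K_def, rule endpoint_decomposition[where \<Lambda> = "\<lambda>G. tensor_err n F G", OF _ _ G A \<gamma>(1)])
         (use 1 D K in \<open>auto simp: tensor_err_linear2 mult_ac\<close>)
    also have "\<dots> = K\<^sup>2 * (4 * C0) / b * (2 ^ (q1 + q2) / b) powr \<gamma>"
      using b by (simp add: D_def power2_eq_square powr_divide powr_mult power_add)
    finally show "\<bar>tensor_err n F G\<bar> \<le> K\<^sup>2 * (4 * C0) / real (fib (Suc n)) * (2 ^ (q1 + q2) / real (fib (Suc n))) powr \<gamma>"
      by (simp add: b_def)
  qed
qed

section \<open>Smoothing by local dilations\<close>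

lemma integrable_compact_support:
  fixes f :: "'a::euclidean_space \<Rightarrow> 'b::{banach, second_countable_topology}"
  assumes "compact S" "continuous_on UNIV f" "\<And>z. z \<notin> S \<Longrightarrow> f z = 0"
  shows "integrable lborel f"
proof -
  have "integrable lborel (\<lambda>x. indicator S x *\<^sub>R f x)"
    using assms by (intro borel_integrable_compact) (auto intro: continuous_on_subset)
  also have "(\<lambda>x. indicator S x *\<^sub>R f x) = f"
    using assms(3) by (auto simp: indicator_def fun_eq_iff)
  finally show ?thesis .
qed

lemma lborel_integral_prod:
  fixes f :: "'a::euclidean_space \<times> 'b::euclidean_space \<Rightarrow> 'c::{banach, second_countable_topology}"
  assumes "integrable lborel f"
  shows "integral\<^sup>L lborel f = (\<integral>x. (\<integral>y. f (x, y) \<partial>lborel) \<partial>lborel)"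
    "integral\<^sup>L lborel f = (\<integral>y. (\<integral>x. f (x, y) \<partial>lborel) \<partial>lborel)"
proof -
  have int: "integrable (lborel \<Otimes>\<^sub>M lborel) f" using assms by (simp add: lborel_prod)
  show "integral\<^sup>L lborel f = (\<integral>x. (\<integral>y. f (x, y) \<partial>lborel) \<partial>lborel)"
    using lborel_pair.integral_fst'[OF int] by (simp add: lborel_prod)
  then show "integral\<^sup>L lborel f = (\<integral>y. (\<integral>x. f (x, y) \<partial>lborel) \<partial>lborel)"
    using lborel_pair.Fubini_integral[of "\<lambda>x y. f (x, y)"] int by (simp add: lborel_prod)
qed

lemma continuous_on_bump [continuous_intros]: "continuous_on S f \<Longrightarrow> continuous_on S (\<lambda>x. bump (f x))"
  unfolding bump_def by (intro continuous_intros)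

lemma bump_nonneg: "bump t \<ge> 0"
  by (simp add: bump_def)

section \<open>A probability density on [0, 1], its dilates, and double means\<close>

definition bump_mass :: real where
  "bump_mass = (\<integral>v. bump (2 * v - 1) \<partial>lborel)"

definition rho :: "real \<Rightarrow> real" where
  "rho v = bump (2 * v - 1) / bump_mass"

lemma integrable_bump: "integrable lborel (\<lambda>v. bump (2 * v - 1))"
  by (rule integrable_compact_support[of "{0..1}"])
     (auto intro!: continuous_intros bump_eq_0)

lemma bump_mass_pos: "bump_mass > 0"
proof -
  have i: "integrable lborel (\<lambda>v. 1 / 2 * indicator {1/4..3/4::real} v :: real)"
    using borel_integrable_compact[of "{1/4..3/4::real}" "\<lambda>_. 1 / 2 :: real"] by (simp add: mult.commute)
  have "(\<integral>v. 1 / 2 * indicator {1/4..3/4::real} v \<partial>lborel) \<le> (\<integral>v. bump (2 * v - 1) \<partial>lborel)"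
  proof (rule integral_mono)
    fix v :: real
    show "1 / 2 * indicator {1/4..3/4::real} v \<le> bump (2 * v - 1)"
    proof (cases "v \<in> {1/4..3/4}")
      case True
      then have "\<bar>2 * v - 1\<bar> \<le> \<bar>1/2\<bar>" unfolding abs_le_iff by auto
      then have "(2 * v - 1)\<^sup>2 \<le> (1/2)\<^sup>2" unfolding abs_le_square_iff .
      then have "3/4 \<le> max 0 (1 - (2 * v - 1)\<^sup>2)" by (simp add: power2_eq_square)
      then have "(3/4)\<^sup>2 \<le> bump (2 * v - 1)" unfolding bump_def by (rule power_mono) simp
      moreover have "(1/2::real) \<le> (3/4)\<^sup>2" by (simp add: power2_eq_square)
      ultimately show ?thesis using True by (simp only: indicator_simps mult_1_right)
    qed (simp add: bump_nonneg)
  qed (rule i integrable_bump)+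
  then show ?thesis by (simp add: bump_mass_def)
qed

lemma rho_nonneg: "rho v \<ge> 0" and rho_zero: "v \<notin> {0<..<1} \<Longrightarrow> rho v = 0"
  and continuous_on_rho [continuous_intros]: "continuous_on S f \<Longrightarrow> continuous_on S (\<lambda>x. rho (f x))"
  and integral_rho: "(\<integral>v. rho v \<partial>lborel) = 1" and integrable_rho: "integrable lborel rho"
proof -
  show "rho v \<ge> 0" using bump_mass_pos by (simp add: rho_def bump_nonneg)
  show "rho v = 0" if "v \<notin> {0<..<1}"
    unfolding rho_def using that by (subst bump_eq_0) (auto simp: abs_le_iff)
  show "continuous_on S f \<Longrightarrow> continuous_on S (\<lambda>x. rho (f x))"
    unfolding rho_def using bump_mass_pos by (intro continuous_intros) auto
  show "integrable lborel rho" unfolding rho_def[abs_def] using integrable_bump by simp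
  show "(\<integral>v. rho v \<partial>lborel) = 1" using bump_mass_pos by (simp add: rho_def bump_mass_def)
qed

definition dil :: "real \<Rightarrow> real \<Rightarrow> real" where
  "dil c t = rho (t / c) / c"

lemma dil_nonzero: "c > 0 \<Longrightarrow> dil c t \<noteq> 0 \<Longrightarrow> 0 < t \<and> t < c"
  unfolding dil_def using rho_zero[of "t / c"] by (auto simp: zero_less_divide_iff divide_less_eq)

lemma continuous_on_dil [continuous_intros]:
  "c > 0 \<Longrightarrow> continuous_on S f \<Longrightarrow> continuous_on S (\<lambda>x. dil c (f x))"
  unfolding dil_def by (intro continuous_intros) auto

lemma integral_dil:
  fixes h :: "real \<Rightarrow> 'b::{banach, second_countable_topology}"
  assumes "c > 0"
  shows "(\<integral>y. dil c (y - a) *\<^sub>R h y \<partial>lborel) = (\<integral>v. rho v *\<^sub>R h (a + c * v) \<partial>lborel)"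
proof -
  have "(\<integral>y. dil c (y - a) *\<^sub>R h y \<partial>lborel) = c *\<^sub>R (\<integral>v. dil c (c * v) *\<^sub>R h (a + c * v) \<partial>lborel)"
    using assms by (subst lborel_integral_real_affine[of c _ a]) auto
  also have "(\<lambda>v. dil c (c * v) *\<^sub>R h (a + c * v)) = (\<lambda>v. (1 / c) *\<^sub>R (rho v *\<^sub>R h (a + c * v)))"
    using assms by (auto simp: dil_def)
  finally show ?thesis using assms by (simp only: integral_scaleR_right) simp
qed

text \<open>With \<open>U = a (V - x)\<close> and \<open>U' = c (V' - x)\<close> for independent \<open>V\<close>, \<open>V'\<close> of density
  \<open>rho\<close>, this is the mean of \<open>g (x + U + U')\<close>.\<close>

definition double_mean :: "(real \<Rightarrow> complex) \<Rightarrow> real \<Rightarrow> real \<Rightarrow> real \<Rightarrow> complex" where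
  "double_mean g x a c = (\<integral>v'. rho v' *\<^sub>R (\<integral>v. rho v *\<^sub>R g (x + a * (v - x) + c * (v' - x)) \<partial>lborel) \<partial>lborel)"

text \<open>The two independent variables may be exchanged, by Fubini. This symmetry is what cancels
  the mixed terms in \<open>smear_Suc\<close>.\<close>

lemma double_mean_commute:
  assumes "continuous_on UNIV g"
  shows "double_mean g x a c = double_mean g x c a"
proof -
  define f where "f z = (rho (fst z) * rho (snd z)) *\<^sub>R g (x + a * (snd z - x) + c * (fst z - x))" for z
  have "integrable lborel f"
    unfolding f_def
    by (rule integrable_compact_support[of "{0..1} \<times> {0..1}"])
       (auto intro!: continuous_intros compact_Times continuous_on_compose2[OF assms] rho_zero)
  from lborel_integral_prod[OF this]
  have "(\<integral>v'. (\<integral>v. f (v', v) \<partial>lborel) \<partial>lborel) = (\<integral>v. (\<integral>v'. f (v', v) \<partial>lborel) \<partial>lborel)" by simp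
  moreover have "(\<integral>v'. (\<integral>v. f (v', v) \<partial>lborel) \<partial>lborel) = double_mean g x a c"
    unfolding f_def double_mean_def by (simp flip: scaleR_scaleR)
  moreover have "(\<integral>v. (\<integral>v'. f (v', v) \<partial>lborel) \<partial>lborel) = double_mean g x c a"
  proof -
    have "f (v', v) = rho v *\<^sub>R rho v' *\<^sub>R g (x + c * (v' - x) + a * (v - x))" for v v'
      by (simp add: f_def algebra_simps)
    then show ?thesis unfolding double_mean_def by (simp flip: scaleR_scaleR)
  qed
  ultimately show ?thesis by simp
qed

lemma double_mean_0: "double_mean g x a 0 = (\<integral>v. rho v *\<^sub>R g (x + a * (v - x)) \<partial>lborel)"
  unfolding double_mean_def by (simp add: integral_rho integrable_rho)

text \<open>The joint density of y = x + a (V - x) and w = c (V' - x). Then y + j w is the argument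
  of the double mean with c replaced by j c, so a single kernel serves all terms of an l-th
  difference with base point y and step w.\<close>

definition mean_kernel :: "real \<Rightarrow> real \<Rightarrow> real \<Rightarrow> real \<times> real \<Rightarrow> real" where
  "mean_kernel a c x z = dil a (fst z - (1 - a) * x) * dil c (snd z + c * x)"

lemma mean_kernel_nonzero:
  assumes "a > 0" "c > 0" "mean_kernel a c x (y, w) \<noteq> 0"
  obtains v v' where "v \<in> {0<..<1}" "v' \<in> {0<..<1}" "y = x + a * (v - x)" "w = c * (v' - x)"
proof (rule that)
  have 1: "0 < y - (1 - a) * x" "y - (1 - a) * x < a" "0 < w + c * x" "w + c * x < c"
    using assms dil_nonzero[of a "y - (1 - a) * x"] dil_nonzero[of c "w + c * x"] by (auto simp: mean_kernel_def)
  show "(y - (1 - a) * x) / a \<in> {0<..<1}" "(w + c * x) / c \<in> {0<..<1}" using 1 assms by auto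
  show "y = x + a * ((y - (1 - a) * x) / a - x)" "w = c * ((w + c * x) / c - x)"
    using assms by (simp_all add: field_simps)
qed

lemma continuous_on_mean_kernel [continuous_intros]:
  "a > 0 \<Longrightarrow> c > 0 \<Longrightarrow> continuous_on S f \<Longrightarrow> continuous_on S g \<Longrightarrow> continuous_on S (\<lambda>u. mean_kernel a c (f u) (g u))"
  unfolding mean_kernel_def by (intro continuous_intros)

lemma mean_kernel_support_compact:
  assumes "a > 0" "c > 0"
  obtains S where "compact S" "\<And>z. z \<notin> S \<Longrightarrow> mean_kernel a c x z = 0"
proof (rule that)
  show "compact ({(1 - a) * x..(1 - a) * x + a} \<times> {- c * x..- c * x + c})" by (intro compact_Times compact_Icc)
  fix z assume "z \<notin> {(1 - a) * x..(1 - a) * x + a} \<times> {- c * x..- c * x + c}"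
  then show "mean_kernel a c x z = 0"
  proof (rule contrapos_np)
    assume "mean_kernel a c x z \<noteq> 0"
    then have "dil a (fst z - (1 - a) * x) \<noteq> 0" "dil c (snd z + c * x) \<noteq> 0" by (auto simp: mean_kernel_def)
    then show "z \<in> {(1 - a) * x..(1 - a) * x + a} \<times> {- c * x..- c * x + c}"
      using dil_nonzero[OF assms(1), of "fst z - (1 - a) * x"] dil_nonzero[OF assms(2), of "snd z + c * x"]
      by (cases z) auto
  qed
qed

lemma integrable_mean_kernel:
  assumes ac: "a > 0" "c > 0" and g: "continuous_on UNIV (g :: real \<times> real \<Rightarrow> complex)"
  shows "integrable lborel (\<lambda>z. mean_kernel a c x z *\<^sub>R g z)"
proof (rule mean_kernel_support_compact[OF ac])
  fix S assume "compact S" "\<And>z. z \<notin> S \<Longrightarrow> mean_kernel a c x z = 0"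
  then show ?thesis
    by (intro integrable_compact_support[of S]) (auto intro!: continuous_intros ac g)
qed

lemma integral_mean_kernel:
  assumes ac: "a > 0" "c > 0" and g: "continuous_on UNIV g"
  shows "(\<integral>z. mean_kernel a c x z *\<^sub>R g (fst z + real j * snd z) \<partial>lborel) = double_mean g x a (real j * c)"
proof -
  have int: "integrable lborel (\<lambda>z. mean_kernel a c x z *\<^sub>R g (fst z + real j * snd z))"
    by (intro integrable_mean_kernel ac) (auto intro!: continuous_intros continuous_on_compose2[OF g])
  have "(\<integral>z. mean_kernel a c x z *\<^sub>R g (fst z + real j * snd z) \<partial>lborel)
     = (\<integral>w. (\<integral>y. mean_kernel a c x (y, w) *\<^sub>R g (y + real j * w) \<partial>lborel) \<partial>lborel)"
    using lborel_integral_prod(2)[OF int] by simp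
  also have "\<dots> = (\<integral>w. dil c (w + c * x) *\<^sub>R (\<integral>y. dil a (y - (1 - a) * x) *\<^sub>R g (y + real j * w) \<partial>lborel) \<partial>lborel)"
    by (simp add: mean_kernel_def mult.commute flip: scaleR_scaleR)
  also have "\<dots> = (\<integral>w. dil c (w - (- c * x)) *\<^sub>R (\<integral>v. rho v *\<^sub>R g ((1 - a) * x + a * v + real j * w) \<partial>lborel) \<partial>lborel)"
    using ac by (subst integral_dil) auto
  also have "\<dots> = (\<integral>v'. rho v' *\<^sub>R (\<integral>v. rho v *\<^sub>R g ((1 - a) * x + a * v + real j * (- c * x + c * v')) \<partial>lborel) \<partial>lborel)"
    using ac by (subst integral_dil) auto
  also have "\<dots> = double_mean g x a (real j * c)"
    unfolding double_mean_def by (simp add: algebra_simps)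
  finally show ?thesis .
qed

section \<open>Layer kernels and the telescoping identity\<close>

text \<open>The weights for which g x minus the weighted sum of g (x + i w), i = 1..l, is (-1)^l
  times the l-th difference of g at x with step w.\<close>

definition alt_binom :: "nat \<Rightarrow> nat \<Rightarrow> real" where
  "alt_binom l i = (- 1) ^ (i + 1) * real (l choose i)"

text \<open>With 8 l in the denominator, i * mesh is at most 1/8 for i <= l. This leaves room for a
  base point and a full l-th difference inside [0, 1], and makes the steps at level q shorter than
  2^-(q+1); see \<open>ker_region\<close>.\<close>

definition mesh :: "nat \<Rightarrow> nat \<Rightarrow> real" where
  "mesh l q = 1 / (8 * real l * 2 ^ q)"

definition tau :: "nat \<Rightarrow> nat \<Rightarrow> real \<Rightarrow> real \<Rightarrow> real" where
  "tau l q x y = (\<Sum>i\<in>{1..l}. alt_binom l i * dil (real i * mesh l q) (y - (1 - real i * mesh l q) * x))"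

text \<open>Let P and P' be the weighted means with the meshes of levels q and q - 1, and P P' their
  weighted double mean, which is symmetric. Then P - P' = (P - P P') - (P' - P' P), and each bracket
  is up to the sign (-1)^l a mean of l-th differences. The two groups of kernels belong to the two
  brackets. At q = 0 no difference is taken; \<open>rho (snd z)\<close> is the density of a dummy
  step that gives level 0 the same form.\<close>

definition ker :: "nat \<Rightarrow> nat \<Rightarrow> real \<Rightarrow> real \<times> real \<Rightarrow> real" where
  "ker l q x z = (if q = 0 then tau l 0 x (fst z) * rho (snd z)
     else (- 1) ^ l * (\<Sum>i\<in>{1..l}. alt_binom l i *
       (mean_kernel (real i * mesh l q) (mesh l (q - 1)) x z - mean_kernel (real i * mesh l (q - 1)) (mesh l q) x z)))"

definition udiff :: "nat \<Rightarrow> real \<Rightarrow> (real \<Rightarrow> complex) \<Rightarrow> real \<Rightarrow> complex" where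
  "udiff l w g y = (\<Sum>j\<le>l. (- 1) ^ (l - j) * of_nat (l choose j) * g (y + real j * w))"

definition level_diff :: "nat \<Rightarrow> nat \<Rightarrow> real \<times> real \<Rightarrow> (real \<Rightarrow> complex) \<Rightarrow> complex" where
  "level_diff l q z g = (if q = 0 then g (fst z) else udiff l (snd z) g (fst z))"

definition smear :: "nat \<Rightarrow> nat \<Rightarrow> real \<Rightarrow> (real \<Rightarrow> complex) \<Rightarrow> complex" where
  "smear l q x g = (\<integral>y. tau l q x y *\<^sub>R g y \<partial>lborel)"

lemma mesh_pos: "l > 0 \<Longrightarrow> mesh l q > 0"
  by (simp add: mesh_def)

lemma integrable_dil:
  assumes "c > 0" "continuous_on UNIV (g :: real \<Rightarrow> complex)"
  shows "integrable lborel (\<lambda>y. dil c (y - a) *\<^sub>R g y)"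
proof (rule integrable_compact_support[of "{a..a + c}"])
  fix y assume "y \<notin> {a..a + c}"
  then have "dil c (y - a) = 0" using dil_nonzero[OF assms(1), of "y - a"] by force
  then show "dil c (y - a) *\<^sub>R g y = 0" by simp
qed (auto intro!: continuous_intros assms)

lemma smear_eq:
  assumes l: "l > 0" and g: "continuous_on UNIV g"
  shows "smear l q x g = (\<Sum>i\<in>{1..l}. alt_binom l i *\<^sub>R double_mean g x (real i * mesh l q) 0)"
proof -
  have "smear l q x g = (\<integral>y. (\<Sum>i\<in>{1..l}. alt_binom l i *\<^sub>R (dil (real i * mesh l q) (y - (1 - real i * mesh l q) * x) *\<^sub>R g y)) \<partial>lborel)"
    unfolding smear_def tau_def by (simp add: scaleR_sum_left)
  also have "\<dots> = (\<Sum>i\<in>{1..l}. alt_binom l i *\<^sub>R (\<integral>y. dil (real i * mesh l q) (y - (1 - real i * mesh l q) * x) *\<^sub>R g y \<partial>lborel))"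
    using mesh_pos[OF l] g by (subst Bochner_Integration.integral_sum) (auto intro!: integrable_dil simp del: scaleR_scaleR)
  also have "\<dots> = (\<Sum>i\<in>{1..l}. alt_binom l i *\<^sub>R double_mean g x (real i * mesh l q) 0)"
  proof (rule sum.cong[OF refl])
    fix i assume i: "i \<in> {1..l}"
    define c where "c = real i * mesh l q"
    have c: "c > 0" using i mesh_pos[OF l, of q] by (simp add: c_def)
    have e: "(1 - c) * x + c * v = x + c * (v - x)" for v by (simp add: algebra_simps)
    show "alt_binom l i *\<^sub>R (\<integral>y. dil (real i * mesh l q) (y - (1 - real i * mesh l q) * x) *\<^sub>R g y \<partial>lborel) = alt_binom l i *\<^sub>R double_mean g x (real i * mesh l q) 0"
      unfolding c_def[symmetric] integral_dil[OF c] double_mean_0 e ..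
  qed
  finally show ?thesis .
qed

lemma smear_0:
  assumes l: "l > 0" and g: "continuous_on UNIV g"
  shows "smear l 0 x g = (\<integral>z. ker l 0 x z *\<^sub>R level_diff l 0 z g \<partial>lborel)"
proof -
  define f where "f z = ker l 0 x z *\<^sub>R g (fst z)" for z
  have int: "integrable lborel f"
  proof -
    have fe: "f = (\<lambda>z. \<Sum>i\<in>{1..l}. alt_binom l i *\<^sub>R ((dil (real i * mesh l 0) (fst z - (1 - real i * mesh l 0) * x) * rho (snd z)) *\<^sub>R g (fst z)))"
      by (rule ext) (simp add: f_def ker_def tau_def sum_distrib_right scaleR_sum_left mult.assoc)
    have ii: "integrable lborel (\<lambda>z. (dil (real i * mesh l 0) (fst z - (1 - real i * mesh l 0) * x) * rho (snd z)) *\<^sub>R g (fst z))"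
      if i: "i \<in> {1..l}" for i
    proof (rule integrable_compact_support)
      let ?c = "real i * mesh l 0"
      have c: "?c > 0" using i mesh_pos[OF l] by auto
      show "compact ({(1 - ?c) * x..(1 - ?c) * x + ?c} \<times> {0..1::real})" by (intro compact_Times compact_Icc)
      show "continuous_on UNIV (\<lambda>z. (dil ?c (fst z - (1 - ?c) * x) * rho (snd z)) *\<^sub>R g (fst z))"
        by (auto intro!: continuous_intros c continuous_on_compose2[OF g])
      fix z :: "real \<times> real" assume "z \<notin> {(1 - ?c) * x..(1 - ?c) * x + ?c} \<times> {0..1}"
      then have "dil ?c (fst z - (1 - ?c) * x) = 0 \<or> rho (snd z) = 0"
        using dil_nonzero[OF c, of "fst z - (1 - ?c) * x"] rho_zero[of "snd z"] by (cases z) force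
      then show "(dil ?c (fst z - (1 - ?c) * x) * rho (snd z)) *\<^sub>R g (fst z) = 0" by auto
    qed
    show ?thesis unfolding fe by (intro Bochner_Integration.integrable_sum integrable_scaleR_right ii)
  qed
  have "(\<integral>z. f z \<partial>lborel) = (\<integral>w. (\<integral>y. rho w *\<^sub>R (tau l 0 x y *\<^sub>R g y) \<partial>lborel) \<partial>lborel)"
    unfolding lborel_integral_prod(2)[OF int] by (simp add: f_def ker_def mult.commute)
  also have "\<dots> = (\<integral>w. rho w *\<^sub>R smear l 0 x g \<partial>lborel)"
    by (simp only: integral_scaleR_right smear_def)
  also have "\<dots> = smear l 0 x g" by (simp add: integral_rho integrable_rho)
  finally show ?thesis by (simp add: f_def[abs_def] level_diff_def)
qed

lemma sum_binomial_alt_binom: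
  fixes W :: "nat \<Rightarrow> complex"
  shows "(\<Sum>j\<le>l. (- 1) ^ (l - j) * of_nat (l choose j) * W j) = (- 1) ^ l * (W 0 - (\<Sum>j\<in>{1..l}. of_real (alt_binom l j) * W j))"
proof -
  have "{..l} = insert 0 {1..l}" by auto
  then have "(\<Sum>j\<le>l. (- 1) ^ (l - j) * of_nat (l choose j) * W j)
     = (- 1) ^ l * W 0 + (\<Sum>j\<in>{1..l}. (- 1) ^ (l - j) * of_nat (l choose j) * W j)" by simp
  also have "(\<Sum>j\<in>{1..l}. (- 1) ^ (l - j) * of_nat (l choose j) * W j) = (\<Sum>j\<in>{1..l}. - ((- 1) ^ l * (of_real (alt_binom l j) * W j)))"
  proof (rule sum.cong[OF refl])
    fix j assume "j \<in> {1..l}"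
    then have "(- 1) ^ (l - j) = ((- 1) ^ l * (- 1) ^ j :: complex)"
      by (cases "even j"; cases "even l") auto
    then show "(- 1) ^ (l - j) * of_nat (l choose j) * W j = - ((- 1) ^ l * (of_real (alt_binom l j) * W j))"
      by (simp only: alt_binom_def) simp
  qed
  finally show ?thesis by (simp add: sum_negf right_diff_distrib sum_distrib_left)
qed

lemma integral_mean_kernel_udiff:
  assumes ac: "a > 0" "c > 0" and g: "continuous_on UNIV g"
  shows "(\<integral>z. mean_kernel a c x z *\<^sub>R udiff l (snd z) g (fst z) \<partial>lborel)
    = (- 1) ^ l * (double_mean g x a 0 - (\<Sum>j\<in>{1..l}. of_real (alt_binom l j) * double_mean g x a (real j * c)))"
proof -
  have i: "integrable lborel (\<lambda>z. mean_kernel a c x z *\<^sub>R g (fst z + real j * snd z))" for j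
    by (intro integrable_mean_kernel ac) (auto intro!: continuous_intros continuous_on_compose2[OF g])
  have "(\<integral>z. mean_kernel a c x z *\<^sub>R udiff l (snd z) g (fst z) \<partial>lborel)
     = (\<integral>z. (\<Sum>j\<le>l. ((- 1) ^ (l - j) * of_nat (l choose j)) * (mean_kernel a c x z *\<^sub>R g (fst z + real j * snd z))) \<partial>lborel)"
    unfolding udiff_def by (simp add: scaleR_sum_right)
  also have "\<dots> = (\<Sum>j\<le>l. \<integral>z. ((- 1) ^ (l - j) * of_nat (l choose j)) * (mean_kernel a c x z *\<^sub>R g (fst z + real j * snd z)) \<partial>lborel)"
    by (intro Bochner_Integration.integral_sum integrable_mult_right i)
  also have "\<dots> = (\<Sum>j\<le>l. (- 1) ^ (l - j) * of_nat (l choose j) * double_mean g x a (real j * c))"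
    by (simp only: integral_mult_right_zero integral_mean_kernel[OF ac g])
  also have "\<dots> = (- 1) ^ l * (double_mean g x a 0 - (\<Sum>j\<in>{1..l}. of_real (alt_binom l j) * double_mean g x a (real j * c)))"
    using sum_binomial_alt_binom[of l "\<lambda>j. double_mean g x a (real j * c)"] by simp
  finally show ?thesis .
qed

text \<open>Integrating the kernel yields single means minus double means; the sign (-1)^l in the
  kernel cancels that of the l-th difference. The single means form the two smears, and the double
  means of meshes (a, c) and (c, a) cancel by symmetry.\<close>

lemma smear_Suc:
  assumes l: "l > 0" and g: "continuous_on UNIV g"
  shows "smear l (Suc q) x g = smear l q x g + (\<integral>z. ker l (Suc q) x z *\<^sub>R level_diff l (Suc q) z g \<partial>lborel)"
proof -
  define a c where "a = mesh l (Suc q)" and "c = mesh l q"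
  have ac: "a > 0" "c > 0" using mesh_pos[OF l] by (auto simp: a_def c_def)
  define W where "W s t = double_mean g x s t" for s t
  define u where "u z = udiff l (snd z) g (fst z)" for z
  have cu: "continuous_on UNIV u"
    unfolding u_def udiff_def by (auto intro!: continuous_intros continuous_on_compose2[OF g])
  have int: "integrable lborel (\<lambda>z. mean_kernel (real i * s) t x z *\<^sub>R u z)" if "i \<in> {1..l}" "s > 0" "t > 0" for i s t
    using that by (intro integrable_mean_kernel cu) auto
  have val: "(\<integral>z. mean_kernel (real i * s) t x z *\<^sub>R u z \<partial>lborel)
    = (- 1) ^ l * (W (real i * s) 0 - (\<Sum>j\<in>{1..l}. of_real (alt_binom l j) * W (real i * s) (real j * t)))"
    if "i \<in> {1..l}" "s > 0" "t > 0" for i s t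
    unfolding u_def W_def using that by (intro integral_mean_kernel_udiff g) auto
  have "(\<integral>z. ker l (Suc q) x z *\<^sub>R level_diff l (Suc q) z g \<partial>lborel)
     = (\<integral>z. (- 1) ^ l *\<^sub>R (\<Sum>i\<in>{1..l}. alt_binom l i *\<^sub>R (mean_kernel (real i * a) c x z *\<^sub>R u z - mean_kernel (real i * c) a x z *\<^sub>R u z)) \<partial>lborel)"
    by (intro Bochner_Integration.integral_cong refl)
       (simp add: ker_def level_diff_def a_def c_def u_def scaleR_sum_left scaleR_diff_left flip: scaleR_scaleR)
  also have "\<dots> = (- 1) ^ l *\<^sub>R (\<integral>z. (\<Sum>i\<in>{1..l}. alt_binom l i *\<^sub>R (mean_kernel (real i * a) c x z *\<^sub>R u z - mean_kernel (real i * c) a x z *\<^sub>R u z)) \<partial>lborel)"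
    by (rule integral_scaleR_right)
  also have "(\<integral>z. (\<Sum>i\<in>{1..l}. alt_binom l i *\<^sub>R (mean_kernel (real i * a) c x z *\<^sub>R u z - mean_kernel (real i * c) a x z *\<^sub>R u z)) \<partial>lborel)
     = (\<Sum>i\<in>{1..l}. \<integral>z. alt_binom l i *\<^sub>R (mean_kernel (real i * a) c x z *\<^sub>R u z - mean_kernel (real i * c) a x z *\<^sub>R u z) \<partial>lborel)"
    by (intro Bochner_Integration.integral_sum integrable_scaleR_right Bochner_Integration.integrable_diff int ac)
  also have "\<dots> = (\<Sum>i\<in>{1..l}. alt_binom l i *\<^sub>R ((\<integral>z. mean_kernel (real i * a) c x z *\<^sub>R u z \<partial>lborel) - (\<integral>z. mean_kernel (real i * c) a x z *\<^sub>R u z \<partial>lborel)))"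
  proof (rule sum.cong[OF refl])
    fix i assume i: "i \<in> {1..l}"
    show "(\<integral>z. alt_binom l i *\<^sub>R (mean_kernel (real i * a) c x z *\<^sub>R u z - mean_kernel (real i * c) a x z *\<^sub>R u z) \<partial>lborel)
      = alt_binom l i *\<^sub>R ((\<integral>z. mean_kernel (real i * a) c x z *\<^sub>R u z \<partial>lborel) - (\<integral>z. mean_kernel (real i * c) a x z *\<^sub>R u z \<partial>lborel))"
      unfolding integral_scaleR_right
      by (subst Bochner_Integration.integral_diff) (auto intro!: int i ac)
  qed
  also have "(- 1) ^ l *\<^sub>R \<dots> = (\<Sum>i\<in>{1..l}. ((- 1) ^ l * (- 1) ^ l) * of_real (alt_binom l i) * (W (real i * a) 0 - W (real i * c) 0
       - (\<Sum>j\<in>{1..l}. of_real (alt_binom l j) * W (real i * a) (real j * c)) + (\<Sum>j\<in>{1..l}. of_real (alt_binom l j) * W (real i * c) (real j * a))))"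
    unfolding scaleR_sum_right
  proof (rule sum.cong[OF refl])
    fix i assume i: "i \<in> {1..l}"
    have gen: "s *\<^sub>R (k *\<^sub>R (of_real s * (p - r) - of_real s * (p' - r'))) = (of_real s * of_real s) * of_real k * (p - p' - r + r')"
      for s k :: real and p r p' r' :: complex
      by (simp add: scaleR_conv_of_real algebra_simps)
    show "(- 1) ^ l *\<^sub>R alt_binom l i *\<^sub>R ((\<integral>z. mean_kernel (real i * a) c x z *\<^sub>R u z \<partial>lborel) - (\<integral>z. mean_kernel (real i * c) a x z *\<^sub>R u z \<partial>lborel))
      = ((- 1) ^ l * (- 1) ^ l) * of_real (alt_binom l i) * (W (real i * a) 0 - W (real i * c) 0
       - (\<Sum>j\<in>{1..l}. of_real (alt_binom l j) * W (real i * a) (real j * c)) + (\<Sum>j\<in>{1..l}. of_real (alt_binom l j) * W (real i * c) (real j * a)))"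
      unfolding val[OF i ac] val[OF i ac(2) ac(1)] using gen[of "(- 1) ^ l"] by simp
  qed
  also have "(- 1) ^ l * (- 1) ^ l = (1 :: complex)" by (simp flip: power_mult_distrib)
  also have "(\<Sum>i\<in>{1..l}. 1 * of_real (alt_binom l i) * (W (real i * a) 0 - W (real i * c) 0
       - (\<Sum>j\<in>{1..l}. of_real (alt_binom l j) * W (real i * a) (real j * c)) + (\<Sum>j\<in>{1..l}. of_real (alt_binom l j) * W (real i * c) (real j * a))))
     = (\<Sum>i\<in>{1..l}. of_real (alt_binom l i) * W (real i * a) 0) - (\<Sum>i\<in>{1..l}. of_real (alt_binom l i) * W (real i * c) 0)
       - (\<Sum>i\<in>{1..l}. \<Sum>j\<in>{1..l}. of_real (alt_binom l i) * (of_real (alt_binom l j) * W (real i * a) (real j * c)))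
       + (\<Sum>i\<in>{1..l}. \<Sum>j\<in>{1..l}. of_real (alt_binom l i) * (of_real (alt_binom l j) * W (real i * c) (real j * a)))"
    by (simp only: mult_1_left right_diff_distrib distrib_left sum_distrib_left sum.distrib sum_subtractf)
  also have "(\<Sum>i\<in>{1..l}. \<Sum>j\<in>{1..l}. of_real (alt_binom l i) * (of_real (alt_binom l j) * W (real i * c) (real j * a)))
     = (\<Sum>i\<in>{1..l}. \<Sum>j\<in>{1..l}. of_real (alt_binom l i) * (of_real (alt_binom l j) * W (real i * a) (real j * c)))"
  proof (subst sum.swap, intro sum.cong refl)
    fix i j :: nat
    have "W (real j * c) (real i * a) = W (real i * a) (real j * c)"
      unfolding W_def by (rule double_mean_commute[OF g])
    then show "of_real (alt_binom l j) * (of_real (alt_binom l i) * W (real j * c) (real i * a)) = of_real (alt_binom l i) * (of_real (alt_binom l j) * W (real i * a) (real j * c))"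
      by simp
  qed
  finally have "(\<integral>z. ker l (Suc q) x z *\<^sub>R level_diff l (Suc q) z g \<partial>lborel) = smear l (Suc q) x g - smear l q x g"
    by (simp add: smear_eq[OF l g] a_def c_def W_def scaleR_conv_of_real)
  then show ?thesis by simp
qed

lemma smear_telescope:
  assumes "l > 0" "continuous_on UNIV g"
  shows "smear l J x g = (\<Sum>q\<le>J. \<integral>z. ker l q x z *\<^sub>R level_diff l q z g \<partial>lborel)"
  using assms by (induction J) (simp_all add: smear_0 smear_Suc)

text \<open>For q > 0 the base point is y = x + a (v - x), and the far end of the difference is y +
  l w = (1 - a - d) x + a v + d v' with d = l c. With a and d at most 1/8, both are convex
  combinations of points of [0, 1]. The strict bound on |w| is the range of steps in the modulus of
  level q. For q = 0 the step is the dummy variable in (0, 1).\<close>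

lemma ker_region:
  assumes l: "l > 0" and x: "x \<in> {0..1}" and nz: "ker l q x (y, w) \<noteq> 0"
  shows "\<bar>x - y\<bar> \<le> 1 / 2 ^ q" "y \<in> {0..1}" "\<bar>w\<bar> \<le> 1 / 2 ^ q"
    "q \<noteq> 0 \<Longrightarrow> \<bar>w\<bar> < 1 / 2 ^ Suc q" "q \<noteq> 0 \<Longrightarrow> y + real l * w \<in> {0..1}"
proof -
  have conv: "x + a * (v - x) \<in> {0..1} \<and> \<bar>x - (x + a * (v - x))\<bar> \<le> a" if "0 < a" "a \<le> 1" "v \<in> {0<..<1}" for a v
  proof -
    have e: "x + a * (v - x) = (1 - a) * x + a * v" by (simp add: algebra_simps)
    have "0 \<le> (1 - a) * x + a * v" using that x by auto
    moreover have "(1 - a) * x + a * v \<le> (1 - a) * 1 + a * 1" using that x by (intro add_mono mult_left_mono) auto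
    moreover have "a * \<bar>v - x\<bar> \<le> a * 1" using that x by (intro mult_left_mono) (auto simp: abs_le_iff)
    moreover have "\<bar>x - (x + a * (v - x))\<bar> = a * \<bar>v - x\<bar>" using that by (simp add: abs_mult)
    ultimately show ?thesis unfolding e by simp
  qed
  have "\<bar>x - y\<bar> \<le> 1 / 2 ^ q \<and> y \<in> {0..1} \<and> \<bar>w\<bar> \<le> 1 / 2 ^ q \<and>
    (q \<noteq> 0 \<longrightarrow> \<bar>w\<bar> < 1 / 2 ^ Suc q \<and> y + real l * w \<in> {0..1})"
  proof (cases "q = 0")
    case True
    then have "tau l 0 x y \<noteq> 0" and w: "rho w \<noteq> 0" using nz by (auto simp: ker_def)
    then obtain i where i: "i \<in> {1..l}" "dil (real i * mesh l 0) (y - (1 - real i * mesh l 0) * x) \<noteq> 0"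
      unfolding tau_def by (metis (no_types, lifting) mult_eq_0_iff sum.neutral)
    define a where "a = real i * mesh l 0"
    have a: "a > 0" "a \<le> 1" using i l by (auto simp: a_def mesh_def)
    have "0 < y - (1 - a) * x" "y - (1 - a) * x < a" using dil_nonzero[OF a(1) i(2)[folded a_def]] by auto
    then have v: "(y - (1 - a) * x) / a \<in> {0<..<1}" and y: "y = x + a * ((y - (1 - a) * x) / a - x)"
      using a by (auto simp: field_simps)
    have "w \<in> {0<..<1}" using rho_zero w by blast
    then show ?thesis using conv[OF a v] a(2) unfolding y[symmetric] True by auto
  next
    case False
    then obtain r where r: "q = Suc r" by (cases q) auto
    have "(\<Sum>i\<in>{1..l}. alt_binom l i * (mean_kernel (real i * mesh l q) (mesh l r) x (y, w) - mean_kernel (real i * mesh l r) (mesh l q) x (y, w))) \<noteq> 0"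
      using nz by (auto simp: ker_def r)
    then obtain i where i: "i \<in> {1..l}" "mean_kernel (real i * mesh l q) (mesh l r) x (y, w) - mean_kernel (real i * mesh l r) (mesh l q) x (y, w) \<noteq> 0"
      by (metis (no_types, lifting) mult_eq_0_iff sum.neutral)
    have dlr: "mesh l q \<le> mesh l r" using l by (simp add: mesh_def r divide_simps)
    have "\<exists>a c. 0 < a \<and> 0 < c \<and> a \<le> real l * mesh l r \<and> c \<le> mesh l r \<and> mean_kernel a c x (y, w) \<noteq> 0"
    proof (cases "mean_kernel (real i * mesh l q) (mesh l r) x (y, w) = 0")
      case True
      have "real i * mesh l r \<le> real l * mesh l r" using i mesh_pos[OF l, of r] by auto
      then show ?thesis using i True mesh_pos[OF l] dlr
        by (intro exI[of _ "real i * mesh l r"] exI[of _ "mesh l q"]) auto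
    next
      case False
      have "real i * mesh l q \<le> real l * mesh l r" using i dlr mesh_pos[OF l, of q] by (intro mult_mono) auto
      then show ?thesis using i False mesh_pos[OF l]
        by (intro exI[of _ "real i * mesh l q"] exI[of _ "mesh l r"]) auto
    qed
    then obtain a c where ac: "0 < a" "0 < c" "a \<le> real l * mesh l r" "c \<le> mesh l r" "mean_kernel a c x (y, w) \<noteq> 0" by blast
    obtain v v' where v: "v \<in> {0<..<1}" "v' \<in> {0<..<1}" "y = x + a * (v - x)" "w = c * (v' - x)"
      by (rule mean_kernel_nonzero[OF ac(1,2,5)])
    have ldl: "real l * mesh l r = 1 / (4 * 2 ^ q)" using l by (simp add: mesh_def r)
    have p1: "(1::real) \<le> 2 ^ r" by simp
    have a1: "a \<le> 1 / (4 * 2 ^ q)" using ac ldl by simp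
    have le8: "1 / (4 * 2 ^ q) \<le> (1/8 :: real)" using p1 by (simp add: r field_simps)
    have c1: "real l * c \<le> 1 / (4 * 2 ^ q)"
      using mult_left_mono[OF ac(4), of "real l"] by (simp add: ldl)
    have "1 * c \<le> real l * c" using l ac by (intro mult_right_mono) auto
    then have c2: "c \<le> 1 / (4 * 2 ^ q)" using c1 by simp
    have "\<bar>v' - x\<bar> \<le> 1" unfolding abs_le_iff using v x by auto
    then have "c * \<bar>v' - x\<bar> \<le> c * 1" using ac by (intro mult_left_mono) auto
    then have w: "\<bar>w\<bar> \<le> c" unfolding v(4) abs_mult using ac by simp
    have a2: "a \<le> 1" using a1 le8 by linarith
    have 1: "y \<in> {0..1}" "\<bar>x - y\<bar> \<le> a" using conv[OF ac(1) a2 v(1)] unfolding v(3) by blast+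
    have 2: "y + real l * w \<in> {0..1}"
    proof -
      define d where "d = real l * c"
      have d: "0 \<le> d" "d \<le> 1/8" "a \<le> 1/8"
        using order_trans[OF c1 le8] order_trans[OF a1 le8] ac by (simp_all add: d_def)
      have e: "y + real l * w = (1 - a - d) * x + a * v + d * v'" by (simp add: v(3,4) d_def algebra_simps)
      have "0 \<le> (1 - a - d) * x" "0 \<le> a * v" "0 \<le> d * v'" using d ac x v by auto
      then have "0 \<le> (1 - a - d) * x + a * v + d * v'" by simp
      moreover have "(1 - a - d) * x + a * v + d * v' \<le> (1 - a - d) * 1 + a * 1 + d * 1"
        using d ac x v by (intro add_mono mult_left_mono) auto
      ultimately show ?thesis unfolding e by simp
    qed
    have q4: "1 / (4 * 2 ^ q) \<le> 1 / (2 ^ q :: real)" "1 / (4 * 2 ^ q) < 1 / (2 ^ Suc q :: real)"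
      by (auto simp: field_simps)
    have "\<bar>x - y\<bar> \<le> 1 / 2 ^ q" using 1 a1 q4 by linarith
    moreover have "\<bar>w\<bar> \<le> 1 / 2 ^ q" "\<bar>w\<bar> < 1 / 2 ^ Suc q" using w c2 q4 by linarith+
    ultimately show ?thesis using 1 2 by blast
  qed
  then show "\<bar>x - y\<bar> \<le> 1 / 2 ^ q" "y \<in> {0..1}" "\<bar>w\<bar> \<le> 1 / 2 ^ q"
    "q \<noteq> 0 \<Longrightarrow> \<bar>w\<bar> < 1 / 2 ^ Suc q" "q \<noteq> 0 \<Longrightarrow> y + real l * w \<in> {0..1}" by blast+
qed

text \<open>A factor c in the scale is paid for by c^2 in the constant, because at most second
  differences are measured.\<close>

lemma scaled_C2_rescale: "scaled_C2 (c * r) B F \<Longrightarrow> c \<ge> 1 \<Longrightarrow> scaled_C2 r (c\<^sup>2 * B) F"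
proof -
  assume F: "scaled_C2 (c * r) B F" and c: "c \<ge> 1"
  have B: "B \<ge> 0" using smD(4)[OF F] .
  have c2: "1 \<le> c\<^sup>2" "c \<le> c\<^sup>2" using c by (auto simp: power2_eq_square mult_le_cancel_left1 intro: order_trans)
  show ?thesis unfolding scaled_C2_def
  proof (intro conjI allI)
    fix x y h
    have "B * 1 \<le> B * c\<^sup>2" using B c2 by (intro mult_left_mono) auto
    then show "\<bar>F x\<bar> \<le> c\<^sup>2 * B" using smD(1)[OF F, of x] by (simp add: mult.commute)
    show "\<bar>F x - F y\<bar> \<le> c\<^sup>2 * B * r * \<bar>x - y\<bar>"
    proof (cases "r \<ge> 0")
      case True
      have "\<bar>F x - F y\<bar> \<le> c * (B * r * \<bar>x - y\<bar>)" using smD(2)[OF F, of x y] by (simp add: mult_ac)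
      also have "\<dots> \<le> c\<^sup>2 * (B * r * \<bar>x - y\<bar>)" using True B c2 by (intro mult_right_mono) auto
      finally show ?thesis by (simp add: mult_ac)
    next
      case False
      have "0 \<le> B * (c * r) * \<bar>0 - 1\<bar>" using smD(2)[OF F, of 0 1] by (rule order_trans[rotated]) simp
      then have "B = 0" using False c B by (auto simp: zero_le_mult_iff)
      then show ?thesis using smD(2)[OF F, of x y] by simp
    qed
    show "\<bar>F (x + h) - 2 * F x + F (x - h)\<bar> \<le> c\<^sup>2 * B * r\<^sup>2 * h\<^sup>2"
      using smD(3)[OF F, of x h] by (simp add: power_mult_distrib mult_ac)
  qed
qed

lemma scaled_C2_rho: "scaled_C2 2 (16 / bump_mass) rho"
proof -
  have "scaled_C2 (1 * \<bar>2\<bar>) 16 (\<lambda>v. bump (2 * v + - 1))" by (rule scaled_C2_affine[OF scaled_C2_bump])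
  then have "scaled_C2 2 16 (\<lambda>v. bump (2 * v + - 1))" by simp
  from scaled_C2_scale[OF this, of "1 / bump_mass"]
  have "scaled_C2 2 (\<bar>1 / bump_mass\<bar> * 16) (\<lambda>v. 1 / bump_mass * bump (2 * v + - 1))" .
  moreover have "(\<lambda>v. 1 / bump_mass * bump (2 * v + - 1)) = rho" by (simp add: rho_def fun_eq_iff)
  moreover have "\<bar>1 / bump_mass\<bar> * 16 = 16 / bump_mass" using bump_mass_pos by simp
  ultimately show ?thesis by simp
qed

text \<open>For q > 0 each term is a product of two dilates of \<open>rho\<close>, each of height
  and inverse width of order 2^q, hence the factor 4^q. Meshes of levels up to q have inverse at
  most 8 l 2^q, and the scale 2 of \<open>rho\<close> doubles this to L 2^q with L = 16 l; the
  factor L then moves into the constant.\<close>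

lemma scaled_C2_ker:
  assumes l: "l > 0"
  obtains K where "K > 0" "\<And>q z. scaled_C2 (2 ^ q) (K * 4 ^ q) (\<lambda>x. ker l q x z)"
proof -
  define B where "B = 16 / bump_mass"
  have B: "B > 0" using bump_mass_pos by (simp add: B_def)
  define L where "L = 16 * real l"
  have L: "L \<ge> 16" using l by (simp add: L_def)
  have sd: "scaled_C2 (L * 2 ^ q) (B * (L * 2 ^ q)) (\<lambda>x. dil a (t - (1 - a) * x))" if a: "a \<ge> mesh l q" "a \<le> 1" for a t q
  proof -
    have a0: "a > 0" using a mesh_pos[OF l, of q] by linarith
    have ia: "1 / a \<le> 8 * real l * 2 ^ q" using a(1) a0 l by (simp add: mesh_def divide_simps mult.commute)
    have "scaled_C2 (2 * \<bar>- (1 - a) / a\<bar>) B (\<lambda>x. rho (- (1 - a) / a * x + t / a))"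
      unfolding B_def by (rule scaled_C2_affine[OF scaled_C2_rho])
    then have 1: "scaled_C2 (2 * \<bar>- (1 - a) / a\<bar>) (\<bar>1 / a\<bar> * B) (\<lambda>x. 1 / a * rho (- (1 - a) / a * x + t / a))"
      by (rule scaled_C2_scale)
    have 2: "(\<lambda>x. 1 / a * rho (- (1 - a) / a * x + t / a)) = (\<lambda>x. dil a (t - (1 - a) * x))"
    proof
      fix x
      have "- (1 - a) / a * x + t / a = (t - (1 - a) * x) / a" using a0 by (simp add: field_simps)
      then show "1 / a * rho (- (1 - a) / a * x + t / a) = dil a (t - (1 - a) * x)" by (simp only: dil_def) simp
    qed
    have "\<bar>- (1 - a) / a\<bar> \<le> 1 / a" using a a0 by (simp add: abs_divide divide_right_mono)
    then have 3: "2 * \<bar>- (1 - a) / a\<bar> \<le> L * 2 ^ q" using ia unfolding L_def by linarith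
    have "\<bar>1 / a\<bar> * B \<le> (8 * real l * 2 ^ q) * B" using ia a0 B by (intro mult_right_mono) auto
    also have "\<dots> \<le> B * (L * 2 ^ q)" using B by (simp add: L_def)
    finally show ?thesis using scaled_C2_mono[OF 1[unfolded 2] _ 3] by simp
  qed
  have sw: "scaled_C2 (L * 2 ^ q) (B * (L * 2 ^ q)) (\<lambda>x. dil c (w + c * x))" if c: "c \<ge> mesh l q" for c w q
  proof -
    have c0: "c > 0" using c mesh_pos[OF l, of q] by linarith
    have ia: "1 / c \<le> 8 * real l * 2 ^ q" using c c0 l by (simp add: mesh_def divide_simps mult.commute)
    have "scaled_C2 (2 * \<bar>1\<bar>) B (\<lambda>x. rho (1 * x + w / c))"
      unfolding B_def by (rule scaled_C2_affine[OF scaled_C2_rho])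
    then have 1: "scaled_C2 (2 * \<bar>1\<bar>) (\<bar>1 / c\<bar> * B) (\<lambda>x. 1 / c * rho (1 * x + w / c))"
      by (rule scaled_C2_scale)
    have 2: "(\<lambda>x. 1 / c * rho (1 * x + w / c)) = (\<lambda>x. dil c (w + c * x))"
      using c0 by (simp add: dil_def fun_eq_iff add_divide_distrib add.commute)
    have "(1::real) \<le> 2 ^ q" by simp
    then have "16 * 1 \<le> L * 2 ^ q" using L by (intro mult_mono) auto
    then have 3: "2 * \<bar>1\<bar> \<le> L * 2 ^ q" by simp
    have "\<bar>1 / c\<bar> * B \<le> (8 * real l * 2 ^ q) * B" using ia c0 B by (intro mult_right_mono) auto
    also have "\<dots> \<le> B * (L * 2 ^ q)" using B by (simp add: L_def)
    finally show ?thesis using scaled_C2_mono[OF 1[unfolded 2] _ 3] by simp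
  qed
  define K0 where "K0 = L\<^sup>2 * (4 * ((B * L) * (B * L)))"
  have K0: "K0 > 0" using L B by (simp add: K0_def)
  have prod: "scaled_C2 (2 ^ q) (K0 * 4 ^ q) (\<lambda>x. F x * G x)"
    if "scaled_C2 (L * 2 ^ q) (B * (L * 2 ^ q)) F" "scaled_C2 (L * 2 ^ q) (B * (L * 2 ^ q)) G" for F G q
  proof -
    have "scaled_C2 (L * 2 ^ q) (4 * ((B * (L * 2 ^ q)) * (B * (L * 2 ^ q)))) (\<lambda>x. F x * G x)"
      by (rule scaled_C2_mult[OF that]) (use L in auto)
    then have "scaled_C2 (2 ^ q) (L\<^sup>2 * (4 * ((B * (L * 2 ^ q)) * (B * (L * 2 ^ q))))) (\<lambda>x. F x * G x)"
      by (rule scaled_C2_rescale) (use L in auto)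
    moreover have "(4::real) ^ q = 2 ^ q * 2 ^ q" by (simp flip: power_mult_distrib)
    ultimately show ?thesis by (simp add: K0_def mult_ac)
  qed
  have cK: "mesh l q \<le> mesh l r" if "r \<le> q" for r q
    using l that by (simp add: mesh_def divide_simps)
  have dl1: "real i * mesh l q \<le> 1" if "i \<in> {1..l}" for i q
  proof -
    have "(1::real) \<le> 2 ^ q" by simp
    then have "(1::real) \<le> 8 * 2 ^ q" by linarith
    then have "real i * 1 \<le> real l * (8 * 2 ^ q)" using that by (intro mult_mono) auto
    then show ?thesis using l by (simp add: mesh_def divide_simps mult_ac)
  qed
  have dli: "mesh l r \<le> real i * mesh l r" if "i \<in> {1..l}" for i r
    using that mesh_pos[OF l, of r] by simp
  have smkap: "scaled_C2 (2 ^ q) (K0 * 4 ^ q) (\<lambda>x. mean_kernel (real i * mesh l s) (mesh l t) x z)" if "i \<in> {1..l}" "s \<le> q" "t \<le> q" for i q s t z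
    unfolding mean_kernel_def
    by (rule prod[OF sd sw]) (use that cK dl1 dli in \<open>auto intro: order_trans[OF cK dli]\<close>)
  define S where "S = (\<Sum>i\<in>{1..l}. \<bar>alt_binom l i\<bar> * (2 * K0))"
  have S: "S \<ge> 0" unfolding S_def using K0 by (intro sum_nonneg) auto
  define S' where "S' = (\<Sum>i\<in>{1..l}. \<bar>alt_binom l i\<bar> * (B * L)) * (B * L)"
  show thesis
  proof (rule that[of "S + L\<^sup>2 * ((\<Sum>i\<in>{1..l}. \<bar>alt_binom l i\<bar> * (B * L)) * B) + 1"])
    have T: "0 \<le> L\<^sup>2 * ((\<Sum>i\<in>{1..l}. \<bar>alt_binom l i\<bar> * (B * L)) * B)"
      using B L by (intro mult_nonneg_nonneg sum_nonneg) auto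
    then show "S + L\<^sup>2 * ((\<Sum>i\<in>{1..l}. \<bar>alt_binom l i\<bar> * (B * L)) * B) + 1 > 0" using S by simp
    fix q z
    show "scaled_C2 (2 ^ q) ((S + L\<^sup>2 * ((\<Sum>i\<in>{1..l}. \<bar>alt_binom l i\<bar> * (B * L)) * B) + 1) * 4 ^ q) (\<lambda>x. ker l q x z)"
    proof (cases "q = 0")
      case True
      have "scaled_C2 L (\<Sum>i\<in>{1..l}. \<bar>alt_binom l i\<bar> * (B * L)) (\<lambda>x. tau l 0 x (fst z))"
        unfolding tau_def
      proof (intro scaled_C2_sum scaled_C2_scale)
        fix i assume i: "i \<in> {1..l}"
        show "scaled_C2 L (B * L) (\<lambda>x. dil (real i * mesh l 0) (fst z - (1 - real i * mesh l 0) * x))"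
          using sd[of 0 "real i * mesh l 0" "fst z"] dl1[OF i, of 0] dli[OF i, of 0] by simp
      qed simp
      then have "scaled_C2 L (\<bar>rho (snd z)\<bar> * (\<Sum>i\<in>{1..l}. \<bar>alt_binom l i\<bar> * (B * L))) (\<lambda>x. rho (snd z) * tau l 0 x (fst z))"
        by (rule scaled_C2_scale)
      then have "scaled_C2 L ((\<Sum>i\<in>{1..l}. \<bar>alt_binom l i\<bar> * (B * L)) * B) (\<lambda>x. rho (snd z) * tau l 0 x (fst z))"
      proof (rule scaled_C2_mono)
        have "\<bar>rho (snd z)\<bar> \<le> B" unfolding B_def by (rule smD(1)[OF scaled_C2_rho])
        then show "\<bar>rho (snd z)\<bar> * (\<Sum>i\<in>{1..l}. \<bar>alt_binom l i\<bar> * (B * L)) \<le> (\<Sum>i\<in>{1..l}. \<bar>alt_binom l i\<bar> * (B * L)) * B"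
          using B L by (subst mult.commute) (intro mult_left_mono sum_nonneg, auto)
      qed (use L in auto)
      then have "scaled_C2 1 (L\<^sup>2 * ((\<Sum>i\<in>{1..l}. \<bar>alt_binom l i\<bar> * (B * L)) * B)) (\<lambda>x. rho (snd z) * tau l 0 x (fst z))"
        using scaled_C2_rescale[of L 1] L by simp
      then show ?thesis using True S by (auto simp: ker_def mult.commute intro: scaled_C2_mono)
    next
      case False
      have "scaled_C2 (2 ^ q) (\<bar>(- 1) ^ l\<bar> * (\<Sum>i\<in>{1..l}. \<bar>alt_binom l i\<bar> * (K0 * 4 ^ q + \<bar>- 1\<bar> * (K0 * 4 ^ q))))
         (\<lambda>x. (- 1) ^ l * (\<Sum>i\<in>{1..l}. alt_binom l i * (mean_kernel (real i * mesh l q) (mesh l (q - 1)) x z + - 1 * mean_kernel (real i * mesh l (q - 1)) (mesh l q) x z)))"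
        by (intro scaled_C2_scale scaled_C2_sum scaled_C2_add smkap) auto
      moreover have "\<bar>(- 1) ^ l\<bar> * (\<Sum>i\<in>{1..l}. \<bar>alt_binom l i\<bar> * (K0 * 4 ^ q + \<bar>- 1\<bar> * (K0 * 4 ^ q))) = S * 4 ^ q"
      proof -
        have one: "\<bar>(- 1) ^ l\<bar> = (1::real)" by (simp add: power_abs)
        show ?thesis unfolding one S_def sum_distrib_right mult_1_left by (intro sum.cong refl) simp
      qed
      moreover have "(\<lambda>x. ker l q x z) = (\<lambda>x. (- 1) ^ l * (\<Sum>i\<in>{1..l}. alt_binom l i * (mean_kernel (real i * mesh l q) (mesh l (q - 1)) x z + - 1 * mean_kernel (real i * mesh l (q - 1)) (mesh l q) x z)))"
        using False by (simp add: ker_def)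
      ultimately have "scaled_C2 (2 ^ q) (S * 4 ^ q) (\<lambda>x. ker l q x z)" by (simp only:)
      then show ?thesis by (rule scaled_C2_mono) (use T in auto)
    qed
  qed
qed

lemma continuous_on_ker [continuous_intros]:
  "l > 0 \<Longrightarrow> continuous_on S f \<Longrightarrow> continuous_on S g \<Longrightarrow> continuous_on S (\<lambda>u. ker l q (f u) (g u))"
  unfolding ker_def tau_def using mesh_pos[of l]
  by (cases "q = 0") (auto intro!: continuous_intros)

section \<open>Layers in two variables\<close>

definition mixed_level_diff :: "nat \<Rightarrow> nat \<Rightarrow> nat \<Rightarrow> (real \<times> real \<Rightarrow> complex) \<Rightarrow> (real \<times> real) \<times> (real \<times> real) \<Rightarrow> complex" where
  "mixed_level_diff l q1 q2 f z = level_diff l q2 (snd z) (\<lambda>y2. level_diff l q1 (fst z) (\<lambda>y1. f (y1, y2)))"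

lemma continuous_on_level_diff:
  assumes f: "continuous_on UNIV f" and g: "continuous_on S g" and h: "continuous_on S h"
  shows "continuous_on S (\<lambda>u. level_diff l q (g u) (\<lambda>y1. f (y1, h u)))"
  unfolding level_diff_def udiff_def using g h
  by (cases "q = 0") (auto intro!: continuous_intros continuous_on_compose2[OF f])

lemma continuous_on_mixed_level_diff:
  assumes f: "continuous_on UNIV f" and g: "continuous_on S g"
  shows "continuous_on S (\<lambda>u. mixed_level_diff l q1 q2 f (g u))"
  unfolding mixed_level_diff_def level_diff_def udiff_def using g
  by (cases "q1 = 0"; cases "q2 = 0") (auto intro!: continuous_intros continuous_on_compose2[OF f])

lemma tau_nonzero:
  assumes l: "l > 0" and x: "x \<in> {0..1}" and nz: "tau l q x y \<noteq> 0"
  shows "y \<in> {0..1}" "\<bar>y - x\<bar> \<le> 1 / 2 ^ q"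
proof -
  obtain i where i: "i \<in> {1..l}" "dil (real i * mesh l q) (y - (1 - real i * mesh l q) * x) \<noteq> 0"
    using nz unfolding tau_def by (metis (no_types, lifting) mult_eq_0_iff sum.neutral)
  define a where "a = real i * mesh l q"
  have a0: "a > 0" using i mesh_pos[OF l, of q] by (simp add: a_def)
  have a2: "a \<le> 1 / 2 ^ q"
  proof -
    have "a \<le> real l * mesh l q" unfolding a_def using i mesh_pos[OF l, of q] by (intro mult_right_mono) auto
    also have "\<dots> = 1 / 8 * (1 / 2 ^ q)" using l by (simp add: mesh_def)
    also have "\<dots> \<le> 1 / 2 ^ q" by (simp add: divide_simps)
    finally show ?thesis .
  qed
  have "1 / 2 ^ q \<le> (1::real)" by simp
  then have a1: "a \<le> 1" using a2 by linarith
  have d: "0 < y - (1 - a) * x" "y - (1 - a) * x < a" using dil_nonzero[OF a0 i(2)[folded a_def]] by auto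
  have "(1 - a) * x \<ge> 0" "(1 - a) * x \<le> 1 - a" using a1 x by (simp_all add: mult_left_le)
  then show "y \<in> {0..1}" using d by auto
  have "0 \<le> a * x" "a * x \<le> a" using a0 x by (simp_all add: mult_left_le)
  moreover have "0 < y - x + a * x" "y - x + a * x < a" using d by (simp_all add: algebra_simps)
  ultimately have "\<bar>y - x\<bar> \<le> a" unfolding abs_le_iff by linarith
  then show "\<bar>y - x\<bar> \<le> 1 / 2 ^ q" using a2 by linarith
qed

lemma continuous_on_tau [continuous_intros]:
  "l > 0 \<Longrightarrow> continuous_on S g \<Longrightarrow> continuous_on S (\<lambda>u. tau l q x (g u))"
  unfolding tau_def using mesh_pos[of l q] by (auto intro!: continuous_intros)

lemma ker_support:
  assumes "l > 0" "x \<in> {0..1}" "z \<notin> {0..1} \<times> {- 1..1}"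
  shows "ker l q x z = 0"
proof (rule ccontr)
  assume "ker l q x z \<noteq> 0"
  then have nz: "ker l q x (fst z, snd z) \<noteq> 0" by simp
  have "\<bar>snd z\<bar> \<le> 1 / 2 ^ q" "1 / 2 ^ q \<le> (1::real)" using ker_region(3)[OF assms(1,2) nz] by auto
  then have "\<bar>snd z\<bar> \<le> 1" by linarith
  then show False using ker_region(2)[OF assms(1,2) nz] assms(3) by (cases z) (auto simp: abs_le_iff)
qed

lemma integrable_fst_lborel:
  fixes f :: "'a::euclidean_space \<times> 'b::euclidean_space \<Rightarrow> 'c::{banach, second_countable_topology}"
  assumes "integrable lborel f"
  shows "integrable lborel (\<lambda>x. \<integral>y. f (x, y) \<partial>lborel)"
  using lborel_pair.integrable_fst'[of f] assms by (simp add: lborel_prod)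

lemma ker_ker_integrable:
  assumes l: "l > 0" and f: "continuous_on UNIV f" and x: "x \<in> {0..1}" and y: "y \<in> {0..1}"
  shows "integrable lborel (\<lambda>z. (ker l q1 x (fst z) * ker l q2 y (snd z)) *\<^sub>R mixed_level_diff l q1 q2 f z)"
proof (rule integrable_compact_support)
  show "compact (({0..1} \<times> {- 1..1}) \<times> ({0..1} \<times> {- 1..1 :: real}) :: ((real \<times> real) \<times> (real \<times> real)) set)"
    by (intro compact_Times compact_Icc)
  show "continuous_on UNIV (\<lambda>z. (ker l q1 x (fst z) * ker l q2 y (snd z)) *\<^sub>R mixed_level_diff l q1 q2 f z)"
    by (intro continuous_intros continuous_on_mixed_level_diff f l)
  show "(ker l q1 x (fst z) * ker l q2 y (snd z)) *\<^sub>R mixed_level_diff l q1 q2 f z = 0"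
    if "z \<notin> ({0..1} \<times> {- 1..1}) \<times> ({0..1} \<times> {- 1..1 :: real})" for z
    using that ker_support[OF l x, of "fst z" q1] ker_support[OF l y, of "snd z" q2] by (cases z) force
qed

definition smear2 :: "nat \<Rightarrow> nat \<Rightarrow> (real \<times> real \<Rightarrow> complex) \<Rightarrow> real \<times> real \<Rightarrow> complex" where
  "smear2 l J f u = smear l J (snd u) (\<lambda>y2. smear l J (fst u) (\<lambda>y1. f (y1, y2)))"

definition layer :: "nat \<Rightarrow> nat \<Rightarrow> nat \<Rightarrow> (real \<times> real \<Rightarrow> complex) \<Rightarrow> real \<times> real \<Rightarrow> complex" where
  "layer l q1 q2 f u = (\<integral>z. (ker l q1 (fst u) (fst z) * ker l q2 (snd u) (snd z)) *\<^sub>R mixed_level_diff l q1 q2 f z \<partial>lborel)"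

text \<open>Only the first variable is telescoped, while Fubini carries the smearing in the second
  variable inside; \<open>smear2_layers\<close> telescopes that one afterwards.\<close>

lemma smear2_inner:
  assumes l: "l > 0" and f: "continuous_on UNIV f" and x: "x \<in> {0..1}" and y: "y \<in> {0..1}"
  shows "integrable lborel (\<lambda>y2. tau l J y y2 *\<^sub>R smear l J x (\<lambda>y1. f (y1, y2)))"
    and "smear2 l J f (x, y) = (\<Sum>q1\<le>J. \<integral>z1. ker l q1 x z1 *\<^sub>R smear l J y (\<lambda>y2. level_diff l q1 z1 (\<lambda>y1. f (y1, y2))) \<partial>lborel)"
proof -
  define F where "F q1 u = (tau l J y (fst u) * ker l q1 x (snd u)) *\<^sub>R level_diff l q1 (snd u) (\<lambda>y1. f (y1, fst u))" for q1 u
  have int: "integrable lborel (F q1)" for q1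
  proof (rule integrable_compact_support)
    show "compact ({0..1} \<times> ({0..1} \<times> {- 1..1 :: real}) :: (real \<times> (real \<times> real)) set)" by (intro compact_Times compact_Icc)
    show "continuous_on UNIV (F q1)" unfolding F_def
      by (intro continuous_intros continuous_on_level_diff f l)
    show "F q1 u = 0" if "u \<notin> {0..1} \<times> ({0..1} \<times> {- 1..1 :: real})" for u
    proof -
      have "fst u \<notin> {0..1} \<or> snd u \<notin> {0..1} \<times> {- 1..1}" using that by (metis mem_Times_iff)
      then have "tau l J y (fst u) = 0 \<or> ker l q1 x (snd u) = 0"
        using tau_nonzero(1)[OF l y, of J "fst u"] ker_support[OF l x, of "snd u" q1] by blast
      then show ?thesis by (auto simp: F_def)
    qed
  qed
  have f1: "continuous_on UNIV (\<lambda>y1. f (y1, y2))" for y2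
    by (intro continuous_on_compose2[OF f] continuous_intros) auto
  have in1: "(\<integral>z1. F q1 (y2, z1) \<partial>lborel) = tau l J y y2 *\<^sub>R (\<integral>z1. ker l q1 x z1 *\<^sub>R level_diff l q1 z1 (\<lambda>y1. f (y1, y2)) \<partial>lborel)" for q1 y2
    by (simp add: F_def flip: scaleR_scaleR)
  have in2: "(\<integral>y2. F q1 (y2, z1) \<partial>lborel) = ker l q1 x z1 *\<^sub>R smear l J y (\<lambda>y2. level_diff l q1 z1 (\<lambda>y1. f (y1, y2)))" for q1 z1
  proof -
    have "F q1 (y2, z1) = ker l q1 x z1 *\<^sub>R (tau l J y y2 *\<^sub>R level_diff l q1 z1 (\<lambda>y1. f (y1, y2)))" for y2
      by (simp add: F_def mult.commute)
    then show ?thesis by (simp only: integral_scaleR_right smear_def)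
  qed
  have e: "tau l J y y2 *\<^sub>R smear l J x (\<lambda>y1. f (y1, y2)) = (\<Sum>q1\<le>J. \<integral>z1. F q1 (y2, z1) \<partial>lborel)" for y2
    unfolding in1 smear_telescope[OF l f1] by (simp only: scaleR_sum_right)
  show "integrable lborel (\<lambda>y2. tau l J y y2 *\<^sub>R smear l J x (\<lambda>y1. f (y1, y2)))"
    unfolding e by (intro Bochner_Integration.integrable_sum integrable_fst_lborel int)
  have "smear2 l J f (x, y) = (\<integral>y2. (\<Sum>q1\<le>J. \<integral>z1. F q1 (y2, z1) \<partial>lborel) \<partial>lborel)"
    unfolding smear2_def by (simp add: smear_def[of l J y] e)
  also have "\<dots> = (\<Sum>q1\<le>J. \<integral>y2. (\<integral>z1. F q1 (y2, z1) \<partial>lborel) \<partial>lborel)"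
    by (intro Bochner_Integration.integral_sum integrable_fst_lborel int)
  also have "\<dots> = (\<Sum>q1\<le>J. \<integral>z1. (\<integral>y2. F q1 (y2, z1) \<partial>lborel) \<partial>lborel)"
    using lborel_integral_prod[OF int] by simp
  finally show "smear2 l J f (x, y) = (\<Sum>q1\<le>J. \<integral>z1. ker l q1 x z1 *\<^sub>R smear l J y (\<lambda>y2. level_diff l q1 z1 (\<lambda>y1. f (y1, y2))) \<partial>lborel)"
    by (simp only: in2)
qed

lemma smear2_layers:
  assumes l: "l > 0" and f: "continuous_on UNIV f" and x: "x \<in> {0..1}" and y: "y \<in> {0..1}"
  shows "smear2 l J f (x, y) = (\<Sum>q1\<le>J. \<Sum>q2\<le>J. layer l q1 q2 f (x, y))"
proof -
  define G where "G q1 q2 z = (ker l q1 x (fst z) * ker l q2 y (snd z)) *\<^sub>R mixed_level_diff l q1 q2 f z" for q1 q2 z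
  have int: "integrable lborel (G q1 q2)" for q1 q2
    unfolding G_def[abs_def] by (rule ker_ker_integrable[OF l f x y])
  have D: "continuous_on UNIV (\<lambda>y2. level_diff l q1 z1 (\<lambda>y1. f (y1, y2)))" for q1 z1
    by (intro continuous_on_level_diff f continuous_intros)
  have in1: "(\<integral>z2. G q1 q2 (z1, z2) \<partial>lborel) = ker l q1 x z1 *\<^sub>R (\<integral>z2. ker l q2 y z2 *\<^sub>R level_diff l q2 z2 (\<lambda>y2. level_diff l q1 z1 (\<lambda>y1. f (y1, y2))) \<partial>lborel)" for q1 q2 z1
    by (simp add: G_def mixed_level_diff_def flip: scaleR_scaleR)
  have e: "ker l q1 x z1 *\<^sub>R smear l J y (\<lambda>y2. level_diff l q1 z1 (\<lambda>y1. f (y1, y2))) = (\<Sum>q2\<le>J. \<integral>z2. G q1 q2 (z1, z2) \<partial>lborel)" for q1 z1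
    unfolding in1 smear_telescope[OF l D] by (simp only: scaleR_sum_right)
  have "smear2 l J f (x, y) = (\<Sum>q1\<le>J. \<integral>z1. (\<Sum>q2\<le>J. \<integral>z2. G q1 q2 (z1, z2) \<partial>lborel) \<partial>lborel)"
    unfolding smear2_inner(2)[OF assms] e ..
  also have "\<dots> = (\<Sum>q1\<le>J. \<Sum>q2\<le>J. \<integral>z1. (\<integral>z2. G q1 q2 (z1, z2) \<partial>lborel) \<partial>lborel)"
    by (intro sum.cong refl Bochner_Integration.integral_sum integrable_fst_lborel int)
  also have "\<dots> = (\<Sum>q1\<le>J. \<Sum>q2\<le>J. layer l q1 q2 f (x, y))"
  proof -
    have L: "layer l q1 q2 f (x, y) = integral\<^sup>L lborel (G q1 q2)" for q1 q2
      by (simp add: layer_def G_def[abs_def])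
    show ?thesis unfolding L lborel_integral_prod(1)[OF int] ..
  qed
  finally show ?thesis .
qed

section \<open>Uniform convergence of the smeared functions\<close>

lemma sum_alt_binom:
  assumes "l > 0" shows "(\<Sum>i\<in>{1..l}. alt_binom l i) = 1" "(\<Sum>i\<in>{1..l}. \<bar>alt_binom l i\<bar>) \<le> 2 ^ l"
proof -
  have "(\<Sum>j\<le>l. (- 1) ^ (l - j) * of_nat (l choose j) * (1::complex)) = (- 1) ^ l * (1 - (\<Sum>j\<in>{1..l}. of_real (alt_binom l j) * 1))"
    by (rule sum_binomial_alt_binom)
  moreover have "(\<Sum>j\<le>l. (- 1) ^ (l - j) * of_nat (l choose j) * (1::complex)) = (1 + (- 1)) ^ l"
    by (subst binomial_ring) (simp add: mult.commute)
  ultimately have "of_real (\<Sum>j\<in>{1..l}. alt_binom l j) = (1 :: complex)" using assms by (simp add: power_0_left)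
  then show "(\<Sum>i\<in>{1..l}. alt_binom l i) = 1" using of_real_eq_1_iff by blast
  have "(\<Sum>i\<in>{1..l}. \<bar>alt_binom l i\<bar>) = (\<Sum>i\<in>{1..l}. real (l choose i))"
    by (intro sum.cong refl) (simp add: alt_binom_def abs_mult power_abs)
  also have "\<dots> \<le> (\<Sum>i\<le>l. real (l choose i))" by (intro sum_mono2) auto
  also have "\<dots> = real (\<Sum>i\<le>l. l choose i)" by simp
  also have "\<dots> = 2 ^ l" by (simp only: choose_row_sum) simp
  finally show "(\<Sum>i\<in>{1..l}. \<bar>alt_binom l i\<bar>) \<le> 2 ^ l" .
qed

lemma integrable_dil_real: "c > 0 \<Longrightarrow> integrable lborel (\<lambda>y. dil c (y - a))"
  and integral_dil_real: "c > 0 \<Longrightarrow> (\<integral>y. dil c (y - a) \<partial>lborel) = 1"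
proof -
  assume c: "c > 0"
  show "integrable lborel (\<lambda>y. dil c (y - a))"
  proof (rule integrable_compact_support[of "{a..a + c}"])
    fix y assume "y \<notin> {a..a + c}"
    then show "dil c (y - a) = 0" using dil_nonzero[OF c, of "y - a"] by force
  qed (auto intro!: continuous_intros c)
  show "(\<integral>y. dil c (y - a) \<partial>lborel) = 1"
    using integral_dil[OF c, of a "\<lambda>_. 1 :: real"] by (simp add: integral_rho)
qed

text \<open>\<open>tau\<close> changes sign; it is majorised by the same combination of dilates with
  absolute weights, whose mass is at most 2^l.\<close>

lemma smear_bound:
  assumes l: "l > 0" and x: "x \<in> {0..1}" and int: "integrable lborel (\<lambda>y. tau l J x y *\<^sub>R h y)"
    and h: "\<And>y. y \<in> {0..1} \<Longrightarrow> \<bar>y - x\<bar> \<le> 1 / 2 ^ J \<Longrightarrow> norm (h y) \<le> B" and B: "B \<ge> 0"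
  shows "norm (smear l J x h) \<le> 2 ^ l * B"
proof -
  define T where "T y = (\<Sum>i\<in>{1..l}. \<bar>alt_binom l i\<bar> * dil (real i * mesh l J) (y - (1 - real i * mesh l J) * x))" for y
  have c: "real i * mesh l J > 0" if "i \<in> {1..l}" for i using that mesh_pos[OF l, of J] by simp
  have Ti: "integrable lborel T" unfolding T_def
    by (intro Bochner_Integration.integrable_sum integrable_mult_right integrable_dil_real c)
  have TI: "(\<integral>y. T y \<partial>lborel) \<le> 2 ^ l"
  proof -
    have "(\<integral>y. T y \<partial>lborel) = (\<Sum>i\<in>{1..l}. \<integral>y. \<bar>alt_binom l i\<bar> * dil (real i * mesh l J) (y - (1 - real i * mesh l J) * x) \<partial>lborel)"
      unfolding T_def by (intro Bochner_Integration.integral_sum integrable_mult_right integrable_dil_real c)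
    also have "\<dots> = (\<Sum>i\<in>{1..l}. \<bar>alt_binom l i\<bar>)" by (intro sum.cong refl) (simp add: integral_dil_real c)
    finally show ?thesis using sum_alt_binom(2)[OF l] by simp
  qed
  have tauT: "\<bar>tau l J x y\<bar> \<le> T y" for y
    unfolding tau_def T_def
  proof (rule order_trans[OF sum_abs], rule sum_mono)
    fix i assume i: "i \<in> {1..l}"
    have "dil (real i * mesh l J) t \<ge> 0" for t using c[OF i] by (simp add: dil_def rho_nonneg)
    then show "\<bar>alt_binom l i * dil (real i * mesh l J) (y - (1 - real i * mesh l J) * x)\<bar> \<le> \<bar>alt_binom l i\<bar> * dil (real i * mesh l J) (y - (1 - real i * mesh l J) * x)"
      by (simp add: abs_mult)
  qed
  have "norm (smear l J x h) \<le> (\<integral>y. T y * B \<partial>lborel)"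
    unfolding smear_def
  proof (rule Bochner_Integration.integral_norm_bound_integral[OF int])
    show "integrable lborel (\<lambda>y. T y * B)" using Ti by simp
    fix y :: real
    show "norm (tau l J x y *\<^sub>R h y) \<le> T y * B"
    proof (cases "tau l J x y = 0")
      case True
      then show ?thesis using tauT[of y] B by simp
    next
      case False
      have "norm (h y) \<le> B" using tau_nonzero[OF l x False] by (intro h)
      then show ?thesis unfolding norm_scaleR real_norm_def using tauT[of y] B by (intro mult_mono) auto
    qed
  qed
  also have "\<dots> = (\<integral>y. T y \<partial>lborel) * B" by simp
  also have "\<dots> \<le> 2 ^ l * B" using TI B by (rule mult_right_mono)
  finally show ?thesis .
qed

lemma integrable_tau: "l > 0 \<Longrightarrow> x \<in> {0..1} \<Longrightarrow> continuous_on UNIV g \<Longrightarrow> integrable lborel (\<lambda>y. tau l J x y *\<^sub>R (g y :: complex))"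
  using tau_nonzero(1)[of l x J]
  by (intro integrable_compact_support[of "{0..1}"]) (auto intro!: continuous_intros)

lemma smear_const:
  assumes l: "l > 0" and x: "x \<in> {0..1}" shows "smear l J x (\<lambda>_. c) = c"
proof -
  have "smear l J x (\<lambda>_. c) = (\<Sum>i\<in>{1..l}. alt_binom l i *\<^sub>R double_mean (\<lambda>_. c) x (real i * mesh l J) 0)"
    by (rule smear_eq[OF l]) simp
  also have "\<dots> = (\<Sum>i\<in>{1..l}. alt_binom l i) *\<^sub>R c"
    unfolding double_mean_0 by (simp add: integral_rho integrable_rho scaleR_sum_left)
  finally show ?thesis using sum_alt_binom[OF l] by simp
qed

lemma smear_close:
  assumes l: "l > 0" and x: "x \<in> {0..1}" and g: "continuous_on UNIV g"
    and h: "\<And>y. y \<in> {0..1} \<Longrightarrow> \<bar>y - x\<bar> \<le> 1 / 2 ^ J \<Longrightarrow> norm (g y - g x) \<le> B" and B: "B \<ge> 0"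
  shows "norm (smear l J x g - g x) \<le> 2 ^ l * B"
proof -
  have "smear l J x g - g x = smear l J x g - smear l J x (\<lambda>_. g x)" by (simp only: smear_const[OF l x])
  also have "\<dots> = smear l J x (\<lambda>y. g y - g x)"
    unfolding smear_def scaleR_diff_right by (rule Bochner_Integration.integral_diff[symmetric]) (intro integrable_tau l x g continuous_intros)+
  finally show ?thesis
    using smear_bound[OF l x _ h B] integrable_tau[OF l x, of "\<lambda>y. g y - g x" J] g by (simp add: continuous_intros)
qed

text \<open>The deviation is the smear in y of (smear in x minus identity), which costs 2^l * 2^l,
  plus the deviation of the smear in y alone, which costs 2^l.\<close>

lemma smear2_close:
  assumes l: "l > 0" and f: "continuous_on UNIV f" and x: "x \<in> {0..1}" and y: "y \<in> {0..1}"
    and h: "\<And>u v. u \<in> unit_square \<Longrightarrow> v \<in> unit_square \<Longrightarrow> \<bar>fst u - fst v\<bar> \<le> 1 / 2 ^ J \<Longrightarrow> \<bar>snd u - snd v\<bar> \<le> 1 / 2 ^ J \<Longrightarrow> norm (f u - f v) \<le> B" and B: "B \<ge> 0"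
  shows "norm (smear2 l J f (x, y) - f (x, y)) \<le> (2 ^ l * 2 ^ l + 2 ^ l) * B"
proof -
  have f1: "continuous_on UNIV (\<lambda>y1. f (y1, y2))" for y2
    by (intro continuous_on_compose2[OF f] continuous_intros) auto
  have f2: "continuous_on UNIV (\<lambda>y2. f (x, y2))"
    by (intro continuous_on_compose2[OF f] continuous_intros) auto
  define d where "d y2 = smear l J x (\<lambda>y1. f (y1, y2)) - f (x, y2)" for y2
  have db: "norm (d y2) \<le> 2 ^ l * B" if "y2 \<in> {0..1}" for y2
    unfolding d_def using that x by (intro smear_close[OF l x f1] h B) auto
  have int: "integrable lborel (\<lambda>y2. tau l J y y2 *\<^sub>R d y2)"
    unfolding d_def scaleR_diff_right
    by (intro Bochner_Integration.integrable_diff smear2_inner(1) integrable_tau l f x y f2)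
  have "smear2 l J f (x, y) - smear l J y (\<lambda>y2. f (x, y2)) = smear l J y d"
    unfolding smear2_def d_def smear_def[of l J y] scaleR_diff_right fst_conv snd_conv
    by (rule Bochner_Integration.integral_diff[symmetric]) (intro smear2_inner(1) integrable_tau l f x y f2)+
  moreover have "norm (smear l J y d) \<le> 2 ^ l * (2 ^ l * B)"
    using B by (intro smear_bound[OF l y int] db) auto
  moreover have "norm (smear l J y (\<lambda>y2. f (x, y2)) - f (x, y)) \<le> 2 ^ l * B"
    using x y by (intro smear_close[OF l y f2] h B) auto
  ultimately have "norm (smear2 l J f (x, y) - smear l J y (\<lambda>y2. f (x, y2))) + norm (smear l J y (\<lambda>y2. f (x, y2)) - f (x, y)) \<le> 2 ^ l * (2 ^ l * B) + 2 ^ l * B"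
    by simp
  moreover have "norm (smear2 l J f (x, y) - f (x, y)) \<le> norm (smear2 l J f (x, y) - smear l J y (\<lambda>y2. f (x, y2))) + norm (smear l J y (\<lambda>y2. f (x, y2)) - f (x, y))"
    using norm_triangle_ineq[of "smear2 l J f (x, y) - smear l J y (\<lambda>y2. f (x, y2))" "smear l J y (\<lambda>y2. f (x, y2)) - f (x, y)"] by simp
  ultimately show ?thesis by (simp add: algebra_simps)
qed

section \<open>Dyadic moduli of smoothness\<close>

text \<open>At level 0 a layer takes the function value instead of a difference, so that direction
  is absent from e.\<close>

definition active_directions :: "nat \<Rightarrow> nat \<Rightarrow> nat set" where
  "active_directions q1 q2 = (if q1 = 0 then {} else {1}) \<union> (if q2 = 0 then {} else {2})"

text \<open>The lower corner of \<open>dyadic_box\<close>, so the modulus here is a lower bound for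
  the modulus at all points of the box. It is also the range of steps granted by
  \<open>ker_region\<close>. A coordinate of level 0 runs through (1/2, 1] although its direction is
  inactive.\<close>

definition dyadic_step :: "nat \<Rightarrow> nat \<Rightarrow> real \<times> real" where
  "dyadic_step q1 q2 = (1 / 2 ^ Suc q1, 1 / 2 ^ Suc q2)"

definition dyadic_modulus :: "ennreal \<Rightarrow> nat \<Rightarrow> (real \<times> real \<Rightarrow> complex) \<Rightarrow> nat \<Rightarrow> nat \<Rightarrow> ennreal" where
  "dyadic_modulus p l f q1 q2 = mixed_modulus p l (active_directions q1 q2) f (dyadic_step q1 q2)"

definition dyadic_box :: "nat \<Rightarrow> nat \<Rightarrow> (real \<times> real) set" where
  "dyadic_box q1 q2 = {1 / 2 ^ Suc q1<..1 / 2 ^ q1} \<times> {1 / 2 ^ Suc q2<..1 / 2 ^ q2}"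

lemma active_directions_Pow: "active_directions q1 q2 \<in> Pow {1, 2}"
  by (auto simp: active_directions_def)

lemma mixed_modulus_mono:
  "(\<And>i. i \<in> e \<Longrightarrow> coord i t \<le> coord i t') \<Longrightarrow> mixed_modulus p l e f t \<le> mixed_modulus p l e f t'"
  unfolding mixed_modulus_def by (rule SUP_subset_mono) (auto intro: less_le_trans)

lemma epowr_mono: "0 \<le> r \<Longrightarrow> x \<le> y \<Longrightarrow> epowr x r \<le> epowr y r"
  unfolding epowr_def by (auto simp: top_unique intro!: ennreal_leI powr_mono2 enn2real_mono simp: less_top)

lemma epowr_ennreal: "x \<ge> 0 \<Longrightarrow> epowr (ennreal x) r = ennreal (x powr r)"
  by (simp add: epowr_def)

lemma epowr_le_one_iff:
  assumes "r > 0" shows "epowr x r \<le> 1 \<longleftrightarrow> x \<le> 1"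
proof (cases "x = \<infinity>")
  case True then show ?thesis by (simp add: epowr_def)
next
  case False
  then obtain y where y: "x = ennreal y" "y \<ge> 0" by (cases x) auto
  have "y powr r \<le> 1 \<longleftrightarrow> y \<le> 1"
  proof (cases "y \<le> 1")
    case True
    then show ?thesis using powr_mono2[of r y 1] y assms by simp
  next
    case False
    then have "1 powr r < y powr r" using assms by (intro powr_less_mono2) auto
    then show ?thesis using False by simp
  qed
  then show ?thesis using y by (simp add: epowr_ennreal)
qed

lemma dyadic_box_disjoint:
  assumes "t \<in> dyadic_box q1 q2" "t \<in> dyadic_box q1' q2'"
  shows "q1 = q1'" "q2 = q2'"
proof -
  have gen: "\<not> q < q'" if "x \<in> {1 / 2 ^ Suc q<..1 / 2 ^ q}" "x \<in> {1 / 2 ^ Suc q'<..1 / 2 ^ q'}" for q q' and x :: real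
  proof
    assume "q < q'"
    then have "(2::real) ^ Suc q \<le> 2 ^ q'" by (intro power_increasing) auto
    then have "1 / 2 ^ q' \<le> 1 / (2::real) ^ Suc q" by (intro divide_left_mono) auto
    then show False using that by (meson greaterThanAtMost_iff leD le_less_trans order_trans)
  qed
  show "q1 = q1'" using gen[of "fst t" q1 q1'] gen[of "fst t" q1' q1] assms unfolding dyadic_box_def
    by (metis mem_Times_iff nat_neq_iff)
  show "q2 = q2'" using gen[of "snd t" q2 q2'] gen[of "snd t" q2' q2] assms unfolding dyadic_box_def
    by (metis mem_Times_iff nat_neq_iff)
qed

lemma dyadic_box_subset: "dyadic_box q1 q2 \<subseteq> unit_square"
proof
  have gen: "0 \<le> x \<and> x \<le> 1" if "1 / 2 ^ Suc q < x" "x \<le> 1 / 2 ^ q" for q and x :: real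
  proof
    have "0 \<le> 1 / (2::real) ^ Suc q" by simp
    then show "0 \<le> x" using that(1) by linarith
    have "1 / 2 ^ q \<le> (1::real)" by simp
    then show "x \<le> 1" using that(2) by linarith
  qed
  fix t assume "t \<in> dyadic_box q1 q2"
  then show "t \<in> unit_square" using gen[of q1 "fst t"] gen[of q2 "snd t"] unfolding dyadic_box_def by (cases t) auto
qed

lemma emeasure_dyadic_box:
  "dyadic_box q1 q2 \<in> sets (lebesgue_on unit_square)"
  "emeasure (lebesgue_on unit_square) (dyadic_box q1 q2) = ennreal (1 / (4 * 2 ^ (q1 + q2)))"
proof -
  have b: "dyadic_box q1 q2 \<in> sets borel" unfolding dyadic_box_def by (intro borel_Times) auto
  then have L: "dyadic_box q1 q2 \<in> sets lebesgue" by (simp add: sets_completionI_sets)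
  have U: "unit_square \<in> sets lebesgue" by (intro sets_completionI_sets) (auto intro!: borel_Times simp: sets_lborel)
  show "dyadic_box q1 q2 \<in> sets (lebesgue_on unit_square)"
    using L U dyadic_box_subset by (simp add: sets_restrict_space_iff)
  have "emeasure (lebesgue_on unit_square) (dyadic_box q1 q2) = emeasure lborel (dyadic_box q1 q2)"
    using U dyadic_box_subset b by (subst emeasure_restrict_space) auto
  also have "\<dots> = emeasure (lborel \<Otimes>\<^sub>M lborel) (dyadic_box q1 q2)" by (simp add: lborel_prod)
  also have "\<dots> = emeasure lborel {1 / 2 ^ Suc q1<..1 / (2::real) ^ q1} * emeasure lborel {1 / 2 ^ Suc q2<..1 / (2::real) ^ q2}"
    unfolding dyadic_box_def by (rule lborel.emeasure_pair_measure_Times) auto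
  also have "\<dots> = ennreal (1 / 2 ^ Suc q1) * ennreal (1 / 2 ^ Suc q2)"
  proof -
    have "emeasure lborel {1 / 2 ^ Suc q<..1 / (2::real) ^ q} = ennreal (1 / 2 ^ Suc q)" for q
    proof -
      have le: "1 / 2 ^ Suc q \<le> 1 / (2::real) ^ q" by (auto simp: field_simps)
      have "1 / (2::real) ^ q - 1 / 2 ^ Suc q = 1 / 2 ^ Suc q" by (auto simp: field_simps)
      then show ?thesis unfolding emeasure_lborel_Ioc[OF le] by (rule arg_cong)
    qed
    then show ?thesis by (simp only:)
  qed
  also have "\<dots> = ennreal (1 / (4 * 2 ^ (q1 + q2)))"
    by (simp add: ennreal_mult[symmetric] power_add mult_ac)
  finally show "emeasure (lebesgue_on unit_square) (dyadic_box q1 q2) = ennreal (1 / (4 * 2 ^ (q1 + q2)))" .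
qed

lemma prod_active_directions: "(\<Prod>i\<in>active_directions q1 q2. F i) = (if q1 = 0 then 1 else F 1) * (if q2 = 0 then 1 else (F 2 :: real))"
  by (simp add: active_directions_def)

lemma besov_seminorm_le_norm: "besov_seminorm \<alpha> p \<theta> l (active_directions q1 q2) f \<le> besov_norm \<alpha> p \<theta> l f"
  unfolding besov_norm_def by (rule member_le_sum) (use active_directions_Pow in auto)

text \<open>Hoelder's inequality through a pointwise splitting at the threshold d = (m+1)^(-1/r),
  the common size of the terms when all are equal and their r-th powers add up to 1. Both resulting
  summands are then of order (m+1)^(1-1/r).\<close>

lemma sum_powr_mean:
  fixes a :: "nat \<Rightarrow> real"
  assumes r: "r \<ge> 1" and a: "\<And>i. a i \<ge> 0" and S: "(\<Sum>i\<le>m. a i powr r) \<le> S" and S0: "S \<ge> 0"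
  shows "(\<Sum>i\<le>m. a i) \<le> (S + 1) * (real m + 1) powr (1 - 1 / r)"
proof -
  define d where "d = (real m + 1) powr (- 1 / r)"
  have l0: "d > 0" by (simp add: d_def)
  have "a i \<le> d powr (1 - r) * a i powr r + d" for i
  proof (cases "a i \<le> d")
    case True then show ?thesis by (simp add: add_increasing)
  next
    case False
    then have ai: "a i > 0" using l0 by linarith
    have "1 * a i \<le> (d powr (1 - r) * a i powr (r - 1)) * a i"
    proof (rule mult_right_mono)
      have "1 = d powr (1 - r) * d powr (r - 1)" using l0 by (simp flip: powr_add)
      also have "\<dots> \<le> d powr (1 - r) * a i powr (r - 1)" using False l0 r by (intro mult_left_mono powr_mono2) auto
      finally show "1 \<le> d powr (1 - r) * a i powr (r - 1)" .
    qed (use ai in simp)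
    also have "\<dots> = d powr (1 - r) * a i powr r"
    proof -
      have "a i powr r = a i powr (r - 1) * a i powr 1" by (simp only: powr_add[symmetric]) simp
      then show ?thesis using ai by simp
    qed
    finally show ?thesis using l0 by simp
  qed
  then have "(\<Sum>i\<le>m. a i) \<le> (\<Sum>i\<le>m. d powr (1 - r) * a i powr r + d)" by (intro sum_mono) auto
  also have "\<dots> = d powr (1 - r) * (\<Sum>i\<le>m. a i powr r) + (real m + 1) * d"
    by (simp add: sum.distrib sum_distrib_left)
  also have "\<dots> \<le> d powr (1 - r) * S + (real m + 1) * d" using S by (intro add_mono mult_left_mono) auto
  also have "d powr (1 - r) = (real m + 1) powr (1 - 1 / r)"
    unfolding d_def powr_powr using r by (intro arg_cong2[where f = "(powr)"]) (auto simp: field_simps)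
  also have "(real m + 1) * d = (real m + 1) powr (1 - 1 / r)"
  proof -
    have "(real m + 1) * d = (real m + 1) powr 1 * (real m + 1) powr (- 1 / r)" by (simp add: d_def)
    also have "\<dots> = (real m + 1) powr (1 - 1 / r)" by (simp only: powr_add[symmetric]) simp
    finally show ?thesis .
  qed
  finally show ?thesis by (simp add: algebra_simps)
qed

text \<open>The supremum in the seminorm is tested at the single point
  \<open>dyadic_step q1 q2\<close>, where the weights are even larger than needed.\<close>

lemma besov_dyadic_infinite:
  assumes "besov_norm \<alpha> p \<infinity> l f \<le> 1" and \<alpha>: "\<alpha> > 0"
  shows "ennreal (2 powr (\<alpha> * real (q1 + q2))) * dyadic_modulus p l f q1 q2 \<le> 1"
proof -
  let ?t = "dyadic_step q1 q2"
  have tu: "?t \<in> unit_square"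
  proof -
    have "1 / (2::real) ^ Suc q \<le> 1" for q by (simp add: divide_le_eq del: power_Suc)
    then show ?thesis by (simp add: dyadic_step_def del: power_Suc)
  qed
  have pw: "2 powr (\<alpha> * real q) \<le> (1 / 2 ^ Suc q) powr - \<alpha>" for q
  proof -
    have "2 powr (\<alpha> * real q) \<le> 2 powr (\<alpha> * real (Suc q))" using \<alpha> by (intro powr_mono) auto
    also have "\<dots> = (2 ^ Suc q) powr \<alpha>" unfolding two_power_powr powr_powr by (simp add: mult.commute)
    also have "\<dots> = (1 / 2 ^ Suc q) powr - \<alpha>" by (simp add: powr_divide powr_minus_divide del: power_Suc)
    finally show ?thesis .
  qed
  have le: "2 powr (\<alpha> * real (q1 + q2)) \<le> (\<Prod>i\<in>active_directions q1 q2. coord i ?t powr - \<alpha>)"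
  proof -
    have "2 powr (\<alpha> * real (q1 + q2)) = 2 powr (\<alpha> * real q1) * 2 powr (\<alpha> * real q2)"
      by (simp add: distrib_left flip: powr_add)
    also have "\<dots> \<le> (if q1 = 0 then 1 else coord 1 ?t powr - \<alpha>) * (if q2 = 0 then 1 else coord 2 ?t powr - \<alpha>)"
      using pw[of q1] pw[of q2] by (intro mult_mono) (auto simp: coord_def dyadic_step_def)
    finally show ?thesis by (simp add: prod_active_directions)
  qed
  have "ennreal (2 powr (\<alpha> * real (q1 + q2))) * dyadic_modulus p l f q1 q2
     \<le> ennreal (\<Prod>i\<in>active_directions q1 q2. coord i ?t powr - \<alpha>) * mixed_modulus p l (active_directions q1 q2) f ?t"
    unfolding dyadic_modulus_def using le by (intro mult_right_mono ennreal_leI) auto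
  also have "\<dots> \<le> besov_seminorm \<alpha> p \<infinity> l (active_directions q1 q2) f"
    unfolding besov_seminorm_def using tu by (auto intro!: SUP_upper2[of ?t])
  also have "\<dots> \<le> 1" using besov_seminorm_le_norm assms(1) order_trans by blast
  finally show ?thesis .
qed

text \<open>The boxes with q1 + q2 = m are disjoint and have measure 2^-m/4. On each of them the
  integrand of the seminorm is at least 2^m times the corresponding term, so a seminorm of at most 1
  leaves at most 4 for the sum. The terms are grouped by e because every e has its own
  seminorm.\<close>

lemma besov_dyadic_finite:
  assumes norm: "besov_norm \<alpha> p \<theta> l f \<le> 1" and \<alpha>: "\<alpha> > 0" and \<theta>: "\<theta> \<noteq> \<infinity>" "1 \<le> \<theta>"
  shows "(\<Sum>q\<in>{q\<in>{..m}. active_directions q (m - q) = e}. epowr (ennreal (2 powr (\<alpha> * real m)) * dyadic_modulus p l f q (m - q)) (enn2real \<theta>)) \<le> 4"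
proof (cases "{q\<in>{..m}. active_directions q (m - q) = e} = {}")
  case True
  then show ?thesis by (simp only: sum.empty) simp
next
  case False
  then have e: "e \<in> range (\<lambda>(a, b). active_directions a b)" by auto
  define r where "r = enn2real \<theta>"
  have r: "r \<ge> 1" using \<theta> unfolding r_def by (cases \<theta>) (auto simp: ennreal_le_iff2 simp flip: ennreal_1)
  define Q where "Q = {q\<in>{..m}. active_directions q (m - q) = e}"
  have fQ: "finite Q" by (simp add: Q_def)
  define X where "X q = epowr (ennreal (2 powr (\<alpha> * real m)) * dyadic_modulus p l f q (m - q)) r" for q
  define F where "F t = epowr (ennreal (\<Prod>i\<in>e. coord i t powr (- \<alpha>)) * mixed_modulus p l e f t) r * ennreal (\<Prod>i\<in>e. 1 / coord i t)" for t
  have "besov_seminorm \<alpha> p \<theta> l e f \<le> 1"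
    using e besov_seminorm_le_norm norm order_trans by (auto) blast
  then have "epowr (\<integral>\<^sup>+ t. F t \<partial>lebesgue_on unit_square) (1 / r) \<le> 1"
    using \<theta>(1) by (simp add: besov_seminorm_def F_def r_def)
  then have F1: "(\<integral>\<^sup>+ t. F t \<partial>lebesgue_on unit_square) \<le> 1"
    using r epowr_le_one_iff[of "1 / r"] by simp
  \<comment> \<open>The weight 1/t_i of the logarithmic measure supplies 2^m, the weight
    t_i^-\<alpha> supplies 2^(\<alpha> m), and the modulus is monotone in t.\<close>
  have low: "X q * ennreal (2 ^ m) \<le> F t" if q: "q \<in> Q" and t: "t \<in> dyadic_box q (m - q)" for q t
  proof -
    have eq: "e = active_directions q (m - q)" and qm: "q \<le> m" using q by (auto simp: Q_def)
    have t1: "1 / 2 ^ Suc q < fst t" "fst t \<le> 1 / 2 ^ q" and t2: "1 / 2 ^ Suc (m - q) < snd t" "snd t \<le> 1 / 2 ^ (m - q)"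
      using t by (auto simp: dyadic_box_def simp del: power_Suc)
    have one: "2 powr (\<alpha> * real k) \<le> s powr - \<alpha> \<and> 2 ^ k \<le> 1 / s" if "1 / 2 ^ Suc k < s" "s \<le> 1 / 2 ^ k" for k s
    proof -
      have s: "s > 0" using that(1) by (rule le_less_trans[rotated]) simp
      have "2 ^ k \<le> 1 / s" using that(2) s by (simp add: field_simps)
      moreover have "(2 ^ k) powr \<alpha> \<le> (1 / s) powr \<alpha>" using \<alpha> calculation by (intro powr_mono2) auto
      moreover have "(1 / s) powr \<alpha> = s powr - \<alpha>" using s by (simp add: powr_divide powr_minus_divide)
      moreover have "(2 ^ k) powr \<alpha> = 2 powr (\<alpha> * real k)" unfolding two_power_powr powr_powr by (simp add: mult.commute)
      ultimately show ?thesis by simp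
    qed
    note o1 = one[OF t1] and o2 = one[OF t2]
    have t0: "fst t > 0" "snd t > 0"
      by (rule le_less_trans[OF _ t1(1)], simp) (rule le_less_trans[OF _ t2(1)], simp)
    have A: "2 powr (\<alpha> * real m) \<le> (\<Prod>i\<in>e. coord i t powr (- \<alpha>))"
    proof -
      have "2 powr (\<alpha> * real m) = 2 powr (\<alpha> * real q) * 2 powr (\<alpha> * real (m - q))"
        using qm by (simp add: distrib_left of_nat_diff algebra_simps flip: powr_add)
      also have "\<dots> \<le> (if q = 0 then 1 else coord 1 t powr - \<alpha>) * (if m - q = 0 then 1 else coord 2 t powr - \<alpha>)"
        using o1 o2 by (intro mult_mono) (auto simp: coord_def)
      finally show ?thesis unfolding eq by (simp add: prod_active_directions)
    qed
    have B: "2 ^ m \<le> (\<Prod>i\<in>e. 1 / coord i t)"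
    proof -
      have "(2::real) ^ m = 2 ^ q * 2 ^ (m - q)" using qm by (simp flip: power_add)
      also have "\<dots> \<le> (if q = 0 then 1 else 1 / coord 1 t) * (if m - q = 0 then 1 else 1 / coord 2 t)"
      proof (intro mult_mono)
        show "2 ^ q \<le> (if q = 0 then 1 else 1 / coord 1 t)" using o1 by (auto simp: coord_def)
        show "2 ^ (m - q) \<le> (if m - q = 0 then 1 else 1 / coord 2 t)" using o2 by (auto simp: coord_def)
        show "0 \<le> (if q = 0 then 1 else 1 / coord 1 t)" using t0 by (auto simp: coord_def)
      qed auto
      finally show ?thesis unfolding eq by (simp add: prod_active_directions)
    qed
    have M: "dyadic_modulus p l f q (m - q) \<le> mixed_modulus p l e f t"
      unfolding dyadic_modulus_def eq using t1 t2
      by (intro mixed_modulus_mono) (auto simp: active_directions_def coord_def dyadic_step_def less_imp_le split: if_splits simp del: power_Suc)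
    show ?thesis unfolding X_def F_def
      using A B M r by (intro mult_mono epowr_mono ennreal_leI) auto
  qed
  have "(\<Sum>q\<in>Q. X q * ennreal (2 ^ m) * emeasure (lebesgue_on unit_square) (dyadic_box q (m - q)))
     = (\<integral>\<^sup>+ t. (\<Sum>q\<in>Q. X q * ennreal (2 ^ m) * indicator (dyadic_box q (m - q)) t) \<partial>lebesgue_on unit_square)"
    using emeasure_dyadic_box(1) by (subst nn_integral_sum) (auto simp: nn_integral_cmult_indicator)
  also have "\<dots> \<le> (\<integral>\<^sup>+ t. F t \<partial>lebesgue_on unit_square)"
  proof (rule nn_integral_mono)
    fix t
    show "(\<Sum>q\<in>Q. X q * ennreal (2 ^ m) * indicator (dyadic_box q (m - q)) t) \<le> F t"
    proof (cases "\<exists>q\<in>Q. t \<in> dyadic_box q (m - q)")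
      case True
      then obtain q where q: "q \<in> Q" "t \<in> dyadic_box q (m - q)" by blast
      have "(\<Sum>q\<in>Q. X q * ennreal (2 ^ m) * indicator (dyadic_box q (m - q)) t) = (\<Sum>q'\<in>{q}. X q' * ennreal (2 ^ m) * indicator (dyadic_box q' (m - q')) t)"
      proof (rule sum.mono_neutral_right[OF fQ])
        have "t \<notin> dyadic_box q' (m - q')" if "q' \<in> Q - {q}" for q'
          using dyadic_box_disjoint(1)[OF q(2)] that by blast
        then show "\<forall>q'\<in>Q - {q}. X q' * ennreal (2 ^ m) * indicator (dyadic_box q' (m - q')) t = 0" by simp
      qed (use q in simp)
      then show ?thesis using low[OF q] q by simp
    qed (auto simp: indicator_def)
  qed
  also have "\<dots> \<le> 1" by (rule F1)
  finally have "(\<Sum>q\<in>Q. X q * ennreal (2 ^ m) * ennreal (1 / (4 * 2 ^ m))) \<le> 1"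
    using emeasure_dyadic_box(2) by (simp add: Q_def)
  moreover have "X q * ennreal (2 ^ m) * ennreal (1 / (4 * 2 ^ m)) = ennreal (1 / 4) * X q" for q
    by (simp add: mult.assoc ennreal_mult[symmetric] mult.commute)
  ultimately have "ennreal (1 / 4) * (\<Sum>q\<in>Q. X q) \<le> 1" by (simp add: sum_distrib_left)
  then have "ennreal 4 * (ennreal (1 / 4) * (\<Sum>q\<in>Q. X q)) \<le> ennreal 4 * 1" by (intro mult_left_mono) auto
  moreover have "ennreal 4 * ennreal (1 / 4) = 1"
  proof -
    have "ennreal 4 * ennreal (1 / 4) = ennreal (4 * (1 / 4))" by (rule ennreal_mult[symmetric]) auto
    then show ?thesis by simp
  qed
  ultimately have "(\<Sum>q\<in>Q. X q) \<le> ennreal 4" by (simp only: mult.assoc[symmetric] mult_1_left mult_1_right)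
  then have "(\<Sum>q\<in>Q. X q) \<le> 4" by simp
  then show ?thesis by (simp add: X_def[abs_def] Q_def r_def)
qed

text \<open>For finite \<theta>, the four sets e contribute at most 4 each to the sum of the
  \<theta>-th powers; \<open>sum_powr_mean\<close> with S = 16 then gives the constant 17. For
  infinite \<theta>, each of the m + 1 normalised terms is at most 1.\<close>

lemma besov_dyadic_sum:
  assumes norm: "besov_norm \<alpha> p \<theta> l f \<le> 1" and \<alpha>: "\<alpha> > 0" and \<theta>: "1 \<le> \<theta>"
  shows "dyadic_modulus p l f q1 q2 < \<infinity>"
    and "(\<Sum>q\<le>m. enn2real (dyadic_modulus p l f q (m - q)))
      \<le> 17 * 2 powr (- \<alpha> * real m) * (real m + 1) powr max (1 - enn2real (1 / \<theta>)) 0"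
proof -
  let ?M = "dyadic_modulus p l f"
  have "(\<forall>q1 q2. ?M q1 q2 < \<infinity>) \<and> (\<Sum>q\<le>m. 2 powr (\<alpha> * real m) * enn2real (?M q (m - q))) \<le> 17 * (real m + 1) powr max (1 - enn2real (1 / \<theta>)) 0"
  proof (cases "\<theta> = \<infinity>")
    case True
    have le: "ennreal (2 powr (\<alpha> * real (q1 + q2))) * ?M q1 q2 \<le> 1" for q1 q2
      using besov_dyadic_infinite[OF _ \<alpha>] norm True by blast
    have fin: "?M q1 q2 < \<infinity>" for q1 q2
    proof (rule ccontr)
      assume "\<not> ?thesis"
      then have "?M q1 q2 = \<infinity>" by (simp add: not_less top_unique)
      then show False using le[of q1 q2] by (simp add: ennreal_mult_top top_unique)
    qed
    have "(\<Sum>q\<le>m. 2 powr (\<alpha> * real m) * enn2real (?M q (m - q))) \<le> (\<Sum>q\<le>m. 1)"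
    proof (rule sum_mono)
      fix q assume q: "q \<in> {..m}"
      obtain x where x: "?M q (m - q) = ennreal x" "x \<ge> 0" using fin[of q "m - q"] by (cases "?M q (m - q)") auto
      have "ennreal (2 powr (\<alpha> * real m) * x) \<le> ennreal 1"
        using le[of q "m - q"] q x by (simp add: ennreal_mult)
      then have "2 powr (\<alpha> * real m) * x \<le> 1" by (subst (asm) ennreal_le_iff) auto
      then show "2 powr (\<alpha> * real m) * enn2real (?M q (m - q)) \<le> 1" using x by simp
    qed
    then show ?thesis using fin True by simp
  next
    case False
    define r where "r = enn2real \<theta>"
    have \<theta>r: "\<theta> = ennreal r" using False by (simp add: r_def less_top)
    have r: "r \<ge> 1" using \<theta> False unfolding r_def by (cases \<theta>) (auto simp: ennreal_le_iff2 simp flip: ennreal_1)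
    have bd: "(\<Sum>q\<in>{q\<in>{..m}. active_directions q (m - q) = e}. epowr (ennreal (2 powr (\<alpha> * real m)) * ?M q (m - q)) r) \<le> 4" for m e
      unfolding r_def by (rule besov_dyadic_finite[OF norm \<alpha> False \<theta>])
    have fin: "?M q1 q2 < \<infinity>" for q1 q2
    proof (rule ccontr)
      assume "\<not> ?thesis"
      then have "?M q1 q2 = \<infinity>" by (simp add: not_less top_unique)
      then have inf: "epowr (ennreal (2 powr (\<alpha> * real (q1 + q2))) * ?M q1 (q1 + q2 - q1)) r = \<infinity>"
        by (simp add: epowr_def ennreal_mult_top)
      have "epowr (ennreal (2 powr (\<alpha> * real (q1 + q2))) * ?M q1 (q1 + q2 - q1)) r
        \<le> (\<Sum>q\<in>{q\<in>{..q1 + q2}. active_directions q (q1 + q2 - q) = active_directions q1 (q1 + q2 - q1)}. epowr (ennreal (2 powr (\<alpha> * real (q1 + q2))) * ?M q (q1 + q2 - q)) r)"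
        by (rule member_le_sum) auto
      also have "\<dots> \<le> 4" by (rule bd)
      finally show False using inf by (simp add: top_unique)
    qed
    define a where "a q = 2 powr (\<alpha> * real m) * enn2real (?M q (m - q))" for q
    have a0: "a q \<ge> 0" for q by (simp add: a_def)
    have X: "epowr (ennreal (2 powr (\<alpha> * real m)) * ?M q (m - q)) r = ennreal (a q powr r)" for q
    proof -
      have "ennreal (2 powr (\<alpha> * real m)) * ?M q (m - q) = ennreal (a q)"
        using fin[of q "m - q"] by (simp add: a_def ennreal_mult)
      then show ?thesis using a0 by (simp add: epowr_ennreal)
    qed
    have "(\<Sum>q\<le>m. a q powr r) = (\<Sum>e\<in>Pow {1, 2}. \<Sum>q\<in>{q\<in>{..m}. active_directions q (m - q) = e}. a q powr r)"
      by (rule sum.group[symmetric]) (use active_directions_Pow in auto)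
    also have "\<dots> \<le> (\<Sum>e\<in>Pow {1, 2 :: nat}. 4)"
    proof (rule sum_mono)
      fix e
      have "ennreal (\<Sum>q\<in>{q\<in>{..m}. active_directions q (m - q) = e}. a q powr r) \<le> ennreal 4"
        using bd[where m = m and e = e] unfolding X by (simp add: sum_ennreal)
      then show "(\<Sum>q\<in>{q\<in>{..m}. active_directions q (m - q) = e}. a q powr r) \<le> 4" by (subst (asm) ennreal_le_iff) auto
    qed
    also have "\<dots> = 16" by (simp add: card_Pow)
    finally have "(\<Sum>q\<le>m. a q) \<le> (16 + 1) * (real m + 1) powr (1 - 1 / r)"
      by (intro sum_powr_mean r a0) auto
    moreover have "max (1 - enn2real (1 / \<theta>)) 0 = 1 - 1 / r"
    proof -
      have "1 / \<theta> = ennreal (1 / r)" using r by (simp add: \<theta>r divide_ennreal[of 1 r, simplified])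
      then show ?thesis using r by simp
    qed
    ultimately show ?thesis using fin by (simp add: a_def)
  qed
  then have fin: "?M q1 q2 < \<infinity>" and
    S: "(\<Sum>q\<le>m. 2 powr (\<alpha> * real m) * enn2real (?M q (m - q))) \<le> 17 * (real m + 1) powr max (1 - enn2real (1 / \<theta>)) 0" for q1 q2
    by auto
  show "?M q1 q2 < \<infinity>" by (rule fin)
  have "2 powr (- \<alpha> * real m) * (\<Sum>q\<le>m. 2 powr (\<alpha> * real m) * enn2real (?M q (m - q))) = (\<Sum>q\<le>m. enn2real (?M q (m - q)))"
    by (simp add: powr_minus flip: sum_distrib_left)
  then show "(\<Sum>q\<le>m. enn2real (?M q (m - q))) \<le> 17 * 2 powr (- \<alpha> * real m) * (real m + 1) powr max (1 - enn2real (1 / \<theta>)) 0"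
    using mult_left_mono[OF S, of "2 powr (- \<alpha> * real m)"] by (simp add: mult_ac)
qed

section \<open>The cubature error of a layer\<close>

definition node_x :: "nat \<Rightarrow> nat \<Rightarrow> real" where
  "node_x n \<mu> = real \<mu> / real (fib (Suc n))"

definition node_y :: "nat \<Rightarrow> nat \<Rightarrow> real" where
  "node_y n \<mu> = real ((fib n * \<mu>) mod fib (Suc n)) / real (fib (Suc n))"

lemma fib_Suc_pos: "fib (Suc n) > 0"
  by (simp add: fib_neq_0_nat)

lemma node_x_node_y_in: "\<mu> < fib (Suc n) \<Longrightarrow> node_x n \<mu> \<in> {0..1}" "node_y n \<mu> \<in> {0..1}"
  using fib_Suc_pos[of n] by (auto simp: node_x_def node_y_def divide_le_eq less_imp_le)

lemma sum_fib_lattice: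
  "sum F (fib_lattice n) = (\<Sum>\<mu><fib (Suc n). F (node_x n \<mu>, node_y n \<mu>))"
proof -
  have b: "fib_b n = fib (Suc n)" by (simp add: fib_b_def)
  have pt: "(real \<mu> / real (fib_b n), frac (real \<mu> * (real (fib_b (n - 1)) / real (fib_b n)))) = (node_x n \<mu>, node_y n \<mu>)"
    if "\<mu> < fib (Suc n)" for \<mu>
  proof (cases n)
    \<comment> \<open>Here \<open>fib_b (n - 1)\<close> is fib 1 whereas \<open>node_y\<close> uses
      fib 0; the only index is 0, where both give 0.\<close>
    case 0
    then show ?thesis using that by (simp add: node_x_def node_y_def fib_b_def)
  next
    case (Suc k)
    have a: "fib_b (n - 1) = fib n" by (simp add: fib_b_def Suc)
    have "frac (real \<mu> * (real (fib n) / real (fib (Suc n)))) = node_y n \<mu>"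
    proof -
      define m where "m = fib (Suc n)"
      have m: "m > 0" unfolding m_def by (rule fib_Suc_pos)
      have "real (fib n * \<mu>) = real m * real ((fib n * \<mu>) div m) + real ((fib n * \<mu>) mod m)"
        by (metis mult_div_mod_eq of_nat_add of_nat_mult)
      then have "real (fib n * \<mu>) / real m = of_int (int ((fib n * \<mu>) div m)) + real ((fib n * \<mu>) mod m) / real m"
        using m by (simp add: field_simps)
      moreover have "0 \<le> real ((fib n * \<mu>) mod m) / real m" "real ((fib n * \<mu>) mod m) / real m < 1"
        using m by auto
      ultimately have "frac (real (fib n * \<mu>) / real m) = real ((fib n * \<mu>) mod m) / real m"
        by (subst frac_unique_iff) auto
      then show ?thesis by (simp add: node_y_def m_def mult.commute)
    qed
    then show ?thesis unfolding a b by (simp add: node_x_def)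
  qed
  have img: "fib_lattice n = (\<lambda>\<mu>. (node_x n \<mu>, node_y n \<mu>)) ` {..<fib (Suc n)}"
    unfolding fib_lattice_def b atLeast0LessThan by (rule image_cong[OF refl]) (use pt b in simp)
  have inj: "inj_on (\<lambda>\<mu>. (node_x n \<mu>, node_y n \<mu>)) {..<fib (Suc n)}"
    using fib_Suc_pos[of n] by (auto simp: inj_on_def node_x_def)
  show ?thesis unfolding img by (subst sum.reindex[OF inj]) simp
qed

lemma sum_real_lessThan: "(\<Sum>\<mu><b. real \<mu>) = real b * (real b - 1) / 2"
  by (induction b) (auto simp: field_simps)

lemma sum_node_x: "(\<Sum>\<mu><fib (Suc n). node_x n \<mu>) = (real (fib (Suc n)) - 1) / 2"
  using fib_Suc_pos[of n] by (simp add: node_x_def sum_real_lessThan flip: sum_divide_distrib)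

text \<open>Consecutive Fibonacci numbers are coprime, so multiplication by F_n permutes the
  residues and the second coordinates are those of the uniform grid.\<close>

lemma sum_node_y: "(\<Sum>\<mu><fib (Suc n). node_y n \<mu>) = (real (fib (Suc n)) - 1) / 2"
proof -
  define b where "b = fib (Suc n)"
  have b: "b > 0" unfolding b_def by (rule fib_Suc_pos)
  have cop: "coprime (fib n) b" unfolding b_def by (rule coprime_fib_Suc_nat)
  have inj: "inj_on (\<lambda>\<mu>. (fib n * \<mu>) mod b) {..<b}"
  proof (rule inj_onI)
    fix x y assume xy: "x \<in> {..<b}" "y \<in> {..<b}" "(fib n * x) mod b = (fib n * y) mod b"
    then have "int (fib n * x) mod int b = int (fib n * y) mod int b" by (metis zmod_int)
    then have "int b dvd int (fib n) * (int x - int y)" by (simp add: mod_eq_dvd_iff right_diff_distrib)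
    moreover have "coprime (int b) (int (fib n))" using cop by (simp add: coprime_commute)
    ultimately have "int b dvd int x - int y" using coprime_dvd_mult_right_iff by blast
    then have "int x mod int b = int y mod int b" by (simp add: mod_eq_dvd_iff)
    then show "x = y" using xy by simp
  qed
  have im: "(\<lambda>\<mu>. (fib n * \<mu>) mod b) ` {..<b} = {..<b}"
    by (rule endo_inj_surj[OF _ _ inj]) (use b in auto)
  have "(\<Sum>\<mu><b. real ((fib n * \<mu>) mod b)) = (\<Sum>\<nu>\<in>(\<lambda>\<mu>. (fib n * \<mu>) mod b) ` {..<b}. real \<nu>)"
    by (simp add: sum.reindex[OF inj])
  also have "\<dots> = real b * (real b - 1) / 2" unfolding im by (rule sum_real_lessThan)
  finally show ?thesis using b by (simp add: node_y_def b_def flip: sum_divide_distrib)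
qed

section \<open>The cubature formula as a lattice rule, and the error of a layer as an
  integral\<close>

definition periodize2 :: "(real \<times> real \<Rightarrow> complex) \<Rightarrow> real \<Rightarrow> real \<Rightarrow> complex" where
  "periodize2 f x y = f (x, y) + (y - 1 / 2) *\<^sub>R (f (x, 0) - f (x, 1)) + (x - 1 / 2) *\<^sub>R (f (0, y) - f (1, y))
     + ((x - 1 / 2) * (y - 1 / 2)) *\<^sub>R (f (0, 0) - f (1, 0) + f (1, 1) - f (0, 1))"

text \<open>The point is the coefficient of the corner term: since both coordinates have mean
  (b-1)/(2b) over the nodes, 1/(2b) - 1/4 plus the mean of x y is the mean of (x - 1/2)(y -
  1/2).\<close>

lemma fib_cubature_eq:
  "fib_cubature n f = (\<Sum>\<mu><fib (Suc n). periodize2 f (node_x n \<mu>) (node_y n \<mu>)) /\<^sub>R real (fib (Suc n))"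
proof -
  define b where "b = real (fib (Suc n))"
  have b: "b > 0" unfolding b_def using fib_Suc_pos[of n] by simp
  let ?S = "\<lambda>F. \<Sum>\<mu><fib (Suc n). F (node_x n \<mu>) (node_y n \<mu>)"
  have fb: "real (fib_b n) = b" by (simp add: fib_b_def b_def)
  have co: "1 / (2 * b) - 1 / 4 + 1 / b * (\<Sum>\<mu><fib (Suc n). node_x n \<mu> * node_y n \<mu>) = (\<Sum>\<mu><fib (Suc n). (node_x n \<mu> - 1 / 2) * (node_y n \<mu> - 1 / 2)) / b"
  proof -
    have "(\<Sum>\<mu><fib (Suc n). (node_x n \<mu> - 1 / 2) * (node_y n \<mu> - 1 / 2))
      = (\<Sum>\<mu><fib (Suc n). node_x n \<mu> * node_y n \<mu> - node_x n \<mu> / 2 - node_y n \<mu> / 2 + 1 / 4)"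
      by (intro sum.cong refl) (simp add: algebra_simps add_divide_distrib)
    also have "\<dots> = (\<Sum>\<mu><fib (Suc n). node_x n \<mu> * node_y n \<mu>) - (b - 1) / 2 / 2 - (b - 1) / 2 / 2 + b / 4"
      by (simp only: sum.distrib sum_subtractf sum_divide_distrib[symmetric] sum_node_x sum_node_y b_def[symmetric]) (simp add: b_def)
    finally have S: "(\<Sum>\<mu><fib (Suc n). (node_x n \<mu> - 1 / 2) * (node_y n \<mu> - 1 / 2)) = (\<Sum>\<mu><fib (Suc n). node_x n \<mu> * node_y n \<mu>) - (b - 1) / 2 / 2 - (b - 1) / 2 / 2 + b / 4" .
    have "1 / (2 * b) - 1 / 4 + 1 / b * t = (t - (b - 1) / 2 / 2 - (b - 1) / 2 / 2 + b / 4) / b" for t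
      using b by (simp add: field_simps)
    then show ?thesis unfolding S .
  qed
  define C where "C = f (0, 0) - f (1, 0) + f (1, 1) - f (0, 1)"
  have "fib_cubature n f = of_real (1 / b) * (\<Sum>\<mu><fib (Suc n). f (node_x n \<mu>, node_y n \<mu>))
     + of_real (1 / b) * (\<Sum>\<mu><fib (Suc n). of_real (node_y n \<mu> - 1 / 2) * (f (node_x n \<mu>, 0) - f (node_x n \<mu>, 1)) + of_real (node_x n \<mu> - 1 / 2) * (f (0, node_y n \<mu>) - f (1, node_y n \<mu>)))
     + of_real ((\<Sum>\<mu><fib (Suc n). (node_x n \<mu> - 1 / 2) * (node_y n \<mu> - 1 / 2)) / b) * C"
    unfolding fib_cubature_def sum_fib_lattice fb prod.case co C_def ..
  also have "of_real ((\<Sum>\<mu><fib (Suc n). (node_x n \<mu> - 1 / 2) * (node_y n \<mu> - 1 / 2)) / b) * C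
     = of_real (1 / b) * (\<Sum>\<mu><fib (Suc n). ((node_x n \<mu> - 1 / 2) * (node_y n \<mu> - 1 / 2)) *\<^sub>R C)"
    unfolding scaleR_sum_left[symmetric] by (simp only: scaleR_conv_of_real of_real_mult[symmetric] mult.assoc[symmetric]) simp
  also have "of_real (1 / b) * (\<Sum>\<mu><fib (Suc n). f (node_x n \<mu>, node_y n \<mu>))
     + of_real (1 / b) * (\<Sum>\<mu><fib (Suc n). of_real (node_y n \<mu> - 1 / 2) * (f (node_x n \<mu>, 0) - f (node_x n \<mu>, 1)) + of_real (node_x n \<mu> - 1 / 2) * (f (0, node_y n \<mu>) - f (1, node_y n \<mu>)))
     + of_real (1 / b) * (\<Sum>\<mu><fib (Suc n). ((node_x n \<mu> - 1 / 2) * (node_y n \<mu> - 1 / 2)) *\<^sub>R C)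
     = of_real (1 / b) * (\<Sum>\<mu><fib (Suc n). periodize2 f (node_x n \<mu>) (node_y n \<mu>))"
    unfolding periodize2_def C_def[symmetric] by (simp only: distrib_left[symmetric] sum.distrib[symmetric] scaleR_conv_of_real add.assoc)
  finally show ?thesis by (simp add: b_def scaleR_conv_of_real divide_inverse)
qed

lemma unit_square_lebesgue: "unit_square \<in> sets lebesgue" "unit_square \<in> sets borel" "compact unit_square"
proof -
  show c: "compact unit_square" by (intro compact_Times compact_Icc)
  then show b: "unit_square \<in> sets borel" by (simp add: borel_compact)
  then show "unit_square \<in> sets lebesgue" by (simp add: sets_completionI_sets)
qed

lemma square_integral_lborel:
  assumes "(\<lambda>u. indicator unit_square u *\<^sub>R g u) \<in> borel_measurable lborel"
  shows "square_integral g = (\<integral>u. indicator unit_square u *\<^sub>R g u \<partial>lborel)"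
  unfolding square_integral_def
  using assms unit_square_lebesgue by (subst integral_restrict_space) (auto simp: integral_completion)

lemma integral_indicator_Icc:
  fixes F :: "real \<Rightarrow> real"
  assumes "continuous_on {0..1} F"
  shows "(\<integral>x. indicator {0..1} x * F x \<partial>lborel) = integral {0..1} F"
    "integrable lborel (\<lambda>x. indicator {0..1} x * F x)"
proof -
  have i: "set_integrable lborel {0..1} F"
    unfolding set_integrable_def using assms by (intro borel_integrable_compact) auto
  then show "integrable lborel (\<lambda>x. indicator {0..1} x * F x)" by (simp add: set_integrable_def)
  show "(\<integral>x. indicator {0..1} x * F x \<partial>lborel) = integral {0..1} F"
    using set_borel_integral_eq_integral(2)[OF i] by (simp add: set_lebesgue_integral_def)
qed

lemma integral_square_tensor:
  fixes F G :: "real \<Rightarrow> real"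
  assumes F: "continuous_on UNIV F" and G: "continuous_on UNIV G"
  shows "(\<integral>u. indicator unit_square u * (F (fst u) * G (snd u)) \<partial>lborel) = integral {0..1} F * integral {0..1} G"
    "integrable lborel (\<lambda>u. indicator unit_square u * (F (fst u) * G (snd u)))"
proof -
  have "integrable lborel (\<lambda>u. indicator unit_square u *\<^sub>R (F (fst u) * G (snd u)))"
    by (intro borel_integrable_compact unit_square_lebesgue continuous_intros continuous_on_compose2[OF F] continuous_on_compose2[OF G]) auto
  then show int: "integrable lborel (\<lambda>u. indicator unit_square u * (F (fst u) * G (snd u)))" by simp
  have "(\<integral>u. indicator unit_square u * (F (fst u) * G (snd u)) \<partial>lborel)
     = (\<integral>x. (\<integral>y. indicator {0..1} x * F x * (indicator {0..1} y * G y) \<partial>lborel) \<partial>lborel)"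
    unfolding lborel_integral_prod(1)[OF int] by (simp add: indicator_times mult_ac)
  also have "\<dots> = (\<integral>x. indicator {0..1} x * F x \<partial>lborel) * (\<integral>y. indicator {0..1} y * G y \<partial>lborel)" by simp
  finally show "(\<integral>u. indicator unit_square u * (F (fst u) * G (snd u)) \<partial>lborel) = integral {0..1} F * integral {0..1} G"
    using continuous_on_subset[OF F subset_UNIV] continuous_on_subset[OF G subset_UNIV] by (simp add: integral_indicator_Icc(1))
qed

text \<open>Fubini on the product of the square and \<open>Z\<close>, a compact set outside which
  the kernels vanish for every point of the square.\<close>

lemma layer_square_integral:
  assumes l: "l > 0" and f: "continuous_on UNIV f"
  shows "square_integral (layer l q1 q2 f)
     = (\<integral>z. (integral {0..1} (\<lambda>x. ker l q1 x (fst z)) * integral {0..1} (\<lambda>y. ker l q2 y (snd z))) *\<^sub>R mixed_level_diff l q1 q2 f z \<partial>lborel)"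
    and "integrable lborel (\<lambda>z. (integral {0..1} (\<lambda>x. ker l q1 x (fst z)) * integral {0..1} (\<lambda>y. ker l q2 y (snd z))) *\<^sub>R mixed_level_diff l q1 q2 f z)"
    and "integrable lborel (\<lambda>u. indicator unit_square u *\<^sub>R layer l q1 q2 f u)"
proof -
  define Z :: "((real \<times> real) \<times> (real \<times> real)) set" where "Z = ({0..1} \<times> {- 1..1}) \<times> ({0..1} \<times> {- 1..1})"
  define k where "k u z = ker l q1 (fst u) (fst z) * ker l q2 (snd u) (snd z)" for u z
  define \<Phi> where "\<Phi> w = indicator unit_square (fst w) *\<^sub>R (k (fst w) (snd w) *\<^sub>R mixed_level_diff l q1 q2 f (snd w))" for w
  have int: "integrable lborel \<Phi>"
  proof -
    have "integrable lborel (\<lambda>w. indicator (unit_square \<times> Z) w *\<^sub>R (k (fst w) (snd w) *\<^sub>R mixed_level_diff l q1 q2 f (snd w)))"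
      unfolding k_def Z_def
      by (intro borel_integrable_compact compact_Times compact_Icc continuous_intros continuous_on_mixed_level_diff f l)
    moreover have "indicator (unit_square \<times> Z) w *\<^sub>R (k (fst w) (snd w) *\<^sub>R mixed_level_diff l q1 q2 f (snd w)) = \<Phi> w" for w
    proof (cases "fst w \<in> unit_square")
      case True
      have "k (fst w) (snd w) = 0" if "snd w \<notin> Z"
        using that True ker_support[OF l, of "fst (fst w)" "fst (snd w)" q1] ker_support[OF l, of "snd (fst w)" "snd (snd w)" q2]
        unfolding Z_def k_def by (metis mem_Times_iff mult_eq_0_iff)
      then show ?thesis using True by (cases w) (auto simp: \<Phi>_def indicator_def)
    qed (cases w, auto simp: \<Phi>_def indicator_def)
    ultimately show ?thesis by simp
  qed
  have in1: "(\<integral>z. \<Phi> (u, z) \<partial>lborel) = indicator unit_square u *\<^sub>R layer l q1 q2 f u" for u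
    by (simp add: \<Phi>_def layer_def k_def del: scaleR_scaleR)
  have in2: "(\<integral>u. \<Phi> (u, z) \<partial>lborel) = (integral {0..1} (\<lambda>x. ker l q1 x (fst z)) * integral {0..1} (\<lambda>y. ker l q2 y (snd z))) *\<^sub>R mixed_level_diff l q1 q2 f z" for z
  proof -
    have c: "continuous_on UNIV (\<lambda>x. ker l q1 x (fst z))" "continuous_on UNIV (\<lambda>x. ker l q2 x (snd z))"
      using l by (auto intro!: continuous_intros)
    have "\<Phi> (u, z) = (indicator unit_square u * (ker l q1 (fst u) (fst z) * ker l q2 (snd u) (snd z))) *\<^sub>R mixed_level_diff l q1 q2 f z" for u
      by (simp add: \<Phi>_def k_def)
    then show ?thesis using integral_square_tensor[OF c] by simp
  qed
  show i3: "integrable lborel (\<lambda>u. indicator unit_square u *\<^sub>R layer l q1 q2 f u)"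
    using integrable_fst_lborel[OF int] unfolding in1 .
  have "square_integral (layer l q1 q2 f) = (\<integral>u. (\<integral>z. \<Phi> (u, z) \<partial>lborel) \<partial>lborel)"
    unfolding in1 by (rule square_integral_lborel) (use i3 in auto)
  also have "\<dots> = (\<integral>z. (\<integral>u. \<Phi> (u, z) \<partial>lborel) \<partial>lborel)"
    using lborel_integral_prod[OF int] by simp
  finally show "square_integral (layer l q1 q2 f)
     = (\<integral>z. (integral {0..1} (\<lambda>x. ker l q1 x (fst z)) * integral {0..1} (\<lambda>y. ker l q2 y (snd z))) *\<^sub>R mixed_level_diff l q1 q2 f z \<partial>lborel)"
    unfolding in2 .
  have "integrable lborel (\<lambda>z. \<integral>u. \<Phi> (u, z) \<partial>lborel)"
    using lborel_pair.integrable_snd[of "\<lambda>u z. \<Phi> (u, z)"] int by (simp add: lborel_prod)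
  then show "integrable lborel (\<lambda>z. (integral {0..1} (\<lambda>x. ker l q1 x (fst z)) * integral {0..1} (\<lambda>y. ker l q2 y (snd z))) *\<^sub>R mixed_level_diff l q1 q2 f z)"
    unfolding in2 .
qed

text \<open>On a product F(x) G(y) the correction in two variables factorises into
  \<open>periodize F\<close> times \<open>periodize G\<close>, and a layer is an integral over z of
  such products. The corrections evaluate the kernels at 0 and 1 as well, so integrability is
  collected at all of these points.\<close>

lemma periodize2_layer:
  assumes l: "l > 0" and f: "continuous_on UNIV f" and x: "x \<in> {0..1}" and y: "y \<in> {0..1}"
  shows "periodize2 (layer l q1 q2 f) x y = (\<integral>z. (periodize (\<lambda>x. ker l q1 x (fst z)) x * periodize (\<lambda>y. ker l q2 y (snd z)) y) *\<^sub>R mixed_level_diff l q1 q2 f z \<partial>lborel)"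
    and "integrable lborel (\<lambda>z. (periodize (\<lambda>x. ker l q1 x (fst z)) x * periodize (\<lambda>y. ker l q2 y (snd z)) y) *\<^sub>R mixed_level_diff l q1 q2 f z)"
proof -
  define t where "t x y z = (ker l q1 x (fst z) * ker l q2 y (snd z)) *\<^sub>R mixed_level_diff l q1 q2 f z" for x y z
  have i: "integrable lborel (t x y)" if "x \<in> {0..1}" "y \<in> {0..1}" for x y
    unfolding t_def[abs_def] by (rule ker_ker_integrable[OF l f that])
  have L: "layer l q1 q2 f (x, y) = integral\<^sup>L lborel (t x y)" for x y
    by (simp add: layer_def t_def[abs_def])
  have e: "(periodize (\<lambda>x. ker l q1 x (fst z)) x * periodize (\<lambda>y. ker l q2 y (snd z)) y) *\<^sub>R mixed_level_diff l q1 q2 f z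
     = t x y z + (y - 1 / 2) *\<^sub>R (t x 0 z - t x 1 z) + (x - 1 / 2) *\<^sub>R (t 0 y z - t 1 y z)
       + ((x - 1 / 2) * (y - 1 / 2)) *\<^sub>R (t 0 0 z - t 1 0 z + t 1 1 z - t 0 1 z)" for z
    unfolding t_def periodize_def scaleR_scaleR scaleR_diff_left[symmetric] scaleR_add_left[symmetric]
    by (rule arg_cong2[where f = scaleR]) (simp_all add: algebra_simps)
  have ii: "integrable lborel (t x y)" "integrable lborel (t x 0)" "integrable lborel (t x 1)" "integrable lborel (t 0 y)" "integrable lborel (t 1 y)"
    "integrable lborel (t 0 0)" "integrable lborel (t 1 0)" "integrable lborel (t 1 1)" "integrable lborel (t 0 1)"
    using x y by (auto intro!: i)
  show "integrable lborel (\<lambda>z. (periodize (\<lambda>x. ker l q1 x (fst z)) x * periodize (\<lambda>y. ker l q2 y (snd z)) y) *\<^sub>R mixed_level_diff l q1 q2 f z)"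
    unfolding e by (intro Bochner_Integration.integrable_add Bochner_Integration.integrable_diff integrable_scaleR_right ii)
  show "periodize2 (layer l q1 q2 f) x y = (\<integral>z. (periodize (\<lambda>x. ker l q1 x (fst z)) x * periodize (\<lambda>y. ker l q2 y (snd z)) y) *\<^sub>R mixed_level_diff l q1 q2 f z \<partial>lborel)"
    unfolding e periodize2_def L using ii
    by (simp add: Bochner_Integration.integral_add Bochner_Integration.integral_diff Bochner_Integration.integrable_add Bochner_Integration.integrable_diff integrable_scaleR_right)
qed

lemma integral_periodize:
  assumes "continuous_on {0..1} F" shows "integral {0..1} (periodize F) = integral {0..1} F"
proof -
  have "((\<lambda>x::real. (x - 1 / 2) * (F 0 - F 1)) has_integral ((1\<^sup>2 / 2 - 1 / 2) * (F 0 - F 1) - (0\<^sup>2 / 2 - 0 / 2) * (F 0 - F 1))) {0..1}"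
    by (rule fundamental_theorem_of_calculus)
       (auto intro!: derivative_eq_intros simp: has_real_derivative_iff_has_vector_derivative[symmetric])
  then have "((\<lambda>x::real. (x - 1 / 2) * (F 0 - F 1)) has_integral 0) {0..1}" by simp
  from has_integral_add[OF integrable_integral[OF integrable_continuous_interval[OF assms]] this]
  have "(periodize F has_integral integral {0..1} F) {0..1}" by (simp add: periodize_def[abs_def])
  then show ?thesis by (rule integral_unique)
qed

lemma tensor_err_eq:
  assumes "continuous_on {0..1} F" "continuous_on {0..1} G"
  shows "tensor_err n F G = (\<Sum>\<mu><fib (Suc n). periodize F (node_x n \<mu>) * periodize G (node_y n \<mu>)) / real (fib (Suc n))
    - integral {0..1} F * integral {0..1} G"
  unfolding tensor_err_def lattice_err_def
  by (simp add: integral_periodize assms grid_def node_x_def node_y_def)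

text \<open>The difference of f in the integrand depends on z only. The error functional acts on the
  kernels alone and passes under the integral by linearity.\<close>

lemma layer_error:
  assumes l: "l > 0" and f: "continuous_on UNIV f"
  shows "fib_cubature n (layer l q1 q2 f) - square_integral (layer l q1 q2 f)
     = (\<integral>z. tensor_err n (\<lambda>x. ker l q1 x (fst z)) (\<lambda>y. ker l q2 y (snd z)) *\<^sub>R mixed_level_diff l q1 q2 f z \<partial>lborel)"
    and "integrable lborel (\<lambda>z. tensor_err n (\<lambda>x. ker l q1 x (fst z)) (\<lambda>y. ker l q2 y (snd z)) *\<^sub>R mixed_level_diff l q1 q2 f z)"
proof -
  define P where "P \<mu> z = (periodize (\<lambda>x. ker l q1 x (fst z)) (node_x n \<mu>) * periodize (\<lambda>y. ker l q2 y (snd z)) (node_y n \<mu>)) *\<^sub>R mixed_level_diff l q1 q2 f z" for \<mu> z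
  define Q where "Q z = (integral {0..1} (\<lambda>x. ker l q1 x (fst z)) * integral {0..1} (\<lambda>y. ker l q2 y (snd z))) *\<^sub>R mixed_level_diff l q1 q2 f z" for z
  have iP: "integrable lborel (P \<mu>)" if "\<mu> \<in> {..<fib (Suc n)}" for \<mu>
    unfolding P_def[abs_def] using that by (intro periodize2_layer(2) l f node_x_node_y_in) auto
  have iQ: "integrable lborel Q" unfolding Q_def[abs_def] by (rule layer_square_integral(2)[OF l f])
  have e: "tensor_err n (\<lambda>x. ker l q1 x (fst z)) (\<lambda>y. ker l q2 y (snd z)) *\<^sub>R mixed_level_diff l q1 q2 f z
     = (\<Sum>\<mu><fib (Suc n). P \<mu> z) /\<^sub>R real (fib (Suc n)) - Q z" for z
  proof -
    have c: "continuous_on {0..1} (\<lambda>x. ker l q1 x (fst z))" "continuous_on {0..1} (\<lambda>x. ker l q2 x (snd z))"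
      using l by (auto intro!: continuous_intros)
    show ?thesis unfolding tensor_err_eq[OF c] P_def Q_def
      by (simp add: scaleR_diff_left scaleR_sum_left[symmetric] divide_inverse mult.commute)
  qed
  show "integrable lborel (\<lambda>z. tensor_err n (\<lambda>x. ker l q1 x (fst z)) (\<lambda>y. ker l q2 y (snd z)) *\<^sub>R mixed_level_diff l q1 q2 f z)"
    unfolding e by (intro Bochner_Integration.integrable_diff integrable_scaleR_right Bochner_Integration.integrable_sum iP iQ)
  have "(\<integral>z. tensor_err n (\<lambda>x. ker l q1 x (fst z)) (\<lambda>y. ker l q2 y (snd z)) *\<^sub>R mixed_level_diff l q1 q2 f z \<partial>lborel)
     = (\<integral>z. (\<Sum>\<mu><fib (Suc n). P \<mu> z) /\<^sub>R real (fib (Suc n)) \<partial>lborel) - (\<integral>z. Q z \<partial>lborel)"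
    unfolding e by (intro Bochner_Integration.integral_diff integrable_scaleR_right Bochner_Integration.integrable_sum iP iQ)
  also have "(\<integral>z. (\<Sum>\<mu><fib (Suc n). P \<mu> z) /\<^sub>R real (fib (Suc n)) \<partial>lborel) = (\<Sum>\<mu><fib (Suc n). integral\<^sup>L lborel (P \<mu>)) /\<^sub>R real (fib (Suc n))"
    unfolding integral_scaleR_right by (subst Bochner_Integration.integral_sum[OF iP]) auto
  also have "(\<Sum>\<mu><fib (Suc n). integral\<^sup>L lborel (P \<mu>)) = (\<Sum>\<mu><fib (Suc n). periodize2 (layer l q1 q2 f) (node_x n \<mu>) (node_y n \<mu>))"
    unfolding P_def[abs_def] by (intro sum.cong refl periodize2_layer(1)[symmetric] l f node_x_node_y_in) auto
  finally show "fib_cubature n (layer l q1 q2 f) - square_integral (layer l q1 q2 f)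
     = (\<integral>z. tensor_err n (\<lambda>x. ker l q1 x (fst z)) (\<lambda>y. ker l q2 y (snd z)) *\<^sub>R mixed_level_diff l q1 q2 f z \<partial>lborel)"
    unfolding fib_cubature_eq layer_square_integral(1)[OF l f] Q_def by simp
qed

section \<open>The error kernel: support, mass and supremum\<close>

lemma young_split:
  fixes h p \<epsilon> :: real
  assumes "p \<ge> 1" "\<epsilon> > 0" "h \<ge> 0"
  shows "h \<le> \<epsilon> powr (1 - p) * h powr p + \<epsilon>"
proof (cases "h \<le> \<epsilon>")
  case True
  then show ?thesis using assms by (simp add: add_increasing)
next
  case False
  then have h: "h > 0" "\<epsilon> \<le> h" using assms by auto
  have "h = h powr (1 - p) * h powr p" using h by (simp flip: powr_add)
  also have "\<dots> \<le> \<epsilon> powr (1 - p) * h powr p"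
    using assms h by (intro mult_right_mono powr_mono2') auto
  finally show ?thesis using assms by linarith
qed

text \<open>A form of Hoelder's inequality with a free parameter: after \<open>young_split\<close>
  the weight E is estimated by its supremum S next to the p-th power, and by its mass A next to
  \<epsilon>. The choice of \<epsilon> is left open so that two different ones can be made
  later.\<close>

lemma weighted_integral_bound:
  fixes E :: "'a \<Rightarrow> real" and H :: "'a \<Rightarrow> complex"
  assumes p: "p \<ge> 1" and \<epsilon>: "\<epsilon> > 0" and int: "integrable M (\<lambda>z. E z *\<^sub>R H z)"
    and E: "E \<in> borel_measurable M" and H: "H \<in> borel_measurable M" and Z: "Z \<in> sets M"
    and S: "\<And>z. \<bar>E z\<bar> \<le> S" "\<And>z. E z \<noteq> 0 \<Longrightarrow> z \<in> Z"
    and V: "(\<integral>\<^sup>+z. indicator Z z * ennreal (norm (H z) powr p) \<partial>M) \<le> ennreal V" "V \<ge> 0"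
    and A: "(\<integral>\<^sup>+z. ennreal \<bar>E z\<bar> \<partial>M) \<le> ennreal A" "A \<ge> 0"
  shows "norm (\<integral>z. E z *\<^sub>R H z \<partial>M) \<le> \<epsilon> powr (1 - p) * S * V + \<epsilon> * A"
proof -
  have S0: "S \<ge> 0" using S(1) by (rule order_trans[OF abs_ge_zero])
  note [measurable] = E H Z
  have pt: "ennreal (norm (E z *\<^sub>R H z)) \<le> ennreal (\<epsilon> powr (1 - p) * S) * (indicator Z z * ennreal (norm (H z) powr p)) + ennreal \<epsilon> * ennreal \<bar>E z\<bar>" for z
  proof (cases "E z = 0")
    case False
    have "norm (E z *\<^sub>R H z) \<le> \<bar>E z\<bar> * (\<epsilon> powr (1 - p) * norm (H z) powr p + \<epsilon>)"
      using young_split[OF p \<epsilon>, of "norm (H z)"] by (simp add: mult_left_mono)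
    also have "\<dots> \<le> S * (\<epsilon> powr (1 - p) * norm (H z) powr p) + \<epsilon> * \<bar>E z\<bar>"
      using S(1)[of z] by (simp add: distrib_left mult_right_mono mult.commute)
    finally have "ennreal (norm (E z *\<^sub>R H z)) \<le> ennreal (\<epsilon> powr (1 - p) * S * norm (H z) powr p + \<epsilon> * \<bar>E z\<bar>)"
      by (intro ennreal_leI) (simp add: mult_ac)
    also have "\<dots> = ennreal (\<epsilon> powr (1 - p) * S) * (indicator Z z * ennreal (norm (H z) powr p)) + ennreal \<epsilon> * ennreal \<bar>E z\<bar>"
      using S(2)[OF False] S0 \<epsilon> by (simp add: ennreal_plus ennreal_mult)
    finally show ?thesis .
  qed simp
  have "ennreal (norm (\<integral>z. E z *\<^sub>R H z \<partial>M)) \<le> (\<integral>\<^sup>+z. ennreal (norm (E z *\<^sub>R H z)) \<partial>M)"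
    by (rule integral_norm_bound_ennreal[OF int])
  also have "\<dots> \<le> (\<integral>\<^sup>+z. ennreal (\<epsilon> powr (1 - p) * S) * (indicator Z z * ennreal (norm (H z) powr p)) + ennreal \<epsilon> * ennreal \<bar>E z\<bar> \<partial>M)"
    by (rule nn_integral_mono[OF pt])
  also have "\<dots> = ennreal (\<epsilon> powr (1 - p) * S) * (\<integral>\<^sup>+z. indicator Z z * ennreal (norm (H z) powr p) \<partial>M) + ennreal \<epsilon> * (\<integral>\<^sup>+z. ennreal \<bar>E z\<bar> \<partial>M)"
    by (subst nn_integral_add) (auto simp: nn_integral_cmult)
  also have "\<dots> \<le> ennreal (\<epsilon> powr (1 - p) * S) * ennreal V + ennreal \<epsilon> * ennreal A"
    by (intro add_mono mult_left_mono V A) auto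
  also have "\<dots> = ennreal (\<epsilon> powr (1 - p) * S * V + \<epsilon> * A)"
    using S0 \<epsilon> V A by (simp add: ennreal_plus ennreal_mult)
  finally show ?thesis using S0 \<epsilon> V A by (subst (asm) ennreal_le_iff) auto
qed

text \<open>The pairs of base point and step that \<open>ker_region\<close> allows, made independent
  of x.\<close>

definition kernel_region :: "nat \<Rightarrow> nat \<Rightarrow> (real \<times> real) set" where
  "kernel_region l q = {z. fst z \<in> {0..1} \<and> \<bar>snd z\<bar> \<le> 1 / 2 ^ q \<and>
     (q \<noteq> 0 \<longrightarrow> \<bar>snd z\<bar> < 1 / 2 ^ Suc q \<and> fst z + real l * snd z \<in> {0..1})}"

lemma kernel_region_borel [measurable]: "kernel_region l q \<in> sets borel"
proof -
  have "Measurable.pred (borel \<Otimes>\<^sub>M borel) (\<lambda>z::real \<times> real. fst z \<in> {0..1} \<and> \<bar>snd z\<bar> \<le> 1 / 2 ^ q \<and>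
     (q \<noteq> 0 \<longrightarrow> \<bar>snd z\<bar> < 1 / 2 ^ Suc q \<and> fst z + real l * snd z \<in> {0..1}))"
    by measurable
  then show ?thesis by (simp add: pred_def borel_prod kernel_region_def)
qed

lemma ker_kernel_region: "l > 0 \<Longrightarrow> x \<in> {0..1} \<Longrightarrow> ker l q x z \<noteq> 0 \<Longrightarrow> z \<in> kernel_region l q"
  using ker_region[of l x q "fst z" "snd z"] unfolding kernel_region_def by auto

lemma nn_integral_prod:
  fixes u :: "'a::euclidean_space \<Rightarrow> ennreal" and v :: "'b::euclidean_space \<Rightarrow> ennreal"
  assumes [measurable]: "u \<in> borel_measurable borel" "v \<in> borel_measurable borel"
  shows "(\<integral>\<^sup>+z. u (fst z) * v (snd z) \<partial>lborel) = (\<integral>\<^sup>+x. u x \<partial>lborel) * (\<integral>\<^sup>+y. v y \<partial>lborel)"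
proof -
  have "(\<integral>\<^sup>+z. u (fst z) * v (snd z) \<partial>lborel) = (\<integral>\<^sup>+z. u (fst z) * v (snd z) \<partial>(lborel \<Otimes>\<^sub>M lborel))"
    by (simp add: lborel_prod)
  also have "\<dots> = (\<integral>\<^sup>+x. \<integral>\<^sup>+y. u (fst (x, y)) * v (snd (x, y)) \<partial>lborel \<partial>lborel)"
    by (rule lborel.nn_integral_fst[symmetric]) measurable
  also have "\<dots> = (\<integral>\<^sup>+x. u x \<partial>lborel) * (\<integral>\<^sup>+y. v y \<partial>lborel)"
    by (simp add: nn_integral_cmult nn_integral_multc)
  finally show ?thesis .
qed

lemma emeasure_rectangle:
  fixes a b c d :: real
  assumes "a \<le> b" "c \<le> d"
  shows "emeasure lborel ({a..b} \<times> {c..d}) = ennreal ((b - a) * (d - c))"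
proof -
  have "emeasure lborel ({a..b} \<times> {c..d}) = emeasure (lborel \<Otimes>\<^sub>M lborel) ({a..b} \<times> {c..d})" by (simp add: lborel_prod)
  also have "\<dots> = emeasure lborel {a..b} * emeasure lborel {c..d}" by (rule lborel.emeasure_pair_measure_Times) auto
  finally show ?thesis using assms by (simp add: ennreal_mult)
qed

lemma emeasure_kernel_region: "emeasure lborel (kernel_region l q) \<le> ennreal (2 / 2 ^ q)"
proof -
  have "kernel_region l q \<subseteq> {0..1} \<times> {- 1 / 2 ^ q..1 / 2 ^ q}" by (auto simp: kernel_region_def abs_le_iff)
  then have "emeasure lborel (kernel_region l q) \<le> emeasure lborel ({0..1::real} \<times> {- 1 / 2 ^ q..1 / 2 ^ q :: real})"
    by (rule emeasure_mono) (auto intro: borel_closed closed_Times)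
  also have "\<dots> = ennreal ((1 - 0) * (1 / 2 ^ q - - 1 / 2 ^ q))" by (rule emeasure_rectangle) auto
  finally show ?thesis by simp
qed

lemma ker_measurable [measurable]:
  "l > 0 \<Longrightarrow> (\<lambda>z. ker l q x z) \<in> borel_measurable borel"
  by (intro borel_measurable_continuous_onI continuous_intros)

text \<open>Height K 4^q on a rectangle of area 4/4^q.\<close>

lemma ker_mass:
  assumes l: "l > 0" and K: "K > 0" "\<And>q z. scaled_C2 (2 ^ q) (K * 4 ^ q) (\<lambda>x. ker l q x z)" and x: "x \<in> {0..1}"
  shows "(\<integral>\<^sup>+z. ennreal \<bar>ker l q x z\<bar> \<partial>lborel) \<le> ennreal (4 * K)"
proof -
  define D where "D = {x - 1 / 2 ^ q..x + 1 / 2 ^ q} \<times> {- 1 / 2 ^ q..1 / (2::real) ^ q}"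
  have D: "D \<in> sets borel" unfolding D_def by (auto intro: borel_closed closed_Times)
  have "ennreal \<bar>ker l q x z\<bar> \<le> ennreal (K * 4 ^ q) * indicator D z" for z
  proof (cases "ker l q x z = 0")
    case False
    then have "z \<in> D" using ker_region(1,3)[OF l x, of q "fst z" "snd z"]
      by (cases z) (auto simp: D_def abs_le_iff)
    then show ?thesis using smD(1)[OF K(2)[of q z], of x] by (simp add: ennreal_leI)
  qed simp
  then have "(\<integral>\<^sup>+z. ennreal \<bar>ker l q x z\<bar> \<partial>lborel) \<le> (\<integral>\<^sup>+z. ennreal (K * 4 ^ q) * indicator D z \<partial>lborel)"
    by (intro nn_integral_mono) auto
  also have "\<dots> = ennreal (K * 4 ^ q) * emeasure lborel D" using D by (simp add: nn_integral_cmult_indicator)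
  also have "emeasure lborel D = ennreal ((x + 1 / 2 ^ q - (x - 1 / 2 ^ q)) * (1 / 2 ^ q - - 1 / 2 ^ q))"
    unfolding D_def by (rule emeasure_rectangle) auto
  also have "ennreal (K * 4 ^ q) * \<dots> = ennreal (K * 4 ^ q * ((x + 1 / 2 ^ q - (x - 1 / 2 ^ q)) * (1 / 2 ^ q - - 1 / 2 ^ q)))"
    using K by (intro ennreal_mult[symmetric]) auto
  also have "K * 4 ^ q * ((x + 1 / 2 ^ q - (x - 1 / 2 ^ q)) * (1 / 2 ^ q - - 1 / 2 ^ q)) = 4 * K"
    by (simp add: field_simps power_mult_distrib[symmetric])
  finally show ?thesis .
qed

text \<open>The kernels at x, 0 and 1 enter with weights of modulus at most 1, each with mass at
  most 4 K.\<close>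

lemma periodize_ker_mass:
  assumes l: "l > 0" and K: "K > 0" "\<And>q z. scaled_C2 (2 ^ q) (K * 4 ^ q) (\<lambda>x. ker l q x z)" and x: "x \<in> {0..1}"
  shows "(\<integral>\<^sup>+z. ennreal \<bar>periodize (\<lambda>x. ker l q x z) x\<bar> \<partial>lborel) \<le> ennreal (12 * K)"
proof -
  note [measurable] = ker_measurable[OF l]
  have "ennreal \<bar>periodize (\<lambda>x. ker l q x z) x\<bar> \<le> ennreal \<bar>ker l q x z\<bar> + (ennreal \<bar>ker l q 0 z\<bar> + ennreal \<bar>ker l q 1 z\<bar>)" for z
  proof -
    have a: "\<bar>(x - 1 / 2) * (c - d)\<bar> \<le> \<bar>c\<bar> + \<bar>d\<bar>" for c d
    proof -
      have "\<bar>x - 1 / 2\<bar> * \<bar>c - d\<bar> \<le> 1 * (\<bar>c\<bar> + \<bar>d\<bar>)" using x by (intro mult_mono) auto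
      then show ?thesis by (simp add: abs_mult)
    qed
    have "\<bar>periodize (\<lambda>x. ker l q x z) x\<bar> \<le> \<bar>ker l q x z\<bar> + (\<bar>ker l q 0 z\<bar> + \<bar>ker l q 1 z\<bar>)"
      unfolding periodize_def by (rule order_trans[OF abs_triangle_ineq add_left_mono[OF a]])
    then show ?thesis by (simp add: ennreal_leI flip: ennreal_plus)
  qed
  then have "(\<integral>\<^sup>+z. ennreal \<bar>periodize (\<lambda>x. ker l q x z) x\<bar> \<partial>lborel)
     \<le> (\<integral>\<^sup>+z. ennreal \<bar>ker l q x z\<bar> + (ennreal \<bar>ker l q 0 z\<bar> + ennreal \<bar>ker l q 1 z\<bar>) \<partial>lborel)"
    by (intro nn_integral_mono) auto
  also have "\<dots> = (\<integral>\<^sup>+z. ennreal \<bar>ker l q x z\<bar> \<partial>lborel) + ((\<integral>\<^sup>+z. ennreal \<bar>ker l q 0 z\<bar> \<partial>lborel) + (\<integral>\<^sup>+z. ennreal \<bar>ker l q 1 z\<bar> \<partial>lborel))"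
    by (subst nn_integral_add nn_integral_add; measurable)+
  also have "\<dots> \<le> ennreal (4 * K) + (ennreal (4 * K) + ennreal (4 * K))"
    using x by (intro add_mono ker_mass[OF l K]) auto
  also have "\<dots> = ennreal (12 * K)" using K by (simp flip: ennreal_plus)
  finally show ?thesis .
qed

lemma ker_integral_measurable:
  assumes l: "l > 0"
  shows "(\<lambda>z. integral {0..1} (\<lambda>x. ker l q x z)) \<in> borel_measurable borel"
proof -
  have "(\<lambda>w. ker l q (snd w) (fst w)) \<in> borel_measurable (borel \<Otimes>\<^sub>M borel)"
    unfolding borel_prod using l by (intro borel_measurable_continuous_onI continuous_intros) auto
  then have "(\<lambda>w. indicator {0..1} (snd w) * ker l q (snd w) (fst w)) \<in> borel_measurable (borel \<Otimes>\<^sub>M borel)"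
    by measurable
  then have "(\<lambda>w. indicator {0..1} (snd w) * ker l q (snd w) (fst w)) \<in> borel_measurable (borel \<Otimes>\<^sub>M lborel)"
    by (subst measurable_cong_sets[OF sets_pair_measure_cong[OF refl sets_lborel] refl])
  then have "(\<lambda>z. \<integral>x. indicator {0..1} x * ker l q x z \<partial>lborel) \<in> borel_measurable borel"
    by (intro lborel.borel_measurable_lebesgue_integral) (simp add: case_prod_beta')
  moreover have "(\<integral>x. indicator {0..1} x * ker l q x z \<partial>lborel) = integral {0..1} (\<lambda>x. ker l q x z)" for z
    using l by (intro integral_indicator_Icc continuous_intros) auto
  ultimately show ?thesis by simp
qed

text \<open>For fixed z the kernel is at most K 4^q on an x-interval of length 2/2^q, and z ranges
  over a region of measure at most 2/2^q.\<close>

lemma ker_integral_mass: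
  assumes l: "l > 0" and K: "K > 0" "\<And>q z. scaled_C2 (2 ^ q) (K * 4 ^ q) (\<lambda>x. ker l q x z)"
  shows "(\<integral>\<^sup>+z. ennreal \<bar>integral {0..1} (\<lambda>x. ker l q x z)\<bar> \<partial>lborel) \<le> ennreal (4 * K)"
proof -
  have "ennreal \<bar>integral {0..1} (\<lambda>x. ker l q x z)\<bar> \<le> ennreal (K * 4 ^ q * (2 / 2 ^ q)) * indicator (kernel_region l q) z" for z
  proof (cases "z \<in> kernel_region l q")
    case False
    then have "ker l q x z = 0" if "x \<in> {0..1}" for x using ker_kernel_region[OF l that] by blast
    then have "integral {0..1} (\<lambda>x. ker l q x z) = integral {0..1} (\<lambda>x::real. 0)"
      by (intro Henstock_Kurzweil_Integration.integral_cong) auto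
    then show ?thesis by simp
  next
    case True
    define D where "D = {fst z - 1 / 2 ^ q..fst z + 1 / (2::real) ^ q}"
    have c: "continuous_on {0..1} (\<lambda>x. ker l q x z)" using l by (intro continuous_intros) auto
    have "ennreal \<bar>integral {0..1} (\<lambda>x. ker l q x z)\<bar> = ennreal (norm (\<integral>x. indicator {0..1} x * ker l q x z \<partial>lborel))"
      unfolding integral_indicator_Icc(1)[OF c] by simp
    also have "\<dots> \<le> (\<integral>\<^sup>+x. ennreal (norm (indicator {0..1} x * ker l q x z)) \<partial>lborel)"
      by (rule integral_norm_bound_ennreal[OF integral_indicator_Icc(2)[OF c]])
    also have "\<dots> \<le> (\<integral>\<^sup>+x. ennreal (K * 4 ^ q) * indicator D x \<partial>lborel)"
    proof (rule nn_integral_mono)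
      fix x
      show "ennreal (norm (indicator {0..1} x * ker l q x z)) \<le> ennreal (K * 4 ^ q) * indicator D x"
      proof (cases "x \<in> {0..1} \<and> ker l q x z \<noteq> 0")
        case True
        then have "x \<in> D" using ker_region(1)[OF l, of x q "fst z" "snd z"] by (auto simp: D_def abs_le_iff)
        then show ?thesis using True smD(1)[OF K(2)[of q z], of x] by (simp add: ennreal_leI)
      qed auto
    qed
    also have "\<dots> = ennreal (K * 4 ^ q) * emeasure lborel D" by (subst nn_integral_cmult_indicator) (auto simp: D_def)
    also have "\<dots> = ennreal (K * 4 ^ q * (2 / 2 ^ q))" using K by (simp add: D_def flip: ennreal_mult)
    finally show ?thesis using True by simp
  qed
  then have "(\<integral>\<^sup>+z. ennreal \<bar>integral {0..1} (\<lambda>x. ker l q x z)\<bar> \<partial>lborel)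
    \<le> (\<integral>\<^sup>+z. ennreal (K * 4 ^ q * (2 / 2 ^ q)) * indicator (kernel_region l q) z \<partial>lborel)"
    by (intro nn_integral_mono) auto
  also have "\<dots> = ennreal (K * 4 ^ q * (2 / 2 ^ q)) * emeasure lborel (kernel_region l q)"
    by (subst nn_integral_cmult_indicator) auto
  also have "\<dots> \<le> ennreal (K * 4 ^ q * (2 / 2 ^ q)) * ennreal (2 / 2 ^ q)"
    by (intro mult_left_mono emeasure_kernel_region) auto
  also have "\<dots> = ennreal (K * 4 ^ q * (2 / 2 ^ q) * (2 / 2 ^ q))" using K by (intro ennreal_mult[symmetric]) auto
  also have "K * 4 ^ q * (2 / 2 ^ q) * (2 / 2 ^ q) = 4 * K" by (simp add: field_simps power_mult_distrib[symmetric])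
  finally show ?thesis .
qed

definition ker_err :: "nat \<Rightarrow> nat \<Rightarrow> nat \<Rightarrow> nat \<Rightarrow> (real \<times> real) \<times> (real \<times> real) \<Rightarrow> real" where
  "ker_err l n q1 q2 z = tensor_err n (\<lambda>x. ker l q1 x (fst z)) (\<lambda>y. ker l q2 y (snd z))"

lemma ker_err_eq:
  assumes "l > 0"
  shows "ker_err l n q1 q2 z = (\<Sum>\<mu><fib (Suc n). periodize (\<lambda>x. ker l q1 x (fst z)) (node_x n \<mu>) * periodize (\<lambda>y. ker l q2 y (snd z)) (node_y n \<mu>)) / real (fib (Suc n))
    - integral {0..1} (\<lambda>x. ker l q1 x (fst z)) * integral {0..1} (\<lambda>y. ker l q2 y (snd z))"
  unfolding ker_err_def using assms by (intro tensor_err_eq) (auto intro!: continuous_intros)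

lemma periodize_ker_measurable:
  assumes "l > 0" shows "(\<lambda>z. periodize (\<lambda>x. ker l q x z) x) \<in> borel_measurable borel"
  unfolding periodize_def using assms by measurable

lemma ker_err_measurable:
  assumes l: "l > 0" shows "ker_err l n q1 q2 \<in> borel_measurable borel"
proof -
  note [measurable] = periodize_ker_measurable[OF l] ker_integral_measurable[OF l]
  have "(\<lambda>z. ker_err l n q1 q2 z) \<in> borel_measurable (borel \<Otimes>\<^sub>M borel)"
    unfolding ker_err_eq[OF l] by measurable
  then show ?thesis by (simp add: borel_prod)
qed

lemma ker_err_kernel_region:
  assumes l: "l > 0" and nz: "ker_err l n q1 q2 z \<noteq> 0"
  shows "fst z \<in> kernel_region l q1" "snd z \<in> kernel_region l q2"
proof -
  have z: "ker l q x w = 0" if "x \<in> {0..1}" "w \<notin> kernel_region l q" for q x w using that ker_kernel_region[OF l] by blast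
  have p: "periodize (\<lambda>x. ker l q x w) x = 0" "integral {0..1} (\<lambda>x. ker l q x w) = 0" if "x \<in> {0..1}" "w \<notin> kernel_region l q" for q x w
  proof -
    show "periodize (\<lambda>x. ker l q x w) x = 0" using that z by (simp add: periodize_def)
    have "integral {0..1} (\<lambda>x. ker l q x w) = integral {0..1} (\<lambda>x::real. 0)"
      using that z by (intro Henstock_Kurzweil_Integration.integral_cong) auto
    then show "integral {0..1} (\<lambda>x. ker l q x w) = 0" by simp
  qed
  have 0: "(0::real) \<in> {0..1}" by simp
  show "fst z \<in> kernel_region l q1"
  proof (rule ccontr)
    assume a: "fst z \<notin> kernel_region l q1"
    have "(\<Sum>\<mu><fib (Suc n). periodize (\<lambda>x. ker l q1 x (fst z)) (node_x n \<mu>) * periodize (\<lambda>y. ker l q2 y (snd z)) (node_y n \<mu>)) = 0"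
      by (intro sum.neutral ballI) (use p(1)[OF node_x_node_y_in(1) a] in auto)
    then show False using nz unfolding ker_err_eq[OF l] p(2)[OF 0 a] by simp
  qed
  show "snd z \<in> kernel_region l q2"
  proof (rule ccontr)
    assume a: "snd z \<notin> kernel_region l q2"
    have "(\<Sum>\<mu><fib (Suc n). periodize (\<lambda>x. ker l q1 x (fst z)) (node_x n \<mu>) * periodize (\<lambda>y. ker l q2 y (snd z)) (node_y n \<mu>)) = 0"
      by (intro sum.neutral ballI) (use p(1)[OF node_x_node_y_in(2) a] in auto)
    then show False using nz unfolding ker_err_eq[OF l] p(2)[OF 0 a] by simp
  qed
qed

text \<open>The sum over the nodes and the integral are bounded separately, without cancellation:
  144 K^2 from the average over the nodes and 16 K^2 from the integral. This bound is uniform in n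
  and in the levels, and it governs the fine layers with R > 1.\<close>

lemma ker_err_mass:
  assumes l: "l > 0" and K: "K > 0" "\<And>q z. scaled_C2 (2 ^ q) (K * 4 ^ q) (\<lambda>x. ker l q x z)"
  shows "(\<integral>\<^sup>+z. ennreal \<bar>ker_err l n q1 q2 z\<bar> \<partial>lborel) \<le> ennreal (160 * K\<^sup>2)"
proof -
  define b where "b = real (fib (Suc n))"
  have b: "b > 0" unfolding b_def using fib_Suc_pos[of n] by simp
  define P where "P q x z = ennreal \<bar>periodize (\<lambda>x. ker l q x z) x\<bar>" for q x z
  define I where "I q z = ennreal \<bar>integral {0..1} (\<lambda>x. ker l q x z)\<bar>" for q z
  have mP [measurable]: "P q x \<in> borel_measurable borel" for q x
    unfolding P_def using periodize_ker_measurable[OF l] by measurable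
  have mI [measurable]: "I q \<in> borel_measurable borel" for q
    unfolding I_def using ker_integral_measurable[OF l] by measurable
  have mPP: "(\<lambda>z. P q1 x (fst z) * P q2 y (snd z)) \<in> borel_measurable lborel" for x y
  proof -
    have "(\<lambda>z. P q1 x (fst z) * P q2 y (snd z)) \<in> borel_measurable (borel \<Otimes>\<^sub>M borel)" by measurable
    then show ?thesis by (simp add: borel_prod)
  qed
  have mII: "(\<lambda>z. I q1 (fst z) * I q2 (snd z)) \<in> borel_measurable lborel"
  proof -
    have "(\<lambda>z. I q1 (fst z) * I q2 (snd z)) \<in> borel_measurable (borel \<Otimes>\<^sub>M borel)" by measurable
    then show ?thesis by (simp add: borel_prod)
  qed
  have "ennreal \<bar>ker_err l n q1 q2 z\<bar> \<le> ennreal (1 / b) * (\<Sum>\<mu><fib (Suc n). P q1 (node_x n \<mu>) (fst z) * P q2 (node_y n \<mu>) (snd z)) + I q1 (fst z) * I q2 (snd z)" for z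
  proof -
    define u where "u \<mu> = periodize (\<lambda>x. ker l q1 x (fst z)) (node_x n \<mu>)" for \<mu>
    define v where "v \<mu> = periodize (\<lambda>x. ker l q2 x (snd z)) (node_y n \<mu>)" for \<mu>
    define s where "s = integral {0..1} (\<lambda>x. ker l q1 x (fst z))"
    define t where "t = integral {0..1} (\<lambda>x. ker l q2 x (snd z))"
    have "\<bar>ker_err l n q1 q2 z\<bar> \<le> \<bar>(\<Sum>\<mu><fib (Suc n). u \<mu> * v \<mu>) / b\<bar> + \<bar>s * t\<bar>"
      unfolding ker_err_eq[OF l] u_def v_def s_def t_def b_def by (rule abs_triangle_ineq4)
    also have "\<dots> \<le> 1 / b * (\<Sum>\<mu><fib (Suc n). \<bar>u \<mu>\<bar> * \<bar>v \<mu>\<bar>) + \<bar>s\<bar> * \<bar>t\<bar>"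
      using b sum_abs[of "\<lambda>\<mu>. u \<mu> * v \<mu>" "{..<fib (Suc n)}"] by (simp add: abs_mult divide_right_mono)
    finally have "ennreal \<bar>ker_err l n q1 q2 z\<bar> \<le> ennreal (1 / b * (\<Sum>\<mu><fib (Suc n). \<bar>u \<mu>\<bar> * \<bar>v \<mu>\<bar>) + \<bar>s\<bar> * \<bar>t\<bar>)"
      by (rule ennreal_leI)
    also have "\<dots> = ennreal (1 / b) * (\<Sum>\<mu><fib (Suc n). ennreal \<bar>u \<mu>\<bar> * ennreal \<bar>v \<mu>\<bar>) + ennreal \<bar>s\<bar> * ennreal \<bar>t\<bar>"
    proof -
      have "ennreal (\<Sum>\<mu><fib (Suc n). \<bar>u \<mu>\<bar> * \<bar>v \<mu>\<bar>) = (\<Sum>\<mu><fib (Suc n). ennreal \<bar>u \<mu>\<bar> * ennreal \<bar>v \<mu>\<bar>)"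
        by (simp add: sum_ennreal[symmetric] ennreal_mult)
      moreover have "ennreal (1 / b * t + \<bar>s\<bar> * \<bar>t'\<bar>) = ennreal (1 / b) * ennreal t + ennreal \<bar>s\<bar> * ennreal \<bar>t'\<bar>" if "t \<ge> 0" for t t'
        using b that by (simp only: ennreal_plus ennreal_mult mult_nonneg_nonneg abs_ge_zero divide_nonneg_pos zero_le_one)
      ultimately show ?thesis by (simp add: sum_nonneg)
    qed
    finally show ?thesis unfolding u_def v_def s_def t_def P_def I_def .
  qed
  then have "(\<integral>\<^sup>+z. ennreal \<bar>ker_err l n q1 q2 z\<bar> \<partial>lborel)
     \<le> (\<integral>\<^sup>+z. ennreal (1 / b) * (\<Sum>\<mu><fib (Suc n). P q1 (node_x n \<mu>) (fst z) * P q2 (node_y n \<mu>) (snd z)) + I q1 (fst z) * I q2 (snd z) \<partial>lborel)"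
    by (intro nn_integral_mono) auto
  also have "\<dots> = ennreal (1 / b) * (\<Sum>\<mu><fib (Suc n). \<integral>\<^sup>+z. P q1 (node_x n \<mu>) (fst z) * P q2 (node_y n \<mu>) (snd z) \<partial>lborel) + (\<integral>\<^sup>+z. I q1 (fst z) * I q2 (snd z) \<partial>lborel)"
    using mPP mII by (subst nn_integral_add) (auto simp: nn_integral_cmult nn_integral_sum)
  also have "\<dots> \<le> ennreal (1 / b) * (\<Sum>\<mu><fib (Suc n). ennreal (12 * K) * ennreal (12 * K)) + ennreal (4 * K) * ennreal (4 * K)"
    unfolding nn_integral_prod[OF mP mP] nn_integral_prod[OF mI mI]
    unfolding P_def I_def
    by (intro add_mono mult_left_mono sum_mono mult_mono periodize_ker_mass[OF l K] ker_integral_mass[OF l K] node_x_node_y_in) auto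
  also have "\<dots> = ennreal (1 / b * (b * (12 * K * (12 * K))) + 4 * K * (4 * K))"
  proof -
    have "(\<Sum>\<mu><fib (Suc n). ennreal x * ennreal x) = ennreal (b * (x * x))" if "x \<ge> 0" for x
      using that by (simp add: b_def ennreal_mult ennreal_of_nat_eq_real_of_nat)
    moreover have "ennreal (1 / b) * ennreal t + ennreal s * ennreal s = ennreal (1 / b * t + s * s)" if "t \<ge> 0" "s \<ge> 0" for t s
      using b that by (simp only: ennreal_plus ennreal_mult mult_nonneg_nonneg divide_nonneg_pos zero_le_one)
    ultimately show ?thesis using K b by (simp flip: ennreal_plus)
  qed
  also have "1 / b * (b * (12 * K * (12 * K))) + 4 * K * (4 * K) = 160 * K\<^sup>2" using b by (simp add: power2_eq_square)
  finally show ?thesis .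
qed

text \<open>Divided by K 4^q, the kernel at z is a function of x smooth at scale 2^q and supported
  within 2^-q of the base point, so \<open>tensor_err_local\<close> applies with A = 1.\<close>

lemma ker_err_sup:
  assumes l: "l > 0" and K: "K > 0" "\<And>q z. scaled_C2 (2 ^ q) (K * 4 ^ q) (\<lambda>x. ker l q x z)" and \<gamma>: "0 < \<gamma>" "\<gamma> < 1"
  obtains C where "C > 0" "\<And>n q1 q2 z. \<bar>ker_err l n q1 q2 z\<bar>
      \<le> C * 4 ^ (q1 + q2) / real (fib (Suc n)) * (2 ^ (q1 + q2) / real (fib (Suc n))) powr \<gamma>"
proof (rule tensor_err_local[OF \<gamma>, of 1])
  fix C :: real assume C: "C > 0" and
    loc: "\<And>n q1 q2 F G c1 c2. scaled_C2 (2 ^ q1) 1 F \<Longrightarrow> (\<And>x. x \<in> {0..1} \<Longrightarrow> F x \<noteq> 0 \<Longrightarrow> \<bar>x - c1\<bar> \<le> 1 / 2 ^ q1) \<Longrightarrow>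
       scaled_C2 (2 ^ q2) 1 G \<Longrightarrow> (\<And>x. x \<in> {0..1} \<Longrightarrow> G x \<noteq> 0 \<Longrightarrow> \<bar>x - c2\<bar> \<le> 1 / 2 ^ q2) \<Longrightarrow>
       \<bar>tensor_err n F G\<bar> \<le> C / real (fib (Suc n)) * (2 ^ (q1 + q2) / real (fib (Suc n))) powr \<gamma>"
  show thesis
  proof (rule that[of "K\<^sup>2 * C"])
    fix n q1 q2 z
    define k where "k q w x = ker l q x w / (K * 4 ^ q)" for q w x
    have k: "scaled_C2 (2 ^ q) 1 (k q w)" for q w
    proof -
      have Kq: "K * 4 ^ q > 0" using K by simp
      have e: "k q w x - k q w y = (ker l q x w - ker l q y w) / (K * 4 ^ q)"
        "k q w (x + h) - 2 * k q w x + k q w (x - h) = (ker l q (x + h) w - 2 * ker l q x w + ker l q (x - h) w) / (K * 4 ^ q)" for x y h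
        by (simp_all add: k_def diff_divide_distrib add_divide_distrib)
      show ?thesis unfolding scaled_C2_def e
        using smD(1-3)[OF K(2)[of q w]] Kq K(1) by (simp add: k_def divide_le_eq abs_mult mult_ac)
    qed
    have s: "x \<in> {0..1} \<Longrightarrow> k q w x \<noteq> 0 \<Longrightarrow> \<bar>x - fst w\<bar> \<le> 1 / 2 ^ q" for q w x
      using ker_region(1)[OF l, of x q "fst w" "snd w"] by (simp add: k_def)
    have c: "continuous_on {0..1} (k q w)" for q w
      unfolding k_def using l K by (intro continuous_intros) auto
    \<comment> \<open>The scalar multiple is written in the shape F + c G for which linearity of
      \<open>tensor_err\<close> is stated.\<close>
    have sc: "ker l q x w = k q w x + (K * 4 ^ q - 1) * k q w x" for q w x
      using K by (simp add: k_def field_simps)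
    have "ker_err l n q1 q2 z = K * 4 ^ q1 * (K * 4 ^ q2 * tensor_err n (k q1 (fst z)) (k q2 (snd z)))"
      unfolding ker_err_def sc[abs_def] sc
      by (simp only: tensor_err_linear1[OF c c] tensor_err_linear2[OF c c]) (simp add: algebra_simps)
    then have "\<bar>ker_err l n q1 q2 z\<bar> = K\<^sup>2 * 4 ^ (q1 + q2) * \<bar>tensor_err n (k q1 (fst z)) (k q2 (snd z))\<bar>"
      using K by (simp add: abs_mult power2_eq_square power_add mult_ac)
    also have "\<dots> \<le> K\<^sup>2 * 4 ^ (q1 + q2) * (C / real (fib (Suc n)) * (2 ^ (q1 + q2) / real (fib (Suc n))) powr \<gamma>)"
      using K by (intro mult_left_mono loc[OF k s[where w = "fst z"] k s[where w = "snd z"]]) auto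
    finally show "\<bar>ker_err l n q1 q2 z\<bar>
      \<le> K\<^sup>2 * C * 4 ^ (q1 + q2) / real (fib (Suc n)) * (2 ^ (q1 + q2) / real (fib (Suc n))) powr \<gamma>"
      by (simp add: mult_ac)
  qed (use C K in auto)
qed auto

text \<open>A modulus of smoothness controls differences as functions of the base point for each
  fixed step. Fubini therefore moves the two steps outside, where they fill a rectangle of area
  4/2^(q1+q2).\<close>

lemma kernel_region_integral_bound:
  fixes g :: "(real \<times> real) \<times> (real \<times> real) \<Rightarrow> ennreal"
  assumes g: "g \<in> borel_measurable borel"
    and hyp: "\<And>w1 w2. \<bar>w1\<bar> \<le> 1 / 2 ^ q1 \<Longrightarrow> \<bar>w2\<bar> \<le> 1 / 2 ^ q2 \<Longrightarrow> (\<integral>\<^sup>+y. g ((fst y, w1), (snd y, w2)) \<partial>lborel) \<le> ennreal B"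
    and supp: "\<And>y1 w1 y2 w2. g ((y1, w1), (y2, w2)) \<noteq> 0 \<Longrightarrow> \<bar>w1\<bar> \<le> 1 / 2 ^ q1 \<and> \<bar>w2\<bar> \<le> 1 / 2 ^ q2"
    and B: "B \<ge> 0"
  shows "(\<integral>\<^sup>+z. g z \<partial>lborel) \<le> ennreal (4 / 2 ^ (q1 + q2) * B)"
proof -
  have m [measurable]: "g \<in> borel_measurable ((borel \<Otimes>\<^sub>M borel) \<Otimes>\<^sub>M (borel \<Otimes>\<^sub>M borel))"
    using g by (simp add: borel_prod)
  have fst2: "(\<integral>\<^sup>+u. h u \<partial>lborel) = (\<integral>\<^sup>+x. \<integral>\<^sup>+y. h (x, y) \<partial>lborel \<partial>lborel)"
    if "h \<in> borel_measurable (borel \<Otimes>\<^sub>M borel)" for h :: "'a::euclidean_space \<times> 'b::euclidean_space \<Rightarrow> ennreal"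
  proof -
    have "h \<in> borel_measurable (lborel \<Otimes>\<^sub>M lborel)" using that by (simp add: lborel_prod borel_prod)
    from lborel.nn_integral_fst[OF this] show ?thesis by (simp add: lborel_prod)
  qed
  have gm: "g \<in> borel_measurable (borel \<Otimes>\<^sub>M borel)" using g by (simp add: borel_prod)
  have sl: "(\<lambda>z2. g (z1, z2)) \<in> borel_measurable (borel \<Otimes>\<^sub>M borel)" for z1
  proof -
    have "(\<lambda>z2. g ((fst z1, snd z1), z2)) \<in> borel_measurable (borel \<Otimes>\<^sub>M borel)" by measurable
    then show ?thesis by simp
  qed
  have "(\<integral>\<^sup>+z. g z \<partial>lborel) = (\<integral>\<^sup>+z1. \<integral>\<^sup>+z2. g (z1, z2) \<partial>lborel \<partial>lborel)"
    by (rule fst2[OF gm])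
  also have "\<dots> = (\<integral>\<^sup>+z1. \<integral>\<^sup>+y2. \<integral>\<^sup>+w2. g (z1, (y2, w2)) \<partial>lborel \<partial>lborel \<partial>lborel)"
    by (intro nn_integral_cong fst2 sl)
  also have "\<dots> = (\<integral>\<^sup>+y1. \<integral>\<^sup>+w1. \<integral>\<^sup>+y2. \<integral>\<^sup>+w2. g ((y1, w1), (y2, w2)) \<partial>lborel \<partial>lborel \<partial>lborel \<partial>lborel)"
    by (intro fst2) measurable
  also have "\<dots> = (\<integral>\<^sup>+w1. \<integral>\<^sup>+y1. \<integral>\<^sup>+y2. \<integral>\<^sup>+w2. g ((y1, w1), (y2, w2)) \<partial>lborel \<partial>lborel \<partial>lborel \<partial>lborel)"
    by (rule lborel_pair.Fubini') measurable
  also have "\<dots> = (\<integral>\<^sup>+w1. \<integral>\<^sup>+y1. \<integral>\<^sup>+w2. \<integral>\<^sup>+y2. g ((y1, w1), (y2, w2)) \<partial>lborel \<partial>lborel \<partial>lborel \<partial>lborel)"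
    by (intro nn_integral_cong lborel_pair.Fubini') measurable
  also have "\<dots> = (\<integral>\<^sup>+w1. \<integral>\<^sup>+w2. \<integral>\<^sup>+y1. \<integral>\<^sup>+y2. g ((y1, w1), (y2, w2)) \<partial>lborel \<partial>lborel \<partial>lborel \<partial>lborel)"
    by (intro nn_integral_cong lborel_pair.Fubini') measurable
  also have "\<dots> = (\<integral>\<^sup>+w1. \<integral>\<^sup>+w2. \<integral>\<^sup>+y. g ((fst y, w1), (snd y, w2)) \<partial>lborel \<partial>lborel \<partial>lborel)"
    by (intro nn_integral_cong) (subst fst2; measurable)
  also have "\<dots> \<le> (\<integral>\<^sup>+(w1::real). \<integral>\<^sup>+(w2::real). ennreal B * indicator {- 1 / 2 ^ q1..1 / 2 ^ q1} w1 * indicator {- 1 / 2 ^ q2..1 / 2 ^ q2} w2 \<partial>lborel \<partial>lborel)"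
  proof (intro nn_integral_mono)
    fix w1 w2 :: real
    show "(\<integral>\<^sup>+y. g ((fst y, w1), (snd y, w2)) \<partial>lborel) \<le> ennreal B * indicator {- 1 / 2 ^ q1..1 / 2 ^ q1} w1 * indicator {- 1 / 2 ^ q2..1 / 2 ^ q2} w2"
    proof (cases "\<bar>w1\<bar> \<le> 1 / 2 ^ q1 \<and> \<bar>w2\<bar> \<le> 1 / 2 ^ q2")
      case True
      then have "w1 \<in> {- 1 / 2 ^ q1..1 / 2 ^ q1}" "w2 \<in> {- 1 / 2 ^ q2..1 / 2 ^ q2}" by (auto simp: abs_le_iff)
      then show ?thesis using hyp[of w1 w2] True by simp
    next
      case False
      then have "g ((fst y, w1), (snd y, w2)) = 0" for y using supp[of "fst y" w1 "snd y" w2] by blast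
      then show ?thesis by simp
    qed
  qed
  also have "\<dots> = ennreal B * ennreal (2 / 2 ^ q1) * ennreal (2 / 2 ^ q2)"
    by (simp add: nn_integral_cmult nn_integral_multc mult_ac)
  also have "\<dots> = ennreal (4 / 2 ^ (q1 + q2) * B)"
    using B by (simp add: power_add mult_ac flip: ennreal_mult)
  finally show ?thesis .
qed

lemma ker_err_mass_sup:
  assumes l: "l > 0" and S: "\<And>z. \<bar>ker_err l n q1 q2 z\<bar> \<le> S"
  shows "(\<integral>\<^sup>+z. ennreal \<bar>ker_err l n q1 q2 z\<bar> \<partial>lborel) \<le> ennreal (4 / 2 ^ (q1 + q2) * S)"
proof -
  have S0: "S \<ge> 0" using S by (rule order_trans[OF abs_ge_zero])
  have "(\<integral>\<^sup>+z. ennreal \<bar>ker_err l n q1 q2 z\<bar> \<partial>lborel) \<le> (\<integral>\<^sup>+z. ennreal S * indicator (kernel_region l q1) (fst z) * indicator (kernel_region l q2) (snd z) \<partial>lborel)"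
  proof (rule nn_integral_mono)
    fix z
    show "ennreal \<bar>ker_err l n q1 q2 z\<bar> \<le> ennreal S * indicator (kernel_region l q1) (fst z) * indicator (kernel_region l q2) (snd z)"
      using S[of z] ker_err_kernel_region[OF l, of n q1 q2 z] by (cases "ker_err l n q1 q2 z = 0") (auto intro: ennreal_leI)
  qed
  also have "\<dots> = (\<integral>\<^sup>+z. ennreal S * indicator (kernel_region l q1) z \<partial>lborel) * (\<integral>\<^sup>+z. indicator (kernel_region l q2) z \<partial>lborel)"
    by (rule nn_integral_prod) measurable
  also have "\<dots> = ennreal S * emeasure lborel (kernel_region l q1) * emeasure lborel (kernel_region l q2)"
    by (simp add: nn_integral_cmult_indicator)
  also have "\<dots> \<le> ennreal S * ennreal (2 / 2 ^ q1) * ennreal (2 / 2 ^ q2)"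
    by (intro mult_mono emeasure_kernel_region) auto
  also have "\<dots> = ennreal (4 / 2 ^ (q1 + q2) * S)"
    using S0 by (simp add: power_add mult_ac flip: ennreal_mult)
  finally show ?thesis .
qed

text \<open>The exponent is a real number of its own, so that a finite one can stand in when the p
  of the Besov space is infinite. At level 0 the step is a dummy, hence no condition on it in the
  premises.\<close>

definition mixed_level_diff_bound :: "real \<Rightarrow> nat \<Rightarrow> nat \<Rightarrow> nat \<Rightarrow> (real \<times> real \<Rightarrow> complex) \<Rightarrow> real \<Rightarrow> bool" where
  "mixed_level_diff_bound p l q1 q2 f M \<longleftrightarrow> (\<forall>w1 w2. (q1 \<noteq> 0 \<longrightarrow> \<bar>w1\<bar> < 1 / 2 ^ Suc q1) \<longrightarrow> (q2 \<noteq> 0 \<longrightarrow> \<bar>w2\<bar> < 1 / 2 ^ Suc q2) \<longrightarrow>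
     (\<integral>\<^sup>+y. indicator (kernel_region l q1) (fst y, w1) * indicator (kernel_region l q2) (snd y, w2) *
        ennreal (norm (mixed_level_diff l q1 q2 f ((fst y, w1), (snd y, w2))) powr p) \<partial>lborel) \<le> ennreal (M powr p))"

lemma mixed_level_diff_kernel_region_integral:
  assumes f: "continuous_on UNIV f" and h: "mixed_level_diff_bound p l q1 q2 f M"
  shows "(\<integral>\<^sup>+z. indicator (kernel_region l q1 \<times> kernel_region l q2) z * ennreal (norm (mixed_level_diff l q1 q2 f z) powr p) \<partial>lborel) \<le> ennreal (4 / 2 ^ (q1 + q2) * M powr p)"
proof (rule kernel_region_integral_bound)
  have [measurable]: "mixed_level_diff l q1 q2 f \<in> borel_measurable borel"
    by (intro borel_measurable_continuous_onI continuous_on_mixed_level_diff f continuous_on_id)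
  have [measurable]: "kernel_region l q1 \<times> kernel_region l q2 \<in> sets borel" by (intro borel_Times) auto
  show "(\<lambda>z. indicator (kernel_region l q1 \<times> kernel_region l q2) z * ennreal (norm (mixed_level_diff l q1 q2 f z) powr p)) \<in> borel_measurable borel"
    by measurable
next
  fix w1 w2
  show "(\<integral>\<^sup>+y. indicator (kernel_region l q1 \<times> kernel_region l q2) ((fst y, w1), snd y, w2) * ennreal (norm (mixed_level_diff l q1 q2 f ((fst y, w1), snd y, w2)) powr p) \<partial>lborel) \<le> ennreal (M powr p)"
  proof (cases "(q1 \<noteq> 0 \<longrightarrow> \<bar>w1\<bar> < 1 / 2 ^ Suc q1) \<and> (q2 \<noteq> 0 \<longrightarrow> \<bar>w2\<bar> < 1 / 2 ^ Suc q2)")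
    case True
    then show ?thesis using h unfolding mixed_level_diff_bound_def indicator_times by simp
  next
    case False
    then have "((y1, w1), y2, w2) \<notin> kernel_region l q1 \<times> kernel_region l q2" for y1 y2 by (auto simp: kernel_region_def)
    then show ?thesis by simp
  qed
next
  fix y1 w1 y2 w2 :: real
  assume "indicator (kernel_region l q1 \<times> kernel_region l q2) ((y1, w1), y2, w2) * ennreal (norm (mixed_level_diff l q1 q2 f ((y1, w1), y2, w2)) powr p) \<noteq> 0"
  then have "((y1, w1), y2, w2) \<in> kernel_region l q1 \<times> kernel_region l q2" by (metis indicator_simps(2) mult_zero_left)
  then show "\<bar>w1\<bar> \<le> 1 / 2 ^ q1 \<and> \<bar>w2\<bar> \<le> 1 / 2 ^ q2" by (auto simp: kernel_region_def)
qed auto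

text \<open>The supremum 4^(q1+q2) R^\<gamma>/b times the volume 4/2^(q1+q2) is of order
  R^(1+\<gamma>). This product occurs in the term with the p-th moment; the mass in the other term
  is the smaller of it and the uniform bound of \<open>ker_err_mass\<close>.\<close>

lemma layer_error_split:
  assumes l: "l > 0" and \<gamma>: "0 < \<gamma>" "\<gamma> < 1"
  obtains C where "C > 0" "\<And>n q1 q2 f M p \<epsilon>. continuous_on UNIV f \<Longrightarrow> mixed_level_diff_bound p l q1 q2 f M \<Longrightarrow> p \<ge> 1 \<Longrightarrow> \<epsilon> > 0 \<Longrightarrow>
     norm (fib_cubature n (layer l q1 q2 f) - square_integral (layer l q1 q2 f))
     \<le> C * (\<epsilon> powr (1 - p) * M powr p * (2 ^ (q1 + q2) / real (fib (Suc n))) powr (1 + \<gamma>)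
          + \<epsilon> * min 1 ((2 ^ (q1 + q2) / real (fib (Suc n))) powr (1 + \<gamma>)))"
proof (rule scaled_C2_ker[OF l])
  fix K :: real assume K: "K > 0" "\<And>q z. scaled_C2 (2 ^ q) (K * 4 ^ q) (\<lambda>x. ker l q x z)"
  show thesis
  proof (rule ker_err_sup[OF l K \<gamma>])
    fix C0 :: real assume C0: "C0 > 0" and sup: "\<And>n q1 q2 z. \<bar>ker_err l n q1 q2 z\<bar>
      \<le> C0 * 4 ^ (q1 + q2) / real (fib (Suc n)) * (2 ^ (q1 + q2) / real (fib (Suc n))) powr \<gamma>"
    define C where "C = max (4 * C0) (160 * K\<^sup>2)"
    show thesis
    proof (rule that)
      show "C > 0" using C0 by (simp add: C_def)
      fix n q1 q2 f and M p \<epsilon> :: real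
      assume f: "continuous_on UNIV f" and h: "mixed_level_diff_bound p l q1 q2 f M" and p: "p \<ge> 1" and \<epsilon>: "\<epsilon> > 0"
      define b where "b = real (fib (Suc n))"
      have b: "b > 0" unfolding b_def using fib_Suc_pos[of n] by simp
      define R where "R = 2 ^ (q1 + q2) / b"
      have R: "R > 0" using b by (simp add: R_def)
      define S where "S = C0 * 4 ^ (q1 + q2) / b * R powr \<gamma>"
      define V where "V = 4 / 2 ^ (q1 + q2) * M powr p"
      have SV: "S * (4 / 2 ^ (q1 + q2)) = 4 * C0 * R powr (1 + \<gamma>)"
      proof -
        have "(4::real) ^ (q1 + q2) = 2 ^ (q1 + q2) * 2 ^ (q1 + q2)" by (simp flip: power_mult_distrib)
        then show ?thesis using b R by (simp add: S_def powr_add R_def field_simps)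
      qed
      define A where "A = C * min 1 (R powr (1 + \<gamma>))"
      have mass: "(\<integral>\<^sup>+z. ennreal \<bar>ker_err l n q1 q2 z\<bar> \<partial>lborel) \<le> ennreal A"
      proof -
        have "(\<integral>\<^sup>+z. ennreal \<bar>ker_err l n q1 q2 z\<bar> \<partial>lborel) \<le> ennreal (C * 1)"
          by (rule order_trans[OF ker_err_mass[OF l K]]) (auto simp: C_def intro: ennreal_leI)
        moreover have "(\<integral>\<^sup>+z. ennreal \<bar>ker_err l n q1 q2 z\<bar> \<partial>lborel) \<le> ennreal (C * R powr (1 + \<gamma>))"
        proof (rule order_trans[OF ker_err_mass_sup[OF l]])
          show "\<bar>ker_err l n q1 q2 z\<bar> \<le> S" for z unfolding S_def R_def b_def by (rule sup)
          have "4 / 2 ^ (q1 + q2) * S = 4 * C0 * R powr (1 + \<gamma>)" using SV by (simp only: mult.commute)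
          also have "\<dots> \<le> C * R powr (1 + \<gamma>)" by (intro mult_right_mono) (auto simp: C_def)
          finally show "ennreal (4 / 2 ^ (q1 + q2) * S) \<le> ennreal (C * R powr (1 + \<gamma>))" by (rule ennreal_leI)
        qed
        ultimately show ?thesis unfolding A_def by (cases "1 \<le> R powr (1 + \<gamma>)") (simp_all add: min_def)
      qed
      have C: "C > 0" using C0 by (simp add: C_def)
      have "norm (\<integral>z. ker_err l n q1 q2 z *\<^sub>R mixed_level_diff l q1 q2 f z \<partial>lborel) \<le> \<epsilon> powr (1 - p) * S * V + \<epsilon> * A"
      proof (rule weighted_integral_bound[OF p \<epsilon>, where Z = "kernel_region l q1 \<times> kernel_region l q2"])
        show "integrable lborel (\<lambda>z. ker_err l n q1 q2 z *\<^sub>R mixed_level_diff l q1 q2 f z)"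
          unfolding ker_err_def by (rule layer_error(2)[OF l f])
        show "ker_err l n q1 q2 \<in> borel_measurable lborel" using ker_err_measurable[OF l] by simp
        show "mixed_level_diff l q1 q2 f \<in> borel_measurable lborel"
          by (simp, intro borel_measurable_continuous_onI continuous_on_mixed_level_diff f continuous_on_id)
        show "kernel_region l q1 \<times> kernel_region l q2 \<in> sets lborel" by (simp, intro borel_Times) auto
        show "\<bar>ker_err l n q1 q2 z\<bar> \<le> S" for z unfolding S_def R_def b_def by (rule sup)
        show "z \<in> kernel_region l q1 \<times> kernel_region l q2" if "ker_err l n q1 q2 z \<noteq> 0" for z
          using ker_err_kernel_region[OF l that] by (cases z) auto
        show "(\<integral>\<^sup>+z. indicator (kernel_region l q1 \<times> kernel_region l q2) z * ennreal (norm (mixed_level_diff l q1 q2 f z) powr p) \<partial>lborel) \<le> ennreal V"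
          unfolding V_def by (rule mixed_level_diff_kernel_region_integral[OF f h])
        show "V \<ge> 0" by (simp add: V_def)
        show "A \<ge> 0" using C by (simp add: A_def)
      qed (rule mass)
      also have "\<epsilon> powr (1 - p) * S * V = \<epsilon> powr (1 - p) * M powr p * (S * (4 / 2 ^ (q1 + q2)))"
        by (simp add: V_def mult_ac)
      also have "\<dots> \<le> \<epsilon> powr (1 - p) * M powr p * (C * R powr (1 + \<gamma>))"
        unfolding SV by (intro mult_left_mono mult_right_mono) (auto simp: C_def)
      finally have "norm (\<integral>z. ker_err l n q1 q2 z *\<^sub>R mixed_level_diff l q1 q2 f z \<partial>lborel)
        \<le> C * (\<epsilon> powr (1 - p) * M powr p * R powr (1 + \<gamma>) + \<epsilon> * min 1 (R powr (1 + \<gamma>)))"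
        by (simp add: A_def algebra_simps)
      then show "norm (fib_cubature n (layer l q1 q2 f) - square_integral (layer l q1 q2 f))
     \<le> C * (\<epsilon> powr (1 - p) * M powr p * (2 ^ (q1 + q2) / real (fib (Suc n))) powr (1 + \<gamma>)
          + \<epsilon> * min 1 ((2 ^ (q1 + q2) / real (fib (Suc n))) powr (1 + \<gamma>)))"
        unfolding layer_error(1)[OF l f] ker_err_def R_def b_def .
    qed
  qed
qed

text \<open>Two choices of \<epsilon>. With \<epsilon> = M both terms are of order M R^(1+\<gamma>),
  which is the better bound for R <= 1. With \<epsilon> = M R^((1+\<gamma>)/p) the term with the
  p-th moment equals \<epsilon>, and bounding the minimum by 1 gives the better bound for R >=
  1.\<close>

lemma layer_error_bound:
  assumes l: "l > 0" and \<gamma>: "0 < \<gamma>" "\<gamma> < 1"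
  obtains C where "C > 0" "\<And>n q1 q2 f M p. continuous_on UNIV f \<Longrightarrow> mixed_level_diff_bound p l q1 q2 f M \<Longrightarrow> p \<ge> 1 \<Longrightarrow> M \<ge> 0 \<Longrightarrow>
     norm (fib_cubature n (layer l q1 q2 f) - square_integral (layer l q1 q2 f))
     \<le> C * M * min ((2 ^ (q1 + q2) / real (fib (Suc n))) powr (1 + \<gamma>)) ((2 ^ (q1 + q2) / real (fib (Suc n))) powr ((1 + \<gamma>) / p))"
proof (rule layer_error_split[OF l \<gamma>])
  fix C :: real assume C: "C > 0" and
    split: "\<And>n q1 q2 f M p \<epsilon>. continuous_on UNIV f \<Longrightarrow> mixed_level_diff_bound p l q1 q2 f M \<Longrightarrow> p \<ge> 1 \<Longrightarrow> \<epsilon> > 0 \<Longrightarrow>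
     norm (fib_cubature n (layer l q1 q2 f) - square_integral (layer l q1 q2 f))
     \<le> C * (\<epsilon> powr (1 - p) * M powr p * (2 ^ (q1 + q2) / real (fib (Suc n))) powr (1 + \<gamma>)
          + \<epsilon> * min 1 ((2 ^ (q1 + q2) / real (fib (Suc n))) powr (1 + \<gamma>)))"
  show thesis
  proof (rule that[of "2 * C"])
    fix n q1 q2 f and M p :: real
    assume f: "continuous_on UNIV f" and h: "mixed_level_diff_bound p l q1 q2 f M" and p: "p \<ge> 1" and M: "M \<ge> 0"
    define R where "R = 2 ^ (q1 + q2) / real (fib (Suc n))"
    have R: "R > 0" using fib_Suc_pos[of n] by (simp add: R_def)
    define e where "e = norm (fib_cubature n (layer l q1 q2 f) - square_integral (layer l q1 q2 f))"
    have sp: "e \<le> C * (\<epsilon> powr (1 - p) * M powr p * R powr (1 + \<gamma>) + \<epsilon> * min 1 (R powr (1 + \<gamma>)))" if "\<epsilon> > 0" for \<epsilon>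
      unfolding e_def R_def by (rule split[OF f h p that])
    have "e \<le> 2 * C * M * min (R powr (1 + \<gamma>)) (R powr ((1 + \<gamma>) / p))"
    \<comment> \<open>Neither choice of \<epsilon> is positive for M = 0; there only the term with
      \<epsilon> remains, and letting it tend to 0 shows that the error is 0.\<close>
    proof (cases "M = 0")
      case True
      have "e \<le> 0 + \<epsilon>" if "\<epsilon> > 0" for \<epsilon>
      proof -
        have "e \<le> C * (\<epsilon> / C * min 1 (R powr (1 + \<gamma>)))" using sp[of "\<epsilon> / C"] True C that by simp
        also have "\<dots> \<le> C * (\<epsilon> / C * 1)" using C that by (intro mult_left_mono) auto
        finally show ?thesis using C by simp
      qed
      then have "e \<le> 0" by (rule field_le_epsilon)
      then show ?thesis using True by simp
    next
      case False
      then have M: "M > 0" using M by simp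
      have "e \<le> C * (M powr (1 - p) * M powr p * R powr (1 + \<gamma>) + M * min 1 (R powr (1 + \<gamma>)))"
        by (rule sp[OF M])
      also have "M powr (1 - p) * M powr p = M" using M by (simp flip: powr_add)
      also have "C * (M * R powr (1 + \<gamma>) + M * min 1 (R powr (1 + \<gamma>))) \<le> C * (M * R powr (1 + \<gamma>) + M * R powr (1 + \<gamma>))"
        using C M by (intro mult_left_mono add_left_mono) auto
      finally have 1: "e \<le> 2 * C * M * R powr (1 + \<gamma>)" by (simp add: algebra_simps)
      define \<epsilon> where "\<epsilon> = M * R powr ((1 + \<gamma>) / p)"
      have \<epsilon>: "\<epsilon> > 0" using M R by (simp add: \<epsilon>_def)
      have "\<epsilon> powr (1 - p) * M powr p * R powr (1 + \<gamma>) = M powr (1 - p) * M powr p * (R powr ((1 + \<gamma>) / p * (1 - p)) * R powr (1 + \<gamma>))"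
        using M R by (simp add: \<epsilon>_def powr_mult powr_powr mult_ac)
      also have "R powr ((1 + \<gamma>) / p * (1 - p)) * R powr (1 + \<gamma>) = R powr ((1 + \<gamma>) / p)"
      proof -
        have "(1 + \<gamma>) / p * (1 - p) + (1 + \<gamma>) = (1 + \<gamma>) / p" using p by (simp add: field_simps)
        then show ?thesis by (simp only: powr_add[symmetric])
      qed
      also have "M powr (1 - p) * M powr p = M" using M by (simp flip: powr_add)
      finally have eps: "\<epsilon> powr (1 - p) * M powr p * R powr (1 + \<gamma>) = \<epsilon>" by (simp add: \<epsilon>_def)
      have "e \<le> C * (\<epsilon> + \<epsilon> * min 1 (R powr (1 + \<gamma>)))" using sp[OF \<epsilon>] unfolding eps .
      also have "\<dots> \<le> C * (\<epsilon> + \<epsilon> * 1)" using C \<epsilon> by (intro mult_left_mono add_left_mono) auto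
      finally have 2: "e \<le> 2 * C * M * R powr ((1 + \<gamma>) / p)" by (simp add: \<epsilon>_def)
      show ?thesis using 1 2 by (simp add: min_def)
    qed
    then show "norm (fib_cubature n (layer l q1 q2 f) - square_integral (layer l q1 q2 f))
     \<le> 2 * C * M * min ((2 ^ (q1 + q2) / real (fib (Suc n))) powr (1 + \<gamma>)) ((2 ^ (q1 + q2) / real (fib (Suc n))) powr ((1 + \<gamma>) / p))"
      unfolding e_def R_def .
  qed (use C in auto)
qed

section \<open>Summation over the layers\<close>

definition clamp :: "real \<Rightarrow> real" where
  "clamp x = max 0 (min 1 x)"

text \<open>Provides the continuity on the whole plane that the preceding statements assume. The
  particular extension is immaterial: where the kernels do not vanish, f is evaluated inside the
  square.\<close>

definition clamp2 :: "(real \<times> real \<Rightarrow> complex) \<Rightarrow> real \<times> real \<Rightarrow> complex" where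
  "clamp2 f u = f (clamp (fst u), clamp (snd u))"

lemma clamp_in: "clamp x \<in> {0..1}" and clamp_id: "x \<in> {0..1} \<Longrightarrow> clamp x = x"
  by (auto simp: clamp_def)

lemma clamp2_id: "x \<in> {0..1} \<Longrightarrow> y \<in> {0..1} \<Longrightarrow> clamp2 f (x, y) = f (x, y)"
  by (simp add: clamp2_def clamp_id)

lemma continuous_on_clamp2:
  assumes "continuous_on unit_square f" shows "continuous_on UNIV (clamp2 f)"
proof -
  have "continuous_on UNIV (\<lambda>u::real \<times> real. (clamp (fst u), clamp (snd u)))"
    unfolding clamp_def by (intro continuous_intros)
  then show ?thesis unfolding clamp2_def
    using clamp_in by (intro continuous_on_compose2[OF assms]) auto
qed

lemma segment_in_unit:
  fixes y w :: real
  assumes "y \<in> {0..1}" "y + real l * w \<in> {0..1}" "j \<le> l"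
  shows "y + real j * w \<in> {0..1}"
proof (cases "w \<ge> 0")
  case True
  then have "real j * w \<le> real l * w" "0 \<le> real j * w" using assms(3) by (auto intro: mult_right_mono)
  then show ?thesis using assms by auto
next
  case False
  then have "real l * w \<le> real j * w" "real j * w \<le> 0"
    using assms(3) by (auto intro: mult_right_mono_neg mult_nonneg_nonpos)
  then show ?thesis using assms by auto
qed

lemma finite_difference_udiff:
  assumes "y \<in> {0..1}" "y + real l * w \<in> {0..1}" "\<And>u. u \<in> {0..1} \<Longrightarrow> g u = h u"
  shows "finite_difference l w g y = udiff l w h y"
proof -
  have "g (y + real j * w) = h (y + real j * w)" if "j \<in> {..l}" for j
    using that by (intro assms(3) segment_in_unit[OF assms(1,2)]) simp
  then show ?thesis unfolding finite_difference_def udiff_def if_P[OF conjI[OF assms(1,2)]]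
    by (intro sum.cong refl) simp
qed

lemma udiff_swap:
  "udiff l w1 (\<lambda>u. udiff l w2 (\<lambda>v. g u v) y2) y1 = udiff l w2 (\<lambda>v. udiff l w1 (\<lambda>u. g u v) y1) y2"
proof -
  have "(\<Sum>i\<le>l. a i * (\<Sum>j\<le>l. a j * G i j)) = (\<Sum>j\<le>l. a j * (\<Sum>i\<le>l. a i * G i j))" for a :: "nat \<Rightarrow> complex" and G
  proof -
    have "(\<Sum>i\<le>l. a i * (\<Sum>j\<le>l. a j * G i j)) = (\<Sum>i\<le>l. \<Sum>j\<le>l. a i * (a j * G i j))"
      by (simp only: sum_distrib_left)
    also have "\<dots> = (\<Sum>j\<le>l. \<Sum>i\<le>l. a i * (a j * G i j))" by (rule sum.swap)
    also have "\<dots> = (\<Sum>j\<le>l. a j * (\<Sum>i\<le>l. a i * G i j))"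
      unfolding sum_distrib_left by (intro sum.cong refl) (rule mult.left_commute)
    finally show ?thesis .
  qed
  then show ?thesis unfolding udiff_def .
qed

text \<open>On \<open>kernel_region\<close> the first and last points of each active difference lie
  in [0, 1], hence all of them do: the zero convention of \<open>finite_difference\<close> does not
  apply and clamping changes nothing. The two sides take the directions in opposite orders, which
  \<open>udiff_swap\<close> reconciles.\<close>

lemma mixed_level_diff_mixed_difference:
  assumes "(y1, w1) \<in> kernel_region l q1" "(y2, w2) \<in> kernel_region l q2"
  shows "mixed_level_diff l q1 q2 (clamp2 f) ((y1, w1), (y2, w2)) = mixed_difference l (active_directions q1 q2) (w1, w2) f (y1, y2)"
proof -
  have y: "y1 \<in> {0..1}" "y2 \<in> {0..1}" using assms by (auto simp: kernel_region_def)
  have g1: "y1 + real l * w1 \<in> {0..1}" if "q1 \<noteq> 0" using assms that by (auto simp: kernel_region_def)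
  have g2: "y2 + real l * w2 \<in> {0..1}" if "q2 \<noteq> 0" using assms that by (auto simp: kernel_region_def)
  have D2: "(if q2 \<noteq> 0 then coord_difference l 2 w2 f else f) (u, y2) = level_diff l q2 (y2, w2) (\<lambda>v. clamp2 f (u, v))"
    if "u \<in> {0..1}" for u
    using that y(2) g2 by (auto simp: coord_difference_def level_diff_def clamp2_id intro!: finite_difference_udiff)
  have D1: "mixed_difference l (active_directions q1 q2) (w1, w2) f (y1, y2) = level_diff l q1 (y1, w1) (\<lambda>u. level_diff l q2 (y2, w2) (\<lambda>v. clamp2 f (u, v)))"
  proof -
    have "mixed_difference l (active_directions q1 q2) (w1, w2) f (y1, y2)
      = (if q1 \<noteq> 0 then finite_difference l w1 (\<lambda>u. (if q2 \<noteq> 0 then coord_difference l 2 w2 f else f) (u, y2)) y1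
         else (if q2 \<noteq> 0 then coord_difference l 2 w2 f else f) (y1, y2))"
      by (auto simp: mixed_difference_def active_directions_def coord_def coord_difference_def)
    also have "\<dots> = level_diff l q1 (y1, w1) (\<lambda>u. level_diff l q2 (y2, w2) (\<lambda>v. clamp2 f (u, v)))"
      using finite_difference_udiff[OF y(1) g1 D2] D2[OF y(1)] by (auto simp: level_diff_def)
    finally show ?thesis .
  qed
  have "level_diff l q1 (y1, w1) (\<lambda>u. level_diff l q2 (y2, w2) (\<lambda>v. g (u, v))) = level_diff l q2 (y2, w2) (\<lambda>v. level_diff l q1 (y1, w1) (\<lambda>u. g (u, v)))" for g
    unfolding level_diff_def by (simp add: udiff_swap[of l w1])
  then show ?thesis unfolding D1 mixed_level_diff_def by simp
qed

lemma epowr_le_ennreal: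
  assumes "epowr X (1 / p) \<le> ennreal M" "p > 0" "M \<ge> 0"
  shows "X \<le> ennreal (M powr p)"
proof (cases X)
  case (real x)
  then have "x powr (1 / p) \<le> M" using assms by (simp add: epowr_ennreal)
  then have "(x powr (1 / p)) powr p \<le> M powr p" using assms by (intro powr_mono2) auto
  then show ?thesis using real assms by (simp add: powr_powr ennreal_leI)
next
  case top
  then have "\<infinity> \<le> ennreal M" using assms(1) by (simp add: epowr_def)
  then show ?thesis by (simp add: top_unique)
qed

text \<open>For infinite p the function is essentially bounded by M, and the square has measure 1,
  so every finite moment is bounded by the corresponding power of M.\<close>

lemma Lp_norm_moment:
  assumes D: "Lp_norm p g \<le> ennreal M" and M: "M \<ge> 0" and p: "1 \<le> p"
    and r: "r > 0" "p \<noteq> \<infinity> \<Longrightarrow> r = enn2real p"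
  shows "(\<integral>\<^sup>+z. ennreal (cmod (g z) powr r) \<partial>lebesgue_on unit_square) \<le> ennreal (M powr r)"
proof (cases "p = \<infinity>")
  case False
  then show ?thesis using D r M by (intro epowr_le_ennreal) (auto simp: Lp_norm_def)
next
  case True
  have one: "emeasure (lebesgue_on unit_square) (space (lebesgue_on unit_square)) = 1"
    using unit_square_lebesgue emeasure_rectangle[of 0 1 0 1] by (simp add: emeasure_restrict_space)
  have "AE z in lebesgue_on unit_square. ennreal (cmod (g z)) \<le> esssup (lebesgue_on unit_square) (\<lambda>z. ennreal (cmod (g z)))"
    by (rule esssup_AE)
  then have "AE z in lebesgue_on unit_square. ennreal (cmod (g z) powr r) \<le> ennreal (M powr r)"
  proof (rule AE_mp, intro AE_I2 impI)
    fix z assume "ennreal (cmod (g z)) \<le> esssup (lebesgue_on unit_square) (\<lambda>z. ennreal (cmod (g z)))"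
    also have "\<dots> \<le> ennreal M" using D True by (simp add: Lp_norm_def)
    finally have "cmod (g z) \<le> M" using M by simp
    then show "ennreal (cmod (g z) powr r) \<le> ennreal (M powr r)" using r(1) by (intro ennreal_leI powr_mono2) auto
  qed
  then have "(\<integral>\<^sup>+z. ennreal (cmod (g z) powr r) \<partial>lebesgue_on unit_square) \<le> (\<integral>\<^sup>+z. ennreal (M powr r) \<partial>lebesgue_on unit_square)"
    by (rule nn_integral_mono_AE)
  then show ?thesis using one by simp
qed

lemma mixed_level_diff_bound_modulus:
  assumes p: "1 \<le> p" and r: "r > 0" "p \<noteq> \<infinity> \<Longrightarrow> r = enn2real p"
    and fin: "dyadic_modulus p l f q1 q2 < \<infinity>"
  shows "mixed_level_diff_bound r l q1 q2 (clamp2 f) (enn2real (dyadic_modulus p l f q1 q2))"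
  unfolding mixed_level_diff_bound_def
proof (intro allI impI)
  define M where "M = enn2real (dyadic_modulus p l f q1 q2)"
  fix w1 w2 :: real
  assume w: "q1 \<noteq> 0 \<longrightarrow> \<bar>w1\<bar> < 1 / 2 ^ Suc q1" "q2 \<noteq> 0 \<longrightarrow> \<bar>w2\<bar> < 1 / 2 ^ Suc q2"
  define D where "D = mixed_difference l (active_directions q1 q2) (w1, w2) f"
  have "Lp_norm p D \<le> dyadic_modulus p l f q1 q2"
    unfolding D_def dyadic_modulus_def mixed_modulus_def
    by (rule SUP_upper) (use w in \<open>auto simp: active_directions_def dyadic_step_def coord_def split: if_splits\<close>)
  also have "\<dots> = ennreal M" using fin by (simp add: M_def)
  finally have *: "(\<integral>\<^sup>+z. ennreal (cmod (D z) powr r) \<partial>lebesgue_on unit_square) \<le> ennreal (M powr r)"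
    by (intro Lp_norm_moment[OF _ _ p r]) (auto simp: M_def)
  have "(\<integral>\<^sup>+y. indicator (kernel_region l q1) (fst y, w1) * indicator (kernel_region l q2) (snd y, w2) *
        ennreal (norm (mixed_level_diff l q1 q2 (clamp2 f) ((fst y, w1), (snd y, w2))) powr r) \<partial>lborel)
    \<le> (\<integral>\<^sup>+y. ennreal (cmod (D y) powr r) * indicator unit_square y \<partial>lborel)"
  proof (rule nn_integral_mono)
    fix y :: "real \<times> real"
    show "indicator (kernel_region l q1) (fst y, w1) * indicator (kernel_region l q2) (snd y, w2) *
        ennreal (norm (mixed_level_diff l q1 q2 (clamp2 f) ((fst y, w1), (snd y, w2))) powr r)
      \<le> ennreal (cmod (D y) powr r) * indicator unit_square y"
    proof (cases "(fst y, w1) \<in> kernel_region l q1 \<and> (snd y, w2) \<in> kernel_region l q2")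
      case True
      then have "y \<in> unit_square" by (cases y) (auto simp: kernel_region_def)
      then show ?thesis using True mixed_level_diff_mixed_difference[of "fst y" w1 l q1 "snd y" w2 q2 f] by (simp add: D_def)
    qed auto
  qed
  also have "\<dots> = (\<integral>\<^sup>+y. ennreal (cmod (D y) powr r) \<partial>lebesgue_on unit_square)"
    using unit_square_lebesgue by (simp add: nn_integral_restrict_space nn_integral_completion)
  also note *
  finally show "(\<integral>\<^sup>+y. indicator (kernel_region l q1) (fst y, w1) * indicator (kernel_region l q2) (snd y, w2) *
        ennreal (norm (mixed_level_diff l q1 q2 (clamp2 f) ((fst y, w1), (snd y, w2))) powr r) \<partial>lborel)
    \<le> ennreal (enn2real (dyadic_modulus p l f q1 q2) powr r)" unfolding M_def .
qed

lemma periodize2_diff_sum: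
  "periodize2 (\<lambda>u. f u - (\<Sum>i\<in>I. g i u)) x y = periodize2 f x y - (\<Sum>i\<in>I. periodize2 (g i) x y)"
proof -
  have "(\<Sum>i\<in>I. periodize2 (g i) x y) = (\<Sum>i\<in>I. g i (x, y)) + (y - 1 / 2) *\<^sub>R ((\<Sum>i\<in>I. g i (x, 0)) - (\<Sum>i\<in>I. g i (x, 1)))
     + (x - 1 / 2) *\<^sub>R ((\<Sum>i\<in>I. g i (0, y)) - (\<Sum>i\<in>I. g i (1, y)))
     + ((x - 1 / 2) * (y - 1 / 2)) *\<^sub>R ((\<Sum>i\<in>I. g i (0, 0)) - (\<Sum>i\<in>I. g i (1, 0)) + (\<Sum>i\<in>I. g i (1, 1)) - (\<Sum>i\<in>I. g i (0, 1)))"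
    by (simp add: periodize2_def sum.distrib sum_subtractf flip: scaleR_sum_right)
  then show ?thesis by (simp add: periodize2_def scaleR_diff_right scaleR_add_right)
qed

text \<open>The four summands of \<open>periodize2\<close> carry weights at most 1, 1/2, 1/2, 1/4
  and involve 1, 2, 2, 4 values of g, so each is at most B.\<close>

lemma norm_periodize2_le:
  assumes g: "\<And>u. u \<in> unit_square \<Longrightarrow> norm (g u) \<le> B" and x: "x \<in> {0..1}" and y: "y \<in> {0..1}"
  shows "norm (periodize2 g x y) \<le> 4 * B"
proof -
  have B: "norm (g (s, t)) \<le> B" if "s \<in> {0..1}" "t \<in> {0..1}" for s t using g that by auto
  have mid: "\<bar>c - 1 / 2\<bar> \<le> 1 / 2" if "c \<in> {0..1}" for c :: real
    using that unfolding atLeastAtMost_iff abs_le_iff by linarith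
  have half: "norm ((c - 1 / 2) *\<^sub>R d) \<le> 1 / 2 * norm d" if "c \<in> {0..1}" for c :: real and d :: complex
    unfolding norm_scaleR real_norm_def using mid[OF that] by (rule mult_right_mono) simp
  have quarter: "norm (((x - 1 / 2) * (y - 1 / 2)) *\<^sub>R d) \<le> 1 / 4 * norm d" for d :: complex
  proof -
    have "\<bar>x - 1 / 2\<bar> * \<bar>y - 1 / 2\<bar> \<le> 1 / 2 * (1 / 2)" by (intro mult_mono mid x y) auto
    then have "\<bar>x - 1 / 2\<bar> * \<bar>y - 1 / 2\<bar> * norm d \<le> 1 / 4 * norm d" by (intro mult_right_mono) auto
    then show ?thesis by (simp add: abs_mult)
  qed
  have "norm (periodize2 g x y) \<le> norm (g (x, y)) + norm ((y - 1 / 2) *\<^sub>R (g (x, 0) - g (x, 1))) + norm ((x - 1 / 2) *\<^sub>R (g (0, y) - g (1, y)))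
    + norm (((x - 1 / 2) * (y - 1 / 2)) *\<^sub>R (g (0, 0) - g (1, 0) + g (1, 1) - g (0, 1)))"
    unfolding periodize2_def by (intro norm_triangle_le add_mono order_refl)
  moreover have "norm ((y - 1 / 2) *\<^sub>R (g (x, 0) - g (x, 1))) \<le> B"
    using half[OF y, of "g (x, 0) - g (x, 1)"] norm_triangle_ineq4[of "g (x, 0)" "g (x, 1)"] B[OF x, of 0] B[OF x, of 1] by simp
  moreover have "norm ((x - 1 / 2) *\<^sub>R (g (0, y) - g (1, y))) \<le> B"
    using half[OF x, of "g (0, y) - g (1, y)"] norm_triangle_ineq4[of "g (0, y)" "g (1, y)"] B[OF _ y, of 0] B[OF _ y, of 1] by simp
  moreover have "norm (((x - 1 / 2) * (y - 1 / 2)) *\<^sub>R (g (0, 0) - g (1, 0) + g (1, 1) - g (0, 1))) \<le> B"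
    using quarter[of "g (0, 0) - g (1, 0) + g (1, 1) - g (0, 1)"]
      norm_triangle_ineq4[of "g (0, 0)" "g (1, 0)"] norm_triangle_ineq[of "g (0, 0) - g (1, 0)" "g (1, 1)"]
      norm_triangle_ineq4[of "g (0, 0) - g (1, 0) + g (1, 1)" "g (0, 1)"] B[of 0 0] B[of 1 0] B[of 1 1] B[of 0 1] by simp
  ultimately show ?thesis using B[OF x y] by simp
qed

text \<open>The remainder after the levels up to J is small uniformly on the square, and the
  cubature formula and the integral are bounded for the uniform norm. J depends on f and \<epsilon>;
  this is harmless because the layers will be summed with a bound that does not depend on J.\<close>

lemma error_le_layers:
  assumes l: "l > 0" and f: "continuous_on UNIV f" and \<epsilon>: "\<epsilon> > 0"
  obtains J where "norm (fib_cubature n f - square_integral f)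
    \<le> (\<Sum>(q1, q2)\<in>{..J} \<times> {..J}. norm (fib_cubature n (layer l q1 q2 f) - square_integral (layer l q1 q2 f))) + \<epsilon>"
proof -
  define A where "A = (2::real) ^ l * 2 ^ l + 2 ^ l"
  have A: "A > 0" by (simp add: A_def add_pos_pos)
  \<comment> \<open>A is the constant of \<open>smear2_close\<close>. The remainder costs 4 A
    \<delta> in the cubature formula, by \<open>norm_periodize2_le\<close>, and A \<delta> in the
    integral.\<close>
  define \<delta> where "\<delta> = \<epsilon> / (5 * A)"
  have \<delta>: "\<delta> > 0" using \<epsilon> A by (simp add: \<delta>_def)
  have "uniformly_continuous_on unit_square f"
    by (intro compact_uniformly_continuous continuous_on_subset[OF f] unit_square_lebesgue) auto
  then obtain d where d: "d > 0" "\<And>u v. u \<in> unit_square \<Longrightarrow> v \<in> unit_square \<Longrightarrow> dist v u < d \<Longrightarrow> dist (f v) (f u) < \<delta>"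
    unfolding uniformly_continuous_on_def using \<delta> by metis
  obtain J where J: "(1 / 2) ^ J < d / 2" using real_arch_pow_inv[of "d / 2" "1 / 2"] d(1) by auto
  define Q where "Q = {..J} \<times> {..J}"
  define L where "L q = layer l (fst q) (snd q) f" for q
  define g where "g u = f u - (\<Sum>q\<in>Q. L q u)" for u
  have close: "norm (g u) \<le> A * \<delta>" if u: "u \<in> unit_square" for u
  proof -
    obtain x y where xy: "u = (x, y)" "x \<in> {0..1}" "y \<in> {0..1}" using u by auto
    have "(\<Sum>q\<in>Q. L q u) = smear2 l J f (x, y)"
      unfolding smear2_layers[OF l f xy(2,3)] Q_def L_def xy(1) by (simp add: sum.cartesian_product case_prod_beta')
    then have "norm (g u) = norm (smear2 l J f (x, y) - f (x, y))" unfolding g_def xy(1) by (simp add: norm_minus_commute)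
    also have "\<dots> \<le> A * \<delta>" unfolding A_def
    proof (rule smear2_close[OF l f xy(2,3)])
      fix u v :: "real \<times> real"
      assume uv: "u \<in> unit_square" "v \<in> unit_square" "\<bar>fst u - fst v\<bar> \<le> 1 / 2 ^ J" "\<bar>snd u - snd v\<bar> \<le> 1 / 2 ^ J"
      have "dist u v \<le> \<bar>fst u - fst v\<bar> + \<bar>snd u - snd v\<bar>"
        by (simp add: dist_prod_def dist_real_def sqrt_sum_squares_le_sum_abs[THEN order_trans])
      also have "\<dots> < d" using uv(3,4) J by (simp add: power_one_over)
      finally show "norm (f u - f v) \<le> \<delta>" using d(2)[OF uv(2,1)] by (simp add: dist_norm)
    qed (use \<delta> in simp)
    finally show ?thesis .
  qed
  have sum_if: "integrable lborel (\<lambda>u. indicator unit_square u *\<^sub>R L q u)" for q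
    unfolding L_def by (rule layer_square_integral(3)[OF l f])
  have int_f: "integrable lborel (\<lambda>u. indicator unit_square u *\<^sub>R f u)"
    by (intro borel_integrable_compact unit_square_lebesgue continuous_on_subset[OF f]) auto
  have e: "indicator unit_square u *\<^sub>R g u = indicator unit_square u *\<^sub>R f u - (\<Sum>q\<in>Q. indicator unit_square u *\<^sub>R L q u)" for u
    by (simp add: g_def scaleR_diff_right scaleR_sum_right)
  have int_g: "integrable lborel (\<lambda>u. indicator unit_square u *\<^sub>R g u)"
    unfolding e by (intro Bochner_Integration.integrable_diff Bochner_Integration.integrable_sum int_f sum_if)
  have "(\<integral>u. indicator unit_square u *\<^sub>R g u \<partial>lborel) = square_integral f - (\<Sum>q\<in>Q. square_integral (L q))"
    unfolding e using int_f sum_if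
    by (simp add: Bochner_Integration.integral_diff Bochner_Integration.integral_sum Bochner_Integration.integrable_sum square_integral_lborel)
  moreover have "norm (\<integral>u. indicator unit_square u *\<^sub>R g u \<partial>lborel) \<le> A * \<delta>"
  proof -
    have em: "emeasure lborel unit_square = ennreal 1" using emeasure_rectangle[of 0 1 0 1] by simp
    have i1: "integrable lborel (\<lambda>u. indicator unit_square u *\<^sub>R (A * \<delta>) :: real)"
      using unit_square_lebesgue em by (intro integrable_scaleR_left integrable_real_indicator) auto
    have "norm (\<integral>u. indicator unit_square u *\<^sub>R g u \<partial>lborel) \<le> (\<integral>u. indicator unit_square u *\<^sub>R (A * \<delta>) \<partial>lborel)"
      by (rule Bochner_Integration.integral_norm_bound_integral[OF int_g i1, THEN order_trans]) (use close in \<open>auto simp: indicator_def\<close>)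
    also have "\<dots> = A * \<delta>" using em unit_square_lebesgue by (simp add: measure_def)
    finally show ?thesis .
  qed
  ultimately have I: "norm (square_integral f - (\<Sum>q\<in>Q. square_integral (L q))) \<le> A * \<delta>" by simp
  define b where "b = real (fib (Suc n))"
  have b: "b > 0" unfolding b_def using fib_Suc_pos[of n] by simp
  have "fib_cubature n f - (\<Sum>q\<in>Q. fib_cubature n (L q)) = (\<Sum>\<mu><fib (Suc n). periodize2 g (node_x n \<mu>) (node_y n \<mu>)) /\<^sub>R b"
    unfolding fib_cubature_eq g_def periodize2_diff_sum sum_subtractf scaleR_diff_right b_def scaleR_sum_right[symmetric]
    by (subst sum.swap) simp
  moreover have "norm ((\<Sum>\<mu><fib (Suc n). periodize2 g (node_x n \<mu>) (node_y n \<mu>)) /\<^sub>R b) \<le> 4 * (A * \<delta>)"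
  proof -
    have "norm (\<Sum>\<mu><fib (Suc n). periodize2 g (node_x n \<mu>) (node_y n \<mu>)) \<le> (\<Sum>\<mu><fib (Suc n). 4 * (A * \<delta>))"
      by (intro sum_norm_le norm_periodize2_le close node_x_node_y_in) auto
    also have "\<dots> = b * (4 * (A * \<delta>))" by (simp add: b_def)
    finally show ?thesis using b by (simp add: divide_simps mult_ac)
  qed
  ultimately have II: "norm (fib_cubature n f - (\<Sum>q\<in>Q. fib_cubature n (L q))) \<le> 4 * (A * \<delta>)" by simp
  have "fib_cubature n f - square_integral f
     = (\<Sum>q\<in>Q. fib_cubature n (L q) - square_integral (L q)) + ((fib_cubature n f - (\<Sum>q\<in>Q. fib_cubature n (L q))) - (square_integral f - (\<Sum>q\<in>Q. square_integral (L q))))"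
    by (simp add: sum_subtractf)
  then have "norm (fib_cubature n f - square_integral f) \<le> norm (\<Sum>q\<in>Q. fib_cubature n (L q) - square_integral (L q))
     + norm ((fib_cubature n f - (\<Sum>q\<in>Q. fib_cubature n (L q))) - (square_integral f - (\<Sum>q\<in>Q. square_integral (L q))))"
    by (simp only: norm_triangle_ineq)
  also have "\<dots> \<le> (\<Sum>q\<in>Q. norm (fib_cubature n (L q) - square_integral (L q))) + (4 * (A * \<delta>) + A * \<delta>)"
    by (intro add_mono norm_sum order_trans[OF norm_triangle_ineq4] I II)
  also have "4 * (A * \<delta>) + A * \<delta> = \<epsilon>" using A by (simp add: \<delta>_def)
  finally show ?thesis using that[of J] by (simp add: Q_def L_def case_prod_beta')
qed

section \<open>The series over the levels and the choice of the exponents\<close>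

lemma linear_times_geometric:
  fixes s :: real
  assumes "0 \<le> s" "s < 1"
  shows "(real t + 1) * s ^ t \<le> 1 / (1 - s)"
proof -
  have "(real t + 1) * s ^ t = (\<Sum>i\<le>t. s ^ t)" by simp
  also have "\<dots> \<le> (\<Sum>i\<le>t. s ^ i)" using assms by (intro sum_mono power_decreasing) auto
  also have "\<dots> = (1 - s ^ Suc t) / (1 - s)" using assms by (simp only: lessThan_Suc_atMost[symmetric] sum_gp_strict) simp
  also have "\<dots> \<le> 1 / (1 - s)" using assms by (intro divide_right_mono) auto
  finally show ?thesis .
qed

text \<open>Let L be the integer part of log2 b. Apart from the polynomial factor, the m-th term is
  at most a constant times b^-\<alpha> s^(2|m-L|): up to L because \<beta> > \<alpha>, beyond it
  because \<sigma> < \<alpha>. One factor s^|m-L| absorbs the growth of (m+1)^\<kappa> away from L,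
  the other is summed.\<close>

lemma dyadic_series_bound:
  fixes \<alpha> \<beta> \<sigma> \<kappa> :: real
  assumes ab: "\<alpha> < \<beta>" and sa: "\<sigma> < \<alpha>" and \<kappa>: "0 \<le> \<kappa>" "\<kappa> \<le> 1"
  obtains C where "C > 0" "\<And>b T. b \<ge> 1 \<Longrightarrow>
     (\<Sum>m\<le>T. min ((2 ^ m / b) powr \<beta>) ((2 ^ m / b) powr \<sigma>) * (2 powr (- \<alpha> * real m) * (real m + 1) powr \<kappa>))
     \<le> C * (b powr (- \<alpha>) * (1 + log 2 b) powr \<kappa>)"
proof -
  define \<delta> where "\<delta> = min (\<beta> - \<alpha>) (\<alpha> - \<sigma>)"
  have \<delta>: "\<delta> > 0" using ab sa by (simp add: \<delta>_def)
  define s where "s = (2::real) powr (- \<delta> / 2)"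
  have s: "0 < s" "s < 1" unfolding s_def using \<delta> powr_less_mono[of "- \<delta> / 2" 0 2] by auto
  define C where "C = 2 powr (\<alpha> - \<sigma>) * (1 / (1 - s)) * (2 / (1 - s))"
  show thesis
  proof (rule that[of C])
    show "C > 0" using s by (simp add: C_def)
    fix b :: real and T :: nat assume b: "b \<ge> 1"
    define L where "L = nat \<lfloor>log 2 b\<rfloor>"
    have lb: "log 2 b \<ge> 0" using b by simp
    have L: "real L \<le> log 2 b" "log 2 b < real L + 1" using lb unfolding L_def by linarith+
    have b2: "b = 2 powr log 2 b" using b by simp
    have pw: "(2 ^ m / b) powr c = 2 powr ((real m - log 2 b) * c)" for m c
    proof -
      have "2 ^ m / b = 2 powr (real m - log 2 b)" using b by (simp add: powr_diff powr_realpow)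
      then show ?thesis by (simp add: powr_powr)
    qed
    \<comment> \<open>The factor 2^(\<alpha>-\<sigma>) pays for rounding log2 b down to L: for m >
      L, the distance m - L exceeds m - log2 b by less than 1.\<close>
    have tm: "min ((2 ^ m / b) powr \<beta>) ((2 ^ m / b) powr \<sigma>) * 2 powr (- \<alpha> * real m)
        \<le> 2 powr (\<alpha> - \<sigma>) * b powr (- \<alpha>) * (s ^ nat \<bar>int m - int L\<bar> * s ^ nat \<bar>int m - int L\<bar>)" for m
    proof -
      define t where "t = nat \<bar>int m - int L\<bar>"
      have t: "real t = \<bar>real m - real L\<bar>" by (simp add: t_def of_nat_nat)
      define a where "a = real m - log 2 b"
      have st: "s ^ t * s ^ t = 2 powr (- \<delta> * real t)"
        using s by (simp add: s_def powr_realpow[symmetric] powr_powr powr_add[symmetric])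
      have ba: "b powr (- \<alpha>) = 2 powr (- \<alpha> * log 2 b)" by (subst b2) (simp add: powr_powr mult.commute)
      have "min ((2 ^ m / b) powr \<beta>) ((2 ^ m / b) powr \<sigma>) \<le> 2 powr (a * (if m \<le> L then \<beta> else \<sigma>))"
        unfolding pw a_def by auto
      then have "min ((2 ^ m / b) powr \<beta>) ((2 ^ m / b) powr \<sigma>) * 2 powr (- \<alpha> * real m)
         \<le> 2 powr (a * (if m \<le> L then \<beta> else \<sigma>)) * 2 powr (- \<alpha> * real m)" by (intro mult_right_mono) auto
      also have "\<dots> = 2 powr (a * (if m \<le> L then \<beta> else \<sigma>) - \<alpha> * real m)" by (simp add: powr_add[symmetric])
      also have "\<dots> \<le> 2 powr ((\<alpha> - \<sigma>) + (- \<alpha> * log 2 b) + (- \<delta> * real t))"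
      proof (intro powr_mono)
        have *: "a * (c - \<alpha>) \<le> (\<alpha> - \<sigma>) - \<delta> * real t \<Longrightarrow> a * c - \<alpha> * real m \<le> (\<alpha> - \<sigma>) + (- \<alpha> * log 2 b) + (- \<delta> * real t)" for c
          by (simp add: a_def algebra_simps)
        show "a * (if m \<le> L then \<beta> else \<sigma>) - \<alpha> * real m \<le> (\<alpha> - \<sigma>) + (- \<alpha> * log 2 b) + (- \<delta> * real t)"
        proof (cases "m \<le> L")
          case True
          then have ta: "real t \<le> - a" using t L by (simp add: a_def)
          have "\<delta> * real t \<le> (\<beta> - \<alpha>) * (- a)" using ta ab by (intro mult_mono) (auto simp: \<delta>_def)
          then have "a * (\<beta> - \<alpha>) \<le> (\<alpha> - \<sigma>) - \<delta> * real t" using sa by (simp add: algebra_simps)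
          from *[OF this] show ?thesis using True by simp
        next
          case False
          then have ta: "real t \<le> a + 1" using t L by (simp add: a_def)
          have "\<delta> * real t \<le> (\<alpha> - \<sigma>) * (a + 1)" using ta sa by (intro mult_mono) (auto simp: \<delta>_def)
          then have "a * (\<sigma> - \<alpha>) \<le> (\<alpha> - \<sigma>) - \<delta> * real t" by (simp add: algebra_simps)
          from *[OF this] show ?thesis using False by simp
        qed
      qed simp
      also have "\<dots> = 2 powr (\<alpha> - \<sigma>) * b powr (- \<alpha>) * (s ^ t * s ^ t)" unfolding st ba by (simp only: powr_add)
      finally show ?thesis unfolding t_def .
    qed
    \<comment> \<open>With t = |m - L|, m + 1 <= (1 + L)(t + 1), so the power splits into two
      factors; as \<kappa> <= 1, the second is at most t + 1.\<close>
    have poly: "(real m + 1) powr \<kappa> \<le> (1 + log 2 b) powr \<kappa> * (real (nat \<bar>int m - int L\<bar>) + 1)" for m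
    proof -
      define t where "t = nat \<bar>int m - int L\<bar>"
      have t: "real m \<le> real L + real t" by (simp add: t_def of_nat_nat)
      have "real m + 1 \<le> (1 + real L) * (real t + 1)"
      proof -
        have "0 \<le> real L * real t" by simp
        moreover have "(1 + real L) * (real t + 1) = real L + real t + 1 + real L * real t" by (simp add: algebra_simps)
        ultimately show ?thesis using t by linarith
      qed
      also have "\<dots> \<le> (1 + log 2 b) * (real t + 1)" using L by (intro mult_right_mono) auto
      finally have "(real m + 1) powr \<kappa> \<le> ((1 + log 2 b) * (real t + 1)) powr \<kappa>" using \<kappa> by (intro powr_mono2) auto
      also have "\<dots> = (1 + log 2 b) powr \<kappa> * (real t + 1) powr \<kappa>" using lb by (simp add: powr_mult)
      also have "\<dots> \<le> (1 + log 2 b) powr \<kappa> * (real t + 1) powr 1" using \<kappa> by (intro mult_left_mono powr_mono) auto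
      finally show ?thesis by (simp add: t_def)
    qed
    have "(\<Sum>m\<le>T. min ((2 ^ m / b) powr \<beta>) ((2 ^ m / b) powr \<sigma>) * (2 powr (- \<alpha> * real m) * (real m + 1) powr \<kappa>))
      \<le> (\<Sum>m<Suc T. 2 powr (\<alpha> - \<sigma>) * (1 / (1 - s)) * (b powr (- \<alpha>) * (1 + log 2 b) powr \<kappa>) * s ^ nat \<bar>int m - int L\<bar>)"
      unfolding lessThan_Suc_atMost
    proof (rule sum_mono)
      fix m
      define t where "t = nat \<bar>int m - int L\<bar>"
      have "min ((2 ^ m / b) powr \<beta>) ((2 ^ m / b) powr \<sigma>) * 2 powr (- \<alpha> * real m) * (real m + 1) powr \<kappa>
        \<le> 2 powr (\<alpha> - \<sigma>) * b powr (- \<alpha>) * (s ^ t * s ^ t) * ((1 + log 2 b) powr \<kappa> * (real t + 1))"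
        unfolding t_def by (rule mult_mono[OF tm poly]) (use s in auto)
      also have "\<dots> = 2 powr (\<alpha> - \<sigma>) * (b powr (- \<alpha>) * (1 + log 2 b) powr \<kappa>) * s ^ t * ((real t + 1) * s ^ t)"
        by (simp add: mult_ac)
      also have "\<dots> \<le> 2 powr (\<alpha> - \<sigma>) * (b powr (- \<alpha>) * (1 + log 2 b) powr \<kappa>) * s ^ t * (1 / (1 - s))"
        using s by (intro mult_left_mono linear_times_geometric) auto
      finally show "min ((2 ^ m / b) powr \<beta>) ((2 ^ m / b) powr \<sigma>) * (2 powr (- \<alpha> * real m) * (real m + 1) powr \<kappa>)
        \<le> 2 powr (\<alpha> - \<sigma>) * (1 / (1 - s)) * (b powr (- \<alpha>) * (1 + log 2 b) powr \<kappa>) * s ^ nat \<bar>int m - int L\<bar>"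
        by (simp add: t_def mult_ac)
    qed
    also have "\<dots> = 2 powr (\<alpha> - \<sigma>) * (1 / (1 - s)) * (b powr (- \<alpha>) * (1 + log 2 b) powr \<kappa>) * (\<Sum>m<Suc T. s ^ nat \<bar>int m - int L\<bar>)"
      by (rule sum_distrib_left[symmetric])
    also have "\<dots> \<le> 2 powr (\<alpha> - \<sigma>) * (1 / (1 - s)) * (b powr (- \<alpha>) * (1 + log 2 b) powr \<kappa>) * (2 / (1 - s))"
      using s by (intro mult_left_mono two_sided_geometric_sum) auto
    finally show "(\<Sum>m\<le>T. min ((2 ^ m / b) powr \<beta>) ((2 ^ m / b) powr \<sigma>) * (2 powr (- \<alpha> * real m) * (real m + 1) powr \<kappa>))
     \<le> C * (b powr (- \<alpha>) * (1 + log 2 b) powr \<kappa>)" by (simp add: C_def mult_ac)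
  qed
qed

lemma sum_square_le_triangle:
  fixes g :: "nat \<Rightarrow> nat \<Rightarrow> real"
  assumes "\<And>i j. g i j \<ge> 0"
  shows "(\<Sum>(i, j)\<in>{..J} \<times> {..J}. g i j) \<le> (\<Sum>m\<le>2 * J. \<Sum>q\<le>m. g q (m - q))"
proof -
  have "{(i, j). i + j \<le> 2 * J} \<subseteq> {..2 * J} \<times> {..2 * J}" by auto
  then have "finite {(i, j). i + j \<le> 2 * J}" by (rule finite_subset) auto
  then have "(\<Sum>(i, j)\<in>{..J} \<times> {..J}. g i j) \<le> (\<Sum>(i, j)\<in>{(i, j). i + j \<le> 2 * J}. g i j)"
    using assms by (intro sum_mono2) auto
  also have "\<dots> = (\<Sum>m\<le>2 * J. \<Sum>q\<le>m. g q (m - q))" by (rule sum.triangle_reindex_eq)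
  finally show ?thesis .
qed

text \<open>r replaces p in all moment estimates. For infinite p the assumption reads 0 < \<alpha> <
  1, and r = 2/\<alpha> has 1/r = \<alpha>/2, strictly below \<alpha>.\<close>

lemma exponent_choice:
  assumes p: "1 \<le> p" and a: "enn2real (1 / p) < \<alpha>" "\<alpha> < 1 + enn2real (1 / p)"
  obtains r :: real where "r \<ge> 1" "1 / r < \<alpha>" "\<alpha> < 2" "p \<noteq> \<infinity> \<Longrightarrow> r = enn2real p"
proof (cases p)
  case top
  then have \<alpha>: "0 < \<alpha>" "\<alpha> < 1" using a by simp_all
  show thesis
  proof (rule that[of "2 / \<alpha>"])
    show "2 / \<alpha> \<ge> 1" using \<alpha> by (simp add: field_simps)
    show "1 / (2 / \<alpha>) < \<alpha>" using \<alpha> by simp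
  qed (use \<alpha> top in auto)
next
  case (real r)
  then have r: "r \<ge> 1" using p by simp
  have "enn2real (1 / p) = 1 / r"
    unfolding real(2) using r by (simp add: divide_ennreal[symmetric] flip: ennreal_1)
  then have *: "1 / r < \<alpha>" "\<alpha> < 1 + 1 / r" using a by simp_all
  show thesis
  proof (rule that[OF r *(1)])
    have "1 / r \<le> 1" using r by simp
    then show "\<alpha> < 2" using *(2) by linarith
    show "r = enn2real p" unfolding real(2) using real(1) by (rule enn2real_ennreal[symmetric])
  qed
qed

text \<open>\<open>layer_error_bound\<close> is used for two values of \<gamma>: one supplies the
  exponent \<beta> > \<alpha> for the coarse levels, the other the exponent \<sigma> < \<alpha> for
  the fine ones.\<close>

lemma cubature_error_bound:
  assumes p: "1 \<le> p" and \<theta>: "1 \<le> \<theta>" and a: "enn2real (1 / p) < \<alpha>" "\<alpha> < 1 + enn2real (1 / p)" and l: "\<alpha> < real l"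
  defines "\<kappa> \<equiv> max (1 - enn2real (1 / \<theta>)) 0"
  obtains C where "C > 0" "\<And>n f. continuous_on unit_square f \<Longrightarrow> besov_norm \<alpha> p \<theta> l f \<le> 1 \<Longrightarrow>
     norm (fib_cubature n f - square_integral f) \<le> C * (real (fib (Suc n)) powr (- \<alpha>) * (1 + log 2 (real (fib (Suc n)))) powr \<kappa>)"
proof (rule exponent_choice[OF p a])
  fix r :: real assume r: "r \<ge> 1" "1 / r < \<alpha>" "\<alpha> < 2" "p \<noteq> \<infinity> \<Longrightarrow> r = enn2real p"
  have "enn2real (1 / p) \<ge> 0" by simp
  then have \<alpha>: "\<alpha> > 0" using a(1) by linarith
  have l0: "l > 0" using l \<alpha> by (cases l) auto
  have \<kappa>: "0 \<le> \<kappa>" "\<kappa> \<le> 1" by (auto simp: \<kappa>_def)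
  \<comment> \<open>\<beta> lies midway between max \<alpha> 1 and 2, and \<sigma> midway between
    1/r and min \<alpha> (2/r). Hence \<beta> - 1 and \<sigma> r - 1 both lie in (0, 1), as required
    of \<gamma>.\<close>
  define \<beta> where "\<beta> = (max \<alpha> 1 + 2) / 2"
  define \<sigma> where "\<sigma> = (1 / r + min \<alpha> (2 / r)) / 2"
  have \<beta>: "1 < \<beta>" "\<beta> < 2" "\<alpha> < \<beta>" using r(3) by (auto simp: \<beta>_def max_def)
  have "1 / r < 2 / r" using r(1) by (simp add: divide_strict_right_mono)
  then have \<sigma>: "1 / r < \<sigma>" "\<sigma> < 2 / r" "\<sigma> < \<alpha>" using r(2) by (auto simp: \<sigma>_def min_def)
  have \<sigma>r: "1 < \<sigma> * r" "\<sigma> * r < 2" using \<sigma> r(1) by (auto simp: field_simps)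
  show thesis
  proof (rule layer_error_bound[OF l0, of "\<beta> - 1"])
    fix C1 :: real assume C1: "C1 > 0" and
      b1: "\<And>n q1 q2 f M p. continuous_on UNIV f \<Longrightarrow> mixed_level_diff_bound p l q1 q2 f M \<Longrightarrow> p \<ge> 1 \<Longrightarrow> M \<ge> 0 \<Longrightarrow>
        norm (fib_cubature n (layer l q1 q2 f) - square_integral (layer l q1 q2 f))
        \<le> C1 * M * min ((2 ^ (q1 + q2) / real (fib (Suc n))) powr (1 + (\<beta> - 1))) ((2 ^ (q1 + q2) / real (fib (Suc n))) powr ((1 + (\<beta> - 1)) / p))"
  show thesis
  proof (rule layer_error_bound[OF l0, of "\<sigma> * r - 1"])
    fix C2 :: real assume C2: "C2 > 0" and
      b2: "\<And>n q1 q2 f M p. continuous_on UNIV f \<Longrightarrow> mixed_level_diff_bound p l q1 q2 f M \<Longrightarrow> p \<ge> 1 \<Longrightarrow> M \<ge> 0 \<Longrightarrow>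
        norm (fib_cubature n (layer l q1 q2 f) - square_integral (layer l q1 q2 f))
        \<le> C2 * M * min ((2 ^ (q1 + q2) / real (fib (Suc n))) powr (1 + (\<sigma> * r - 1))) ((2 ^ (q1 + q2) / real (fib (Suc n))) powr ((1 + (\<sigma> * r - 1)) / p))"
  show thesis
  proof (rule dyadic_series_bound[OF \<beta>(3) \<sigma>(3) \<kappa>])
    fix C3 :: real assume C3: "C3 > 0" and
      b3: "\<And>b T. b \<ge> 1 \<Longrightarrow>
       (\<Sum>m\<le>T. min ((2 ^ m / b) powr \<beta>) ((2 ^ m / b) powr \<sigma>) * (2 powr (- \<alpha> * real m) * (real m + 1) powr \<kappa>))
       \<le> C3 * (b powr (- \<alpha>) * (1 + log 2 b) powr \<kappa>)"
    define C where "C = max C1 C2"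
    have C: "C > 0" using C1 by (simp add: C_def)
    show thesis
    proof (rule that[of "C * 17 * C3"])
      show "C * 17 * C3 > 0" using C C3 by simp
      fix n f assume f: "continuous_on unit_square f" and nrm: "besov_norm \<alpha> p \<theta> l f \<le> 1"
      define b where "b = real (fib (Suc n))"
      have b: "b \<ge> 1" unfolding b_def using fib_Suc_pos[of n] by simp
      define g where "g = clamp2 f"
      have g: "continuous_on UNIV g" unfolding g_def by (rule continuous_on_clamp2[OF f])
      have gf: "g (x, y) = f (x, y)" if "x \<in> {0..1}" "y \<in> {0..1}" for x y unfolding g_def by (rule clamp2_id[OF that])
      define M where "M q1 q2 = enn2real (dyadic_modulus p l f q1 q2)" for q1 q2
      define w where "w m = min ((2 ^ m / b) powr \<beta>) ((2 ^ m / b) powr \<sigma>)" for m :: nat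
      have w: "w m \<ge> 0" for m by (simp add: w_def)
      have layer: "norm (fib_cubature n (layer l q1 q2 g) - square_integral (layer l q1 q2 g)) \<le> C * w (q1 + q2) * M q1 q2" for q1 q2
      proof -
        define e where "e = norm (fib_cubature n (layer l q1 q2 g) - square_integral (layer l q1 q2 g))"
        have H: "mixed_level_diff_bound r l q1 q2 g (M q1 q2)" unfolding g_def M_def
          using r by (intro mixed_level_diff_bound_modulus[OF p _ _ besov_dyadic_sum(1)[OF nrm \<alpha> \<theta>]]) auto
        have M0: "M q1 q2 \<ge> 0" by (simp add: M_def)
        have "e \<le> C1 * M q1 q2 * min ((2 ^ (q1 + q2) / b) powr (1 + (\<beta> - 1))) ((2 ^ (q1 + q2) / b) powr ((1 + (\<beta> - 1)) / r))"
          unfolding e_def b_def by (rule b1[OF g H r(1) M0])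
        also have "\<dots> \<le> C * M q1 q2 * (2 ^ (q1 + q2) / b) powr \<beta>"
          using M0 C1 by (intro mult_mono) (auto simp: C_def)
        finally have 1: "e \<le> C * M q1 q2 * (2 ^ (q1 + q2) / b) powr \<beta>" .
        \<comment> \<open>From the first bound the exponent 1 + \<gamma> = \<beta> was taken; from
          the second it is (1 + \<gamma>)/r.\<close>
        have s: "(1 + (\<sigma> * r - 1)) / r = \<sigma>" using r(1) by simp
        have "e \<le> C2 * M q1 q2 * min ((2 ^ (q1 + q2) / b) powr (1 + (\<sigma> * r - 1))) ((2 ^ (q1 + q2) / b) powr \<sigma>)"
          unfolding e_def b_def using b2[OF g H r(1) M0, of n] unfolding s .
        also have "\<dots> \<le> C * M q1 q2 * (2 ^ (q1 + q2) / b) powr \<sigma>"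
          using M0 C2 by (intro mult_mono) (auto simp: C_def)
        finally have 2: "e \<le> C * M q1 q2 * (2 ^ (q1 + q2) / b) powr \<sigma>" .
        have "e \<le> C * M q1 q2 * w (q1 + q2)" using 1 2 by (simp add: w_def min_def)
        then show ?thesis unfolding e_def by (simp add: mult_ac)
      qed
      have all: "(\<Sum>(q1, q2)\<in>{..J} \<times> {..J}. norm (fib_cubature n (layer l q1 q2 g) - square_integral (layer l q1 q2 g)))
         \<le> C * 17 * C3 * (b powr (- \<alpha>) * (1 + log 2 b) powr \<kappa>)" for J
      proof -
        have "(\<Sum>(q1, q2)\<in>{..J} \<times> {..J}. norm (fib_cubature n (layer l q1 q2 g) - square_integral (layer l q1 q2 g)))
          \<le> (\<Sum>(q1, q2)\<in>{..J} \<times> {..J}. C * w (q1 + q2) * M q1 q2)"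
          using layer by (intro sum_mono) auto
        \<comment> \<open>The square of levels is enlarged to a triangle in order to sum along q1 +
          q2 = m, where the weight is constant and the Besov bound applies.\<close>
        also have "\<dots> \<le> (\<Sum>m\<le>2 * J. \<Sum>q\<le>m. C * w (q + (m - q)) * M q (m - q))"
          by (rule sum_square_le_triangle) (use C w in \<open>simp add: M_def\<close>)
        also have "\<dots> = (\<Sum>m\<le>2 * J. C * w m * (\<Sum>q\<le>m. M q (m - q)))"
          by (simp add: sum_distrib_left)
        also have "\<dots> \<le> (\<Sum>m\<le>2 * J. C * w m * (17 * 2 powr (- \<alpha> * real m) * (real m + 1) powr \<kappa>))"
          unfolding M_def \<kappa>_def using C w by (intro sum_mono mult_left_mono besov_dyadic_sum(2)[OF nrm \<alpha> \<theta>]) auto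
        also have "\<dots> = C * 17 * (\<Sum>m\<le>2 * J. w m * (2 powr (- \<alpha> * real m) * (real m + 1) powr \<kappa>))"
          unfolding sum_distrib_left by (intro sum.cong refl) (simp add: mult_ac)
        also have "\<dots> \<le> C * 17 * (C3 * (b powr (- \<alpha>) * (1 + log 2 b) powr \<kappa>))"
          unfolding w_def using C by (intro mult_left_mono b3 b) auto
        finally show ?thesis by (simp add: mult_ac)
      qed
      have "norm (fib_cubature n g - square_integral g) \<le> C * 17 * C3 * (b powr (- \<alpha>) * (1 + log 2 b) powr \<kappa>) + \<epsilon>" if "\<epsilon> > 0" for \<epsilon>
      proof (rule error_le_layers[OF l0 g that, of n])
        fix J
        assume "norm (fib_cubature n g - square_integral g)
          \<le> (\<Sum>(q1, q2)\<in>{..J} \<times> {..J}. norm (fib_cubature n (layer l q1 q2 g) - square_integral (layer l q1 q2 g))) + \<epsilon>"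
        then show ?thesis using all[of J] by linarith
      qed
      then have "norm (fib_cubature n g - square_integral g) \<le> C * 17 * C3 * (b powr (- \<alpha>) * (1 + log 2 b) powr \<kappa>)"
        by (rule field_le_epsilon)
      moreover have "fib_cubature n g = fib_cubature n f"
        unfolding fib_cubature_eq periodize2_def using node_x_node_y_in by (auto intro!: arg_cong2[where f = scaleR] sum.cong simp: gf)
      moreover have "square_integral g = square_integral f"
        unfolding square_integral_def by (intro Bochner_Integration.integral_cong refl) (auto simp: gf)
      ultimately show "norm (fib_cubature n f - square_integral f) \<le> C * 17 * C3 * (real (fib (Suc n)) powr (- \<alpha>) * (1 + log 2 (real (fib (Suc n)))) powr \<kappa>)"
        by (simp add: b_def)
    qed
  qed
  qed (use \<sigma>r in auto)
  qed (use \<beta> in auto)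
qed

text \<open>N = 5 b - 2 lies between b and 5 b, whence the factor 5^\<alpha>. Moreover N >= 3 > e,
  so ln N >= 1 absorbs the summand 1 next to log2 b; this covers b = 1, where log2 b is 0.\<close>

lemma fib_rate_le:
  fixes b \<alpha> \<kappa> :: real
  assumes b: "b \<ge> 1" and \<alpha>: "\<alpha> > 0" and \<kappa>: "0 \<le> \<kappa>" "\<kappa> \<le> 1"
  shows "b powr (- \<alpha>) * (1 + log 2 b) powr \<kappa> \<le> 5 powr \<alpha> * (1 + 1 / ln 2) * ((5 * b - 2) powr (- \<alpha>) * ln (5 * b - 2) powr \<kappa>)"
proof -
  define N where "N = 5 * b - 2"
  have N: "N \<ge> 3" "b \<le> N" "N \<le> 5 * b" using b by (auto simp: N_def)
  have "b powr (- \<alpha>) = 5 powr \<alpha> * (5 * b) powr (- \<alpha>)" using b by (simp add: powr_mult powr_minus)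
  also have "\<dots> \<le> 5 powr \<alpha> * N powr (- \<alpha>)" using N \<alpha> by (intro mult_left_mono powr_mono2') auto
  finally have 1: "b powr (- \<alpha>) \<le> 5 powr \<alpha> * N powr (- \<alpha>)" .
  have l1: "ln N \<ge> 1"
  proof -
    have "exp 1 \<le> N" using exp_le N by linarith
    then show ?thesis using N by (simp add: ln_ge_iff)
  qed
  have "log 2 b \<le> ln N / ln 2" unfolding log_def using b N by (intro divide_right_mono) auto
  then have "1 + log 2 b \<le> (1 + 1 / ln 2) * ln N" using l1 by (simp add: algebra_simps)
  then have "(1 + log 2 b) powr \<kappa> \<le> ((1 + 1 / ln 2) * ln N) powr \<kappa>" using b \<kappa> by (intro powr_mono2) auto
  also have "\<dots> = (1 + 1 / ln 2) powr \<kappa> * ln N powr \<kappa>" using l1 by (simp add: powr_mult add_nonneg_nonneg)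
  also have "\<dots> \<le> (1 + 1 / ln 2) powr 1 * ln N powr \<kappa>" using \<kappa> by (intro mult_right_mono powr_mono) auto
  also have "(1 + 1 / ln 2) powr 1 = 1 + 1 / ln (2::real)" by (simp add: add_nonneg_nonneg)
  finally have 2: "(1 + log 2 b) powr \<kappa> \<le> (1 + 1 / ln 2) * ln N powr \<kappa>" .
  have "b powr (- \<alpha>) * (1 + log 2 b) powr \<kappa> \<le> 5 powr \<alpha> * N powr (- \<alpha>) * ((1 + 1 / ln 2) * ln N powr \<kappa>)"
    by (intro mult_mono 1 2) auto
  then show ?thesis unfolding N_def by (simp add: mult_ac)
qed

theorem theorem3p6:
  fixes p \<theta> :: ennreal and \<alpha> :: real and l :: nat
  assumes "1 \<le> p" and "1 \<le> \<theta>"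
    and "enn2real (1 / p) < \<alpha>" and "\<alpha> < 1 + enn2real (1 / p)"
    and "\<alpha> < real l"
  shows "\<exists>C>0. \<forall>n. let N = 5 * real (fib_b n) - 2 in
    (SUP f\<in>{f \<in> besov_unit_ball \<alpha> p \<theta> l. continuous_on unit_square f}.
       ennreal (cmod (fib_cubature n f - square_integral f)))
    \<le> ennreal (C * N powr (- \<alpha>) * ln N powr max (1 - enn2real (1 / \<theta>)) 0)"
proof (rule cubature_error_bound[OF assms])
  define \<kappa> where "\<kappa> = max (1 - enn2real (1 / \<theta>)) 0"
  fix C :: real assume C: "C > 0" and
    bound: "\<And>n f. continuous_on unit_square f \<Longrightarrow> besov_norm \<alpha> p \<theta> l f \<le> 1 \<Longrightarrow>
     norm (fib_cubature n f - square_integral f)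
     \<le> C * (real (fib (Suc n)) powr (- \<alpha>) * (1 + log 2 (real (fib (Suc n)))) powr max (1 - enn2real (1 / \<theta>)) 0)"
  have "enn2real (1 / p) \<ge> 0" by simp
  then have \<alpha>: "\<alpha> > 0" using assms(3) by linarith
  have \<kappa>: "0 \<le> \<kappa>" "\<kappa> \<le> 1" by (auto simp: \<kappa>_def)
  define D where "D = C * (5 powr \<alpha> * (1 + 1 / ln 2))"
  show ?thesis
  proof (intro exI[of _ D] conjI allI)
    have "1 + 1 / ln (2::real) > 0" by (simp add: add_pos_pos)
    then show "D > 0" using C by (simp add: D_def)
    fix n
    define b where "b = real (fib_b n)"
    have b: "b \<ge> 1" unfolding b_def fib_b_def using fib_Suc_pos[of n] by simp
    show "let N = 5 * real (fib_b n) - 2 in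
      (SUP f\<in>{f \<in> besov_unit_ball \<alpha> p \<theta> l. continuous_on unit_square f}.
         ennreal (cmod (fib_cubature n f - square_integral f)))
      \<le> ennreal (D * N powr (- \<alpha>) * ln N powr max (1 - enn2real (1 / \<theta>)) 0)"
      unfolding Let_def b_def[symmetric] \<kappa>_def[symmetric]
    proof (intro SUP_least ennreal_leI)
      fix f assume f: "f \<in> {f \<in> besov_unit_ball \<alpha> p \<theta> l. continuous_on unit_square f}"
      have "cmod (fib_cubature n f - square_integral f) \<le> C * (b powr (- \<alpha>) * (1 + log 2 b) powr \<kappa>)"
        unfolding b_def \<kappa>_def fib_b_def using f by (intro bound) (auto simp: besov_unit_ball_def)
      also have "\<dots> \<le> C * (5 powr \<alpha> * (1 + 1 / ln 2) * ((5 * b - 2) powr (- \<alpha>) * ln (5 * b - 2) powr \<kappa>))"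
        using C by (intro mult_left_mono fib_rate_le b \<alpha> \<kappa>) auto
      finally show "cmod (fib_cubature n f - square_integral f) \<le> D * (5 * b - 2) powr (- \<alpha>) * ln (5 * b - 2) powr \<kappa>"
        by (simp add: D_def mult_ac)
    qed
  qed
qed

end
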